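(* Fix $A\geq 0$, $B>A+5$ and $\gamma >2A+6$. Given $x \geq 2$, let $Q=x^{1/2}/(\log x)^{B}$ and $y = x/(\log x)^{\gamma}$. Suppose that $f\in \mathcal C$, and assume that $$\sum_{q\leq Q} \max_{a:\ (a,q)=1} | \Delta(f\cdot 1_{\mathcal P},X;q,a) | \ll \frac X {(\log x)^A \log (x/y)}$$ for all $X$ in the range $y\leq X\leq x$; and that $$|\Delta(f,X;q,a)| \ll \frac X {(\log x)^{A+2B}},$$ whenever $(a,q)=1$, for all $X$ in the range $x^{1/2}\leq X\leq x$. Then $$\sum_{q \leq Q} \max_{(a,q)=1} |\Delta(f,x; q,a)| \ll \frac x{(\log x)^{A-1}}.$$ Here the implied constant in the conclusion depends only on $A$, $B$, $\gamma$ and the implied constants in the two hypotheses (in particular it does not depend on $x$ or $f$).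
   Context: For an arithmetic function $h$, real $X$, and integers $q\ge 1$, $a$ with $(a,q)=1$, put $$\Delta(h,X;q,a):=\sum_{\substack{n\leq X \\ n\equiv a \pmod q}} h(n) - \frac 1{\varphi(q)} \sum_{\substack{n\leq X \\ (n,q)=1}} h(n).$$ For a multiplicative function $f$ let $F(s)=\sum_{n\ge1} f(n)n^{-s}$, and define $\Lambda_f$ by $-F'(s)/F(s)=\sum_{n\ge2}\Lambda_f(n)n^{-s}$ for $\mathrm{Re}(s)>1$ (equivalently $f(n)\log n=\sum_{d\mid n}\Lambda_f(d)f(n/d)$ for all $n\geq 1$). $\mathcal C$ is the class of multiplicative functions $f$ with $|\Lambda_f(n)|\le\Lambda(n)$ for all $n\ge1$, where $\Lambda$ is the von Mangoldt function. $\mathcal P$ is the set of primes, and $f\cdot 1_{\mathcal P}$ is the function equal to $f$ on primes and $0$ elsewhere. *)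

theory Defs
  imports Complex_Main "HOL-Number_Theory.Number_Theory"
begin

definition Delta :: "(nat \<Rightarrow> complex) \<Rightarrow> real \<Rightarrow> nat \<Rightarrow> int \<Rightarrow> complex" where
  "Delta h X q a =
     (\<Sum>n | 1 \<le> n \<and> real n \<le> X \<and> [int n = a] (mod int q). h n)
     - (\<Sum>n | 1 \<le> n \<and> real n \<le> X \<and> coprime n q. h n) / of_nat (totient q)"

text \<open>The residue \<open>a\<close> ranges over all integers coprime to \<open>q\<close>; the set of values is
  nevertheless finite and nonempty (see below), so that \<^const>\<open>Max\<close> is the true maximum.\<close>

definition max_Delta :: "(nat \<Rightarrow> complex) \<Rightarrow> real \<Rightarrow> nat \<Rightarrow> real" where
  "max_Delta h X q = Max ((\<lambda>a. cmod (Delta h X q a)) ` {a. coprime a (int q)})"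

lemma Delta_mod: "Delta h X q (a mod int q) = Delta h X q a"
  by (simp add: Delta_def)

lemma max_Delta_set:
  assumes "q \<ge> 1"
  shows "finite ((\<lambda>a. cmod (Delta h X q a)) ` {a. coprime a (int q)})"
    and "(\<lambda>a. cmod (Delta h X q a)) ` {a. coprime a (int q)} \<noteq> {}"
proof -
  have "(\<lambda>a. cmod (Delta h X q a)) ` {a. coprime a (int q)}
          \<subseteq> (\<lambda>a. cmod (Delta h X q a)) ` {0..<int q}"
  proof safe
    fix a :: int
    have "a mod int q \<in> {0..<int q}" using assms by simp
    moreover have "cmod (Delta h X q a) = cmod (Delta h X q (a mod int q))"
      by (simp add: Delta_mod)
    ultimately show "cmod (Delta h X q a) \<in> (\<lambda>a. cmod (Delta h X q a)) ` {0..<int q}"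
      by (metis image_eqI)
  qed
  then show "finite ((\<lambda>a. cmod (Delta h X q a)) ` {a. coprime a (int q)})"
    by (rule finite_subset) simp
  have "(1::int) \<in> {a. coprime a (int q)}" by simp
  then show "(\<lambda>a. cmod (Delta h X q a)) ` {a. coprime a (int q)} \<noteq> {}" by blast
qed

text \<open>Arithmetic functions are functions on the positive integers; their value at \<open>0\<close> is never
  used.\<close>

definition multiplicative :: "(nat \<Rightarrow> complex) \<Rightarrow> bool" where
  "multiplicative f \<longleftrightarrow> f 1 = 1 \<and>
     (\<forall>m n. m \<ge> 1 \<longrightarrow> n \<ge> 1 \<longrightarrow> coprime m n \<longrightarrow> f (m * n) = f m * f n)"

text \<open>For \<open>f 1 = 1\<close>, the function \<open>\<Lambda>\<^sub>f\<close> is the unique solution of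
  \<open>f(n) log n = (\<Sum>d | d dvd n. \<Lambda>\<^sub>f(d) f(n / d))\<close> for all \<open>n \<ge> 1\<close>, that is, the sequence of
  coefficients of the Dirichlet series \<open>-F'/F\<close>. The recursion isolates the term \<open>d = n\<close>; the two
  lemmas following it are the identity and its uniqueness.\<close>

function Lambda_of :: "(nat \<Rightarrow> complex) \<Rightarrow> nat \<Rightarrow> complex" where
  "Lambda_of f n = f n * of_real (ln (real n))
     - (\<Sum>d | d dvd n \<and> d < n. Lambda_of f d * f (n div d))"
  by auto
termination by (relation "measure snd") auto

declare Lambda_of.simps [simp del]

lemma divisors_split:
  fixes n :: nat
  assumes "n \<ge> 1"
  shows "{d. d dvd n} = insert n {d. d dvd n \<and> d < n}" "finite {d. d dvd n \<and> d < n}"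
proof -
  have "d \<le> n" if "d dvd n" for d using that assms by (simp add: dvd_imp_le)
  then show "{d. d dvd n} = insert n {d. d dvd n \<and> d < n}" by (auto simp: le_less)
  show "finite {d. d dvd n \<and> d < n}" by simp
qed

lemma Lambda_of_conv:
  assumes "f 1 = 1" "n \<ge> 1"
  shows "f n * of_real (ln (real n)) = (\<Sum>d | d dvd n. Lambda_of f d * f (n div d))"
  using assms divisors_split[OF assms(2)] by (simp add: Lambda_of.simps[of f n])

lemma Lambda_of_unique:
  assumes "f 1 = 1"
    and L: "\<And>n. n \<ge> 1 \<Longrightarrow> f n * of_real (ln (real n)) = (\<Sum>d | d dvd n. L d * f (n div d))"
    and "n \<ge> 1"
  shows "L n = Lambda_of f n"
  using assms(3)
proof (induction n rule: less_induct)
  case (less n)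
  have "(\<Sum>d | d dvd n \<and> d < n. L d * f (n div d))
      = (\<Sum>d | d dvd n \<and> d < n. Lambda_of f d * f (n div d))"
  proof (rule sum.cong)
    fix d assume "d \<in> {d. d dvd n \<and> d < n}"
    then have "d < n" "d \<ge> 1" using less.prems by (auto intro: Suc_leI gr0I)
    then show "L d * f (n div d) = Lambda_of f d * f (n div d)" by (simp add: less.IH)
  qed simp
  moreover have "f n * of_real (ln (real n))
      = L n * f (n div n) + (\<Sum>d | d dvd n \<and> d < n. L d * f (n div d))"
    using L[OF less.prems] divisors_split[OF less.prems] by simp
  ultimately show ?case
    using assms(1) less.prems by (simp add: Lambda_of.simps[of f n])
qed

definition class_C :: "(nat \<Rightarrow> complex) set" where
  "class_C = {f. multiplicative f \<and> (\<forall>n\<ge>1. cmod (Lambda_of f n) \<le> mangoldt n)}"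

definition on_primes :: "(nat \<Rightarrow> complex) \<Rightarrow> nat \<Rightarrow> complex" where
  "on_primes f n = (if prime n then f n else 0)"

end

theory Submission
  imports "HOL-Real_Asymp.Real_Asymp" "HOL-Analysis.L2_Norm" Defs
begin

text \<open>The discrepancy modulo \<open>q\<close> splits over the conductors \<open>1 < r dvd q\<close>, using in place of
  characters the real kernel that sums all primitive characters modulo \<open>r\<close>. Let \<open>V = x / y\<close>. Apart
  from a negligible part, an integer \<open>n \<le> x\<close> is either \<open>u p\<close> with \<open>p\<close> prime and \<open>u \<le> V\<close>
  (type I), or \<open>k l\<close> with \<open>k > V\<close>, \<open>l\<close> large, and every prime of \<open>l\<close> exceeding those of \<open>k\<close>
  (type II). For conductors exceeding a power of \<open>log x\<close> only the type II part is kept, and the large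
  sieve bounds it, the condition on the primes being removed by binary splitting; the type I part
  as a whole is controlled by the hypothesis on primes. For small conductors the hypothesis on \<open>f\<close> applies to
  \<open>f\<close> itself; the coprimality condition \<open>(n, q) = 1\<close> is inserted by convolving with a function
  supported on integers composed of the primes of \<open>q\<close>, and the type I part, subtracted again, is
  averaged over the moduli \<open>r k\<close> with \<open>k\<close> free of small primes, which saves the
  logarithm that counting each conductor separately would lose.\<close>

section \<open>Reduced residues and the primitive kernel\<close>

text \<open>Characters can be avoided because two properties of the kernel suffice: it reproduces
  itself under summation over reduced residues, and it sums to zero over residue classes modulo
  proper divisors of \<open>r\<close>. The first separates the variables of a bilinear form, the
  second links the additive large sieve to primitive conductors. Bilinear structure has to come from
  multiplicativity alone, so \<open>n\<close> is cut between two of its prime powers: then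
  \<open>k\<close> and \<open>l\<close> are coprime and f(n) = f(k) f(l). The price is a joint
  condition on \<open>k\<close> and \<open>l\<close>; comparing the largest prime of
  \<open>k\<close> with the smallest prime of \<open>l\<close> turns it into a rank condition, whose
  removal costs one logarithm. The exponents come from counting logarithms. In the type II part the
  cofactor of the conductor costs one, the removal of two joint conditions (separated primes, k l <=
  x) costs two, and the dyadic or harmonic sum costs one. With log^4 x lost and x / log^(A-1) x
  wanted, each of 1/R0, Q / sqrt x and 1 / sqrt V must be at most log^(-A-3) x. Hence R0 is about
  log^(A+3) x, and V = log^gamma x with gamma > 2A + 6.\<close>

definition ures :: "nat \<Rightarrow> int set" where
  "ures r = {b. 0 \<le> b \<and> b < int r \<and> coprime b (int r)}"

lemma finite_ures [simp]: "finite (ures r)"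
  by (rule finite_subset[of _ "{0..<int r}"]) (auto simp: ures_def)

lemma mod_in_ures: "r > 0 \<Longrightarrow> coprime b (int r) \<Longrightarrow> b mod int r \<in> ures r"
  by (auto simp: ures_def)

lemma ures_eqI: "b \<in> ures r \<Longrightarrow> c \<in> ures r \<Longrightarrow> [b = c] (mod int r) \<Longrightarrow> b = c"
  by (auto simp: ures_def cong_def)

lemma card_ures:
  assumes "r > 0"
  shows "card (ures r) = totient r"
proof (cases "r = 1")
  case True
  \<comment> \<open>Modulo 1 the representative is 0 here but 1 in \<open>totatives\<close>; for
    \<open>r > 1\<close> the two ranges contain the same units.\<close>
  then have "ures r = {0}" by (auto simp: ures_def)
  then show ?thesis using True by simp
next
  case False
  then have r: "r > 1" using assms by simp
  have "ures r = int ` totatives r"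
  proof safe
    fix b assume b: "b \<in> ures r"
    then have "b \<noteq> 0" using r by (auto simp: ures_def)
    then have "nat b \<in> totatives r" "b = int (nat b)" using b
      by (auto simp: ures_def in_totatives_iff simp flip: coprime_int_iff)
    then show "b \<in> int ` totatives r" by blast
  next
    fix b assume "b \<in> totatives r"
    then show "int b \<in> ures r" using r totatives_less[of b r] by (auto simp: ures_def in_totatives_iff)
  qed
  then show ?thesis by (simp add: card_image totient_def)
qed

lemma sum_ures_mult:
  assumes "r > 0" "coprime u (int r)" and g: "\<And>x. g (x mod int r) = g x"
  shows "(\<Sum>b\<in>ures r. g (u * b)) = (\<Sum>b\<in>ures r. g b)"
proof -
  have inj: "inj_on (\<lambda>b. (u * b) mod int r) (ures r)"
  proof (rule inj_onI)
    fix b c assume bc: "b \<in> ures r" "c \<in> ures r" "(u * b) mod int r = (u * c) mod int r"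
    then have "[b = c] (mod int r)"
      using cong_mult_lcancel[of u "int r" b c] assms(2) by (simp add: cong_def)
    then show "b = c" using bc ures_eqI by blast
  qed
  have "(\<lambda>b. (u * b) mod int r) ` ures r \<subseteq> ures r"
    using assms by (auto intro!: mod_in_ures) (auto simp: ures_def)
  then have "(\<lambda>b. (u * b) mod int r) ` ures r = ures r"
    using inj by (simp add: endo_inj_surj)
  then have "(\<Sum>b\<in>ures r. g b) = (\<Sum>b\<in>(\<lambda>b. (u * b) mod int r) ` ures r. g b)" by simp
  also have "\<dots> = (\<Sum>b\<in>ures r. g ((u * b) mod int r))"
    using inj by (simp add: sum.reindex)
  finally show ?thesis by (simp add: g)
qed

lemma sum_ures_fibres:
  assumes "r > 0" "m dvd r"
  shows "(\<Sum>b\<in>ures r. g b) = (\<Sum>c\<in>ures m. \<Sum>b | b \<in> ures r \<and> [b = c] (mod int m). g b)"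
proof -
  have m: "m > 0" using assms dvd_pos_nat by blast
  have "(\<lambda>b. b mod int m) ` ures r \<subseteq> ures m"
  proof safe
    fix b assume "b \<in> ures r"
    then have "coprime b (int m)" using assms(2)
      by (auto simp: ures_def intro: coprime_divisors[of b b "int m" "int r"])
    then show "b mod int m \<in> ures m" using m mod_in_ures by blast
  qed
  then have "(\<Sum>b\<in>ures r. g b) = (\<Sum>c\<in>ures m. \<Sum>b | b \<in> ures r \<and> b mod int m = c. g b)"
    by (subst sum.group[of "ures r" "ures m" "\<lambda>b. b mod int m" g]) auto
  also have "\<dots> = (\<Sum>c\<in>ures m. \<Sum>b | b \<in> ures r \<and> [b = c] (mod int m). g b)"
    by (intro sum.cong) (auto simp: ures_def cong_def)
  finally show ?thesis .
qed

text \<open>The moduli \<open>m\<close> and \<open>r div m\<close> may share primes, so this is not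
  a plain Chinese remainder argument. Adding to \<open>c\<close> the product of \<open>m\<close>
  with all primes of \<open>r\<close> not dividing \<open>c\<close> makes each prime of
  \<open>r\<close> divide exactly one of the two summands.\<close>

lemma lift_unit:
  assumes "r > 0" "m dvd r" "coprime c (int m)"
  shows "\<exists>b. [b = c] (mod int m) \<and> coprime b (int r)"
proof -
  define T where "T = {p \<in> prime_factors r. \<not> int p dvd c}"
  define t where "t = int (\<Prod>T)"
  have finT: "finite T" by (simp add: T_def)
  define b where "b = c + int m * t"
  have "coprime b (int r)"
  proof (rule ccontr)
    assume "\<not> coprime b (int r)"
    then have "nat (gcd b (int r)) \<noteq> 1" by (auto simp: coprime_iff_gcd_eq_1)
    then obtain q where q1: "prime q" "q dvd nat (gcd b (int r))" using prime_factor_nat by blast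
    then have "int q dvd gcd b (int r)" by (metis gcd_ge_0_int int_dvd_int_iff nat_0_le)
    then have q: "prime q" "int q dvd b" "q dvd r" using q1(1) by auto
    show False
    proof (cases "int q dvd c")
      case True
      then have nm: "\<not> q dvd m" using assms(3) q(1)
        using coprime_common_divisor[OF assms(3) True] by (auto simp: prime_nat_iff)
      have "int q dvd int m * t" using True q(2) by (simp add: b_def dvd_add_right_iff)
      then have "q dvd m * \<Prod>T" unfolding t_def by (metis int_dvd_int_iff of_nat_mult)
      then have "q dvd \<Prod>T" using nm q(1) prime_dvd_mult_iff by blast
      then obtain s where "s \<in> T" "q dvd s" using q(1) finT by (auto simp: prime_dvd_prod_iff)
      then have "q \<in> T" using q(1) by (auto simp: T_def dest: primes_dvd_imp_eq)
      then show False using True by (simp add: T_def)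
    next
      case False
      then have "q \<in> T" using q assms(1) by (auto simp: T_def prime_factors_dvd)
      then have "q dvd \<Prod>T" using finT dvd_prodI[of T q "\<lambda>x. x"] by simp
      then have "int q dvd t" unfolding t_def by (simp only: int_dvd_int_iff)
      then have "int q dvd int m * t" by (rule dvd_mult)
      then show False using False q(2) by (simp add: b_def dvd_add_left_iff)
    qed
  qed
  moreover have "[b = c] (mod int m)" by (simp add: b_def cong_def)
  ultimately show ?thesis by blast
qed

text \<open>All fibres of reduction modulo \<open>m\<close> have the same size, because
  multiplication by a lifted unit permutes the reduced residues modulo \<open>r\<close> and carries
  the fibre over 1 to the fibre over \<open>c\<close>.\<close>

lemma card_fibre:
  assumes "r > 0" "m dvd r" "coprime c (int m)"
  shows "card {b \<in> ures r. [b = c] (mod int m)} * totient m = totient r"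
proof -
  have m: "m > 0" using assms dvd_pos_nat by blast
  have eq: "card {b \<in> ures r. [b = c] (mod int m)} = card {b \<in> ures r. [b = 1] (mod int m)}"
    if c: "coprime c (int m)" for c
  proof -
    obtain u where u: "[u = c] (mod int m)" "coprime u (int r)"
      using lift_unit[OF assms(1,2) c] by blast
    have um: "coprime u (int m)" using u(2) assms(2) coprime_divisors[of u u "int m" "int r"] by simp
    have dv: "int m dvd int r" using assms(2) by simp
    define g where "g = (\<lambda>b. if [b = c] (mod int m) then 1 else (0::nat))"
    have "card {b \<in> ures r. [b = c] (mod int m)} = (\<Sum>b\<in>ures r. g b)"
      by (simp add: g_def sum.If_cases Int_def)
    also have "\<dots> = (\<Sum>b\<in>ures r. g (u * b))"
      using assms(1) u(2) dv by (subst sum_ures_mult) (auto simp: g_def cong_def mod_mod_cancel)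
    also have "\<dots> = (\<Sum>b\<in>ures r. if [b = 1] (mod int m) then 1 else 0)"
    proof (rule sum.cong)
      fix b
      have "[u * b = c] (mod int m) \<longleftrightarrow> [u * b = u * 1] (mod int m)"
        using u(1) by (auto simp: cong_def)
      also have "\<dots> \<longleftrightarrow> [b = 1] (mod int m)" by (rule cong_mult_lcancel[OF um])
      finally show "g (u * b) = (if [b = 1] (mod int m) then 1 else 0)" by (simp add: g_def)
    qed simp
    also have "\<dots> = card {b \<in> ures r. [b = 1] (mod int m)}"
      by (simp add: sum.If_cases Int_def)
    finally show ?thesis .
  qed
  have "totient r = (\<Sum>b\<in>ures r. 1)" using card_ures[OF assms(1)] by simp
  also have "\<dots> = (\<Sum>c\<in>ures m. card {b \<in> ures r. [b = c] (mod int m)})"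
    by (subst sum_ures_fibres[OF assms(1,2)]) simp
  also have "\<dots> = (\<Sum>c\<in>ures m. card {b \<in> ures r. [b = 1] (mod int m)})"
    by (intro sum.cong refl eq) (auto simp: ures_def)
  also have "\<dots> = totient m * card {b \<in> ures r. [b = 1] (mod int m)}"
    using card_ures[OF m] by simp
  finally show ?thesis using eq[OF assms(3)] by simp
qed

lemma cong_lcm_iff_int:
  fixes b z :: int
  shows "[b = z] (mod lcm d s) \<longleftrightarrow> [b = z] (mod d) \<and> [b = z] (mod s)"
  by (auto simp: cong_iff_dvd_diff)

lemma cong_pair_solvable_int:
  fixes c n d s :: int
  assumes "[c = n] (mod gcd d s)"
  shows "\<exists>z. [z = c] (mod d) \<and> [z = n] (mod s)"
proof -
  obtain u v where uv: "u * d + v * s = gcd d s" using bezout_int by blast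
  obtain k where k: "n - c = gcd d s * k"
    using assms by (metis cong_iff_dvd_diff cong_sym dvdE)
  define z where "z = c + u * d * k"
  have "[z = c] (mod d)" by (simp add: z_def cong_iff_dvd_diff)
  moreover have "z - n = s * (- v * k)" using k uv
    by (simp add: z_def algebra_simps flip: uv) 
  then have "[z = n] (mod s)" unfolding cong_iff_dvd_diff by (metis dvd_triv_left)
  ultimately show ?thesis by blast
qed

text \<open>Two congruences are either incompatible or amount to one congruence modulo the lcm, so
  \<open>card_fibre\<close> applies; the totients of gcd and lcm multiply to those of
  \<open>d\<close> and \<open>s\<close>.\<close>

lemma card_double_fibre:
  assumes r: "r > 0" "d dvd r" "s dvd r" and c: "coprime c (int d)" and n: "coprime n (int s)"
  shows "card {b \<in> ures r. [b = c] (mod int d) \<and> [b = n] (mod int s)} * (totient d * totient s)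
    = (if [c = n] (mod int (gcd d s)) then totient r * totient (gcd d s) else 0)"
proof (cases "[c = n] (mod int (gcd d s))")
  case False
  have "{b \<in> ures r. [b = c] (mod int d) \<and> [b = n] (mod int s)} = {}"
  proof safe
    fix b assume b: "[b = c] (mod int d)" "[b = n] (mod int s)"
    then have "[b = c] (mod int (gcd d s))" "[b = n] (mod int (gcd d s))"
      by (auto intro: cong_dvd_modulus)
    then show "b \<in> {}" using False by (metis cong_sym cong_trans)
  qed
  then show ?thesis using False by simp
next
  case True
  then obtain z where z: "[z = c] (mod int d)" "[z = n] (mod int s)"
    using cong_pair_solvable_int[of c n "int d" "int s"] by auto
  have zd: "coprime z (int d)" by (rule cong_imp_coprime[OF cong_sym[OF z(1)] c])
  have zs: "coprime z (int s)" by (rule cong_imp_coprime[OF cong_sym[OF z(2)] n])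
  have "int (lcm d s) dvd int d * int s" by (metis lcm_least dvd_triv_left dvd_triv_right of_nat_mult int_dvd_int_iff)
  then have zl: "coprime z (int (lcm d s))"
    using zd zs by (meson coprime_divisors coprime_mult_right_iff dvd_refl)
  have eq: "[b = c] (mod int d) \<and> [b = n] (mod int s) \<longleftrightarrow> [b = z] (mod int (lcm d s))" for b
    using z unfolding lcm_int_int_eq[symmetric] cong_lcm_iff_int by (metis cong_sym cong_trans)
  have "card {b \<in> ures r. [b = z] (mod int (lcm d s))} * totient (lcm d s) = totient r"
    using r zl by (intro card_fibre) auto
  then have "card {b \<in> ures r. [b = z] (mod int (lcm d s))} * totient (lcm d s) * totient (gcd d s)
     = totient r * totient (gcd d s)" by simp
  then show ?thesis using True totient_gcd_lcm[of d s]
    unfolding eq if_P[OF True] by (metis mult.assoc mult.commute)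
qed

text \<open>In terms of Dirichlet characters, \<open>prim_kernel r n a\<close> is the sum of \<open>\<chi>(n) \<chi>\<^sup>*(a)\<close> (conjugate
  on the second factor) over the primitive characters \<open>\<chi>\<close> modulo \<open>r\<close>.\<close>

function prim_kernel :: "nat \<Rightarrow> int \<Rightarrow> int \<Rightarrow> real" where
  "prim_kernel r n a = (if [n = a] (mod int r) then real (totient r) else 0)
     - (\<Sum>s | s dvd r \<and> s < r. prim_kernel s n a)"
  by auto
termination by (relation "measure fst") auto

declare prim_kernel.simps [simp del]

lemma sum_prim_kernel:
  assumes "r > 0"
  shows "(\<Sum>s | s dvd r. prim_kernel s n a) = (if [n = a] (mod int r) then real (totient r) else 0)"
  using assms divisors_split[of r] by (simp add: prim_kernel.simps[of r n a])

lemma prim_kernel_1 [simp]: "prim_kernel (Suc 0) n a = 1"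
proof -
  have "{s::nat. s dvd 1 \<and> s < 1} = {}" by auto
  then show ?thesis by (simp add: prim_kernel.simps[of "Suc 0"])
qed

lemma prim_kernel_cong:
  assumes "r > 0" "[n = n'] (mod int r)" "[a = a'] (mod int r)"
  shows "prim_kernel r n a = prim_kernel r n' a'"
  using assms
proof (induction r rule: less_induct)
  case (less r)
  have "(\<Sum>s | s dvd r \<and> s < r. prim_kernel s n a) = (\<Sum>s | s dvd r \<and> s < r. prim_kernel s n' a')"
  proof (rule sum.cong)
    fix s assume "s \<in> {s. s dvd r \<and> s < r}"
    then have s: "s dvd r" "s < r" by auto
    then have "int s dvd int r" by simp
    then show "prim_kernel s n a = prim_kernel s n' a'"
      using less.IH[OF s(2)] less.prems s by (meson cong_dvd_modulus dvd_pos_nat)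
  qed simp
  moreover have "[n = a] (mod int r) \<longleftrightarrow> [n' = a'] (mod int r)"
    using less.prems by (simp add: cong_def)
  ultimately show ?case by (simp add: prim_kernel.simps[of r])
qed

lemma prim_kernel_mod_right: "r > 0 \<Longrightarrow> prim_kernel r n (a mod int r) = prim_kernel r n a"
  by (rule prim_kernel_cong; simp)

lemma prim_kernel_commute: "prim_kernel r n a = prim_kernel r a n"
proof (induction r rule: less_induct)
  case (less r)
  have "(\<Sum>s | s dvd r \<and> s < r. prim_kernel s n a) = (\<Sum>s | s dvd r \<and> s < r. prim_kernel s a n)"
    by (rule sum.cong) (use less in auto)
  then show ?case by (simp add: prim_kernel.simps[of r] cong_sym_eq)
qed

lemma prim_kernel_scale:
  assumes "r > 0" "coprime u (int r)"
  shows "prim_kernel r (u * n) (u * a) = prim_kernel r n a"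
  using assms
proof (induction r rule: less_induct)
  case (less r)
  have "(\<Sum>s | s dvd r \<and> s < r. prim_kernel s (u * n) (u * a)) = (\<Sum>s | s dvd r \<and> s < r. prim_kernel s n a)"
  proof (rule sum.cong)
    fix s assume "s \<in> {s. s dvd r \<and> s < r}"
    then have s: "s dvd r" "s < r" by auto
    then have "coprime u (int s)" using less.prems coprime_divisors[of u u "int s" "int r"] by simp
    then show "prim_kernel s (u * n) (u * a) = prim_kernel s n a"
      using less.IH[OF s(2)] less.prems s by (meson dvd_pos_nat)
  qed simp
  moreover have "[u * n = u * a] (mod int r) \<longleftrightarrow> [n = a] (mod int r)"
    using less.prems by (simp add: cong_mult_lcancel)
  ultimately show ?case by (simp add: prim_kernel.simps[of r])
qed

text \<open>Averaging over a class modulo \<open>d\<close> keeps exactly the characters whose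
  conductor divides \<open>d\<close>. By induction on \<open>s\<close>: the indicator modulo
  \<open>s\<close> averages to the sum of all kernels of modulus dividing gcd(d, s), the proper
  divisors of \<open>s\<close> are subtracted by the induction hypothesis, and a term remains only
  if \<open>s\<close> itself divides \<open>d\<close>.\<close>

lemma sum_prim_kernel_class:
  assumes r: "r > 0" "d dvd r" and c: "coprime c (int d)" and n: "coprime n (int r)" and s: "s dvd r"
  shows "(\<Sum>b | b \<in> ures r \<and> [b = c] (mod int d). prim_kernel s n b) * real (totient d)
    = (if s dvd d then real (totient r) * prim_kernel s n c else 0)"
  using s
proof (induction s rule: less_induct)
  case (less s)
  have s0: "s > 0" and d0: "d > 0" using less.prems r dvd_pos_nat by blast+
  let ?F = "{b \<in> ures r. [b = c] (mod int d)}"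
  have ns: "coprime n (int s)" using n less.prems coprime_divisors[of n n "int s" "int r"] by simp
  have fin: "finite ?F" by simp
  have "(\<Sum>b\<in>?F. if [n = b] (mod int s) then real (totient s) else 0)
      = real (card {b \<in> ures r. [b = c] (mod int d) \<and> [b = n] (mod int s)}) * real (totient s)"
    using fin by (simp add: sum.If_cases Int_def cong_sym_eq conj_assoc)
  then have 1: "(\<Sum>b\<in>?F. if [n = b] (mod int s) then real (totient s) else 0) * real (totient d)
     = (if [c = n] (mod int (gcd d s)) then real (totient r) * real (totient (gcd d s)) else 0)"
    using card_double_fibre[OF r less.prems c ns]
    by (auto simp: mult.assoc mult.commute mult.left_commute simp flip: of_nat_mult split: if_splits)
  have 2: "\<dots> = real (totient r) * (\<Sum>t | t dvd gcd d s. prim_kernel t n c)"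
    using d0 by (subst sum_prim_kernel) (auto simp: cong_sym_eq)
  have fs: "finite {t. t dvd s \<and> t < s}" using s0 by simp
  have "(\<Sum>b\<in>?F. \<Sum>t | t dvd s \<and> t < s. prim_kernel t n b) * real (totient d)
     = (\<Sum>t | t dvd s \<and> t < s. (\<Sum>b\<in>?F. prim_kernel t n b) * real (totient d))"
    by (subst sum.swap) (simp add: sum_distrib_right)
  also have "\<dots> = (\<Sum>t | t dvd s \<and> t < s. if t dvd d then real (totient r) * prim_kernel t n c else 0)"
    using less.prems by (intro sum.cong refl less.IH) auto
  also have "\<dots> = real (totient r) * (\<Sum>t | t dvd s \<and> t < s \<and> t dvd d. prim_kernel t n c)"
    using fs by (simp add: sum.If_cases sum_distrib_left Int_def conj_assoc)
  finally have 3: "(\<Sum>b\<in>?F. \<Sum>t | t dvd s \<and> t < s. prim_kernel t n b) * real (totient d)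
     = real (totient r) * (\<Sum>t | t dvd s \<and> t < s \<and> t dvd d. prim_kernel t n c)" .
  have "(\<Sum>b\<in>?F. prim_kernel s n b) * real (totient d)
     = real (totient r) * ((\<Sum>t | t dvd gcd d s. prim_kernel t n c)
         - (\<Sum>t | t dvd s \<and> t < s \<and> t dvd d. prim_kernel t n c))"
    by (simp add: prim_kernel.simps[of s] sum_subtractf left_diff_distrib right_diff_distrib 1 2 3)
  also have "(\<Sum>t | t dvd gcd d s. prim_kernel t n c)
         - (\<Sum>t | t dvd s \<and> t < s \<and> t dvd d. prim_kernel t n c) = (if s dvd d then prim_kernel s n c else 0)"
  proof (cases "s dvd d")
    case True
    then have "{t. t dvd s \<and> t < s \<and> t dvd d} = {t. t dvd s \<and> t < s}" by (auto intro: dvd_trans)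
    moreover have "gcd d s = s" using True by (simp add: gcd_nat.absorb2)
    ultimately show ?thesis using True divisors_split[of s] s0 by simp
  next
    case False
    have "{t. t dvd gcd d s} = {t. t dvd s \<and> t < s \<and> t dvd d}"
      using False s0 by (auto simp: le_less dest: dvd_imp_le)
    then show ?thesis using False by simp
  qed
  finally show ?case by simp
qed

text \<open>The form in which primitivity is used from here on: orthogonality to every function of
  smaller period.\<close>

lemma prim_kernel_class_sum_0:
  assumes "r > 0" "d dvd r" "d < r" "coprime c (int d)" "coprime n (int r)"
  shows "(\<Sum>b | b \<in> ures r \<and> [b = c] (mod int d). prim_kernel r n b) = 0"
proof -
  have d0: "d > 0" using assms dvd_pos_nat by blast
  then have "\<not> r dvd d" using assms(3) by (auto dest: dvd_imp_le)
  then show ?thesis using sum_prim_kernel_class[of r d c n r] assms d0 by simp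
qed

text \<open>Expand the second factor by its recursion. The kernels of smaller modulus
  \<open>s\<close> are constant on classes modulo \<open>s\<close> and are annihilated by the first
  factor; the indicator term evaluates the first factor at \<open>a\<close>.\<close>

lemma prim_kernel_reproducing:
  assumes r: "r > 0" and n: "coprime n (int r)" and a: "coprime a (int r)"
  shows "(\<Sum>b\<in>ures r. prim_kernel r n b * prim_kernel r b a) = real (totient r) * prim_kernel r n a"
proof -
  have 0: "(\<Sum>b\<in>ures r. prim_kernel r n b * prim_kernel s b a) = 0" if s: "s dvd r" "s < r" for s
  proof -
    have s0: "s > 0" using r s dvd_pos_nat by blast
    have "(\<Sum>b\<in>ures r. prim_kernel r n b * prim_kernel s b a)
      = (\<Sum>c\<in>ures s. \<Sum>b | b \<in> ures r \<and> [b = c] (mod int s). prim_kernel r n b * prim_kernel s b a)"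
      using r s by (intro sum_ures_fibres)
    also have "\<dots> = (\<Sum>c\<in>ures s. \<Sum>b | b \<in> ures r \<and> [b = c] (mod int s). prim_kernel r n b * prim_kernel s c a)"
      using s0 by (intro sum.cong refl arg_cong2[of _ _ _ _ times] prim_kernel_cong) auto
    also have "\<dots> = 0"
    proof (rule sum.neutral, safe)
      fix c assume "c \<in> ures s"
      then have "coprime c (int s)" by (simp add: ures_def)
      then show "(\<Sum>b | b \<in> ures r \<and> [b = c] (mod int s). prim_kernel r n b * prim_kernel s c a) = 0"
        using prim_kernel_class_sum_0[OF r s _ n, of c] by (simp flip: sum_distrib_right)
    qed
    finally show ?thesis .
  qed
  have ab: "[b = a] (mod int r) \<longleftrightarrow> b = a mod int r" if "b \<in> ures r" for b
    using that by (auto simp: ures_def cong_def)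
  have "(\<Sum>b\<in>ures r. prim_kernel r n b * prim_kernel r b a)
    = (\<Sum>b\<in>ures r. prim_kernel r n b * (if [b = a] (mod int r) then real (totient r) else 0))
      - (\<Sum>b\<in>ures r. \<Sum>s | s dvd r \<and> s < r. prim_kernel r n b * prim_kernel s b a)"
    by (simp add: prim_kernel.simps[of r _ a] right_diff_distrib sum_subtractf sum_distrib_left)
  also have "(\<Sum>b\<in>ures r. \<Sum>s | s dvd r \<and> s < r. prim_kernel r n b * prim_kernel s b a) = 0"
    by (subst sum.swap, rule sum.neutral) (use 0 in auto)
  also have "(\<Sum>b\<in>ures r. prim_kernel r n b * (if [b = a] (mod int r) then real (totient r) else 0))
     = (\<Sum>b\<in>ures r. if b = a mod int r then prim_kernel r n b * real (totient r) else 0)"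
    by (intro sum.cong) (auto simp: ab)
  also have "\<dots> = prim_kernel r n a * real (totient r)"
    using mod_in_ures[OF r a] r by (simp add: prim_kernel_mod_right)
  finally show ?thesis by simp
qed

lemma sum_alternating_Pow:
  assumes "finite A"
  shows "(\<Sum>T\<in>Pow A. (-1) ^ card T) = (if A = {} then 1 else (0::real))"
proof -
  have "(\<Prod>x\<in>A. (1::real) - 1) = (\<Sum>X\<in>Pow A. (-1) ^ card X * (\<Prod>x\<in>X. 1) * (\<Prod>x\<in>A-X. 1))"
    using assms by (rule prod_diff_conv_sum)
  then show ?thesis using assms by (auto simp: power_0_left)
qed

lemma prod_primes_dvd:
  assumes "finite T" "\<And>p. p \<in> T \<Longrightarrow> prime p \<and> p dvd (n::nat)"
  shows "\<Prod>T dvd n"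
  using assms
proof (induction T rule: finite_induct)
  case (insert p T)
  have "coprime p (\<Prod>T)"
    using insert by (intro prod_coprime_right primes_coprime) auto
  then show ?case using insert by (simp add: divides_mult)
qed simp

text \<open>Moebius inversion of \<open>sum_prim_kernel\<close>. The squarefree divisors are
  represented by sets \<open>T\<close> of primes, so that the Moebius function is a sign and the
  number of terms is visibly 2 to the number of primes of \<open>r\<close>.\<close>

lemma prim_kernel_expansion:
  assumes r: "r > 0"
  shows "prim_kernel r n a = (\<Sum>T\<in>Pow (prime_factors r). (-1) ^ card T *
     (if [n = a] (mod int (r div \<Prod>T)) then real (totient (r div \<Prod>T)) else 0))"
proof -
  have dv: "\<Prod>T dvd r" if "T \<in> Pow (prime_factors r)" for T
    using that by (intro prod_primes_dvd) (auto intro: finite_subset)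
  have pos: "r div \<Prod>T > 0" if "T \<in> Pow (prime_factors r)" for T
    using dv[OF that] r by (auto elim!: dvdE)
  have iff: "s dvd r div \<Prod>T \<longleftrightarrow> T \<subseteq> prime_factors (r div s)"
    if T: "T \<in> Pow (prime_factors r)" and s: "s dvd r" for s T
  proof -
    obtain k where k: "r = s * k" using s by blast
    have k0: "k > 0" "s > 0" using k r by auto
    have T0: "\<Prod>T > 0" using dv[OF T] r by (meson dvd_pos_nat)
    have fT: "finite T" using T by (auto intro: finite_subset)
    have "s dvd r div \<Prod>T \<longleftrightarrow> s * \<Prod>T dvd r"
      using dv[OF T] T0 by (simp add: dvd_div_iff_mult)
    also have "\<dots> \<longleftrightarrow> \<Prod>T dvd k" using k k0 by simp
    also have "\<dots> \<longleftrightarrow> (\<forall>p\<in>T. p dvd k)"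
    proof
      assume "\<Prod>T dvd k" 
      then show "\<forall>p\<in>T. p dvd k" using fT by (meson dvd_prodI dvd_trans)
    next
      assume "\<forall>p\<in>T. p dvd k"
      then show "\<Prod>T dvd k" using T fT by (intro prod_primes_dvd) auto
    qed
    also have "\<dots> \<longleftrightarrow> T \<subseteq> prime_factors (r div s)"
      using T k k0 by (auto simp: prime_factors_dvd)
    finally show ?thesis .
  qed
  have "(\<Sum>T\<in>Pow (prime_factors r). (-1) ^ card T *
     (if [n = a] (mod int (r div \<Prod>T)) then real (totient (r div \<Prod>T)) else 0))
    = (\<Sum>T\<in>Pow (prime_factors r). (-1) ^ card T * (\<Sum>s | s dvd r div \<Prod>T. prim_kernel s n a))"
    using pos by (intro sum.cong refl) (simp add: sum_prim_kernel)
  also have "\<dots> = (\<Sum>T\<in>Pow (prime_factors r). \<Sum>s | s dvd r.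
     if s dvd r div \<Prod>T then (-1) ^ card T * prim_kernel s n a else 0)"
  proof (intro sum.cong refl)
    fix T assume T: "T \<in> Pow (prime_factors r)"
    have "{s. s dvd r div \<Prod>T} = {s \<in> {s. s dvd r}. s dvd r div \<Prod>T}"
      using dv[OF T] by (auto intro: dvd_trans[OF _ div_dvd_iff_mult[THEN iffD2]] dvd_trans simp: div_dvd_div)
         (metis dvd_div_mult_self dvd_mult2 dvd_trans)
    then show "(-1) ^ card T * (\<Sum>s | s dvd r div \<Prod>T. prim_kernel s n a)
      = (\<Sum>s | s dvd r. if s dvd r div \<Prod>T then (-1) ^ card T * prim_kernel s n a else 0)"
      using r by (simp add: sum.inter_filter[symmetric] sum_distrib_left)
  qed
  also have "\<dots> = (\<Sum>s | s dvd r. \<Sum>T\<in>Pow (prime_factors r).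
     if T \<subseteq> prime_factors (r div s) then (-1) ^ card T * prim_kernel s n a else 0)"
    by (subst sum.swap) (intro sum.cong refl, auto simp: iff)
  also have "\<dots> = (\<Sum>s | s dvd r. if s = r then prim_kernel s n a else 0)"
  proof (intro sum.cong refl)
    fix s assume "s \<in> {s. s dvd r}"
    then have s: "s dvd r" by simp
    then obtain k where k: "r = s * k" by blast
    have k0: "k > 0" "s > 0" using k r by auto
    have sub: "prime_factors (r div s) \<subseteq> prime_factors r" using k k0 by (auto simp: prime_factors_dvd)
    have "(\<Sum>T\<in>Pow (prime_factors r).
       if T \<subseteq> prime_factors (r div s) then (-1) ^ card T * prim_kernel s n a else 0)
      = (\<Sum>T | T \<in> Pow (prime_factors r) \<and> T \<subseteq> prime_factors (r div s). (-1) ^ card T * prim_kernel s n a)"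
      by (rule sum.inter_filter[symmetric]) simp
    also have "{T. T \<in> Pow (prime_factors r) \<and> T \<subseteq> prime_factors (r div s)} = Pow (prime_factors (r div s))"
      using sub by auto
    also have "(\<Sum>T\<in>Pow (prime_factors (r div s)). (-1) ^ card T * prim_kernel s n a)
       = (\<Sum>T\<in>Pow (prime_factors (r div s)). (-1) ^ card T) * prim_kernel s n a"
      by (simp add: sum_distrib_right)
    also have "\<dots> = (if s = r then prim_kernel s n a else 0)"
      using k k0 by (subst sum_alternating_Pow) (auto simp: prime_factorization_empty_iff)
    finally show "(\<Sum>T\<in>Pow (prime_factors r).
       if T \<subseteq> prime_factors (r div s) then (-1) ^ card T * prim_kernel s n a else 0)
       = (if s = r then prim_kernel s n a else 0)" .
  qed
  also have "\<dots> = prim_kernel r n a" using r by simp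
  finally show ?thesis ..
qed

section \<open>The large sieve\<close>

lemma Cauchy_Schwarz_sum_real:
  fixes f g :: "'a \<Rightarrow> real"
  shows "(\<Sum>i\<in>I. f i * g i) \<le> sqrt (\<Sum>i\<in>I. (f i)\<^sup>2) * sqrt (\<Sum>i\<in>I. (g i)\<^sup>2)"
proof -
  have "(\<Sum>i\<in>I. f i * g i) \<le> (\<Sum>i\<in>I. \<bar>f i\<bar> * \<bar>g i\<bar>)"
    by (intro sum_mono) (metis abs_ge_self abs_mult)
  also have "\<dots> \<le> L2_set f I * L2_set g I" by (rule L2_set_mult_ineq)
  finally show ?thesis by (simp add: L2_set_def)
qed

lemma Cauchy_Schwarz_sum_cmod:
  fixes f g :: "'a \<Rightarrow> complex"
  shows "cmod (\<Sum>i\<in>I. f i * g i) \<le> sqrt (\<Sum>i\<in>I. (cmod (f i))\<^sup>2) * sqrt (\<Sum>i\<in>I. (cmod (g i))\<^sup>2)"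
proof -
  have "cmod (\<Sum>i\<in>I. f i * g i) \<le> (\<Sum>i\<in>I. cmod (f i) * cmod (g i))"
    by (rule order_trans[OF norm_sum]) (simp add: norm_mult)
  also have "\<dots> \<le> sqrt (\<Sum>i\<in>I. (cmod (f i))\<^sup>2) * sqrt (\<Sum>i\<in>I. (cmod (g i))\<^sup>2)"
    by (rule Cauchy_Schwarz_sum_real)
  finally show ?thesis .
qed

definition ee :: "real \<Rightarrow> complex" where "ee t = cis (2 * pi * t)"

lemma ee_0 [simp]: "ee 0 = 1" by (simp add: ee_def)
lemma norm_ee [simp]: "cmod (ee t) = 1" by (simp add: ee_def)
lemma ee_add: "ee (s + t) = ee s * ee t" by (simp add: ee_def cis_mult distrib_left)
lemma cnj_ee: "cnj (ee t) = ee (- t)" by (simp add: ee_def cis_cnj)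
lemma ee_int [simp]: "ee (of_int k) = 1"
  using cis_multiple_2pi[of "of_int k"] by (simp add: ee_def)
lemma ee_power: "ee t ^ n = ee (real n * t)"
  by (simp add: ee_def DeMoivre mult_ac)
lemma ee_add_int: "ee (t + of_int k) = ee t" by (simp add: ee_add)

text \<open>A weak form of Jordan's inequality from the cubic Taylor bound. Together with
  \<open>pi_ge_3\<close> the constant 1/3 is just enough for the bound by min(t, 1 - t) in
  \<open>sin_pi_ge\<close>.\<close>

lemma sin_ge_fraction:
  assumes "0 \<le> u" "u \<le> pi / 2"
  shows "u / 3 \<le> sin u"
proof -
  have "\<bar>sin u - (\<Sum>m<3. sin_coeff m * u ^ m)\<bar> \<le> inverse (fact 3) * \<bar>u\<bar> ^ 3"
    by (rule Maclaurin_sin_bound)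
  then have "6 * \<bar>sin u - u\<bar> \<le> u ^ 3"
    using assms(1) by (simp add: eval_nat_numeral sin_coeff_def field_simps)
  then have "sin u \<ge> u - u ^ 3 / 6" unfolding abs_if by (simp split: if_splits)
  moreover have "u\<^sup>2 \<le> 4"
  proof -
    have "u \<le> 2" using assms pi_less_4 by simp
    then have "u\<^sup>2 \<le> 2\<^sup>2" using assms(1) by (intro power_mono) auto
    then show ?thesis by simp
  qed
  then have "u * u\<^sup>2 \<le> u * 4" using assms(1) by (intro mult_left_mono) auto
  ultimately show ?thesis by (simp add: power3_eq_cube power2_eq_square)
qed

lemma pi_ge_3: "pi \<ge> 3"
  using sin_x_le_x[of "pi / 6"] by (simp add: sin_30)

lemma sin_pi_ge:
  assumes "0 \<le> t" "t \<le> 1"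
  shows "min t (1 - t) \<le> sin (pi * t)"
proof (cases "t \<le> 1 / 2")
  case True
  have "pi * t / 3 \<le> sin (pi * t)" using True assms by (intro sin_ge_fraction) auto
  moreover have "t \<le> pi * t / 3" using mult_right_mono[OF pi_ge_3 assms(1)] by simp
  ultimately show ?thesis by simp
next
  case False
  have "pi * (1 - t) / 3 \<le> sin (pi * (1 - t))" using False assms
    by (intro sin_ge_fraction) (auto simp: field_simps)
  moreover have "3 * (1 - t) \<le> pi * (1 - t)" using assms pi_ge_3 by (intro mult_right_mono) auto
  moreover have "sin (pi * (1 - t)) = sin (pi * t)" by (simp add: right_diff_distrib)
  ultimately show ?thesis by simp
qed

lemma norm_one_minus_ee: "cmod (1 - ee t) = 2 * \<bar>sin (pi * t)\<bar>"
proof -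
  have "(cmod (1 - ee t))\<^sup>2 = (1 - cos (2 * (pi * t)))\<^sup>2 + (sin (2 * (pi * t)))\<^sup>2"
    by (simp add: cmod_power2 ee_def mult.assoc)
  also have "\<dots> = 2 - 2 * cos (2 * (pi * t))"
    using sin_cos_squared_add[of "2 * (pi * t)"] by (simp add: power2_eq_square algebra_simps)
  also have "\<dots> = (2 * \<bar>sin (pi * t)\<bar>)\<^sup>2"
    by (simp only: cos_double_sin) (simp add: power_mult_distrib)
  finally show ?thesis by (rule power2_eq_imp_eq) auto
qed

lemma geometric_ee_bound:
  assumes "0 < t" "t < 1"
  shows "(cmod (\<Sum>u<H. ee (real u * t)))\<^sup>2 \<le> 1 / t\<^sup>2 + 1 / (1 - t)\<^sup>2"
proof -
  have m: "min t (1 - t) > 0" using assms by simp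
  then have s: "sin (pi * t) \<ge> min t (1 - t)" "sin (pi * t) > 0" using sin_pi_ge[of t] assms by auto
  have "(\<Sum>u<H. ee (real u * t)) * (1 - ee t) = 1 - ee t ^ H"
    unfolding ee_power[symmetric] one_diff_power_eq by (rule mult.commute)
  then have "cmod (\<Sum>u<H. ee (real u * t)) * cmod (1 - ee t) = cmod (1 - ee t ^ H)"
    by (metis norm_mult)
  also have "\<dots> \<le> 2" using norm_triangle_ineq4[of 1 "ee t ^ H"] by (simp add: norm_power)
  finally have "cmod (\<Sum>u<H. ee (real u * t)) * sin (pi * t) \<le> 1"
    using s by (simp add: norm_one_minus_ee)
  then have "cmod (\<Sum>u<H. ee (real u * t)) * min t (1 - t) \<le> 1"
    using s(1) by (meson mult_left_mono norm_ge_zero order_trans)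
  then have "cmod (\<Sum>u<H. ee (real u * t)) \<le> 1 / min t (1 - t)"
    using m by (simp add: pos_le_divide_eq)
  then have "(cmod (\<Sum>u<H. ee (real u * t)))\<^sup>2 \<le> (1 / min t (1 - t))\<^sup>2"
    by (intro power_mono) auto
  also have "\<dots> \<le> 1 / t\<^sup>2 + 1 / (1 - t)\<^sup>2" by (simp add: min_def power_divide)
  finally show ?thesis .
qed

lemma sum_inverse_squares_le: "(\<Sum>k\<in>{1..n::nat}. 1 / (real k)\<^sup>2) \<le> 2"
proof -
  have "(\<Sum>k\<in>{1..Suc n}. 1 / (real k)\<^sup>2) \<le> 2 - 1 / real (Suc n)" for n
  proof (induction n)
    case (Suc n)
    have "1 / (real (Suc (Suc n)))\<^sup>2 \<le> 1 / real (Suc n) - 1 / real (Suc (Suc n))"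
      by (simp add: divide_simps power2_eq_square)
    then show ?case using Suc by simp
  qed simp
  note * = this
  show ?thesis
  proof (cases n)
    case (Suc m)
    show ?thesis unfolding Suc by (rule order_trans[OF *]) simp
  qed simp
qed

text \<open>The integer parts of the t(i) / d are distinct positive integers, so the sum is
  dominated by the series of inverse squares.\<close>

lemma sum_spaced_inverse_squares:
  fixes t :: "'a \<Rightarrow> real"
  assumes "finite I" and d: "d > 0" and "inj_on (\<lambda>i. \<lfloor>t i / d\<rfloor>) I" and t: "\<And>i. i \<in> I \<Longrightarrow> t i \<ge> d"
  shows "(\<Sum>i\<in>I. 1 / (t i)\<^sup>2) \<le> 2 / d\<^sup>2"
proof -
  define k where "k = (\<lambda>i. nat \<lfloor>t i / d\<rfloor>)"
  have k1: "k i \<ge> 1" "real (k i) * d \<le> t i" if "i \<in> I" for i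
  proof -
    have "t i / d \<ge> 1" using t[OF that] d by simp
    then have f: "\<lfloor>t i / d\<rfloor> \<ge> 1" by simp
    then show "k i \<ge> 1" unfolding k_def by linarith
    have "real (k i) \<le> t i / d" using f by (simp add: k_def)
    then show "real (k i) * d \<le> t i" using d by (simp add: field_simps)
  qed
  have inj: "inj_on k I"
  proof (rule inj_onI)
    fix i j assume ij: "i \<in> I" "j \<in> I" "k i = k j"
    then have "\<lfloor>t i / d\<rfloor> = \<lfloor>t j / d\<rfloor>" using k1(1)[of i] k1(1)[of j] by (simp add: k_def)
    then show "i = j" using assms(3) ij by (auto dest: inj_onD)
  qed
  define n where "n = Max (insert 1 (k ` I))"
  have sub: "k ` I \<subseteq> {1..n}" using assms(1) k1(1) by (auto simp: n_def)
  have "(\<Sum>i\<in>I. 1 / (t i)\<^sup>2) \<le> (\<Sum>i\<in>I. 1 / (real (k i) * d)\<^sup>2)"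
  proof (rule sum_mono)
    fix i assume i: "i \<in> I"
    have "0 < real (k i) * d" using k1(1)[OF i] d by simp
    moreover from this have "0 < t i" using k1(2)[OF i] by simp
    ultimately show "1 / (t i)\<^sup>2 \<le> 1 / (real (k i) * d)\<^sup>2"
      using k1(2)[OF i] by (intro divide_left_mono power_mono mult_pos_pos[of "_ ^ 2"] zero_less_power) auto
  qed
  also have "\<dots> = (\<Sum>m\<in>k ` I. 1 / (real m)\<^sup>2) / d\<^sup>2"
    using inj by (simp add: sum.reindex sum_divide_distrib power_mult_distrib)
  also have "\<dots> \<le> (\<Sum>m\<in>{1..n}. 1 / (real m)\<^sup>2) / d\<^sup>2"
    using sub by (intro divide_right_mono sum_mono2) auto
  also have "\<dots> \<le> 2 / d\<^sup>2"
  proof (rule divide_right_mono)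
    show "(\<Sum>m\<in>{1..n}. 1 / (real m)\<^sup>2) \<le> 2" by (rule sum_inverse_squares_le)
  qed simp
  finally show ?thesis .
qed

text \<open>Modulo 1 the differences x(i) - x(j) are \<open>d\<close>-separated and stay
  \<open>d\<close> away from both ends of the unit interval. The Dirichlet kernel is controlled by
  the distance to the nearer end; bounding by the sum over both ends allows each end to be treated
  as a spaced sequence. The diagonal term gives H^2.\<close>

lemma large_sieve_row:
  fixes x :: "'a \<Rightarrow> real"
  assumes "finite I" "i \<in> I" and d: "d > 0"
    and sep: "\<And>i j k. i \<in> I \<Longrightarrow> j \<in> I \<Longrightarrow> i \<noteq> j \<Longrightarrow> \<bar>x i - x j - of_int k\<bar> \<ge> d"
  shows "(\<Sum>j\<in>I. (cmod (\<Sum>u<H. ee (real u * (x i - x j))))\<^sup>2) \<le> (real H)\<^sup>2 + 4 / d\<^sup>2"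
proof -
  define t where "t = (\<lambda>j. frac (x i - x j))"
  have ee_frac: "ee (real u * (x i - x j)) = ee (real u * t j)" for u j
  proof -
    have "real u * (x i - x j) = real u * t j + of_int (int u * \<lfloor>x i - x j\<rfloor>)"
      by (simp add: t_def frac_def algebra_simps)
    then show ?thesis by (metis ee_add_int)
  qed
  have td: "t j \<ge> d" "1 - t j \<ge> d" if "j \<in> I - {i}" for j
  proof -
    have "\<bar>x i - x j - of_int \<lfloor>x i - x j\<rfloor>\<bar> \<ge> d" "\<bar>x i - x j - of_int (\<lfloor>x i - x j\<rfloor> + 1)\<bar> \<ge> d"
      using that assms(2) by (intro sep; auto)+
    then show "t j \<ge> d" "1 - t j \<ge> d"
      using frac_ge_0[of "x i - x j"] frac_lt_1[of "x i - x j"] by (auto simp: t_def frac_def)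
  qed
  have close: "\<bar>t j - t l\<bar> \<ge> d" if "j \<in> I" "l \<in> I" "j \<noteq> l" for j l
  proof -
    have "t j - t l = - (x j - x l - of_int (\<lfloor>x i - x l\<rfloor> - \<lfloor>x i - x j\<rfloor>))"
      by (simp add: t_def frac_def)
    then show ?thesis using sep[OF that] by (metis abs_minus_cancel)
  qed
  have floor_inj: "inj_on (\<lambda>j. \<lfloor>g j / d\<rfloor>) J" if "\<And>j l. j \<in> J \<Longrightarrow> l \<in> J \<Longrightarrow> j \<noteq> l \<Longrightarrow> \<bar>g j - g l\<bar> \<ge> d" for g J
  proof (rule inj_onI, rule ccontr)
    fix j l assume jl: "j \<in> J" "l \<in> J" "\<lfloor>g j / d\<rfloor> = \<lfloor>g l / d\<rfloor>" "j \<noteq> l"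
    have "\<bar>g j / d - g l / d\<bar> < 1" using jl(3) by linarith
    then have "\<bar>g j - g l\<bar> < d" using d by (simp add: diff_divide_distrib[symmetric])
    then show False using that jl by fastforce
  qed
  have "(\<Sum>j\<in>I. (cmod (\<Sum>u<H. ee (real u * (x i - x j))))\<^sup>2)
     = (real H)\<^sup>2 + (\<Sum>j\<in>I - {i}. (cmod (\<Sum>u<H. ee (real u * t j)))\<^sup>2)"
    using assms(1,2) by (subst sum.remove[of I i]) (auto simp: ee_frac[symmetric])
  also have "\<dots> \<le> (real H)\<^sup>2 + (\<Sum>j\<in>I - {i}. 1 / (t j)\<^sup>2 + 1 / (1 - t j)\<^sup>2)"
    using td d by (intro add_left_mono sum_mono geometric_ee_bound) (smt (verit))+
  also have "\<dots> = (real H)\<^sup>2 + ((\<Sum>j\<in>I - {i}. 1 / (t j)\<^sup>2) + (\<Sum>j\<in>I - {i}. 1 / (1 - t j)\<^sup>2))"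
    by (simp add: sum.distrib)
  also have "\<dots> \<le> (real H)\<^sup>2 + (2 / d\<^sup>2 + 2 / d\<^sup>2)"
  proof (intro add_left_mono add_mono sum_spaced_inverse_squares d)
    show "inj_on (\<lambda>j. \<lfloor>t j / d\<rfloor>) (I - {i})" by (rule floor_inj) (use close in auto)
    show "inj_on (\<lambda>j. \<lfloor>(1 - t j) / d\<rfloor>) (I - {i})"
      by (rule floor_inj) (use close in \<open>fastforce simp: abs_minus_commute\<close>)
  qed (use assms(1) td in auto)
  finally show ?thesis by simp
qed

text \<open>The weight counting the representations \<open>n = u - v\<close> with \<open>u, v < 2H\<close> is at least \<open>H\<close> for
  \<open>1 \<le> n \<le> H\<close>, and its Fourier transform is the square of a Dirichlet kernel.\<close>

lemma large_sieve_dual: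
  fixes x :: "'a \<Rightarrow> real"
  assumes I: "finite I" and d: "d > 0" and H: "H > 0" "N \<le> H"
    and sep: "\<And>i j k. i \<in> I \<Longrightarrow> j \<in> I \<Longrightarrow> i \<noteq> j \<Longrightarrow> \<bar>x i - x j - of_int k\<bar> \<ge> d"
  shows "real H * (\<Sum>n\<in>{1..N}. (cmod (\<Sum>i\<in>I. c i * ee (real n * x i)))\<^sup>2)
     \<le> (4 * (real H)\<^sup>2 + 4 / d\<^sup>2) * (\<Sum>i\<in>I. (cmod (c i))\<^sup>2)"
proof -
  define F where "F = (\<lambda>n::real. \<Sum>i\<in>I. c i * ee (n * x i))"
  define D where "D = (\<lambda>t. \<Sum>u<2*H. ee (real u * t))"
  have "real H * (\<Sum>n\<in>{1..N}. (cmod (F (real n)))\<^sup>2)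
      = (\<Sum>n\<in>{1..N}. \<Sum>v<H. (cmod (F (real n)))\<^sup>2)" by (simp add: sum_distrib_left)
  also have "\<dots> = (\<Sum>(n, v)\<in>{1..N} \<times> {..<H}. (cmod (F (real n)))\<^sup>2)"
    by (rule sum.cartesian_product)
  also have "\<dots> = (\<Sum>(u, v)\<in>(\<lambda>(n, v). (n + v, v)) ` ({1..N} \<times> {..<H}). (cmod (F (real u - real v)))\<^sup>2)"
    by (subst sum.reindex) (auto simp: inj_on_def intro!: sum.cong)
  also have "\<dots> \<le> (\<Sum>(u, v)\<in>{..<2*H} \<times> {..<2*H}. (cmod (F (real u - real v)))\<^sup>2)"
    using H by (intro sum_mono2) auto
  also have "\<dots> = (\<Sum>u<2*H. \<Sum>v<2*H. (cmod (F (real u - real v)))\<^sup>2)"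
    by (simp add: sum.cartesian_product)
  finally have 1: "real H * (\<Sum>n\<in>{1..N}. (cmod (F (real n)))\<^sup>2) \<le> \<dots>" .
  have "complex_of_real (\<Sum>u<2*H. \<Sum>v<2*H. (cmod (F (real u - real v)))\<^sup>2)
     = (\<Sum>u<2*H. \<Sum>v<2*H. \<Sum>i\<in>I. \<Sum>j\<in>I. c i * cnj (c j) * (ee (real u * (x i - x j)) * ee (real v * (x j - x i))))"
  proof -
    have "complex_of_real ((cmod (F (real u - real v)))\<^sup>2)
      = (\<Sum>i\<in>I. \<Sum>j\<in>I. c i * cnj (c j) * (ee (real u * (x i - x j)) * ee (real v * (x j - x i))))" for u v :: nat
    proof -
      have "ee ((real u - real v) * x i) * ee (- ((real u - real v) * x j))
        = ee (real u * (x i - x j)) * ee (real v * (x j - x i))" for i j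
        by (simp add: ee_add[symmetric] algebra_simps)
      then show ?thesis
        by (simp only: complex_norm_square F_def cnj_sum complex_cnj_mult cnj_ee sum_product)
          (simp add: mult_ac)
    qed
    then show ?thesis by (simp only: of_real_sum)
  qed
  also have "\<dots> = (\<Sum>i\<in>I. \<Sum>j\<in>I. c i * cnj (c j) * (D (x i - x j) * D (x j - x i)))"
  proof -
    have "(\<Sum>u<2*H. \<Sum>v<2*H. \<Sum>i\<in>I. \<Sum>j\<in>I. g u v i j) = (\<Sum>i\<in>I. \<Sum>j\<in>I. \<Sum>u<2*H. \<Sum>v<2*H. g u v i j)"
      for g :: "nat \<Rightarrow> nat \<Rightarrow> 'a \<Rightarrow> 'a \<Rightarrow> complex"
      by (simp only: sum.swap[of _ "{..<2*H}" I])
    moreover have "D s * D t = (\<Sum>u<2*H. \<Sum>v<2*H. ee (real u * s) * ee (real v * t))" for s t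
      by (simp only: D_def sum_product)
    ultimately show ?thesis by (simp only: sum_distrib_left)
  qed
  finally have 2: "complex_of_real (\<Sum>u<2*H. \<Sum>v<2*H. (cmod (F (real u - real v)))\<^sup>2) = \<dots>" .
  have Dsym: "cmod (D (x j - x i)) = cmod (D (x i - x j))" for i j
  proof -
    have "D (x j - x i) = cnj (D (x i - x j))" by (simp add: D_def cnj_ee algebra_simps)
    then show ?thesis by (simp only: complex_mod_cnj)
  qed
  have "(\<Sum>u<2*H. \<Sum>v<2*H. (cmod (F (real u - real v)))\<^sup>2)
     \<le> cmod (\<Sum>i\<in>I. \<Sum>j\<in>I. c i * cnj (c j) * (D (x i - x j) * D (x j - x i)))"
    by (simp only: 2[symmetric] norm_of_real)
  also have "\<dots> \<le> (\<Sum>i\<in>I. \<Sum>j\<in>I. cmod (c i) * cmod (c j) * (cmod (D (x i - x j)))\<^sup>2)"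
    by (intro order_trans[OF norm_sum] sum_mono) (simp add: norm_mult Dsym power2_eq_square)
  \<comment> \<open>Schur's test: 2ab <= a^2 + b^2 and the symmetry of |D| reduce the quadratic form
    to row sums.\<close>
  also have "\<dots> \<le> (\<Sum>i\<in>I. \<Sum>j\<in>I. ((cmod (c i))\<^sup>2 / 2 + (cmod (c j))\<^sup>2 / 2) * (cmod (D (x i - x j)))\<^sup>2)"
  proof (intro sum_mono mult_right_mono)
    fix i j show "cmod (c i) * cmod (c j) \<le> (cmod (c i))\<^sup>2 / 2 + (cmod (c j))\<^sup>2 / 2"
      using sum_squares_bound[of "cmod (c i)" "cmod (c j)"] by simp
  qed simp
  also have "\<dots> = (\<Sum>i\<in>I. (cmod (c i))\<^sup>2 * (\<Sum>j\<in>I. (cmod (D (x i - x j)))\<^sup>2))"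
  proof -
    have "(\<Sum>i\<in>I. \<Sum>j\<in>I. (cmod (c j))\<^sup>2 / 2 * (cmod (D (x i - x j)))\<^sup>2)
      = (\<Sum>i\<in>I. \<Sum>j\<in>I. (cmod (c i))\<^sup>2 / 2 * (cmod (D (x i - x j)))\<^sup>2)"
      by (subst sum.swap, intro sum.cong refl arg_cong2[of _ _ _ _ times] arg_cong[of _ _ "\<lambda>z. z\<^sup>2"] Dsym)
    then have "(\<Sum>i\<in>I. \<Sum>j\<in>I. ((cmod (c i))\<^sup>2 / 2 + (cmod (c j))\<^sup>2 / 2) * (cmod (D (x i - x j)))\<^sup>2)
      = 2 * (\<Sum>i\<in>I. \<Sum>j\<in>I. (cmod (c i))\<^sup>2 / 2 * (cmod (D (x i - x j)))\<^sup>2)"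
      by (simp only: distrib_right sum.distrib)
    then show ?thesis by (simp add: sum_distrib_left)
  qed
  also have "\<dots> \<le> (\<Sum>i\<in>I. (cmod (c i))\<^sup>2 * ((real (2 * H))\<^sup>2 + 4 / d\<^sup>2))"
    unfolding D_def by (intro sum_mono mult_left_mono large_sieve_row I d sep) auto
  also have "\<dots> = (4 * (real H)\<^sup>2 + 4 / d\<^sup>2) * (\<Sum>i\<in>I. (cmod (c i))\<^sup>2)"
    by (simp add: sum_distrib_right[symmetric] mult.commute power_mult_distrib)
  finally show ?thesis using 1 by (simp add: F_def)
qed

text \<open>The closing step of a duality argument: Cauchy-Schwarz against a bound for the dual form
  estimates \<open>s\<close> by a multiple of its own square root, which is then cancelled.\<close>

lemma norm_sq_le_imp_le:
  fixes s a b :: real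
  assumes "0 \<le> s" "0 \<le> a" "0 \<le> b" "s \<le> sqrt a * sqrt (b * s)"
  shows "s \<le> a * b"
proof (cases "s = 0")
  case False
  have "s\<^sup>2 \<le> (sqrt a * sqrt (b * s))\<^sup>2" using assms by (intro power_mono) auto
  also have "\<dots> = a * b * s" using assms by (simp add: power_mult_distrib)
  finally show ?thesis using False assms(1) by (simp add: power2_eq_square)
qed (use assms in auto)

text \<open>Distinct reduced fractions with denominators up to \<open>R\<close> differ modulo 1 by
  at least 1/R^2, as the difference has a nonzero integer numerator over \<open>r * s\<close>. The
  dual inequality is then tested with the conjugates of the exponential sums themselves.\<close>

lemma large_sieve_additive:
  fixes \<alpha> :: "nat \<Rightarrow> complex"
  assumes R: "R > 0"
  shows "(\<Sum>r\<in>{1..R}. \<Sum>h\<in>ures r. (cmod (\<Sum>n\<in>{1..N}. \<alpha> n * ee (real n * (of_int h / real r))))\<^sup>2)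
     \<le> 8 * (real N + (real R)\<^sup>2) * (\<Sum>n\<in>{1..N}. (cmod (\<alpha> n))\<^sup>2)"
proof -
  define I where "I = Sigma {1..R} ures"
  define x where "x = (\<lambda>(r::nat, h::int). of_int h / real r)"
  have finI: "finite I" by (simp add: I_def)
  have sep: "\<bar>x i - x j - of_int k\<bar> \<ge> 1 / (real R)\<^sup>2" if ij: "i \<in> I" "j \<in> I" "i \<noteq> j" for i j k
  proof -
    obtain r h s g where e: "i = (r, h)" "j = (s, g)" by (cases i; cases j)
    have rs: "1 \<le> r" "r \<le> R" "1 \<le> s" "s \<le> R" "h \<in> ures r" "g \<in> ures s" using ij e by (auto simp: I_def)
    define m where "m = h * int s - g * int r - k * int r * int s"
    have "m \<noteq> 0"
    proof
      assume m: "m = 0"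
      then have 1: "h * int s = int r * (g + k * int s)" "g * int r = int s * (h - k * int r)"
        by (auto simp: m_def algebra_simps)
      have "int r dvd h * int s" "int s dvd g * int r" using 1 by (metis dvd_triv_left)+
      then have "int r dvd int s" "int s dvd int r" using rs
        by (auto simp: ures_def coprime_commute coprime_dvd_mult_right_iff)
      then have rs': "r = s" by (simp add: dvd_antisym)
      then have "int s * h = int s * (g + k * int s)" using 1 by (simp add: algebra_simps)
      then have "h = g + k * int r" using rs rs' by simp
      then have "[h = g] (mod int r)" by (simp add: cong_def)
      then have "h = g" using rs rs' ures_eqI by blast
      then show False using e rs' ij by simp
    qed
    then have "\<bar>m\<bar> \<ge> 1" by simp
    then have "\<bar>real_of_int m\<bar> \<ge> 1" by (metis of_int_abs of_int_1_le_iff)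
    moreover have "x i - x j - of_int k = real_of_int m / (real r * real s)"
      using rs by (simp add: e x_def m_def field_simps)
    moreover have "real r * real s \<le> (real R)\<^sup>2" "real r * real s > 0"
      using rs by (auto simp: power2_eq_square intro!: mult_mono)
    ultimately show ?thesis by (simp add: abs_div frac_le)
  qed
  \<comment> \<open>With this choice R^4 <= H^2, so both terms of \<open>large_sieve_dual\<close>
    are at most 4 H^2, and dividing by \<open>H\<close> leaves 8 (N + R^2).\<close>
  define H where "H = N + R\<^sup>2"
  have H: "H > 0" "N \<le> H" "(real R)\<^sup>2 \<le> real H" using R by (auto simp: H_def)
  have dual: "(\<Sum>n\<in>{1..N}. (cmod (\<Sum>i\<in>I. c i * ee (real n * x i)))\<^sup>2)
     \<le> 8 * (real N + (real R)\<^sup>2) * (\<Sum>i\<in>I. (cmod (c i))\<^sup>2)" for c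
  proof -
    have "real H * (\<Sum>n\<in>{1..N}. (cmod (\<Sum>i\<in>I. c i * ee (real n * x i)))\<^sup>2)
      \<le> (4 * (real H)\<^sup>2 + 4 / (1 / (real R)\<^sup>2)\<^sup>2) * (\<Sum>i\<in>I. (cmod (c i))\<^sup>2)"
      using R by (intro large_sieve_dual finI H sep) auto
    also have "4 / (1 / (real R)\<^sup>2)\<^sup>2 = 4 * ((real R)\<^sup>2 * (real R)\<^sup>2)" by (simp add: power2_eq_square field_simps)
    also have "(4 * (real H)\<^sup>2 + 4 * ((real R)\<^sup>2 * (real R)\<^sup>2)) * (\<Sum>i\<in>I. (cmod (c i))\<^sup>2)
       \<le> (4 * (real H)\<^sup>2 + 4 * (real H * real H)) * (\<Sum>i\<in>I. (cmod (c i))\<^sup>2)"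
      using H by (intro mult_right_mono add_left_mono mult_left_mono mult_mono sum_nonneg) auto
    also have "\<dots> = real H * (8 * real H * (\<Sum>i\<in>I. (cmod (c i))\<^sup>2))" by (simp add: power2_eq_square)
    finally have "(\<Sum>n\<in>{1..N}. (cmod (\<Sum>i\<in>I. c i * ee (real n * x i)))\<^sup>2)
      \<le> 8 * real H * (\<Sum>i\<in>I. (cmod (c i))\<^sup>2)" using H(1) by (subst (asm) mult_le_cancel_left_pos) auto
    then show ?thesis by (simp add: H_def)
  qed
  define S where "S = (\<lambda>i. \<Sum>n\<in>{1..N}. \<alpha> n * ee (real n * x i))"
  define E where "E = (\<Sum>i\<in>I. (cmod (S i))\<^sup>2)"
  have "complex_of_real E = (\<Sum>i\<in>I. cnj (S i) * S i)"
    by (simp only: E_def of_real_sum complex_norm_square mult.commute)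
  also have "\<dots> = (\<Sum>n\<in>{1..N}. \<alpha> n * (\<Sum>i\<in>I. cnj (S i) * ee (real n * x i)))"
    by (simp only: S_def[of] sum_distrib_left) (subst sum.swap, simp add: mult_ac sum_distrib_left)
  finally have EC: "complex_of_real E = \<dots>" .
  have E0: "E \<ge> 0" by (simp add: E_def sum_nonneg)
  have "E = cmod (\<Sum>n\<in>{1..N}. \<alpha> n * (\<Sum>i\<in>I. cnj (S i) * ee (real n * x i)))"
    unfolding EC[symmetric] using E0 by simp
  also have "\<dots> \<le> sqrt (\<Sum>n\<in>{1..N}. (cmod (\<alpha> n))\<^sup>2)
     * sqrt (\<Sum>n\<in>{1..N}. (cmod (\<Sum>i\<in>I. cnj (S i) * ee (real n * x i)))\<^sup>2)"
    by (rule Cauchy_Schwarz_sum_cmod)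
  also have "\<dots> \<le> sqrt (\<Sum>n\<in>{1..N}. (cmod (\<alpha> n))\<^sup>2) * sqrt (8 * (real N + (real R)\<^sup>2) * E)"
    using dual[of "\<lambda>i. cnj (S i)"] by (intro mult_left_mono real_sqrt_le_mono) (auto simp: E_def sum_nonneg)
  finally have "E \<le> (\<Sum>n\<in>{1..N}. (cmod (\<alpha> n))\<^sup>2) * (8 * (real N + (real R)\<^sup>2))"
    by (rule norm_sq_le_imp_le[OF E0, rotated 2]) (auto intro: sum_nonneg)
  moreover have "E = (\<Sum>r\<in>{1..R}. \<Sum>h\<in>ures r. (cmod (S (r, h)))\<^sup>2)"
    unfolding E_def I_def by (subst sum.Sigma) auto
  ultimately show ?thesis by (simp add: S_def x_def mult.commute)
qed

lemma sum_ee_orthogonal: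
  assumes "r > 0"
  shows "(\<Sum>h\<in>{0..<int r}. ee (of_int (h * k) / real r)) = (if int r dvd k then of_nat r else 0)"
proof -
  define z where "z = ee (of_int k / real r)"
  have "{0..<int r} = int ` {..<r}" by (simp add: image_int_atLeastLessThan lessThan_atLeast0)
  then have "(\<Sum>h\<in>{0..<int r}. ee (of_int (h * k) / real r)) = (\<Sum>h<r. z ^ h)"
    by (simp add: sum.reindex z_def ee_power)
  moreover have "(\<Sum>h<r. z ^ h) = (if int r dvd k then of_nat r else 0)"
  proof (cases "int r dvd k")
    case True
    then obtain m where "k = int r * m" by blast
    then have "z = 1" using assms by (simp add: z_def)
    then show ?thesis using True by simp
  next
    case False
    define t where "t = real_of_int (k mod int r) / real r"
    have m: "k mod int r > 0" "k mod int r < int r"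
      using False assms pos_mod_sign[of "int r" k] by (auto simp: dvd_eq_mod_eq_0 order_le_less)
    then have "real_of_int (k mod int r) < real r" by (metis of_int_less_iff of_int_of_nat_eq)
    then have t: "0 < t" "t < 1" using assms m(1) by (auto simp: t_def field_simps)
    have "real_of_int k = real_of_int (k mod int r) + real_of_int (k div int r) * real r"
      by (metis mod_div_mult_eq of_int_add of_int_mult of_int_of_nat_eq)
    then have "of_int k / real r = t + of_int (k div int r)"
      using assms by (simp add: t_def field_simps)
    then have zt: "z = ee t" by (simp add: z_def ee_add_int)
    have "sin (pi * t) > 0" using sin_pi_ge[of t] t by (smt (verit))
    then have "cmod (1 - z) > 0" by (simp add: zt norm_one_minus_ee)
    then have "z \<noteq> 1" by auto
    moreover have "z ^ r = 1" using assms ee_int[of k] by (simp add: z_def ee_power)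
    ultimately show ?thesis using False by (simp add: geometric_sum)
  qed
  ultimately show ?thesis by simp
qed

text \<open>In character language this is the sum over primitive characters chi modulo
  \<open>r\<close> of the conjugate of chi(b) times the character sum of \<alpha> against chi: the
  projection of \<alpha> onto the primitive characters, as a function of the residue
  \<open>b\<close>.\<close>

definition prim_sum :: "(nat \<Rightarrow> complex) \<Rightarrow> nat \<Rightarrow> nat \<Rightarrow> int \<Rightarrow> complex" where
  "prim_sum \<alpha> N r b = (\<Sum>m | m \<in> {1..N} \<and> coprime m r. \<alpha> m * of_real (prim_kernel r (int m) b))"

lemma prim_sum_mod: "r > 0 \<Longrightarrow> prim_sum \<alpha> N r (b mod int r) = prim_sum \<alpha> N r b"
  by (simp add: prim_sum_def prim_kernel_mod_right)

lemma prim_sum_reproducing: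
  assumes r: "r > 0" and n: "coprime n (int r)"
  shows "(\<Sum>b\<in>ures r. of_real (prim_kernel r n b) * prim_sum \<alpha> N r b) = of_nat (totient r) * prim_sum \<alpha> N r n"
proof -
  have "(\<Sum>b\<in>ures r. of_real (prim_kernel r n b) * prim_sum \<alpha> N r b)
    = (\<Sum>m | m \<in> {1..N} \<and> coprime m r. \<alpha> m * of_real (\<Sum>b\<in>ures r. prim_kernel r (int m) b * prim_kernel r b n))"
    by (simp only: prim_sum_def sum_distrib_left of_real_sum of_real_mult, subst sum.swap)
      (simp add: prim_kernel_commute[of r _ n] mult_ac)
  also have "\<dots> = (\<Sum>m | m \<in> {1..N} \<and> coprime m r. \<alpha> m * of_real (real (totient r) * prim_kernel r (int m) n))"
    using r n by (intro sum.cong refl) (subst prim_kernel_reproducing, auto)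
  also have "\<dots> = of_nat (totient r) * prim_sum \<alpha> N r n"
    by (simp add: prim_sum_def sum_distrib_left mult_ac)
  finally show ?thesis .
qed

lemma prim_sum_class_sum_0:
  assumes "r > 0" "d dvd r" "d < r" "coprime c (int d)"
  shows "(\<Sum>b | b \<in> ures r \<and> [b = c] (mod int d). prim_sum \<alpha> N r b) = 0"
proof -
  have "(\<Sum>b | b \<in> ures r \<and> [b = c] (mod int d). prim_sum \<alpha> N r b)
    = (\<Sum>m | m \<in> {1..N} \<and> coprime m r. \<alpha> m * of_real (\<Sum>b | b \<in> ures r \<and> [b = c] (mod int d). prim_kernel r (int m) b))"
    unfolding prim_sum_def by (subst sum.swap) (simp add: sum_distrib_left)
  also have "\<dots> = 0"
    using assms by (intro sum.neutral ballI) (simp add: prim_kernel_class_sum_0)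
  finally show ?thesis .
qed

text \<open>The projection \<open>prim_sum \<alpha> N r\<close>, extended by \<open>0\<close> to the residues not coprime to \<open>r\<close>, has its
  finite Fourier transform supported on frequencies coprime to \<open>r\<close>: a frequency \<open>h / r\<close> in lower
  terms only sees sums over residue classes modulo a proper divisor.\<close>

lemma fourier_prim_sum_vanish:
  assumes r: "r > 0" and h: "\<not> coprime h (int r)"
  shows "(\<Sum>c\<in>ures r. prim_sum \<alpha> N r c * ee (of_int (h * c) / real r)) = 0"
proof -
  define g where "g = nat (gcd h (int r))"
  have "gcd h (int r) > 0" using r by simp
  moreover have "gcd h (int r) \<noteq> 1" using h by (simp add: coprime_iff_gcd_eq_1)
  ultimately have g1: "g > 1" "int g = gcd h (int r)" unfolding g_def by linarith+
  have "int g dvd int r" "int g dvd h" by (simp_all add: g1(2))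
  then obtain d h' where dr: "r = g * d" and hh: "h = int g * h'" by (auto elim!: dvdE)
  have d: "d dvd r" "d < r" "d > 0" using dr g1 r by auto
  have "(\<Sum>c\<in>ures r. prim_sum \<alpha> N r c * ee (of_int (h * c) / real r))
    = (\<Sum>c\<in>ures d. \<Sum>b | b \<in> ures r \<and> [b = c] (mod int d). prim_sum \<alpha> N r b * ee (of_int (h * b) / real r))"
    using r d by (intro sum_ures_fibres)
  also have "\<dots> = (\<Sum>c\<in>ures d. \<Sum>b | b \<in> ures r \<and> [b = c] (mod int d). prim_sum \<alpha> N r b * ee (of_int (h * c) / real r))"
  proof (intro sum.cong refl arg_cong2[of _ _ _ _ times])
    fix c b assume "b \<in> {b \<in> ures r. [b = c] (mod int d)}"
    then obtain k where k: "b - c = int d * k" by (auto simp: cong_iff_dvd_diff)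
    then have "b = c + int d * k" by simp
    then have "of_int (h * b) / real r = of_int (h * c) / real r + of_int (h' * k)"
      using g1 d by (simp add: hh dr field_simps)
    then show "ee (of_int (h * b) / real r) = ee (of_int (h * c) / real r)" by (simp only: ee_add_int)
  qed
  also have "\<dots> = (\<Sum>c\<in>ures d. (\<Sum>b | b \<in> ures r \<and> [b = c] (mod int d). prim_sum \<alpha> N r b) * ee (of_int (h * c) / real r))"
    by (simp add: sum_distrib_right)
  also have "\<dots> = 0"
    using prim_sum_class_sum_0[OF r d(1,2)] by (intro sum.neutral ballI) (simp add: ures_def)
  finally show ?thesis .
qed

lemma parseval_ures:
  fixes A :: "int \<Rightarrow> complex"
  assumes r: "r > 0"
  shows "(\<Sum>h\<in>{0..<int r}. (cmod (\<Sum>c\<in>ures r. A c * ee (of_int (h * c) / real r)))\<^sup>2)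
     = real r * (\<Sum>c\<in>ures r. (cmod (A c))\<^sup>2)"
proof -
  have 1: "ee (of_int (h * c) / real r) * ee (- (of_int (h * b) / real r)) = ee (of_int (h * (c - b)) / real r)" for h b c
    by (simp add: ee_add[symmetric] diff_divide_distrib right_diff_distrib)
  have "complex_of_real (\<Sum>h\<in>{0..<int r}. (cmod (\<Sum>c\<in>ures r. A c * ee (of_int (h * c) / real r)))\<^sup>2)
    = (\<Sum>h\<in>{0..<int r}. \<Sum>c\<in>ures r. \<Sum>b\<in>ures r. A c * cnj (A b) * ee (of_int (h * (c - b)) / real r))"
    by (simp only: of_real_sum complex_norm_square cnj_sum complex_cnj_mult cnj_ee sum_product 1[symmetric])
       (simp add: mult_ac)
  also have "\<dots> = (\<Sum>c\<in>ures r. \<Sum>b\<in>ures r. A c * cnj (A b) * (\<Sum>h\<in>{0..<int r}. ee (of_int (h * (c - b)) / real r)))"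
    by (simp only: sum_distrib_left sum.swap[of _ "{0..<int r}" "ures r"])
  also have "\<dots> = (\<Sum>c\<in>ures r. \<Sum>b\<in>ures r. if b = c then of_nat r * (A c * cnj (A c)) else 0)"
  proof (intro sum.cong refl)
    fix c b assume "c \<in> ures r" "b \<in> ures r"
    then have "int r dvd c - b \<longleftrightarrow> b = c" using ures_eqI[of c r b] by (auto simp: cong_iff_dvd_diff)
    then show "A c * cnj (A b) * (\<Sum>h\<in>{0..<int r}. ee (of_int (h * (c - b)) / real r))
      = (if b = c then of_nat r * (A c * cnj (A c)) else 0)"
      by (subst sum_ee_orthogonal[OF r]) auto
  qed
  also have "\<dots> = complex_of_real (real r * (\<Sum>c\<in>ures r. (cmod (A c))\<^sup>2))"
    by (simp add: sum_distrib_left complex_norm_square del: of_real_power)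
  finally show ?thesis by (simp only: of_real_eq_iff)
qed

text \<open>The substitute for the evaluation of Gauss sums. The energy of the projection is
  rewritten by the reproducing property as \<alpha> tested against the projection itself. Fourier
  inversion of the latter involves only frequencies coprime to \<open>r\<close>, which produces the
  exponential sums \<open>S h\<close>; Parseval and Cauchy-Schwarz finish.\<close>

lemma prim_sum_large_sieve:
  assumes r: "r > 0"
  shows "real r * (\<Sum>b\<in>ures r. (cmod (prim_sum \<alpha> N r b))\<^sup>2)
    \<le> (real (totient r))\<^sup>2 * (\<Sum>h\<in>ures r. (cmod (\<Sum>n\<in>{1..N}. \<alpha> n * ee (real n * (of_int h / real r))))\<^sup>2)"
proof -
  define A where "A = prim_sum \<alpha> N r"
  define E where "E = (\<Sum>b\<in>ures r. (cmod (A b))\<^sup>2)"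
  define S where "S = (\<lambda>h::int. \<Sum>n\<in>{1..N}. \<alpha> n * ee (real n * (of_int h / real r)))"
  define T where "T = (\<lambda>h::int. \<Sum>c\<in>ures r. A c * ee (of_int (h * c) / real r))"
  have E0: "E \<ge> 0" by (simp add: E_def sum_nonneg)
  have inv: "cnj (A n) = (\<Sum>h\<in>ures r. cnj (T h) * ee (of_int (h * n) / real r)) / of_nat r"
    if n: "coprime n (int r)" for n
  proof -
    have 1: "ee (- (of_int (h * c) / real r)) * ee (of_int (h * n) / real r) = ee (of_int (h * (n - c)) / real r)" for h c
      by (simp add: ee_add[symmetric] diff_divide_distrib right_diff_distrib)
    have "(\<Sum>h\<in>ures r. cnj (T h) * ee (of_int (h * n) / real r))
       = (\<Sum>h\<in>{0..<int r}. cnj (T h) * ee (of_int (h * n) / real r))"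
    proof (rule sum.mono_neutral_left)
      show "\<forall>h\<in>{0..<int r} - ures r. cnj (T h) * ee (of_int (h * n) / real r) = 0"
        using fourier_prim_sum_vanish[OF r] by (auto simp: ures_def T_def A_def)
    qed (auto simp: ures_def)
    also have "\<dots> = (\<Sum>h\<in>{0..<int r}. \<Sum>c\<in>ures r. cnj (A c) * ee (of_int (h * (n - c)) / real r))"
      by (simp only: T_def cnj_sum complex_cnj_mult cnj_ee sum_distrib_right 1[symmetric] mult.assoc)
    also have "\<dots> = (\<Sum>c\<in>ures r. cnj (A c) * (\<Sum>h\<in>{0..<int r}. ee (of_int (h * (n - c)) / real r)))"
      by (simp only: sum_distrib_left sum.swap[of _ "{0..<int r}" "ures r"])
    also have "\<dots> = (\<Sum>c\<in>ures r. if c = n mod int r then cnj (A c) * of_nat r else 0)"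
    proof (intro sum.cong refl)
      fix c assume "c \<in> ures r"
      then have "int r dvd n - c \<longleftrightarrow> c = n mod int r"
        by (auto simp: ures_def mod_eq_dvd_iff[symmetric])
      then show "cnj (A c) * (\<Sum>h\<in>{0..<int r}. ee (of_int (h * (n - c)) / real r))
         = (if c = n mod int r then cnj (A c) * of_nat r else 0)"
        by (subst sum_ee_orthogonal[OF r]) auto
    qed
    also have "\<dots> = cnj (A n) * of_nat r"
      using mod_in_ures[OF r n] prim_sum_mod[OF r, of \<alpha> N n] by (simp add: A_def)
    finally show ?thesis using r by simp
  qed
  have "complex_of_real E = (\<Sum>b\<in>ures r. cnj (A b) * A b)"
    by (simp only: E_def of_real_sum complex_norm_square mult.commute)
  also have "\<dots> = (\<Sum>b\<in>ures r. cnj (A b) * (\<Sum>m | m \<in> {1..N} \<and> coprime m r. \<alpha> m * of_real (prim_kernel r (int m) b)))"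
    by (simp only: A_def prim_sum_def)
  also have "\<dots> = (\<Sum>m | m \<in> {1..N} \<and> coprime m r. \<alpha> m * (\<Sum>b\<in>ures r. cnj (A b) * of_real (prim_kernel r (int m) b)))"
    by (simp only: sum_distrib_left, subst sum.swap) (simp add: mult_ac)
  also have "\<dots> = (\<Sum>m | m \<in> {1..N} \<and> coprime m r. \<alpha> m * (of_nat (totient r) * cnj (A (int m))))"
  proof (intro sum.cong refl)
    fix m assume "m \<in> {m \<in> {1..N}. coprime m r}"
    then have "coprime (int m) (int r)" by simp
    then have "cnj (\<Sum>b\<in>ures r. of_real (prim_kernel r (int m) b) * A b) = cnj (of_nat (totient r) * A (int m))"
      unfolding A_def by (subst prim_sum_reproducing[OF r]) auto
    then show "\<alpha> m * (\<Sum>b\<in>ures r. cnj (A b) * of_real (prim_kernel r (int m) b)) = \<alpha> m * (of_nat (totient r) * cnj (A (int m)))"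
      by (simp add: mult.commute)
  qed
  also have "\<dots> = (\<Sum>m | m \<in> {1..N} \<and> coprime m r. \<alpha> m * (of_nat (totient r) *
     ((\<Sum>h\<in>ures r. cnj (T h) * ee (of_int (h * int m) / real r)) / of_nat r)))"
    by (intro sum.cong refl) (subst inv, auto)
  also have "\<dots> = (\<Sum>m\<in>{1..N}. \<alpha> m * (of_nat (totient r) *
     ((\<Sum>h\<in>ures r. cnj (T h) * ee (of_int (h * int m) / real r)) / of_nat r)))"
  proof (rule sum.mono_neutral_left)
    show "\<forall>m\<in>{1..N} - {m \<in> {1..N}. coprime m r}. \<alpha> m * (of_nat (totient r) *
     ((\<Sum>h\<in>ures r. cnj (T h) * ee (of_int (h * int m) / real r)) / of_nat r)) = 0"
    proof
      fix m assume "m \<in> {1..N} - {m \<in> {1..N}. coprime m r}"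
      then have nc: "\<not> coprime (int m) (int r)" by auto
      have 1: "ee (- (of_int (h * c) / real r)) * ee (of_int (h * int m) / real r) = ee (of_int (h * (int m - c)) / real r)" for h c
        by (simp add: ee_add[symmetric] diff_divide_distrib right_diff_distrib)
      have "(\<Sum>h\<in>ures r. cnj (T h) * ee (of_int (h * int m) / real r))
         = (\<Sum>h\<in>{0..<int r}. cnj (T h) * ee (of_int (h * int m) / real r))"
      proof (rule sum.mono_neutral_left)
        show "\<forall>h\<in>{0..<int r} - ures r. cnj (T h) * ee (of_int (h * int m) / real r) = 0"
          using fourier_prim_sum_vanish[OF r] by (auto simp: ures_def T_def A_def)
      qed (auto simp: ures_def)
      also have "\<dots> = (\<Sum>h\<in>{0..<int r}. \<Sum>c\<in>ures r. cnj (A c) * ee (of_int (h * (int m - c)) / real r))"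
        by (simp only: T_def cnj_sum complex_cnj_mult cnj_ee sum_distrib_right 1[symmetric] mult.assoc)
      also have "\<dots> = (\<Sum>c\<in>ures r. cnj (A c) * (\<Sum>h\<in>{0..<int r}. ee (of_int (h * (int m - c)) / real r)))"
        by (simp only: sum_distrib_left sum.swap[of _ "{0..<int r}" "ures r"])
      also have "\<dots> = 0"
      proof (intro sum.neutral ballI)
        fix c assume "c \<in> ures r"
        then have "\<not> int r dvd int m - c" using nc cong_imp_coprime[of c "int m" "int r"]
          by (auto simp: ures_def cong_iff_dvd_diff[symmetric] cong_sym_eq)
        then show "cnj (A c) * (\<Sum>h\<in>{0..<int r}. ee (of_int (h * (int m - c)) / real r)) = 0"
          by (subst sum_ee_orthogonal[OF r]) auto
      qed
      finally show "\<alpha> m * (of_nat (totient r) *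
         ((\<Sum>h\<in>ures r. cnj (T h) * ee (of_int (h * int m) / real r)) / of_nat r)) = 0" by simp
    qed
  qed auto
  also have "\<dots> = of_nat (totient r) / of_nat r * (\<Sum>h\<in>ures r. cnj (T h) * S h)"
    by (simp only: S_def sum_distrib_left sum_divide_distrib, subst sum.swap) (simp add: mult_ac)
  finally have "complex_of_real E = \<dots>" .
  then have "cmod (complex_of_real E) = cmod (of_nat (totient r) / of_nat r * (\<Sum>h\<in>ures r. cnj (T h) * S h))" by simp
  then have "E = real (totient r) / real r * cmod (\<Sum>h\<in>ures r. cnj (T h) * S h)"
    using E0 by (simp add: norm_mult norm_divide)
  also have "\<dots> \<le> real (totient r) / real r * (sqrt (\<Sum>h\<in>ures r. (cmod (cnj (T h)))\<^sup>2) * sqrt (\<Sum>h\<in>ures r. (cmod (S h))\<^sup>2))"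
    by (intro mult_left_mono Cauchy_Schwarz_sum_cmod) auto
  also have "\<dots> \<le> real (totient r) / real r * (sqrt (real r * E) * sqrt (\<Sum>h\<in>ures r. (cmod (S h))\<^sup>2))"
  proof (intro mult_left_mono mult_right_mono real_sqrt_le_mono)
    have "(\<Sum>h\<in>ures r. (cmod (cnj (T h)))\<^sup>2) \<le> (\<Sum>h\<in>{0..<int r}. (cmod (T h))\<^sup>2)"
      unfolding complex_mod_cnj by (rule sum_mono2) (auto simp: ures_def)
    also have "\<dots> = real r * E" unfolding T_def E_def by (rule parseval_ures[OF r])
    finally show "(\<Sum>h\<in>ures r. (cmod (cnj (T h)))\<^sup>2) \<le> real r * E" .
  qed (auto intro: sum_nonneg)
  finally have fin: "E \<le> real (totient r) / real r * (sqrt (real r * E) * sqrt (\<Sum>h\<in>ures r. (cmod (S h))\<^sup>2))" .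
  have "E \<le> ((real (totient r))\<^sup>2 / real r) * (\<Sum>h\<in>ures r. (cmod (S h))\<^sup>2)"
  proof (rule norm_sq_le_imp_le[OF E0])
    have "sqrt ((real (totient r))\<^sup>2 / real r) * sqrt ((\<Sum>h\<in>ures r. (cmod (S h))\<^sup>2) * E)
      = real (totient r) / real r * (sqrt (real r * E) * sqrt (\<Sum>h\<in>ures r. (cmod (S h))\<^sup>2))"
      using r by (simp add: real_sqrt_mult real_sqrt_divide field_simps)
    then show "E \<le> sqrt ((real (totient r))\<^sup>2 / real r) * sqrt ((\<Sum>h\<in>ures r. (cmod (S h))\<^sup>2) * E)"
      using fin by simp
  qed (auto intro: sum_nonneg)
  then show ?thesis using r by (simp add: E_def S_def A_def field_simps)
qed

section \<open>Bilinear forms with primitive kernels\<close>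

lemma inverse_mod_exists:
  fixes n :: int
  assumes "r > 0" "coprime n (int r)"
  shows "\<exists>v. [n * v = 1] (mod int r) \<and> coprime v (int r)"
proof -
  obtain v where "[n * v = 1] (mod int r)" using assms(2) cong_solve_coprime_int by blast
  moreover from this have "coprime (n * v) (int r)" by (metis cong_imp_coprime cong_sym coprime_1_left)
  ultimately show ?thesis by auto
qed

lemma prim_kernel_move:
  assumes "r > 0" "coprime n (int r)" "[n * v = 1] (mod int r)"
  shows "prim_kernel r (m * n) a = prim_kernel r m (a * v)"
proof -
  have "prim_kernel r m (a * v) = prim_kernel r (n * m) (n * (a * v))"
    using assms by (simp add: prim_kernel_scale)
  also have "\<dots> = prim_kernel r (m * n) a"
  proof (rule prim_kernel_cong)
    show "[n * (a * v) = a] (mod int r)"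
      using cong_scalar_left[OF assms(3), of a] by (simp add: mult_ac)
  qed (use assms in \<open>auto simp: mult.commute\<close>)
  finally show ?thesis ..
qed

text \<open>The replacement for chi(mn) = chi(m) chi(n): the reproducing property, with
  \<open>n\<close> moved to the other argument by its inverse modulo \<open>r\<close>. It separates
  \<open>m\<close> from \<open>n\<close> at the cost of a sum over \<open>b\<close>.\<close>

lemma prim_kernel_mult:
  assumes r: "r > 0" and m: "coprime m (int r)" and n: "coprime n (int r)" and a: "coprime a (int r)"
  shows "real (totient r) * prim_kernel r (m * n) a = (\<Sum>b\<in>ures r. prim_kernel r m b * prim_kernel r (b * n) a)"
proof -
  obtain v where v: "[n * v = 1] (mod int r)" "coprime v (int r)" using inverse_mod_exists[OF r n] by blast
  have "real (totient r) * prim_kernel r m (a * v) = (\<Sum>b\<in>ures r. prim_kernel r m b * prim_kernel r b (a * v))"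
    using r m a v by (intro prim_kernel_reproducing[symmetric]) auto
  then show ?thesis by (simp add: prim_kernel_move[OF r n v(1)])
qed

lemma prim_kernel_dual_reproducing:
  assumes r: "r > 0" and m: "coprime m (int r)" and n: "coprime n (int r)" and a: "coprime a (int r)"
  shows "(\<Sum>b\<in>ures r. prim_kernel r (b * m) a * prim_kernel r (b * n) a) = real (totient r) * prim_kernel r m n"
proof -
  obtain v where v: "[n * v = 1] (mod int r)" "coprime v (int r)" using inverse_mod_exists[OF r n] by blast
  obtain u where u: "[m * u = 1] (mod int r)" "coprime u (int r)" using inverse_mod_exists[OF r m] by blast
  have "(\<Sum>b\<in>ures r. prim_kernel r (b * m) a * prim_kernel r (b * n) a)
     = (\<Sum>b\<in>ures r. prim_kernel r (a * u) b * prim_kernel r b (a * v))"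
    by (simp add: prim_kernel_move[OF r n v(1)] prim_kernel_move[OF r m u(1)] prim_kernel_commute[of r _ "a * u"])
  also have "\<dots> = real (totient r) * prim_kernel r (a * u) (a * v)"
    using r a u v by (intro prim_kernel_reproducing) auto
  also have "prim_kernel r (a * u) (a * v) = prim_kernel r u v" using r a by (rule prim_kernel_scale)
  also have "\<dots> = prim_kernel r (u * (m * n)) (v * (m * n))"
    using prim_kernel_scale[OF r, of "m * n" u v] m n by (simp add: mult.commute)
  also have "\<dots> = prim_kernel r n m"
  proof (rule prim_kernel_cong[OF r])
    show "[u * (m * n) = n] (mod int r)" using cong_scalar_right[OF u(1), of n] by (simp add: mult_ac)
    show "[v * (m * n) = m] (mod int r)" using cong_scalar_right[OF v(1), of m] by (simp add: mult_ac)
  qed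
  finally show ?thesis by (simp add: prim_kernel_commute)
qed

lemma norm_square_sum_expand:
  fixes k :: "'a \<Rightarrow> int \<Rightarrow> real"
  shows "complex_of_real (\<Sum>b\<in>B. (cmod (\<Sum>n\<in>I. \<beta> n * of_real (k n b)))\<^sup>2)
    = (\<Sum>m\<in>I. \<Sum>n\<in>I. \<beta> m * cnj (\<beta> n) * of_real (\<Sum>b\<in>B. k m b * k n b))"
proof -
  have "complex_of_real (\<Sum>b\<in>B. (cmod (\<Sum>n\<in>I. \<beta> n * of_real (k n b)))\<^sup>2)
    = (\<Sum>b\<in>B. \<Sum>m\<in>I. \<Sum>n\<in>I. \<beta> m * cnj (\<beta> n) * of_real (k m b * k n b))"
    by (simp only: of_real_sum complex_norm_square cnj_sum complex_cnj_mult complex_cnj_complex_of_real sum_product of_real_mult)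
      (simp add: mult_ac)
  also have "\<dots> = (\<Sum>m\<in>I. \<Sum>n\<in>I. \<Sum>b\<in>B. \<beta> m * cnj (\<beta> n) * of_real (k m b * k n b))"
    by (simp only: sum.swap[of _ B I])
  finally show ?thesis by (simp only: of_real_sum sum_distrib_left)
qed

text \<open>The second factor produced by \<open>prim_kernel_mult\<close> is not literally
  \<open>prim_sum\<close>, but when the squares are expanded both sides have the same Gram matrix,
  totient r times \<open>prim_kernel r m n\<close>.\<close>

lemma prim_sum_dual_norm:
  assumes r: "r > 0" and a: "coprime a (int r)"
  shows "(\<Sum>b\<in>ures r. (cmod (\<Sum>n | n \<in> {1..N} \<and> coprime n r. \<beta> n * of_real (prim_kernel r (b * int n) a)))\<^sup>2)
     = (\<Sum>b\<in>ures r. (cmod (prim_sum \<beta> N r b))\<^sup>2)"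
proof -
  let ?I = "{n. n \<in> {1..N} \<and> coprime n r}"
  have "(\<Sum>b\<in>ures r. prim_kernel r (b * int m) a * prim_kernel r (b * int n) a)
    = (\<Sum>b\<in>ures r. prim_kernel r (int m) b * prim_kernel r (int n) b)" if "m \<in> ?I" "n \<in> ?I" for m n
  proof -
    have "(\<Sum>b\<in>ures r. prim_kernel r (int m) b * prim_kernel r (int n) b)
      = (\<Sum>b\<in>ures r. prim_kernel r (int m) b * prim_kernel r b (int n))" by (simp add: prim_kernel_commute)
    also have "\<dots> = real (totient r) * prim_kernel r (int m) (int n)"
      using that r by (intro prim_kernel_reproducing) auto
    finally show ?thesis using that r a by (subst prim_kernel_dual_reproducing) auto
  qed
  then have "complex_of_real (\<Sum>b\<in>ures r. (cmod (\<Sum>n\<in>?I. \<beta> n * of_real (prim_kernel r (b * int n) a)))\<^sup>2)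
     = complex_of_real (\<Sum>b\<in>ures r. (cmod (\<Sum>n\<in>?I. \<beta> n * of_real (prim_kernel r (int n) b)))\<^sup>2)"
    by (subst (1 2) norm_square_sum_expand) (intro sum.cong refl, simp only:)
  then show ?thesis by (simp only: of_real_eq_iff prim_sum_def)
qed

text \<open>Each of the two factors contributes phi(r) / sqrt r, the separation of variables returns
  one phi(r), and the normalisation on the left removes the other; 1 / r remains.\<close>

lemma prim_bilinear_single:
  assumes r: "r > 0" and a: "coprime a (int r)"
  shows "cmod (\<Sum>m | m \<in> {1..M} \<and> coprime m r. \<Sum>n | n \<in> {1..N} \<and> coprime n r.
      \<alpha> m * \<beta> n * of_real (prim_kernel r (int (m * n)) a)) / real (totient r)
    \<le> sqrt (\<Sum>h\<in>ures r. (cmod (\<Sum>n\<in>{1..M}. \<alpha> n * ee (real n * (of_int h / real r))))\<^sup>2)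
      * sqrt (\<Sum>h\<in>ures r. (cmod (\<Sum>n\<in>{1..N}. \<beta> n * ee (real n * (of_int h / real r))))\<^sup>2) / real r"
proof -
  let ?I = "\<lambda>N. {n. n \<in> {1..N} \<and> coprime n r}"
  define X where "X = (\<Sum>m\<in>?I M. \<Sum>n\<in>?I N. \<alpha> m * \<beta> n * of_real (prim_kernel r (int (m * n)) a))"
  define B where "B = (\<lambda>b. \<Sum>n\<in>?I N. \<beta> n * of_real (prim_kernel r (b * int n) a))"
  define SA where "SA = (\<Sum>h\<in>ures r. (cmod (\<Sum>n\<in>{1..M}. \<alpha> n * ee (real n * (of_int h / real r))))\<^sup>2)"
  define SB where "SB = (\<Sum>h\<in>ures r. (cmod (\<Sum>n\<in>{1..N}. \<beta> n * ee (real n * (of_int h / real r))))\<^sup>2)"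
  define \<phi> where "\<phi> = real (totient r)"
  have \<phi>: "\<phi> > 0" using r by (simp add: \<phi>_def)
  have "of_real \<phi> * X = (\<Sum>m\<in>?I M. \<Sum>n\<in>?I N. \<alpha> m * \<beta> n * of_real (\<phi> * prim_kernel r (int m * int n) a))"
    unfolding X_def sum_distrib_left by (simp add: mult_ac)
  also have "\<dots> = (\<Sum>m\<in>?I M. \<Sum>n\<in>?I N. \<Sum>b\<in>ures r. (\<alpha> m * of_real (prim_kernel r (int m) b)) * (\<beta> n * of_real (prim_kernel r (b * int n) a)))"
    unfolding \<phi>_def using r a
    by (intro sum.cong refl, subst prim_kernel_mult) (auto simp: sum_distrib_left mult_ac)
  also have "\<dots> = (\<Sum>b\<in>ures r. prim_sum \<alpha> M r b * B b)"
    unfolding prim_sum_def B_def sum_product by (simp only: sum.swap[of _ _ "ures r"])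
  finally have "cmod (of_real \<phi> * X) \<le> sqrt (\<Sum>b\<in>ures r. (cmod (prim_sum \<alpha> M r b))\<^sup>2) * sqrt (\<Sum>b\<in>ures r. (cmod (B b))\<^sup>2)"
    using Cauchy_Schwarz_sum_cmod by metis
  also have "(\<Sum>b\<in>ures r. (cmod (B b))\<^sup>2) = (\<Sum>b\<in>ures r. (cmod (prim_sum \<beta> N r b))\<^sup>2)"
    unfolding B_def by (rule prim_sum_dual_norm[OF r a])
  also have "sqrt (\<Sum>b\<in>ures r. (cmod (prim_sum \<alpha> M r b))\<^sup>2) * sqrt (\<Sum>b\<in>ures r. (cmod (prim_sum \<beta> N r b))\<^sup>2)
     \<le> sqrt (\<phi>\<^sup>2 * SA / real r) * sqrt (\<phi>\<^sup>2 * SB / real r)"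
    using prim_sum_large_sieve[OF r, of \<alpha> M] prim_sum_large_sieve[OF r, of \<beta> N] r
    by (intro mult_mono real_sqrt_le_mono) (auto simp: \<phi>_def SA_def SB_def field_simps intro!: sum_nonneg mult_nonneg_nonneg divide_nonneg_nonneg)
  also have "\<dots> = \<phi>\<^sup>2 * (sqrt SA * sqrt SB / real r)"
    using \<phi> by (simp add: real_sqrt_mult real_sqrt_divide power2_eq_square)
  finally have "\<phi> * cmod X \<le> \<phi> * (\<phi> * (sqrt SA * sqrt SB / real r))"
    using \<phi> by (simp add: norm_mult power2_eq_square mult.assoc)
  then have "cmod X \<le> \<phi> * (sqrt SA * sqrt SB / real r)"
    using \<phi> by (subst (asm) mult_le_cancel_left_pos)
  then have "cmod X / \<phi> \<le> sqrt SA * sqrt SB / real r" using \<phi> by (simp add: pos_divide_le_eq mult.commute)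
  then show ?thesis by (simp add: X_def SA_def SB_def \<phi>_def)
qed

text \<open>Partial summation. The part of the growth independent of \<open>k\<close> is damped by 1
  / R0, which is what restricting to conductors above \<open>R0\<close> gains.\<close>

lemma abel_sum_inverse:
  fixes t :: "nat \<Rightarrow> real"
  assumes R0: "R0 > 0" and t: "\<And>r. t r \<ge> 0" and abc: "a \<ge> 0" "b \<ge> 0" "c \<ge> 0"
    and S: "\<And>k. k > 0 \<Longrightarrow> (\<Sum>r\<in>{R0<..k}. t r) \<le> a + b * real k + c * (real k)\<^sup>2"
  shows "(\<Sum>r\<in>{R0<..R}. t r / real r) \<le> a / real R0 + b * (1 + (\<Sum>k\<in>{1..R}. 1 / real k)) + 2 * c * real R"
proof -
  let ?S = "\<lambda>k. \<Sum>r\<in>{R0<..k}. t r"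
  define h where "h = (\<lambda>R. \<Sum>k\<in>{1..R}. 1 / real k)"
  have key: "(\<Sum>r\<in>{R0<..R}. t r / real r) \<le> ?S R / real R + (a * (1 / real R0 - 1 / real R) + b * h R + c * (real R - real R0))"
    if "R \<ge> R0" for R
    using that
  proof (induction R rule: dec_induct)
    case base
    then show ?case using abc by (simp add: h_def sum_nonneg)
  next
    case (step k)
    have k: "k > 0" using step R0 by simp
    have e: "{R0<..Suc k} = insert (Suc k) {R0<..k}" using step by auto
    have "?S k / real k - ?S k / real (Suc k) = ?S k / (real k * real (Suc k))"
      using k by (simp add: field_simps)
    also have "\<dots> \<le> (a + b * real k + c * (real k)\<^sup>2) / (real k * real (Suc k))"
      using S[OF k] by (intro divide_right_mono) auto
    also have "\<dots> = a / (real k * real (Suc k)) + b / real (Suc k) + c * (real k / real (Suc k))"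
      using k by (simp add: add_divide_distrib power2_eq_square)
    also have "\<dots> \<le> a / (real k * real (Suc k)) + b / real (Suc k) + c * 1"
      using abc by (intro add_left_mono mult_left_mono) auto
    also have "a / (real k * real (Suc k)) = a * (1 / real k - 1 / real (Suc k))"
      using k by (simp add: field_simps)
    finally have 1: "?S k / real k \<le> ?S k / real (Suc k) + a * (1 / real k - 1 / real (Suc k)) + b / real (Suc k) + c" by simp
    have "(\<Sum>r\<in>{R0<..Suc k}. t r / real r) = (\<Sum>r\<in>{R0<..k}. t r / real r) + t (Suc k) / real (Suc k)"
      by (simp add: e)
    moreover have "?S (Suc k) / real (Suc k) = ?S k / real (Suc k) + t (Suc k) / real (Suc k)"
      by (simp add: e add_divide_distrib)
    moreover have "h (Suc k) = h k + 1 / real (Suc k)" by (simp add: h_def)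
    ultimately show ?case using step.IH 1 by (simp add: algebra_simps)
  qed
  show ?thesis
  proof (cases "R \<ge> R0 \<and> R > 0")
    case True
    then have "?S R / real R \<le> (a + b * real R + c * (real R)\<^sup>2) / real R"
      using S[of R] by (intro divide_right_mono) auto
    also have "\<dots> = a / real R + b + c * real R"
      using True by (simp add: add_divide_distrib power2_eq_square)
    finally have "(\<Sum>r\<in>{R0<..R}. t r / real r) \<le> a / real R + b + c * real R + (a * (1 / real R0 - 1 / real R) + b * h R + c * (real R - real R0))"
      using key[of R] True by simp
    moreover have "c * real R0 \<ge> 0" using abc by simp
    ultimately show ?thesis by (simp add: h_def algebra_simps)
  next
    case False
    then have "{R0<..R} = {}" using R0 by auto
    then show ?thesis using abc by (simp add: sum_nonneg)
  qed
qed

definition l2 :: "nat \<Rightarrow> (nat \<Rightarrow> complex) \<Rightarrow> real" where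
  "l2 N \<alpha> = sqrt (\<Sum>n\<in>{1..N}. (cmod (\<alpha> n))\<^sup>2)"

lemma l2_nonneg [simp]: "l2 N \<alpha> \<ge> 0" by (simp add: l2_def sum_nonneg)

text \<open>The large sieve factor 8 (sqrt M + k) (sqrt N + k) for conductors up to
  \<open>k\<close>, after partial summation against 1 / r over the conductors beyond
  \<open>R0\<close>.\<close>

definition bilinear_bound :: "nat \<Rightarrow> nat \<Rightarrow> nat \<Rightarrow> nat \<Rightarrow> real" where
  "bilinear_bound R0 R M N = 8 * (sqrt (real M) * sqrt (real N) / real R0
     + (sqrt (real M) + sqrt (real N)) * (1 + (\<Sum>k\<in>{1..R}. 1 / real k)) + 2 * real R)"

lemma prim_bilinear:
  assumes R0: "R0 > 0" and a: "\<And>r. coprime (a r) (int r)"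
  shows "(\<Sum>r\<in>{R0<..R}. cmod (\<Sum>m | m \<in> {1..M} \<and> coprime m r. \<Sum>n | n \<in> {1..N} \<and> coprime n r.
      \<alpha> m * \<beta> n * of_real (prim_kernel r (int (m * n)) (a r))) / real (totient r))
    \<le> bilinear_bound R0 R M N * (l2 M \<alpha> * l2 N \<beta>)"
proof -
  define SA where "SA = (\<lambda>r. \<Sum>h\<in>ures r. (cmod (\<Sum>n\<in>{1..M}. \<alpha> n * ee (real n * (of_int h / real r))))\<^sup>2)"
  define SB where "SB = (\<lambda>r. \<Sum>h\<in>ures r. (cmod (\<Sum>n\<in>{1..N}. \<beta> n * ee (real n * (of_int h / real r))))\<^sup>2)"
  have SA0: "SA r \<ge> 0" and SB0: "SB r \<ge> 0" for r by (auto simp: SA_def SB_def sum_nonneg)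
  define P where "P = 8 * (l2 M \<alpha> * l2 N \<beta>)"
  have P0: "P \<ge> 0" by (simp add: P_def)
  have S: "(\<Sum>r\<in>{R0<..k}. sqrt (SA r) * sqrt (SB r))
     \<le> P * (sqrt (real M) * sqrt (real N)) + P * (sqrt (real M) + sqrt (real N)) * real k + P * (real k)\<^sup>2"
    if k: "k > 0" for k
  proof -
    have le: "sqrt (\<Sum>r\<in>{R0<..k}. T r) \<le> sqrt 8 * (sqrt (real L) + real k) * l2 L \<gamma>"
      if T: "T = (\<lambda>r. \<Sum>h\<in>ures r. (cmod (\<Sum>n\<in>{1..L}. \<gamma> n * ee (real n * (of_int h / real r))))\<^sup>2)" for T L \<gamma>
    proof -
      have "(\<Sum>r\<in>{R0<..k}. T r) \<le> (\<Sum>r\<in>{1..k}. T r)"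
        by (intro sum_mono2) (auto simp: T sum_nonneg)
      also have "\<dots> \<le> 8 * (real L + (real k)\<^sup>2) * (\<Sum>n\<in>{1..L}. (cmod (\<gamma> n))\<^sup>2)"
        unfolding T by (rule large_sieve_additive[OF k])
      also have "\<dots> \<le> 8 * (sqrt (real L) + real k)\<^sup>2 * (\<Sum>n\<in>{1..L}. (cmod (\<gamma> n))\<^sup>2)"
        by (intro mult_right_mono mult_left_mono sum_nonneg) (auto simp: power2_sum)
      finally have "sqrt (\<Sum>r\<in>{R0<..k}. T r) \<le> sqrt (8 * (sqrt (real L) + real k)\<^sup>2 * (\<Sum>n\<in>{1..L}. (cmod (\<gamma> n))\<^sup>2))"
        by (rule real_sqrt_le_mono)
      then show ?thesis by (simp add: real_sqrt_mult l2_def)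
    qed
    have "(\<Sum>r\<in>{R0<..k}. sqrt (SA r) * sqrt (SB r))
      \<le> sqrt (\<Sum>r\<in>{R0<..k}. (sqrt (SA r))\<^sup>2) * sqrt (\<Sum>r\<in>{R0<..k}. (sqrt (SB r))\<^sup>2)"
      by (rule Cauchy_Schwarz_sum_real)
    also have "\<dots> = sqrt (\<Sum>r\<in>{R0<..k}. SA r) * sqrt (\<Sum>r\<in>{R0<..k}. SB r)" by (simp add: SA0 SB0)
    also have "\<dots> \<le> (sqrt 8 * (sqrt (real M) + real k) * l2 M \<alpha>) * (sqrt 8 * (sqrt (real N) + real k) * l2 N \<beta>)"
      by (intro mult_mono le) (auto simp: SA_def SB_def fun_eq_iff intro!: sum_nonneg)
    also have "\<dots> = (sqrt 8 * sqrt 8) * (l2 M \<alpha> * l2 N \<beta>) * ((sqrt (real M) + real k) * (sqrt (real N) + real k))"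
      by (simp only: mult_ac)
    also have "sqrt 8 * sqrt 8 = (8::real)" by simp
    finally show ?thesis by (simp add: P_def algebra_simps power2_eq_square)
  qed
  have "(\<Sum>r\<in>{R0<..R}. cmod (\<Sum>m | m \<in> {1..M} \<and> coprime m r. \<Sum>n | n \<in> {1..N} \<and> coprime n r.
      \<alpha> m * \<beta> n * of_real (prim_kernel r (int (m * n)) (a r))) / real (totient r))
    \<le> (\<Sum>r\<in>{R0<..R}. sqrt (SA r) * sqrt (SB r) / real r)"
    unfolding SA_def SB_def by (intro sum_mono prim_bilinear_single a) auto
  also have "\<dots> \<le> P * (sqrt (real M) * sqrt (real N)) / real R0
     + P * (sqrt (real M) + sqrt (real N)) * (1 + (\<Sum>k\<in>{1..R}. 1 / real k)) + 2 * P * real R"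
    using S P0 SA0 SB0 by (intro abel_sum_inverse R0) auto
  also have "\<dots> = bilinear_bound R0 R M N * (l2 M \<alpha> * l2 N \<beta>)"
    by (simp add: bilinear_bound_def P_def algebra_simps)
  finally show ?thesis .
qed

definition bilinear_form :: "nat \<Rightarrow> nat \<Rightarrow> (nat \<Rightarrow> nat \<Rightarrow> complex) \<Rightarrow> (nat \<Rightarrow> complex) \<Rightarrow> (nat \<Rightarrow> complex) \<Rightarrow> complex" where
  "bilinear_form M N K \<alpha> \<beta> = (\<Sum>m\<in>{1..M}. \<Sum>n\<in>{1..N}. \<alpha> m * \<beta> n * K m n)"

text \<open>\<open>C\<close> bounds the operator norm of the matrix \<open>K\<close> on l2.
  Quantifying over all coefficients allows both sequences to be restricted freely in the
  splitting.\<close>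

definition kernel_bound :: "nat \<Rightarrow> nat \<Rightarrow> real \<Rightarrow> (nat \<Rightarrow> nat \<Rightarrow> complex) \<Rightarrow> bool" where
  "kernel_bound M N C K \<longleftrightarrow> (\<forall>\<alpha> \<beta>. cmod (bilinear_form M N K \<alpha> \<beta>) \<le> C * (l2 M \<alpha> * l2 N \<beta>))"

lemma l2_split:
  "(l2 N \<alpha>)\<^sup>2 = (l2 N (\<lambda>n. if P n then \<alpha> n else 0))\<^sup>2 + (l2 N (\<lambda>n. if P n then 0 else \<alpha> n))\<^sup>2"
  by (simp add: l2_def sum_nonneg sum.distrib[symmetric] if_distrib cong: if_cong) (rule sum.cong, auto)

lemma l2_restrict_le: "l2 N (\<lambda>n. if P n then \<alpha> n else 0) \<le> l2 N \<alpha>"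
  unfolding l2_def by (intro real_sqrt_le_mono sum_mono) auto

text \<open>Cauchy-Schwarz in the plane. It recombines the norms of orthogonal pieces with constant
  1, so that a level of the splitting adds \<open>C\<close> instead of doubling the bound.\<close>

lemma two_products_le_sqrt:
  fixes a b c d :: real
  assumes "x\<^sup>2 = a\<^sup>2 + c\<^sup>2" "y\<^sup>2 = b\<^sup>2 + d\<^sup>2" "x \<ge> 0" "y \<ge> 0"
  shows "a * b + c * d \<le> x * y"
proof (rule power2_le_imp_le)
  have "(x * y)\<^sup>2 - (a * b + c * d)\<^sup>2 = (a * d - b * c)\<^sup>2"
    by (simp only: power_mult_distrib assms(1,2)) (simp add: power2_eq_square algebra_simps)
  then show "(a * b + c * d)\<^sup>2 \<le> (x * y)\<^sup>2" by (smt (verit) zero_le_power2)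
qed (use assms in auto)

text \<open>Binary splitting of the range of the rank function \<open>\<rho>\<close>: at each of the \<open>J\<close> levels, one part
  of the truncated form is a product form, and the remaining two parts act on orthogonal pieces.\<close>

lemma kernel_bound_truncate_aux:
  assumes K: "kernel_bound M N C K" and C: "C \<ge> 0"
    and \<beta>: "\<And>n. n \<in> {1..N} \<Longrightarrow> \<beta> n \<noteq> 0 \<Longrightarrow> s \<le> \<rho> n \<and> \<rho> n < s + 2 ^ J"
  shows "cmod (bilinear_form M N (\<lambda>m n. if \<rho> n < (\<tau> m :: nat) then K m n else 0) \<alpha> \<beta>)
    \<le> (real J + 1) * C * (l2 M \<alpha> * l2 N \<beta>)"
  using \<beta>
proof (induction J arbitrary: s \<alpha> \<beta>)
  case 0
  \<comment> \<open>Only \<open>n\<close> of rank \<open>s\<close> are left, so the truncation has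
    become a condition on \<open>m\<close> alone.\<close>
  let ?a = "\<lambda>m. if s < \<tau> m then \<alpha> m else 0"
  have "bilinear_form M N (\<lambda>m n. if \<rho> n < \<tau> m then K m n else 0) \<alpha> \<beta> = bilinear_form M N K ?a \<beta>"
    unfolding bilinear_form_def
  proof (intro sum.cong refl)
    fix m n assume "n \<in> {1..N}"
    then have "\<beta> n = 0 \<or> \<rho> n = s" using 0 by fastforce
    then show "\<alpha> m * \<beta> n * (if \<rho> n < \<tau> m then K m n else 0) = ?a m * \<beta> n * K m n" by auto
  qed
  also have "cmod \<dots> \<le> C * (l2 M ?a * l2 N \<beta>)" using K by (simp add: kernel_bound_def)
  also have "\<dots> \<le> C * (l2 M \<alpha> * l2 N \<beta>)"
    using C by (intro mult_left_mono mult_right_mono l2_restrict_le) auto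
  finally show ?case by simp
next
  case (Suc J)
  define mid where "mid = s + 2 ^ J"
  define KT where "KT = (\<lambda>m n. if \<rho> n < \<tau> m then K m n else 0)"
  define a1 where "a1 = (\<lambda>m. if \<tau> m \<le> mid then \<alpha> m else 0)"
  define a2 where "a2 = (\<lambda>m. if \<tau> m \<le> mid then 0 else \<alpha> m)"
  define bL where "bL = (\<lambda>n. if \<rho> n < mid then \<beta> n else 0)"
  define bR where "bR = (\<lambda>n. if \<rho> n < mid then 0 else \<beta> n)"
  \<comment> \<open>Of the four quadrants one vanishes (threshold at most \<open>mid\<close>, rank
    at least \<open>mid\<close>) and in one the condition holds automatically, so that the full
    kernel \<open>K\<close> appears there.\<close>
  have "bilinear_form M N KT \<alpha> \<beta>
    = bilinear_form M N KT a1 bL + bilinear_form M N K a2 bL + bilinear_form M N KT a2 bR"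
    unfolding bilinear_form_def sum.distrib[symmetric]
    by (intro sum.cong refl) (auto simp: KT_def a1_def a2_def bL_def bR_def)
  then have "cmod (bilinear_form M N KT \<alpha> \<beta>) \<le>
     cmod (bilinear_form M N KT a1 bL) + cmod (bilinear_form M N K a2 bL) + cmod (bilinear_form M N KT a2 bR)"
    by (metis (no_types, opaque_lifting) add_mono_thms_linordered_semiring(3) norm_triangle_ineq order_trans)
  also have "\<dots> \<le> (real J + 1) * C * (l2 M a1 * l2 N bL) + C * (l2 M \<alpha> * l2 N \<beta>) + (real J + 1) * C * (l2 M a2 * l2 N bR)"
  proof (intro add_mono)
    show "cmod (bilinear_form M N KT a1 bL) \<le> (real J + 1) * C * (l2 M a1 * l2 N bL)"
      unfolding KT_def by (rule Suc.IH[of _ s]) (use Suc.prems in \<open>auto simp: bL_def mid_def split: if_splits\<close>)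
    show "cmod (bilinear_form M N KT a2 bR) \<le> (real J + 1) * C * (l2 M a2 * l2 N bR)"
      unfolding KT_def by (rule Suc.IH[of _ mid]) (use Suc.prems in \<open>fastforce simp: bR_def mid_def split: if_splits\<close>)
    have a2': "a2 = (\<lambda>m. if \<not> \<tau> m \<le> mid then \<alpha> m else 0)" by (auto simp: a2_def)
    have "C * (l2 M a2 * l2 N bL) \<le> C * (l2 M \<alpha> * l2 N \<beta>)"
      unfolding bL_def a2' using C by (intro mult_left_mono mult_mono l2_restrict_le) auto
    moreover have "cmod (bilinear_form M N K a2 bL) \<le> C * (l2 M a2 * l2 N bL)" using K by (simp add: kernel_bound_def)
    ultimately show "cmod (bilinear_form M N K a2 bL) \<le> C * (l2 M \<alpha> * l2 N \<beta>)" by (rule order_trans[rotated])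
  qed
  also have "\<dots> = (real J + 1) * C * (l2 M a1 * l2 N bL + l2 M a2 * l2 N bR) + C * (l2 M \<alpha> * l2 N \<beta>)"
    by (simp add: algebra_simps)
  also have "\<dots> \<le> (real J + 1) * C * (l2 M \<alpha> * l2 N \<beta>) + C * (l2 M \<alpha> * l2 N \<beta>)"
    using C l2_split[of M \<alpha> "\<lambda>m. \<tau> m \<le> mid"] l2_split[of N \<beta> "\<lambda>n. \<rho> n < mid"]
    by (intro add_right_mono mult_left_mono two_products_le_sqrt) (auto simp: a1_def a2_def bL_def bR_def)
  finally show ?case by (simp add: KT_def algebra_simps)
qed

lemma kernel_bound_truncate:
  assumes "kernel_bound M N C K" "C \<ge> 0" "\<And>n. n \<in> {1..N} \<Longrightarrow> \<rho> n < 2 ^ J"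
  shows "kernel_bound M N ((real J + 1) * C) (\<lambda>m n. if \<rho> n < (\<tau> m :: nat) then K m n else 0)"
  unfolding kernel_bound_def
  using kernel_bound_truncate_aux[OF assms(1,2), of _ 0 \<rho> J \<tau>] assms(3) by simp

lemma kernel_bound_truncate_compl:
  assumes K: "kernel_bound M N C K" and C: "C \<ge> 0" and \<rho>: "\<And>n. n \<in> {1..N} \<Longrightarrow> \<rho> n < 2 ^ J"
  shows "kernel_bound M N ((real J + 2) * C) (\<lambda>m n. if \<rho> n < (\<tau> m :: nat) then 0 else K m n)"
  unfolding kernel_bound_def
proof (intro allI)
  fix \<alpha> \<beta>
  let ?K1 = "\<lambda>m n. if \<rho> n < \<tau> m then K m n else 0"
  have "bilinear_form M N (\<lambda>m n. if \<rho> n < \<tau> m then 0 else K m n) \<alpha> \<beta>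
     = bilinear_form M N K \<alpha> \<beta> - bilinear_form M N ?K1 \<alpha> \<beta>"
    unfolding bilinear_form_def sum_subtractf[symmetric] by (intro sum.cong refl) auto
  then have "cmod (bilinear_form M N (\<lambda>m n. if \<rho> n < \<tau> m then 0 else K m n) \<alpha> \<beta>)
    \<le> cmod (bilinear_form M N K \<alpha> \<beta>) + cmod (bilinear_form M N ?K1 \<alpha> \<beta>)"
    by (simp add: norm_triangle_ineq4)
  also have "\<dots> \<le> C * (l2 M \<alpha> * l2 N \<beta>) + ((real J + 1) * C) * (l2 M \<alpha> * l2 N \<beta>)"
    using K kernel_bound_truncate[OF K C, of \<rho> J \<tau>] \<rho> by (intro add_mono) (auto simp: kernel_bound_def)
  finally show "cmod (bilinear_form M N (\<lambda>m n. if \<rho> n < \<tau> m then 0 else K m n) \<alpha> \<beta>)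
    \<le> (real J + 2) * C * (l2 M \<alpha> * l2 N \<beta>)" by (simp add: algebra_simps)
qed

section \<open>Multiplicative functions and their Dirichlet inverses\<close>

lemma class_C_mult: "f \<in> class_C \<Longrightarrow> m \<ge> 1 \<Longrightarrow> n \<ge> 1 \<Longrightarrow> coprime m n \<Longrightarrow> f (m * n) = f m * f n"
  by (simp add: class_C_def multiplicative_def)

lemma class_C_1: "f \<in> class_C \<Longrightarrow> f (Suc 0) = 1"
  by (simp add: class_C_def multiplicative_def)

lemma dvd_imp_ge_1: "d dvd n \<Longrightarrow> n > 0 \<Longrightarrow> d \<ge> (1::nat)"
  by (cases d) auto

lemma sum_divisors_swap:
  fixes g :: "nat \<Rightarrow> nat \<Rightarrow> 'b::comm_monoid_add"
  assumes "n > 0"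
  shows "(\<Sum>d | d dvd n. g d (n div d)) = (\<Sum>d | d dvd n. g (n div d) d)"
  by (rule sum.reindex_bij_witness[of _ "\<lambda>d. n div d" "\<lambda>d. n div d"]) (use assms in \<open>auto elim!: dvdE\<close>)

text \<open>Shared by \<open>f\<close> and its Dirichlet inverse. The weight log n is matched
  exactly by the divisor sum of the von Mangoldt function. As the latter vanishes at 1, only smaller
  arguments of \<open>h\<close> enter, and the recursion is an inequality of absolute values so that
  it covers either sign.\<close>

lemma ln_weighted_bound:
  fixes h :: "nat \<Rightarrow> complex"
  assumes h1: "cmod (h (Suc 0)) \<le> 1" and L: "\<And>d. d \<ge> 1 \<Longrightarrow> cmod (L d) \<le> mangoldt d"
    and rec: "\<And>n. n > 1 \<Longrightarrow> cmod (h n) * ln (real n) \<le> cmod (\<Sum>d | d dvd n. L d * h (n div d))"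
  shows "n \<ge> 1 \<Longrightarrow> cmod (h n) \<le> 1"
proof (induction n rule: less_induct)
  case (less n)
  show ?case
  proof (cases "n = 1")
    case False
    then have n: "n > 1" using less.prems by simp
    have "cmod (h n) * ln (real n) \<le> (\<Sum>d | d dvd n. cmod (L d * h (n div d)))"
      using rec[OF n] norm_sum by (rule order_trans)
    also have "\<dots> \<le> (\<Sum>d | d dvd n. mangoldt d)"
    proof (rule sum_mono)
      fix d assume "d \<in> {d. d dvd n}"
      then have d: "d dvd n" "d \<ge> 1" using n dvd_imp_ge_1[of d n] by auto
      show "cmod (L d * h (n div d)) \<le> mangoldt d"
      proof (cases "d = 1")
        case True
        then have "L d = 0" using L[of d] by simp
        then show ?thesis by (simp add: mangoldt_nonneg)
      next
        case False
        then have "n div d < n" "n div d dvd n" using d n by (auto elim!: dvdE)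
        then have "n div d < n" "n div d \<ge> 1" using n dvd_imp_ge_1[of "n div d" n] by auto
        then have "cmod (h (n div d)) \<le> 1" using less.IH by blast
        then show ?thesis using L[OF d(2)] mult_mono[of "cmod (L d)" "mangoldt d" "cmod (h (n div d))" 1]
          by (simp add: norm_mult mangoldt_nonneg)
      qed
    qed
    also have "\<dots> = ln (real n)" using n mangoldt_sum[of n, where 'a = real] by simp
    finally show ?thesis using n by simp
  qed (use h1 in simp)
qed

lemma class_C_bound:
  assumes f: "f \<in> class_C" and n: "n \<ge> 1"
  shows "cmod (f n) \<le> 1"
proof (rule ln_weighted_bound[where L = "Lambda_of f", OF _ _ _ n])
  show "cmod (f (Suc 0)) \<le> 1" using class_C_1[OF f] by simp
  show "cmod (Lambda_of f d) \<le> mangoldt d" if "d \<ge> 1" for d using f that by (simp add: class_C_def)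
  show "cmod (f n) * ln (real n) \<le> cmod (\<Sum>d | d dvd n. Lambda_of f d * f (n div d))" if "n > 1" for n
    using that class_C_1[OF f] by (subst Lambda_of_conv[symmetric]) (auto simp: norm_mult)
qed

section \<open>Dirichlet inverses and the insertion of coprimality conditions\<close>

function dirichlet_inv :: "(nat \<Rightarrow> complex) \<Rightarrow> nat \<Rightarrow> complex" where
  "dirichlet_inv f n = (if n = 1 then 1 else 0) - (\<Sum>d | d dvd n \<and> d < n. dirichlet_inv f d * f (n div d))"
  by auto
termination by (relation "measure snd") auto

declare dirichlet_inv.simps [simp del]

lemma dirichlet_inv_conv:
  assumes "f (Suc 0) = 1" "n \<ge> 1"
  shows "(\<Sum>d | d dvd n. dirichlet_inv f d * f (n div d)) = (if n = 1 then 1 else 0)"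
  using assms divisors_split[OF assms(2)] by (simp add: dirichlet_inv.simps[of f n])

lemma dirichlet_assoc:
  fixes u v w :: "nat \<Rightarrow> complex"
  assumes "n > 0"
  shows "(\<Sum>d | d dvd n. (\<Sum>e | e dvd d. u e * v (d div e)) * w (n div d))
     = (\<Sum>e | e dvd n. u e * (\<Sum>k | k dvd n div e. v k * w (n div e div k)))"
proof -
  have fin: "finite {d. d dvd m}" if "m dvd n" for m
    using that assms by (intro finite_divisors_nat) (auto intro: dvd_pos_nat)
  have dv: "n div e dvd n" if "e dvd n" for e using that by (auto elim!: dvdE)
  have "(\<Sum>d | d dvd n. (\<Sum>e | e dvd d. u e * v (d div e)) * w (n div d))
    = (\<Sum>d | d dvd n. \<Sum>e | e dvd d. u e * v (d div e) * w (n div d))"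
    by (simp only: sum_distrib_right)
  also have "\<dots> = (\<Sum>(d, e)\<in>(SIGMA d:{d. d dvd n}. {e. e dvd d}). u e * v (d div e) * w (n div d))"
    by (rule sum.Sigma) (use fin in auto)
  also have "\<dots> = (\<Sum>(e, k)\<in>(SIGMA e:{e. e dvd n}. {k. k dvd n div e}). u e * (v k * w (n div e div k)))"
  proof (rule sum.reindex_bij_witness[of _ "\<lambda>(e, k). (e * k, e)" "\<lambda>(d, e). (e, d div e)"])
    fix x assume "x \<in> (SIGMA d:{d. d dvd n}. {e. e dvd d})"
    then obtain d e where x: "x = (d, e)" "d dvd n" "e dvd d" by auto
    then obtain a b where ab: "d = e * a" "n = e * a * b" by (auto elim!: dvdE)
    have pos: "e > 0" "a > 0" "b > 0" using ab assms by auto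
    show "(case case x of (d, e) \<Rightarrow> (e, d div e) of (e, k) \<Rightarrow> (e * k, e)) = x"
      "(case x of (d, e) \<Rightarrow> (e, d div e)) \<in> (SIGMA e:{e. e dvd n}. {k. k dvd n div e})"
      using pos by (auto simp: x(1) ab mult.assoc)
    show "(case case x of (d, e) \<Rightarrow> (e, d div e) of (e, k) \<Rightarrow> u e * (v k * w (n div e div k)))
      = (case x of (d, e) \<Rightarrow> u e * v (d div e) * w (n div d))"
      using pos by (simp add: x(1) ab mult.assoc)
  next
    fix y assume "y \<in> (SIGMA e:{e. e dvd n}. {k. k dvd n div e})"
    then obtain e k where y: "y = (e, k)" "e dvd n" "k dvd n div e" by auto
    then obtain a where a: "n = e * a" by blast
    then have e0: "e > 0" using assms by auto
    have "k dvd a" using y(3) e0 by (simp add: a)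
    then show "(case case y of (e, k) \<Rightarrow> (e * k, e) of (d, e) \<Rightarrow> (e, d div e)) = y"
      "(case y of (e, k) \<Rightarrow> (e * k, e)) \<in> (SIGMA d:{d. d dvd n}. {e. e dvd d})"
      using e0 by (auto simp: y(1) a)
  qed
  also have "\<dots> = (\<Sum>e | e dvd n. \<Sum>k | k dvd n div e. u e * (v k * w (n div e div k)))"
    by (rule sum.Sigma[symmetric]) (use fin dv in auto)
  finally show ?thesis by (simp only: sum_distrib_left)
qed

text \<open>If \<open>g\<close> is the Dirichlet inverse of \<open>f\<close>, then \<open>g log = - \<Lambda>\<^sub>f * g\<close>: multiply
  \<open>f log = \<Lambda>\<^sub>f * f\<close> by \<open>g\<close> twice and use that the logarithm is a derivation.\<close>

lemma dirichlet_inv_bound: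
  assumes f: "f \<in> class_C" and n: "n \<ge> 1"
  shows "cmod (dirichlet_inv f n) \<le> 1"
proof -
  define g where "g = dirichlet_inv f"
  define h where "h = (\<lambda>n. - (\<Sum>d | d dvd n. Lambda_of f d * g (n div d)))"
  have f1: "f (Suc 0) = 1" by (rule class_C_1[OF f])
  have "{d::nat. d dvd Suc 0 \<and> d < Suc 0} = {}" by auto
  then have "dirichlet_inv f (Suc 0) = 1 - sum (\<lambda>d. dirichlet_inv f d * f (Suc 0 div d)) {}"
    by (subst dirichlet_inv.simps) (simp only: One_nat_def if_True refl)
  then have g1: "g (Suc 0) = 1" by (simp add: g_def)
  have glog: "g n * of_real (ln (real n)) = h n" if "n \<ge> 1" for n
    using that
  proof (induction n rule: less_induct)
    case (less n)
    then have n: "n > 0" by simp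
    have gf: "(\<Sum>k | k dvd m. g k * f (m div k)) = (if m = 1 then 1 else 0)" if "m \<ge> 1" for m
      using dirichlet_inv_conv[where f = f, OF f1 that] by (simp add: g_def)
    have "(\<Sum>d | d dvd n. (\<Sum>e | e dvd d. Lambda_of f e * g (d div e)) * f (n div d))
      = (\<Sum>e | e dvd n. Lambda_of f e * (\<Sum>k | k dvd n div e. g k * f (n div e div k)))"
      by (rule dirichlet_assoc[OF n])
    also have "\<dots> = (\<Sum>e | e dvd n. if e = n then Lambda_of f e else 0)"
    proof (intro sum.cong refl)
      fix e assume "e \<in> {e. e dvd n}"
      then obtain k where k: "n = e * k" by auto
      then show "Lambda_of f e * (\<Sum>k | k dvd n div e. g k * f (n div e div k)) = (if e = n then Lambda_of f e else 0)"
        using n by (subst gf) auto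
    qed
    finally have hf: "(\<Sum>d | d dvd n. h d * f (n div d)) = - Lambda_of f n"
      using n by (simp add: h_def sum_negf)
    have "(\<Sum>d | d dvd n. g d * (f (n div d) * of_real (ln (real (n div d)))))
      = (\<Sum>d | d dvd n. g d * (\<Sum>k | k dvd n div d. f k * Lambda_of f (n div d div k)))"
    proof (intro sum.cong refl)
      fix d assume "d \<in> {d. d dvd n}"
      then have "n div d dvd n" by (auto elim!: dvdE)
      then have d: "n div d \<ge> 1" using n dvd_imp_ge_1 by blast
      have "f (n div d) * of_real (ln (real (n div d))) = (\<Sum>k | k dvd n div d. Lambda_of f k * f (n div d div k))"
        using f1 d by (intro Lambda_of_conv) auto
      also have "\<dots> = (\<Sum>k | k dvd n div d. f k * Lambda_of f (n div d div k))"
        using sum_divisors_swap[of "n div d" "\<lambda>a b. Lambda_of f a * f b"] d by (simp add: mult.commute)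
      finally show "g d * (f (n div d) * of_real (ln (real (n div d)))) = g d * (\<Sum>k | k dvd n div d. f k * Lambda_of f (n div d div k))"
        by simp
    qed
    also have "\<dots> = (\<Sum>d | d dvd n. (\<Sum>e | e dvd d. g e * f (d div e)) * Lambda_of f (n div d))"
      by (rule dirichlet_assoc[OF n, symmetric])
    also have "\<dots> = (\<Sum>d | d dvd n. if d = 1 then Lambda_of f n else 0)"
      using n by (intro sum.cong refl) (subst gf, auto dest: dvd_imp_ge_1)
    finally have flog: "(\<Sum>d | d dvd n. g d * (f (n div d) * of_real (ln (real (n div d))))) = Lambda_of f n"
      using n by simp
    have "(\<Sum>d | d dvd n. g d * of_real (ln (real d)) * f (n div d)) + (\<Sum>d | d dvd n. g d * (f (n div d) * of_real (ln (real (n div d)))))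
      = (\<Sum>d | d dvd n. g d * f (n div d) * of_real (ln (real n)))"
      unfolding sum.distrib[symmetric]
    proof (intro sum.cong refl)
      fix d assume "d \<in> {d. d dvd n}"
      then obtain k where k: "n = d * k" by auto
      then have "ln (real n) = ln (real d) + ln (real (n div d))" using n by (simp add: ln_mult)
      then show "g d * of_real (ln (real d)) * f (n div d) + g d * (f (n div d) * of_real (ln (real (n div d))))
        = g d * f (n div d) * of_real (ln (real n))" by (simp add: algebra_simps)
    qed
    also have "\<dots> = (if n = 1 then 1 else 0) * of_real (ln (real n))"
      using gf[of n] n by (simp add: sum_distrib_right[symmetric])
    also have "\<dots> = 0" by simp
    finally have eq: "(\<Sum>d | d dvd n. g d * of_real (ln (real d)) * f (n div d)) = (\<Sum>d | d dvd n. h d * f (n div d))"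
      unfolding hf flog by (simp add: eq_neg_iff_add_eq_0)
    have "(\<Sum>d | d dvd n \<and> d < n. g d * of_real (ln (real d)) * f (n div d)) = (\<Sum>d | d dvd n \<and> d < n. h d * f (n div d))"
    proof (intro sum.cong refl)
      fix d assume "d \<in> {d. d dvd n \<and> d < n}"
      then have "d < n" "d \<ge> 1" using n dvd_imp_ge_1[of d n] by auto
      then show "g d * of_real (ln (real d)) * f (n div d) = h d * f (n div d)" using less.IH by simp
    qed
    then show ?case using eq divisors_split[OF less.prems] n f1 by simp
  qed
  show ?thesis unfolding g_def[symmetric]
  proof (rule ln_weighted_bound[where L = "Lambda_of f", OF _ _ _ n])
    show "cmod (g (Suc 0)) \<le> 1" using g1 by simp
    show "cmod (Lambda_of f d) \<le> mangoldt d" if "d \<ge> 1" for d using f that by (simp add: class_C_def)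
    show "cmod (g n) * ln (real n) \<le> cmod (\<Sum>d | d dvd n. Lambda_of f d * g (n div d))" if "n > 1" for n
    proof -
      have "cmod (g n * of_real (ln (real n))) = cmod (h n)" using glog[of n] that by simp
      then show ?thesis using that by (simp add: h_def norm_mult)
    qed
  qed
qed

lemma factor_by_primes:
  assumes "n > (0::nat)"
  shows "\<exists>j k. n = j * k \<and> prime_factors j \<subseteq> T \<and> prime_factors k \<inter> T = {}"
  using assms
proof (induction n rule: less_induct)
  case (less n)
  show ?case
  proof (cases "prime_factors n \<inter> T = {}")
    case True
    then show ?thesis by (intro exI[of _ 1] exI[of _ n]) auto
  next
    case False
    then obtain p where p: "p \<in> prime_factors n" "p \<in> T" by blast
    then obtain n' where n': "n = p * n'" by (auto simp: prime_factors_dvd elim!: dvdE)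
    have pp: "prime p" using p by auto
    then have "n' < n" "n' > 0" using n' less.prems prime_gt_1_nat[OF pp] by auto
    then obtain j k where jk: "n' = j * k" "prime_factors j \<subseteq> T" "prime_factors k \<inter> T = {}"
      using less.IH by blast
    have "j > 0" using jk \<open>n' > 0\<close> by (cases j) auto
    then have "prime_factors (p * j) \<subseteq> T"
      using jk p pp by (simp add: prime_factors_product prime_factorization_prime prime_gt_0_nat)
    then show ?thesis using n' jk by (intro exI[of _ "p * j"] exI[of _ k]) (auto simp: mult_ac)
  qed
qed

lemma coprime_of_disjoint_prime_factors:
  assumes "j > (0::nat)" "k > 0" "prime_factors j \<inter> prime_factors k = {}"
  shows "coprime j k"
proof (rule ccontr)
  assume "\<not> coprime j k"
  then have "gcd j k \<noteq> 1" using coprime_iff_gcd_eq_1[of j k] by blast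
  then obtain p where "prime p" "p dvd gcd j k" using prime_factor_nat by blast
  then show False using assms by (auto simp: prime_factors_dvd)
qed

text \<open>Sieving with the Moebius function would leave f(dm), which need not factor. With the
  inverse of \<open>f\<close> one writes n = ab, where \<open>a\<close> collects the primes of
  \<open>k\<close>: the admissible \<open>d\<close> are the divisors of \<open>a\<close>, f(b)
  factors out, and the remaining convolution vanishes unless a = 1. The coefficients are bounded by
  1 because of \<open>dirichlet_inv_bound\<close>.\<close>

lemma class_C_coprime_sieve:
  assumes f: "f \<in> class_C" and n: "n \<ge> 1" and k: "k \<ge> 1"
  shows "(if coprime n k then f n else 0)
    = (\<Sum>d | d dvd n \<and> prime_factors d \<subseteq> prime_factors k. dirichlet_inv f d * f (n div d))"
proof -
  obtain a b where ab: "n = a * b" "prime_factors a \<subseteq> prime_factors k" "prime_factors b \<inter> prime_factors k = {}"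
    using factor_by_primes[of n "prime_factors k"] n by auto
  have pos: "a \<ge> 1" "b \<ge> 1" using ab(1) n by (cases a; cases b; simp)+
  have cab: "coprime a b" using pos ab by (intro coprime_of_disjoint_prime_factors) auto
  have bk: "coprime b k" using pos ab k by (intro coprime_of_disjoint_prime_factors) auto
  have sets: "{d. d dvd n \<and> prime_factors d \<subseteq> prime_factors k} = {d. d dvd a}"
  proof safe
    fix d assume d: "d dvd n" "prime_factors d \<subseteq> prime_factors k"
    have "d > 0" using d n dvd_imp_ge_1[of d n] by simp
    then have "coprime d b" using d ab pos by (intro coprime_of_disjoint_prime_factors) auto
    then show "d dvd a" using d ab by (simp add: coprime_dvd_mult_left_iff)
  next
    fix d p assume d: "d dvd a" "p \<in> prime_factors d"
    then show "p \<in> prime_factors k" using ab pos by (auto simp: prime_factors_dvd subset_iff intro: dvd_trans)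
  qed (use ab in auto)
  have "(\<Sum>d | d dvd a. dirichlet_inv f d * f (n div d)) = (\<Sum>d | d dvd a. dirichlet_inv f d * f (a div d)) * f b"
    unfolding sum_distrib_right
  proof (intro sum.cong refl)
    fix d assume "d \<in> {d. d dvd a}"
    then obtain e where e: "a = d * e" by auto
    then have "n div d = e * b" "a div d = e" using ab pos by auto
    moreover have "coprime e b" "e \<ge> 1" using cab e pos by auto
    ultimately show "dirichlet_inv f d * f (n div d) = dirichlet_inv f d * f (a div d) * f b"
      using class_C_mult[OF f, of e b] pos by simp
  qed
  also have "\<dots> = (if a = 1 then f b else 0)"
    using dirichlet_inv_conv[where f = f, OF class_C_1[OF f], of a] pos by simp
  also have "\<dots> = (if coprime n k then f n else 0)"
  proof (cases "a = 1")
    case False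
    then obtain p where p: "prime p" "p dvd a" using prime_factor_nat by blast
    then have "p dvd k" using ab pos by (auto simp: prime_factors_dvd subset_iff)
    then have "\<not> coprime n k" using p ab by (metis coprime_common_divisor_nat dvd_mult2 not_prime_1)
    then show ?thesis using False by simp
  qed (use ab bk in auto)
  finally show ?thesis by (simp add: sets)
qed

section \<open>Sums over smooth and rough numbers\<close>

lemma harmonic_upper: "N \<ge> 1 \<Longrightarrow> (\<Sum>k\<in>{1..N}. 1 / real k) \<le> 1 + ln (real N)"
proof (induction N rule: dec_induct)
  case (step N)
  have "ln (real N / real (Suc N)) \<le> real N / real (Suc N) - 1"
    using step by (intro ln_le_minus_one) auto
  also have "\<dots> = - (1 / real (Suc N))" by (simp add: field_simps)
  finally have "1 / real (Suc N) \<le> ln (real (Suc N)) - ln (real N)"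
    using step by (subst (asm) ln_div) auto
  then show ?case using step.IH by simp
qed simp

lemma harmonic_lower: "ln (real N + 1) \<le> (\<Sum>k\<in>{1..N}. 1 / real k)"
proof (induction N)
  case (Suc N)
  have "ln (1 + 1 / (real N + 1)) \<le> 1 / (real N + 1)" by (intro ln_add_one_self_le_self) auto
  moreover have "1 + 1 / (real N + 1) = (real N + 2) / (real N + 1)" by (simp add: field_simps)
  ultimately have "ln (real N + 2) - ln (real N + 1) \<le> 1 / (real N + 1)" by (simp add: ln_div)
  then show ?case using Suc by (simp add: add.commute)
qed simp

lemma sum_le_sum_of_cover:
  fixes g :: "'b \<Rightarrow> real"
  assumes "finite I" "A \<subseteq> f ` I" "\<And>i. i \<in> I \<Longrightarrow> 0 \<le> g (f i)"
  shows "(\<Sum>a\<in>A. g a) \<le> (\<Sum>i\<in>I. g (f i))"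
proof -
  have "(\<Sum>a\<in>A. g a) \<le> (\<Sum>a\<in>f ` I. g a)" using assms by (intro sum_mono2) auto
  also have "\<dots> \<le> (\<Sum>i\<in>I. g (f i))" using sum_image_le[of I g f] assms by (simp add: o_def)
  finally show ?thesis .
qed

text \<open>A finite Euler product, built by splitting off the full power of one prime at a time.
  The exponent is kept general: s = 1 yields the density of rough numbers, s = 1/2 serves for
  Rankin's trick.\<close>

lemma smooth_sum_le:
  fixes s :: real
  assumes "finite T" "\<And>p. p \<in> T \<Longrightarrow> prime p" and s: "s > 0"
  shows "(\<Sum>n | n \<in> {1..N} \<and> prime_factors n \<subseteq> T. real n powr (- s)) \<le> (\<Prod>p\<in>T. 1 / (1 - real p powr (- s)))"
  using assms(1,2)
proof (induction T rule: finite_induct)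
  case empty
  have "{n. n \<in> {1..N} \<and> prime_factors n \<subseteq> {}} \<subseteq> {1}"
    by (auto simp: prime_factorization_empty_iff)
  then have "(\<Sum>n | n \<in> {1..N} \<and> prime_factors n \<subseteq> {}. real n powr (- s)) \<le> (\<Sum>n\<in>{1::nat}. real n powr (- s))"
    by (intro sum_mono2) auto
  then show ?case by simp
next
  case (insert p T)
  have p: "prime p" using insert by simp
  let ?S = "\<lambda>T. {n. n \<in> {1..N} \<and> prime_factors n \<subseteq> T}"
  define x where "x = real p powr (- s)"
  have p1: "real p > 1" using prime_gt_1_nat[OF p] by simp
  have x: "0 < x" "x < 1" using p1 s by (auto simp: x_def powr_minus field_simps)
  have cover: "?S (insert p T) \<subseteq> (\<lambda>(i, j). p ^ i * j) ` ({..N} \<times> ?S T)"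
  proof
    fix n assume n: "n \<in> ?S (insert p T)"
    then have "n \<noteq> 0" by auto
    then obtain j where j: "n = p ^ multiplicity p n * j" "\<not> p dvd j"
      using p by (metis multiplicity_decompose' not_prime_unit)
    define i where "i = multiplicity p n"
    have nij: "n = p ^ i * j" using j i_def by simp
    have j0: "j > 0" "p ^ i > 0" using nij \<open>n \<noteq> 0\<close> by (auto intro: gr0I)
    have "i < p ^ i" using p1 by (intro power_gt_expt) simp
    moreover have "p ^ i \<le> n" "j \<le> n" using nij j0 by auto
    moreover have "n \<le> N" using n by simp
    ultimately have "i \<in> {..N}" "j \<in> {1..N}" using j0 by auto
    moreover have "prime_factors j \<subseteq> T"
    proof
      fix q assume q: "q \<in> prime_factors j"
      then have "q \<in> prime_factors n" using nij j0 \<open>n \<noteq> 0\<close> by (auto simp: prime_factors_dvd)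
      then have "q \<in> insert p T" using n by auto
      moreover have "q \<noteq> p" using q j by auto
      ultimately show "q \<in> T" by simp
    qed
    ultimately show "n \<in> (\<lambda>(i, j). p ^ i * j) ` ({..N} \<times> ?S T)" using nij by auto
  qed
  have "(\<Sum>n\<in>?S (insert p T). real n powr (- s))
     \<le> (\<Sum>(i, j)\<in>{..N} \<times> ?S T. real (p ^ i * j) powr (- s))"
    using sum_le_sum_of_cover[OF _ cover, of "\<lambda>n. real n powr (- s)"] by (simp add: case_prod_unfold)
  also have "\<dots> = (\<Sum>(i, j)\<in>{..N} \<times> ?S T. x ^ i * real j powr (- s))"
  proof (intro sum.cong refl, clarify)
    fix i j
    have "real (p ^ i * j) powr (- s) = (real p ^ i) powr (- s) * real j powr (- s)"
      by (simp add: powr_mult)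
    also have "(real p ^ i) powr (- s) = x ^ i" using p1
      by (simp add: x_def powr_realpow[symmetric] powr_powr mult.commute)
    finally show "real (p ^ i * j) powr (- s) = x ^ i * real j powr (- s)" .
  qed
  also have "\<dots> = (\<Sum>i\<le>N. x ^ i) * (\<Sum>j\<in>?S T. real j powr (- s))"
    by (simp add: sum_product sum.cartesian_product)
  also have "\<dots> \<le> (1 / (1 - x)) * (\<Prod>p\<in>T. 1 / (1 - real p powr (- s)))"
  proof (rule mult_mono)
    have "(\<Sum>i\<le>N. x ^ i) = (1 - x ^ Suc N) / (1 - x)"
      using x sum_gp_basic[of x N] by (simp add: field_simps)
    also have "\<dots> \<le> 1 / (1 - x)" using x by (intro divide_right_mono) auto
    finally show "(\<Sum>i\<le>N. x ^ i) \<le> 1 / (1 - x)" .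
  qed (use x insert in \<open>auto intro: sum_nonneg\<close>)
  finally show ?case using insert by (simp add: x_def)
qed

lemma inj_on_prod_primes: "inj_on (\<lambda>T. \<Prod>T) {T. finite T \<and> (\<forall>p\<in>T. prime (p::nat))}"
proof (rule inj_onI)
  have eq: "T = {p. prime p \<and> p dvd \<Prod>T}" if T: "finite T" "\<forall>p\<in>T. prime p" for T :: "nat set"
  proof safe
    fix p assume p: "prime p" "p dvd \<Prod>T"
    then obtain q where "q \<in> T" "p dvd q" using T by (auto simp: prime_dvd_prod_iff)
    then show "p \<in> T" using T p primes_dvd_imp_eq[of p q] by auto
  qed (use T dvd_prodI[of T _ "\<lambda>x. x"] in auto)
  fix S T :: "nat set"
  assume S: "S \<in> {T. finite T \<and> (\<forall>p\<in>T. prime p)}" and T: "T \<in> {T. finite T \<and> (\<forall>p\<in>T. prime p)}"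
    and e: "\<Prod>S = \<Prod>T"
  have "S = {p. prime p \<and> p dvd \<Prod>S}" by (rule eq) (use S in auto)
  also have "\<dots> = {p. prime p \<and> p dvd \<Prod>T}" by (simp only: e)
  also have "\<dots> = T" by (rule eq[symmetric]) (use T in auto)
  finally show "S = T" .
qed

lemma prod_one_plus_inverse_le:
  assumes "k > (0::nat)"
  shows "(\<Prod>p\<in>prime_factors k. 1 + 1 / real p) \<le> (\<Sum>d | d dvd k. 1 / real d)"
proof -
  have "(\<Prod>p\<in>prime_factors k. 1 + 1 / real p) = (\<Sum>T\<in>Pow (prime_factors k). \<Prod>p\<in>T. 1 / real p)"
    using prod_add[of "prime_factors k" "\<lambda>p. 1 / real p" "\<lambda>_. 1"] by (simp add: add.commute)
  also have "\<dots> = (\<Sum>T\<in>Pow (prime_factors k). 1 / real (\<Prod>T))"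
    by (simp add: prod_dividef)
  also have "\<dots> = (\<Sum>d\<in>(\<lambda>T. \<Prod>T) ` Pow (prime_factors k). 1 / real d)"
  proof (subst sum.reindex)
    show "inj_on Prod (Pow (prime_factors k))"
      by (rule inj_on_subset[OF inj_on_prod_primes]) (auto intro: finite_subset)
  qed simp
  also have "\<dots> \<le> (\<Sum>d | d dvd k. 1 / real d)"
  proof (rule sum_mono2)
    show "(\<lambda>T. \<Prod>T) ` Pow (prime_factors k) \<subseteq> {d. d dvd k}"
      by (auto intro!: prod_primes_dvd intro: finite_subset)
  qed (use assms in auto)
  finally show ?thesis .
qed

text \<open>The factors (k - 1)(k + 1) / k^2 telescope to (n + 1) / (2n).\<close>

lemma prod_one_minus_inverse_squares_ge: "n \<ge> 1 \<Longrightarrow> (\<Prod>k\<in>{2..n::nat}. 1 - 1 / (real k)\<^sup>2) \<ge> 1 / 2"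
proof -
  assume n: "n \<ge> 1"
  have "(\<Prod>k\<in>{2..n::nat}. 1 - 1 / (real k)\<^sup>2) = (real n + 1) / (2 * real n)" using n
  proof (induction n rule: dec_induct)
    case (step n)
    have "{2..Suc n} = insert (Suc n) {2..n}" using step by auto
    then have "(\<Prod>k\<in>{2..Suc n}. 1 - 1 / (real k)\<^sup>2) = (1 - 1 / (real (Suc n))\<^sup>2) * ((real n + 1) / (2 * real n))"
      using step.IH by simp
    also have "\<dots> = (real (Suc n) + 1) / (2 * real (Suc n))"
      using step by (simp add: divide_simps power2_eq_square) (simp add: algebra_simps)
    finally show ?case .
  qed simp
  also have "\<dots> \<ge> 1 / 2" using n by (simp add: field_simps)
  finally show ?thesis .
qed

text \<open>Since the product of 1 - 1/p^2 is at least 1/2, the quotient k / phi(k) is at most twice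
  the product of 1 + 1/p over the primes of \<open>k\<close>, which is a sum of 1/d over squarefree
  divisors.\<close>

lemma inverse_totient_le:
  assumes k: "k > 0"
  shows "1 / real (totient k) \<le> 2 * (\<Sum>d | d dvd k. 1 / (real d * real k))"
proof -
  let ?P = "prime_factors k"
  have tot: "real (totient k) = real k * (\<Prod>p\<in>?P. 1 - 1 / real p)"
    using totient_formula2[of k] by simp
  have P: "p \<ge> 2" if "p \<in> ?P" for p using that prime_ge_2_nat by auto
  have sub: "?P \<subseteq> {2..k}" using P k by (auto dest: dvd_imp_le simp: prime_factors_dvd)
  have nn: "0 \<le> 1 - 1 / (real p)\<^sup>2" "1 - 1 / (real p)\<^sup>2 \<le> 1" if "p \<ge> 2" for p :: nat
  proof -
    have "1 \<le> (real p)\<^sup>2" using that by (simp add: power2_eq_square) (metis One_nat_def Suc_1 Suc_leD mult_le_mono nat_mult_1 of_nat_1 of_nat_le_iff of_nat_mult)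
    then show "0 \<le> 1 - 1 / (real p)\<^sup>2" "1 - 1 / (real p)\<^sup>2 \<le> 1" by (auto simp: divide_le_eq_1)
  qed
  have "1 / 2 \<le> (\<Prod>p\<in>{2..k}. 1 - 1 / (real p)\<^sup>2)"
    using k by (intro prod_one_minus_inverse_squares_ge) auto
  also have "\<dots> = (\<Prod>p\<in>?P. 1 - 1 / (real p)\<^sup>2) * (\<Prod>p\<in>{2..k} - ?P. 1 - 1 / (real p)\<^sup>2)"
    using sub by (subst mult.commute, intro prod.subset_diff) auto
  also have "\<dots> \<le> (\<Prod>p\<in>?P. 1 - 1 / (real p)\<^sup>2) * 1"
  proof (intro mult_left_mono prod_le_1 prod_nonneg)
    show "0 \<le> 1 - 1 / (real p)\<^sup>2" if "p \<in> ?P" for p using nn(1) P[OF that] by blast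
    show "0 \<le> 1 - 1 / (real p)\<^sup>2 \<and> 1 - 1 / (real p)\<^sup>2 \<le> 1" if "p \<in> {2..k} - ?P" for p
      using nn[of p] that by auto
  qed
  also have "(\<Prod>p\<in>?P. 1 - 1 / (real p)\<^sup>2) = (\<Prod>p\<in>?P. 1 - 1 / real p) * (\<Prod>p\<in>?P. 1 + 1 / real p)"
    by (simp add: prod.distrib[symmetric] power2_eq_square algebra_simps)
  also have "\<dots> * 1 \<le> (\<Prod>p\<in>?P. 1 - 1 / real p) * (\<Sum>d | d dvd k. 1 / real d)"
  proof -
    have "0 \<le> 1 - 1 / real p" if "p \<in> ?P" for p using P[OF that] by (simp add: field_simps)
    then show ?thesis using prod_one_plus_inverse_le[OF k] by (simp add: mult_left_mono prod_nonneg)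
  qed
  finally have "1 / 2 \<le> (\<Prod>p\<in>?P. 1 - 1 / real p) * (\<Sum>d | d dvd k. 1 / real d)" .
  then have "real k * (1 / 2) \<le> real k * ((\<Prod>p\<in>?P. 1 - 1 / real p) * (\<Sum>d | d dvd k. 1 / real d))"
    by (intro mult_left_mono) auto
  then have "real k \<le> 2 * real (totient k) * (\<Sum>d | d dvd k. 1 / real d)" using tot by simp
  then have "1 / real (totient k) \<le> 2 * ((\<Sum>d | d dvd k. 1 / real d) / real k)"
    using k by (simp add: field_simps)
  then show ?thesis by (simp add: sum_divide_distrib)
qed

lemma sum_inverse_totient_le:
  assumes "N \<ge> 1"
  shows "(\<Sum>k\<in>{1..N}. 1 / real (totient k)) \<le> 4 * (1 + ln (real N))"
proof -
  have "(\<Sum>k\<in>{1..N}. 1 / real (totient k)) \<le> (\<Sum>k\<in>{1..N}. 2 * (\<Sum>d | d dvd k. 1 / (real d * real k)))"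
    by (intro sum_mono inverse_totient_le) auto
  also have "\<dots> = 2 * (\<Sum>(k, d)\<in>(SIGMA k:{1..N}. {d. d dvd k}). 1 / (real d * real k))"
    by (subst sum.Sigma[symmetric]) (auto simp: sum_distrib_left)
  also have "\<dots> \<le> 2 * (\<Sum>(d, j)\<in>{1..N} \<times> {1..N}. 1 / (real d)\<^sup>2 * (1 / real j))"
  proof -
    have cover: "(SIGMA k:{1..N}. {d. d dvd k}) \<subseteq> (\<lambda>(d, j). (d * j, d)) ` ({1..N} \<times> {1..N})"
    proof
      fix x assume "x \<in> (SIGMA k:{1..N}. {d. d dvd k})"
      then obtain d j where x: "x = (d * j, d)" "d * j \<in> {1..N}" by (auto elim!: dvdE)
      then have "d \<in> {1..N}" "j \<in> {1..N}" by (cases d; cases j; force)+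
      then show "x \<in> (\<lambda>(d, j). (d * j, d)) ` ({1..N} \<times> {1..N})" using x by force
    qed
    have "(\<Sum>(k, d)\<in>(SIGMA k:{1..N}. {d. d dvd k}). 1 / (real d * real k))
      \<le> (\<Sum>i\<in>{1..N} \<times> {1..N}. (case (case i of (d, j) \<Rightarrow> (d * j, d)) of (k, d) \<Rightarrow> 1 / (real d * real k)))"
      by (rule sum_le_sum_of_cover[OF _ cover]) auto
    also have "\<dots> = (\<Sum>(d, j)\<in>{1..N} \<times> {1..N}. 1 / (real d)\<^sup>2 * (1 / real j))"
      by (intro sum.cong refl) (auto simp: power2_eq_square)
    finally show ?thesis by simp
  qed
  also have "(\<Sum>(d, j)\<in>{1..N} \<times> {1..N}. 1 / (real d)\<^sup>2 * (1 / real j)) = (\<Sum>d\<in>{1..N}. 1 / (real d)\<^sup>2) * (\<Sum>j\<in>{1..N}. 1 / real j)"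
    by (simp only: sum_product sum.cartesian_product)
  also have "2 * \<dots> \<le> 2 * (2 * (1 + ln (real N)))"
    using assms by (intro mult_left_mono mult_mono sum_inverse_squares_le harmonic_upper sum_nonneg) auto
  finally show ?thesis by simp
qed

text \<open>A prime with p^\<epsilon> >= c pays for its own factor \<open>c\<close>; only finitely
  many primes fail this, and they make up the constant.\<close>

lemma power_omega_le:
  fixes c \<epsilon> :: real
  assumes c: "c \<ge> 1" and e: "\<epsilon> > 0"
  shows "\<exists>C>0. \<forall>k\<ge>1. c ^ card (prime_factors k) \<le> C * real k powr \<epsilon>"
proof -
  define S where "S = {p::nat. real p powr \<epsilon> < c}"
  have "S \<subseteq> {..nat \<lceil>c powr (1 / \<epsilon>)\<rceil>}"
  proof
    fix p assume "p \<in> S"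
    then have "(real p powr \<epsilon>) powr (1 / \<epsilon>) \<le> c powr (1 / \<epsilon>)"
      using e by (intro powr_mono2) (auto simp: S_def)
    then have "real p \<le> c powr (1 / \<epsilon>)" using e by (simp add: powr_powr)
    then show "p \<in> {..nat \<lceil>c powr (1 / \<epsilon>)\<rceil>}" by simp linarith
  qed
  then have fS: "finite S" by (rule finite_subset) simp
  have "c ^ card (prime_factors k) \<le> c ^ card S * real k powr \<epsilon>" if k: "k \<ge> 1" for k
  proof -
    let ?P = "prime_factors k"
    have "c ^ card ?P = c ^ card (?P \<inter> S) * c ^ card (?P - S)"
      by (simp only: power_add[symmetric] card_Int_Diff[of ?P S, OF finite_set_mset])
    also have "\<dots> \<le> c ^ card S * (\<Prod>p\<in>?P - S. real p powr \<epsilon>)"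
    proof (rule mult_mono)
      show "c ^ card (?P \<inter> S) \<le> c ^ card S" using c fS by (intro power_increasing card_mono) auto
      have "(\<Prod>p\<in>?P - S. c) \<le> (\<Prod>p\<in>?P - S. real p powr \<epsilon>)"
        using c by (intro prod_mono) (auto simp: S_def)
      then show "c ^ card (?P - S) \<le> (\<Prod>p\<in>?P - S. real p powr \<epsilon>)" by simp
    qed (use c in auto)
    also have "(\<Prod>p\<in>?P - S. real p powr \<epsilon>) = real (\<Prod>(?P - S)) powr \<epsilon>"
      using prod_powr_distrib[of real "?P - S" \<epsilon>] by simp
    also have "\<dots> \<le> real k powr \<epsilon>"
    proof (rule powr_mono2)
      have "\<Prod>(?P - S) dvd k" by (intro prod_primes_dvd) auto
      then have "\<Prod>(?P - S) \<le> k" using k by (intro dvd_imp_le) auto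
      then show "real (\<Prod>(?P - S)) \<le> real k" by (simp only: of_nat_le_iff)
    qed (use e in \<open>auto intro: prod_nonneg\<close>)
    finally show ?thesis using c by (simp add: mult_left_mono)
  qed
  then show ?thesis using c by (intro exI[of _ "c ^ card S"]) auto
qed

text \<open>Chebyshev's argument: with n = 2^i, the primes in (n, 2n] all divide the central
  binomial coefficient of 2n, which is at most 4^n, and each exceeds \<open>n\<close>.\<close>

lemma card_primes_dyadic:
  shows "real i * real (card {p::nat. prime p \<and> 2 ^ i < p \<and> p \<le> 2 ^ Suc i}) \<le> 2 * 2 ^ i"
proof -
  define n where "n = (2::nat) ^ i"
  let ?T = "{p. prime p \<and> n < p \<and> p \<le> 2 * n}"
  have fT: "finite ?T" by simp
  have "\<Prod>?T dvd (2 * n) choose n"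
  proof (rule prod_primes_dvd[OF fT])
    fix p assume p: "p \<in> ?T"
    have "p dvd fact (2 * n)" using p by (simp add: prime_dvd_fact_iff)
    also have "fact (2 * n) = fact n * fact n * ((2 * n) choose n)"
      using binomial_fact_lemma[of n "2 * n"] by (simp add: mult_2)
    finally have "p dvd fact n * fact n * ((2 * n) choose n)" .
    moreover have "\<not> p dvd fact n" using p by (simp add: prime_dvd_fact_iff)
    ultimately have "p dvd (2 * n) choose n" using p by (auto simp: prime_dvd_mult_iff)
    then show "prime p \<and> p dvd (2 * n) choose n" using p by simp
  qed
  then have le: "\<Prod>?T \<le> (2 * n) choose n" by (intro dvd_imp_le) auto
  have "n ^ card ?T = (\<Prod>p\<in>?T. n)" by simp
  also have "\<dots> \<le> \<Prod>?T" by (intro prod_mono) auto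
  also have "\<dots> \<le> 2 ^ (2 * n)" using le binomial_le_pow2[of "2 * n" n] by linarith
  finally have "(2::nat) ^ (i * card ?T) \<le> 2 ^ (2 * n)" by (simp add: n_def power_mult)
  then have "i * card ?T \<le> 2 * n" by simp
  then have "real (i * card ?T) \<le> real (2 * n)" by (simp only: of_nat_le_iff)
  then show ?thesis by (simp add: n_def)
qed

text \<open>A Mertens-type upper bound: the dyadic block starting at 2^i contributes at most 2 / i,
  and 1/2 is the prime 2.\<close>

lemma sum_inverse_primes_le:
  assumes "m \<ge> 1"
  shows "(\<Sum>p | prime p \<and> p \<le> 2 ^ m. 1 / real p) \<le> 1 / 2 + 2 * (1 + ln (real m))"
proof -
  have "(\<Sum>p | prime p \<and> p \<le> 2 ^ m. 1 / real p) \<le> 1 / 2 + 2 * (\<Sum>i\<in>{1..<m}. 1 / real i)" using assms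
  proof (induction m rule: dec_induct)
    case base
    have "{p::nat. prime p \<and> p \<le> 2 ^ 1} = {2}" using prime_ge_2_nat by (auto intro: antisym)
    then show ?case by simp
  next
    case (step m)
    let ?T = "{p. prime p \<and> 2 ^ m < p \<and> p \<le> (2::nat) ^ Suc m}"
    have "(2::nat) ^ m \<le> 2 ^ Suc m" by simp
    then have e: "{p. prime p \<and> p \<le> (2::nat) ^ Suc m} = {p. prime p \<and> p \<le> 2 ^ m} \<union> ?T"
      by (auto intro: le_trans simp del: power_Suc)
    have fin: "finite {p. prime p \<and> p \<le> (2::nat) ^ m}" "finite ?T" by auto
    have "(\<Sum>p\<in>?T. 1 / real p) \<le> (\<Sum>p\<in>?T. 1 / 2 ^ m)"
    proof (rule sum_mono)
      fix p assume "p \<in> ?T"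
      then have "real (2 ^ m) \<le> real p" by (simp only: of_nat_le_iff) auto
      then show "1 / real p \<le> 1 / 2 ^ m" using \<open>p \<in> ?T\<close> prime_gt_0_nat
        by (intro divide_left_mono) auto
    qed
    also have "\<dots> = real (card ?T) / 2 ^ m" by simp
    also have "\<dots> \<le> 2 / real m" using card_primes_dyadic[of m] step(1) by (simp add: field_simps)
    finally have 1: "(\<Sum>p\<in>?T. 1 / real p) \<le> 2 / real m" .
    have "(\<Sum>p | prime p \<and> p \<le> (2::nat) ^ Suc m. 1 / real p)
       = (\<Sum>p | prime p \<and> p \<le> 2 ^ m. 1 / real p) + (\<Sum>p\<in>?T. 1 / real p)"
      unfolding e using fin by (intro sum.union_disjoint) auto
    then show ?case using 1 step.IH step.hyps by (simp add: sum.atLeastLessThan_Suc)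
  qed
  also have "(\<Sum>i\<in>{1..<m}. 1 / real i) \<le> (\<Sum>i\<in>{1..m}. 1 / real i)" by (intro sum_mono2) auto
  also have "\<dots> \<le> 1 + ln (real m)" by (rule harmonic_upper[OF assms])
  finally show ?thesis by simp
qed

text \<open>Each factor is at most (1 + 1/p)^2 <= exp (2/p), so twice the previous bound is
  exponentiated: 5 = 2 (1/2 + 2) and the exponent 4 = 2 * 2. The loss against Mertens' first power
  is harmless, because in the application \<open>m\<close> is of the size of log log x.\<close>

lemma prod_primes_le:
  assumes m: "m \<ge> 1"
  shows "(\<Prod>p | prime p \<and> p \<le> 2 ^ m. 1 / (1 - 1 / real p)) \<le> exp 5 * real m ^ 4"
proof -
  let ?T = "{p::nat. prime p \<and> p \<le> 2 ^ m}"
  have fin: "finite ?T" by simp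
  have P: "0 \<le> 1 / (1 - 1 / real p) \<and> 1 / (1 - 1 / real p) \<le> exp (2 * (1 / real p))" if "p \<in> ?T" for p
  proof -
    have p: "real p \<ge> 2" using that prime_ge_2_nat[of p] by simp
    have pos: "1 - 1 / real p > 0" using p by (simp add: field_simps)
    have "1 \<le> (1 + 1 / real p)\<^sup>2 * (1 - 1 / real p)"
    proof -
      have "(1 + 1 / real p)\<^sup>2 * (1 - 1 / real p) = 1 + (real p * (real p - 1) - 1) / real p ^ 3"
        using p by (simp add: field_simps power2_eq_square power3_eq_cube)
      moreover have "real p * (real p - 1) \<ge> 2 * 1" using p by (intro mult_mono) auto
      ultimately show ?thesis using p by simp
    qed
    then have "1 / (1 - 1 / real p) \<le> (1 + 1 / real p)\<^sup>2" using pos by (simp add: pos_divide_le_eq)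
    also have "\<dots> \<le> (exp (1 / real p))\<^sup>2" using p by (intro power_mono) (auto intro: exp_ge_add_one_self)
    also have "\<dots> = exp (2 * (1 / real p))" by (rule exp_double[symmetric])
    finally show ?thesis using pos by simp
  qed
  have "(\<Prod>p\<in>?T. 1 / (1 - 1 / real p)) \<le> (\<Prod>p\<in>?T. exp (2 * (1 / real p)))"
    by (intro prod_mono P)
  also have "\<dots> = exp (2 * (\<Sum>p\<in>?T. 1 / real p))" using fin by (simp add: exp_sum sum_distrib_left)
  also have "\<dots> \<le> exp (2 * (1 / 2 + 2 * (1 + ln (real m))))"
    using sum_inverse_primes_le[OF m] by simp
  also have "\<dots> = exp 5 * exp (real 4 * ln (real m))" by (simp add: exp_add[symmetric])
  also have "exp (real 4 * ln (real m)) = real m ^ 4" using m by (simp only: exp_of_nat_mult) simp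
  finally show ?thesis .
qed

text \<open>A lower bound without any sieve: every integer up to \<open>z\<close> is a product of a
  part composed of primes in \<open>T\<close> and a part free of them, so the harmonic sum is at
  most the Euler product times the rough sum.\<close>

lemma rough_sum_ge:
  assumes T: "finite T" "\<And>p. p \<in> T \<Longrightarrow> prime p"
  shows "ln (real z + 1) \<le> (\<Prod>p\<in>T. 1 / (1 - 1 / real p)) * (\<Sum>k | k \<in> {1..z} \<and> prime_factors k \<inter> T = {}. 1 / real k)"
proof -
  let ?S = "{n. n \<in> {1..z} \<and> prime_factors n \<subseteq> T}"
  let ?R = "{k. k \<in> {1..z} \<and> prime_factors k \<inter> T = {}}"
  have cover: "{1..z} \<subseteq> (\<lambda>(j, k). j * k) ` (?S \<times> ?R)"
  proof
    fix n assume n: "n \<in> {1..z}"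
    then obtain j k where jk: "n = j * k" "prime_factors j \<subseteq> T" "prime_factors k \<inter> T = {}"
      using factor_by_primes[of n T] by auto
    have "j dvd n" "k dvd n" using jk by auto
    then have "j \<in> {1..z}" "k \<in> {1..z}"
      using n dvd_imp_ge_1[of j n] dvd_imp_ge_1[of k n] dvd_imp_le[of j n] dvd_imp_le[of k n] by auto
    then show "n \<in> (\<lambda>(j, k). j * k) ` (?S \<times> ?R)" using jk by force
  qed
  have "ln (real z + 1) \<le> (\<Sum>n\<in>{1..z}. 1 / real n)" by (rule harmonic_lower)
  also have "\<dots> \<le> (\<Sum>i\<in>?S \<times> ?R. 1 / real (case i of (j, k) \<Rightarrow> j * k))"
    by (rule sum_le_sum_of_cover[OF _ cover]) auto
  also have "\<dots> = (\<Sum>(j, k)\<in>?S \<times> ?R. 1 / real j * (1 / real k))"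
    by (intro sum.cong refl) auto
  also have "\<dots> = (\<Sum>j\<in>?S. 1 / real j) * (\<Sum>k\<in>?R. 1 / real k)"
    by (simp only: sum_product sum.cartesian_product)
  also have "\<dots> \<le> (\<Prod>p\<in>T. 1 / (1 - 1 / real p)) * (\<Sum>k\<in>?R. 1 / real k)"
  proof (intro mult_right_mono sum_nonneg)
    have "(\<Sum>n\<in>?S. 1 / real n) = (\<Sum>n\<in>?S. real n powr (- 1))" by (intro sum.cong refl) (auto simp: powr_minus field_simps)
    also have "\<dots> \<le> (\<Prod>p\<in>T. 1 / (1 - real p powr (- 1)))" by (rule smooth_sum_le) (use T in auto)
    also have "\<dots> = (\<Prod>p\<in>T. 1 / (1 - 1 / real p))" by (intro prod.cong refl) (auto simp: powr_minus field_simps)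
    finally show "(\<Sum>n\<in>?S. 1 / real n) \<le> \<dots>" .
  qed auto
  finally show ?thesis .
qed

text \<open>Rankin's trick with exponent 1/2. Each Euler factor is at most 4 because sqrt 2 >=
  4/3.\<close>

lemma smooth_tail_le:
  assumes k: "k \<ge> 1" and z: "z \<ge> 1"
  shows "(\<Sum>d | d \<in> {1..N} \<and> prime_factors d \<subseteq> prime_factors k \<and> z < real d. 1 / real d)
    \<le> 4 ^ card (prime_factors k) / sqrt z"
proof -
  have "(\<Sum>d | d \<in> {1..N} \<and> prime_factors d \<subseteq> prime_factors k \<and> z < real d. 1 / real d)
    \<le> (\<Sum>d | d \<in> {1..N} \<and> prime_factors d \<subseteq> prime_factors k \<and> z < real d. real d powr (- (1/2)) / sqrt z)"
  proof (rule sum_mono)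
    fix d assume d: "d \<in> {d. d \<in> {1..N} \<and> prime_factors d \<subseteq> prime_factors k \<and> z < real d}"
    then have "1 / real d = 1 / (sqrt (real d) * sqrt (real d))" by simp
    also have "\<dots> \<le> 1 / (sqrt (real d) * sqrt z)"
      using d z by (intro divide_left_mono mult_left_mono mult_pos_pos) auto
    finally show "1 / real d \<le> real d powr (- (1/2)) / sqrt z"
      using d by (simp add: powr_minus powr_half_sqrt field_simps)
  qed
  also have "\<dots> \<le> (\<Sum>d | d \<in> {1..N} \<and> prime_factors d \<subseteq> prime_factors k. real d powr (- (1/2)) / sqrt z)"
    using z by (intro sum_mono2) auto
  also have "\<dots> = (\<Sum>d | d \<in> {1..N} \<and> prime_factors d \<subseteq> prime_factors k. real d powr (- (1/2))) / sqrt z"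
    by (simp add: sum_divide_distrib)
  also have "\<dots> \<le> (\<Prod>p\<in>prime_factors k. 1 / (1 - real p powr (- (1/2)))) / sqrt z"
    using z by (intro divide_right_mono smooth_sum_le) auto
  also have "\<dots> \<le> (\<Prod>p\<in>prime_factors k. 4) / sqrt z"
  proof (intro divide_right_mono prod_mono conjI)
    fix p assume "p \<in> prime_factors k"
    then have p: "real p \<ge> 2" using prime_ge_2_nat[of p] by auto
    have "4 / 3 \<le> sqrt 2" by (rule real_le_rsqrt) (simp add: power2_eq_square)
    also have "\<dots> \<le> sqrt (real p)" using p by simp
    finally have "real p powr (- (1/2)) \<le> 3 / 4" using p by (simp add: powr_minus powr_half_sqrt field_simps)
    then show "0 \<le> 1 / (1 - real p powr (- (1/2)))" "1 / (1 - real p powr (- (1/2))) \<le> 4"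
      by (auto simp: field_simps)
  qed (use z in auto)
  finally show ?thesis by simp
qed

section \<open>Discrepancies in terms of primitive kernels\<close>

definition nats_upto :: "real \<Rightarrow> nat set" where "nats_upto X = {n. 1 \<le> n \<and> real n \<le> X}"

lemma finite_nats_upto [simp]: "finite (nats_upto X)"
proof (rule finite_subset)
  show "nats_upto X \<subseteq> {..nat \<lceil>X\<rceil>}" by (auto simp: nats_upto_def) linarith
qed simp

lemma nats_upto_eq: "nats_upto X = {1..nat \<lfloor>X\<rfloor>}"
proof (rule Set.set_eqI)
  fix n show "n \<in> nats_upto X \<longleftrightarrow> n \<in> {1..nat \<lfloor>X\<rfloor>}"
    by (cases "\<lfloor>X\<rfloor> \<ge> 0") (auto simp: nats_upto_def le_nat_iff le_floor_iff)
qed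

lemma sum_upto_filter:
  "(\<Sum>n | n \<in> nats_upto X \<and> coprime n q \<and> P n. h n) = (\<Sum>n | n \<in> nats_upto X \<and> coprime n q. if P n then h n else 0)"
  using sum.inter_filter[of "{n. n \<in> nats_upto X \<and> coprime n q}" h P] by (simp add: conj_assoc)

lemma card_upto_le: "X \<ge> 0 \<Longrightarrow> real (card (nats_upto X)) \<le> X"
  by (simp add: nats_upto_eq)

text \<open>The contribution of the characters modulo \<open>q\<close> that are induced by primitive
  ones modulo \<open>r\<close>. The kernel depends on the conductor \<open>r\<close>, the
  coprimality condition on the full modulus \<open>q\<close>; both have to be carried along.\<close>

definition prim_part :: "(nat \<Rightarrow> complex) \<Rightarrow> real \<Rightarrow> nat \<Rightarrow> nat \<Rightarrow> int \<Rightarrow> complex" where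
  "prim_part h X q r a = (\<Sum>n | n \<in> nats_upto X \<and> coprime n q. h n * of_real (prim_kernel r (int n) a))"

text \<open>totient d times a discrepancy modulo \<open>d\<close>, but over integers coprime to the
  larger modulus \<open>q\<close>. For d = q it is totient q times \<open>Delta\<close>.\<close>

definition class_part :: "(nat \<Rightarrow> complex) \<Rightarrow> real \<Rightarrow> nat \<Rightarrow> nat \<Rightarrow> int \<Rightarrow> complex" where
  "class_part h X q d a = of_nat (totient d) * (\<Sum>n | n \<in> nats_upto X \<and> coprime n q \<and> [int n = a] (mod int d). h n)
     - (\<Sum>n | n \<in> nats_upto X \<and> coprime n q. h n)"

lemma coprime_of_cong:
  assumes "[int n = a] (mod int q)" "coprime a (int q)"
  shows "coprime n q"
  using cong_imp_coprime[OF cong_sym[OF assms(1)] assms(2)] by simp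

lemma Delta_class_part:
  assumes "q \<ge> 1" "coprime a (int q)"
  shows "of_nat (totient q) * Delta h X q a = class_part h X q q a"
proof -
  have "{n. 1 \<le> n \<and> real n \<le> X \<and> [int n = a] (mod int q)} = {n. n \<in> nats_upto X \<and> coprime n q \<and> [int n = a] (mod int q)}"
    using assms coprime_of_cong by (auto simp: nats_upto_def)
  moreover have "{n. 1 \<le> n \<and> real n \<le> X \<and> coprime n q} = {n. n \<in> nats_upto X \<and> coprime n q}"
    by (auto simp: nats_upto_def)
  ultimately show ?thesis using assms by (simp add: Delta_def class_part_def right_diff_distrib)
qed

lemma sum_indicator_class:
  fixes h :: "nat \<Rightarrow> complex"
  shows "(\<Sum>n | n \<in> nats_upto X \<and> coprime n q. h n * of_real (if [int n = a] (mod int d) then c else 0))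
   = of_real c * (\<Sum>n | n \<in> nats_upto X \<and> coprime n q \<and> [int n = a] (mod int d). h n)"
proof -
  have "(\<Sum>n | n \<in> nats_upto X \<and> coprime n q. h n * of_real (if [int n = a] (mod int d) then c else 0))
    = (\<Sum>n | n \<in> nats_upto X \<and> coprime n q. if [int n = a] (mod int d) then of_real c * h n else 0)"
    by (intro sum.cong) auto
  also have "\<dots> = (\<Sum>n | n \<in> {n. n \<in> nats_upto X \<and> coprime n q} \<and> [int n = a] (mod int d). of_real c * h n)"
    by (rule sum.inter_filter[symmetric]) simp
  finally show ?thesis by (simp add: sum_distrib_left conj_assoc)
qed

text \<open>The divisor 1, that is the principal character, reproduces exactly the subtracted main
  term, so only conductors above 1 remain.\<close>

lemma class_part_eq_sum_prim_part:
  assumes d: "d \<ge> 1"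
  shows "class_part h X q d a = (\<Sum>r | r dvd d \<and> r > 1. prim_part h X q r a)"
proof -
  have "(\<Sum>r | r dvd d. prim_part h X q r a)
     = (\<Sum>n | n \<in> nats_upto X \<and> coprime n q. h n * of_real (\<Sum>r | r dvd d. prim_kernel r (int n) a))"
    unfolding prim_part_def by (subst sum.swap) (simp add: sum_distrib_left)
  also have "\<dots> = (\<Sum>n | n \<in> nats_upto X \<and> coprime n q. h n * of_real (if [int n = a] (mod int d) then real (totient d) else 0))"
    using d by (subst sum_prim_kernel) auto
  also have "\<dots> = of_nat (totient d) * (\<Sum>n | n \<in> nats_upto X \<and> coprime n q \<and> [int n = a] (mod int d). h n)"
    by (subst sum_indicator_class) simp
  finally have 1: "(\<Sum>r | r dvd d. prim_part h X q r a) = \<dots>" .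
  have "{r. r dvd d} = insert 1 {r. r dvd d \<and> r > 1}" using d dvd_imp_ge_1[of _ d] by force
  moreover have "finite {r. r dvd d \<and> r > 1}" by (rule finite_subset[of _ "{r. r dvd d}"]) (use d in auto)
  ultimately have "(\<Sum>r | r dvd d. prim_part h X q r a) = prim_part h X q 1 a + (\<Sum>r | r dvd d \<and> r > 1. prim_part h X q r a)"
    using d by simp
  moreover have "prim_part h X q 1 a = (\<Sum>n | n \<in> nats_upto X \<and> coprime n q. h n)"
    by (simp add: prim_part_def)
  ultimately show ?thesis using 1 by (simp add: class_part_def algebra_simps)
qed

text \<open>In the expansion over sets of primes the main terms all agree, and their alternating sum
  vanishes because r > 1; hence each indicator may be replaced by a discrepancy.\<close>

lemma prim_part_le_class_parts:
  assumes r: "r > 1"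
  shows "cmod (prim_part h X q r a) \<le> (\<Sum>T\<in>Pow (prime_factors r). cmod (class_part h X q (r div \<Prod>T) a))"
proof -
  have alt: "(\<Sum>T\<in>Pow (prime_factors r). (- 1) ^ card T) = (0::real)"
    using r by (subst sum_alternating_Pow) (auto simp: prime_factorization_empty_iff)
  have "prim_part h X q r a = (\<Sum>n | n \<in> nats_upto X \<and> coprime n q. \<Sum>T\<in>Pow (prime_factors r). of_real ((- 1) ^ card T) *
     (h n * of_real (if [int n = a] (mod int (r div \<Prod>T)) then real (totient (r div \<Prod>T)) else 0)))"
    unfolding prim_part_def using r
    by (intro sum.cong refl, subst prim_kernel_expansion) (auto simp: sum_distrib_left mult_ac intro!: sum.cong)
  also have "\<dots> = (\<Sum>T\<in>Pow (prime_factors r). of_real ((- 1) ^ card T) *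
     (\<Sum>n | n \<in> nats_upto X \<and> coprime n q. h n * of_real (if [int n = a] (mod int (r div \<Prod>T)) then real (totient (r div \<Prod>T)) else 0)))"
    by (subst sum.swap) (simp only: sum_distrib_left)
  also have "\<dots> = (\<Sum>T\<in>Pow (prime_factors r). of_real ((- 1) ^ card T) *
     (class_part h X q (r div \<Prod>T) a + (\<Sum>n | n \<in> nats_upto X \<and> coprime n q. h n)))"
    by (simp only: sum_indicator_class class_part_def) simp
  also have "\<dots> = (\<Sum>T\<in>Pow (prime_factors r). of_real ((- 1) ^ card T) * class_part h X q (r div \<Prod>T) a)
     + of_real (\<Sum>T\<in>Pow (prime_factors r). (- 1) ^ card T) * (\<Sum>n | n \<in> nats_upto X \<and> coprime n q. h n)"
    by (simp only: distrib_left sum.distrib of_real_sum sum_distrib_right)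
  also have "\<dots> = (\<Sum>T\<in>Pow (prime_factors r). of_real ((- 1) ^ card T) * class_part h X q (r div \<Prod>T) a)"
    unfolding alt by simp
  finally show ?thesis by (simp only:) (rule order_trans[OF norm_sum], simp add: norm_mult norm_power)
qed

lemma max_Delta_ge: "q \<ge> 1 \<Longrightarrow> coprime a (int q) \<Longrightarrow> cmod (Delta h X q a) \<le> max_Delta h X q"
  unfolding max_Delta_def by (rule Max_ge[OF max_Delta_set(1)]) (simp_all add: image_eqI)

lemma max_Delta_nonneg: "q \<ge> 1 \<Longrightarrow> max_Delta h X q \<ge> 0"
  using order_trans[OF norm_ge_zero max_Delta_ge[of q 1 h X]] by simp

lemma max_Delta_attained:
  assumes "q \<ge> 1"
  shows "\<exists>a. coprime a (int q) \<and> max_Delta h X q = cmod (Delta h X q a)"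
  using Max_in[OF max_Delta_set[OF assms, of h X]] unfolding max_Delta_def[symmetric] by blast

text \<open>The discrepancy in a class modulo \<open>d\<close> is the mean of the discrepancies in
  the reduced classes modulo \<open>q\<close> above it, so it is no larger than the worst of
  them.\<close>

lemma class_part_le_max_Delta:
  assumes q: "q \<ge> 1" and d: "d dvd q" and a: "coprime a (int d)"
  shows "cmod (class_part h X q d a) \<le> real (totient q) * max_Delta h X q"
proof -
  let ?F = "{c \<in> ures q. [c = a] (mod int d)}"
  have q0: "q > 0" using q by simp
  have card: "card ?F * totient d = totient q" by (rule card_fibre[OF q0 d a])
  have cF: "card ?F > 0"
  proof (rule ccontr)
    assume "\<not> card ?F > 0"
    then have "card ?F = 0" by simp
    then have "totient q = 0" using card by (metis mult_0)
    then show False using q0 by simp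
  qed
  have "(\<Sum>c\<in>?F. class_part h X q q c) = of_nat (card ?F) * class_part h X q d a"
  proof -
    have "(\<Sum>c\<in>?F. \<Sum>n | n \<in> nats_upto X \<and> coprime n q \<and> [int n = c] (mod int q). h n)
      = (\<Sum>c\<in>?F. \<Sum>n | n \<in> nats_upto X \<and> coprime n q. if [int n = c] (mod int q) then h n else 0)"
      by (intro sum.cong refl sum_upto_filter)
    also have "\<dots> = (\<Sum>n | n \<in> nats_upto X \<and> coprime n q. \<Sum>c\<in>?F. if c = int n mod int q then h n else 0)"
      by (subst sum.swap, intro sum.cong refl if_cong) (auto simp: ures_def cong_def)
    also have "\<dots> = (\<Sum>n | n \<in> nats_upto X \<and> coprime n q. if [int n = a] (mod int d) then h n else 0)"
    proof (intro sum.cong refl)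
      fix n assume n: "n \<in> {n. n \<in> nats_upto X \<and> coprime n q}"
      then have "int n mod int q \<in> ures q" using q0 by (intro mod_in_ures) auto
      moreover have "[int n mod int q = a] (mod int d) \<longleftrightarrow> [int n = a] (mod int d)"
        using d by (simp add: cong_def mod_mod_cancel)
      ultimately show "(\<Sum>c\<in>?F. if c = int n mod int q then h n else 0) = (if [int n = a] (mod int d) then h n else 0)"
        by simp
    qed
    also have "\<dots> = (\<Sum>n | n \<in> nats_upto X \<and> coprime n q \<and> [int n = a] (mod int d). h n)"
      by (rule sum_upto_filter[symmetric])
    finally have "(\<Sum>c\<in>?F. class_part h X q q c)
      = of_nat (totient q) * (\<Sum>n | n \<in> nats_upto X \<and> coprime n q \<and> [int n = a] (mod int d). h n)
        - of_nat (card ?F) * (\<Sum>n | n \<in> nats_upto X \<and> coprime n q. h n)"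
      by (simp add: class_part_def sum_subtractf sum_distrib_left[symmetric])
    then show ?thesis by (simp add: class_part_def card[symmetric] algebra_simps)
  qed
  then have "real (card ?F) * cmod (class_part h X q d a) = cmod (\<Sum>c\<in>?F. class_part h X q q c)"
    by (simp add: norm_mult)
  also have "\<dots> \<le> (\<Sum>c\<in>?F. real (totient q) * max_Delta h X q)"
  proof (rule order_trans[OF norm_sum], rule sum_mono)
    fix c assume "c \<in> ?F"
    then have c: "coprime c (int q)" by (simp add: ures_def)
    show "cmod (class_part h X q q c) \<le> real (totient q) * max_Delta h X q"
      using max_Delta_ge[OF q c, of h X] by (simp add: Delta_class_part[OF q c, symmetric] norm_mult mult_left_mono)
  qed
  also have "\<dots> = real (card ?F) * (real (totient q) * max_Delta h X q)" by simp
  finally show ?thesis using cF by (subst (asm) mult_le_cancel_left_pos) auto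
qed

lemma totient_mult_ge: "totient a * totient b \<le> totient (a * b)"
proof (cases "gcd a b = 0")
  case False
  have "totient a * totient b * totient (gcd a b) \<le> totient a * totient b * gcd a b"
    by (intro mult_left_mono totient_le) auto
  also have "\<dots> = totient (a * b) * totient (gcd a b)" by (rule totient_gcd[symmetric])
  finally show ?thesis by (rule mult_right_le_imp_le) (use False in \<open>simp only: totient_gt_0_iff neq0_conv\<close>)
qed auto

lemma totient_mult_le:
  assumes "a > 0"
  shows "totient (a * b) \<le> totient a * b"
proof (cases "b = 0")
  case False
  have P: "0 \<le> 1 - 1 / real p \<and> 1 - 1 / real p \<le> 1" if "p \<in> prime_factors (a * b)" for p
    using that prime_ge_1_nat[of p] by (auto simp: divide_le_eq_1)
  have sub: "prime_factors a \<subseteq> prime_factors (a * b)" using assms False by (simp add: prime_factors_product)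
  have "real (totient (a * b)) = real a * real b * (\<Prod>p\<in>prime_factors (a * b). 1 - 1 / real p)"
    using totient_formula2[of "a * b"] by simp
  also have "(\<Prod>p\<in>prime_factors (a * b). 1 - 1 / real p)
     = (\<Prod>p\<in>prime_factors (a * b) - prime_factors a. 1 - 1 / real p) * (\<Prod>p\<in>prime_factors a. 1 - 1 / real p)"
    using sub by (intro prod.subset_diff) auto
  also have "\<dots> \<le> 1 * (\<Prod>p\<in>prime_factors a. 1 - 1 / real p)"
    using P sub by (intro mult_right_mono prod_le_1 prod_nonneg) auto
  also have "real a * real b * (1 * (\<Prod>p\<in>prime_factors a. 1 - 1 / real p)) = real (totient a * b)"
    using totient_formula2[of a] by simp
  finally have "real (totient (a * b)) \<le> real (totient a * b)" by (simp add: mult_left_mono)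
  then show ?thesis by (simp only: of_nat_le_iff)
qed simp

text \<open>Writing q = r k and using phi(q) >= phi(r) phi(k) gives conductor and cofactor
  independent weights. \<open>G\<close> still receives \<open>q\<close>, as the coprimality
  condition and the residue depend on it.\<close>

lemma regroup_moduli:
  fixes G :: "nat \<Rightarrow> nat \<Rightarrow> real"
  assumes G: "\<And>q r. G q r \<ge> 0"
  shows "(\<Sum>q\<in>{1..N}. (\<Sum>r | r dvd q \<and> P r. G q r) / real (totient q))
    \<le> (\<Sum>k\<in>{1..N}. (\<Sum>r | r \<in> {1..N} \<and> P r \<and> r * k \<le> N. G (r * k) r / real (totient r)) / real (totient k))"
proof -
  let ?I = "SIGMA k:{1..N}. {r. r \<in> {1..N} \<and> P r \<and> r * k \<le> N}"
  have cover: "(SIGMA q:{1..N}. {r. r dvd q \<and> P r}) \<subseteq> (\<lambda>(k, r). (r * k, r)) ` ?I"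
  proof
    fix x assume "x \<in> (SIGMA q:{1..N}. {r. r dvd q \<and> P r})"
    then obtain r k where x: "x = (r * k, r)" "r * k \<in> {1..N}" "P r" by (auto elim!: dvdE)
    then have "r \<in> {1..N}" "k \<in> {1..N}" by (cases r; cases k; force)+
    then show "x \<in> (\<lambda>(k, r). (r * k, r)) ` ?I" using x by force
  qed
  have fin: "finite {r. r dvd q \<and> P r}" if "q \<in> {1..N}" for q
    by (rule finite_subset[of _ "{r. r dvd q}"]) (use that in auto)
  have "(\<Sum>q\<in>{1..N}. (\<Sum>r | r dvd q \<and> P r. G q r) / real (totient q))
     = (\<Sum>(q, r)\<in>(SIGMA q:{1..N}. {r. r dvd q \<and> P r}). G q r / real (totient q))"
    unfolding sum_divide_distrib by (rule sum.Sigma) (use fin in auto)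
  also have "\<dots> \<le> (\<Sum>i\<in>?I. (case (case i of (k, r) \<Rightarrow> (r * k, r)) of (q, r) \<Rightarrow> G q r / real (totient q)))"
    by (rule sum_le_sum_of_cover[OF _ cover]) (use G in auto)
  also have "\<dots> \<le> (\<Sum>(k, r)\<in>?I. G (r * k) r / real (totient r) / real (totient k))"
  proof (rule sum_mono)
    fix i assume "i \<in> ?I"
    then obtain k r where i: "i = (k, r)" and "k \<in> {1..N}" "r \<in> {1..N}" by auto
    then have "0 < real (totient r * totient k)" by simp
    moreover have "real (totient r * totient k) \<le> real (totient (r * k))"
      using totient_mult_ge of_nat_le_iff by blast
    ultimately have "G (r * k) r / real (totient (r * k)) \<le> G (r * k) r / real (totient r * totient k)"
      using G by (intro frac_le) auto
    then show "(case (case i of (k, r) \<Rightarrow> (r * k, r)) of (q, r) \<Rightarrow> G q r / real (totient q))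
      \<le> (case i of (k, r) \<Rightarrow> G (r * k) r / real (totient r) / real (totient k))"
      by (simp add: i)
  qed
  also have "\<dots> = (\<Sum>k\<in>{1..N}. (\<Sum>r | r \<in> {1..N} \<and> P r \<and> r * k \<le> N. G (r * k) r / real (totient r)) / real (totient k))"
    unfolding sum_divide_distrib by (rule sum.Sigma[symmetric]) auto
  finally show ?thesis .
qed

section \<open>Cutting off the largest primes\<close>

definition separated :: "nat \<Rightarrow> nat \<Rightarrow> bool" where
  "separated k l \<longleftrightarrow> (\<forall>p\<in>prime_factors k. \<forall>p'\<in>prime_factors l. p < p')"

text \<open>Every \<open>n > V\<close> has exactly one divisor \<open>k\<close> in this set all of whose primes are below those of \<open>n / k\<close>.\<close>

definition cut_set :: "real \<Rightarrow> nat set" where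
  "cut_set V = {k. V < real k \<and> (\<exists>u p e. k = u * p ^ e \<and> prime p \<and> e \<ge> 1 \<and> u \<ge> 1 \<and> real u \<le> V
     \<and> (\<forall>q\<in>prime_factors u. q < p))}"

lemma separated_coprime: "separated k l \<Longrightarrow> k > 0 \<Longrightarrow> l > 0 \<Longrightarrow> coprime k l"
  by (rule coprime_of_disjoint_prime_factors) (auto simp: separated_def)

lemma separated_1 [simp]: "separated k (Suc 0)"
  by (simp add: separated_def)

lemma prime_factors_cut:
  assumes "prime p" "e \<ge> 1" "u \<ge> (1::nat)"
  shows "prime_factors (u * p ^ e) = insert p (prime_factors u)"
proof -
  have "prime_factors (p ^ e) = {p}" using assms by (simp add: prime_factors_power prime_prime_factors)
  then show ?thesis using assms by (simp add: prime_factors_product prime_gt_0_nat)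
qed

text \<open>If the top primes satisfy p < p', then \<open>k\<close> is coprime to p' and to l',
  hence divides u' and is at most \<open>V\<close>, a contradiction. If they agree, \<open>k\<close>
  and k' divide each other.\<close>

lemma cut_set_unique:
  assumes n: "n = k * l" "n = k' * l'" "n > 0" and k: "k \<in> cut_set V" "separated k l"
    and k': "k' \<in> cut_set V" "separated k' l'"
  shows "k = k'"
proof -
  obtain u p e where u: "k = u * p ^ e" "prime p" "e \<ge> 1" "u \<ge> 1" "real u \<le> V" "\<forall>q\<in>prime_factors u. q < p" "V < real k"
    using k(1) by (auto simp: cut_set_def)
  obtain u' p' e' where u': "k' = u' * p' ^ e'" "prime p'" "e' \<ge> 1" "u' \<ge> 1" "real u' \<le> V" "\<forall>q\<in>prime_factors u'. q < p'" "V < real k'"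
    using k'(1) by (auto simp: cut_set_def)
  have pf: "prime_factors k = insert p (prime_factors u)" "prime_factors k' = insert p' (prime_factors u')"
    using prime_factors_cut u u' by auto
  have pos: "k > 0" "l > 0" "k' > 0" "l' > 0" using n by (auto intro: gr0I)
  have aux: False if "p < p'" and n: "n = k * l" "n = k' * l'"
    and u: "prime_factors k = insert p (prime_factors u)" "\<forall>q\<in>prime_factors u. q < p" "V < real k"
    and u': "k' = u' * p' ^ e'" "u' \<ge> 1" "real u' \<le> V" "prime p'"  "prime_factors k' = insert p' (prime_factors u')" "separated k' l'"
    and pos: "k > 0" "l' > 0"
    for p p' k l k' l' u u' e'
  proof -
    have "k dvd u' * (p' ^ e' * l')" using n u' by (metis dvd_triv_left mult.assoc)
    moreover have "coprime k (p' ^ e' * l')"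
    proof -
      have "coprime k p'"
        using \<open>p < p'\<close> u u'(4) pos by (intro coprime_of_disjoint_prime_factors) (auto simp: prime_factorization_prime prime_gt_0_nat)
      moreover have "coprime k l'"
        using \<open>p < p'\<close> u u' pos by (intro coprime_of_disjoint_prime_factors) (fastforce simp: separated_def)+
      ultimately show ?thesis by simp
    qed
    ultimately have "k dvd u'" by (simp add: coprime_dvd_mult_left_iff)
    then have "k \<le> u'" using u' by (intro dvd_imp_le) auto
    then show False using u u' by simp
  qed
  have "\<not> p < p'" using aux[OF _ n(1,2) pf(1) u(6,7) u'(1,4,5,2) pf(2) k'(2) pos(1,4)] by blast
  moreover have "\<not> p' < p" using aux[OF _ n(2,1) pf(2) u'(6,7) u(1,4,5,2) pf(1) k(2) pos(3,2)] by blast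
  ultimately have pp: "p = p'" by simp
  have "coprime k l'" using pf pp k'(2) u(6) pos
    by (intro coprime_of_disjoint_prime_factors) (fastforce simp: separated_def)+
  moreover have "coprime k' l" using pf pp k(2) u'(6) pos
    by (intro coprime_of_disjoint_prime_factors) (fastforce simp: separated_def)+
  moreover have "k dvd k' * l'" "k' dvd k * l" using n by (metis dvd_triv_left)+
  ultimately show ?thesis by (simp add: coprime_dvd_mult_left_iff dvd_antisym)
qed

text \<open>Remove the largest prime with its full power, so that the two factors stay coprime. If
  the rest is at most \<open>V\<close>, then \<open>n\<close> itself lies in the set; otherwise the
  rest is cut by induction and the removed power joins \<open>l\<close>.\<close>

lemma cut_set_exists:
  assumes V: "V \<ge> 1" and n: "V < real n"
  shows "\<exists>k l. n = k * l \<and> k \<in> cut_set V \<and> separated k l"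
  using n
proof (induction n rule: less_induct)
  case (less n)
  have n1: "n > 1" using less.prems V by simp
  define p where "p = Max (prime_factors n)"
  have "prime_factors n \<noteq> {}" using n1 by (simp add: prime_factorization_empty_iff)
  then have pn: "p \<in> prime_factors n" unfolding p_def by (intro Max_in) auto
  have pmax: "q \<le> p" if "q \<in> prime_factors n" for q using that by (simp add: p_def)
  have p: "prime p" "p dvd n" using pn by auto
  obtain u where u: "n = p ^ multiplicity p n * u" "\<not> p dvd u"
    using p n1 by (metis multiplicity_decompose' not_prime_unit not_less_zero)
  define e where "e = multiplicity p n"
  have nu: "n = u * p ^ e" using u by (simp add: e_def mult.commute)
  have e: "e \<ge> 1" using p n1 by (simp add: e_def Suc_le_eq prime_multiplicity_gt_zero_iff)
  have u1: "u \<ge> 1" using nu n1 by (cases u) auto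
  have ulp: "q < p" if "q \<in> prime_factors u" for q
  proof -
    have "n \<noteq> 0" using n1 by simp
    moreover have "u dvd n" using nu by (metis dvd_triv_left)
    ultimately have "prime_factors u \<subseteq> prime_factors n" by (rule dvd_prime_factors)
    then have "q \<in> prime_factors n" using that by (rule subsetD)
    then have "q \<le> p" by (rule pmax)
    moreover have "q \<noteq> p" using that u by auto
    ultimately show ?thesis by simp
  qed
  show ?case
  proof (cases "real u \<le> V")
    case True
    then have "n \<in> cut_set V" using less.prems p nu e u1 ulp unfolding cut_set_def by blast
    then show ?thesis by (intro exI[of _ n] exI[of _ 1]) auto
  next
    case False
    have "p ^ e > 1" using e prime_gt_1_nat[OF p(1)] by (intro one_less_power) auto
    then have "u < n" using nu u1 by simp
    moreover have "V < real u" using False by simp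
    ultimately obtain k l where kl: "u = k * l" "k \<in> cut_set V" "separated k l" using less.IH by blast
    have pos: "k > 0" "l > 0" using kl(1) u1 by (cases k; cases l; simp)+
    have "separated k (l * p ^ e)"
      unfolding separated_def
    proof (intro ballI)
      fix q q' assume q: "q \<in> prime_factors k" "q' \<in> prime_factors (l * p ^ e)"
      have "q' = p \<or> q' \<in> prime_factors l" using q(2) prime_factors_cut[OF p(1) e, of l] pos by auto
      moreover have "q \<in> prime_factors u" using q kl(1) u1 dvd_prime_factors[of u k] by auto
      ultimately show "q < q'" using ulp q kl(3) by (auto simp: separated_def)
    qed
    then show ?thesis using nu kl by (intro exI[of _ k] exI[of _ "l * p ^ e"]) (auto simp: mult.assoc)
  qed
qed

section \<open>Type I part, type II part and remainder\<close>

definition type1_part :: "real \<Rightarrow> (nat \<Rightarrow> complex) \<Rightarrow> nat \<Rightarrow> complex" where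
  "type1_part V f n = (\<Sum>u | u dvd n \<and> real u \<le> V. f u * on_primes f (n div u))"

definition type2_part :: "real \<Rightarrow> real \<Rightarrow> (nat \<Rightarrow> complex) \<Rightarrow> nat \<Rightarrow> complex" where
  "type2_part V Z f n = (\<Sum>k | k dvd n \<and> k \<in> cut_set V \<and> separated k (n div k) \<and> Z < real (n div k). f k * f (n div k))"

text \<open>Beyond V^2 the prime cofactor exceeds \<open>V\<close>: it cannot divide any admissible
  \<open>u\<close>, so the sum has at most one term and multiplicativity recombines it to
  f(n).\<close>

lemma type1_part_eq:
  assumes f: "f \<in> class_C" and V: "V \<ge> 1" and n: "V\<^sup>2 < real n"
  shows "type1_part V f n = (if \<exists>u p. n = u * p \<and> real u \<le> V \<and> prime p then f n else 0)"
proof -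
  have n0: "n > 0" using n V by (intro gr0I) auto
  have big: "V < real p" if "n = u * p" "real u \<le> V" for u p
  proof (rule ccontr)
    assume "\<not> V < real p"
    then have "real u * real p \<le> V * V" using that V by (intro mult_mono) auto
    then show False using n that by (simp add: power2_eq_square)
  qed
  show ?thesis
  proof (cases "\<exists>u p. n = u * p \<and> real u \<le> V \<and> prime p")
    case True
    then obtain u p where u: "n = u * p" "real u \<le> V" "prime p" by blast
    have u0: "u > 0" using u n0 by (intro gr0I) auto
    have pV: "V < real p" using big u by blast
    have "\<not> p dvd u" using u pV u0 by (auto dest: dvd_imp_le)
    then have cop: "coprime u p" using u(3) by (metis coprime_commute prime_imp_coprime)
    have "type1_part V f n = (\<Sum>v | v dvd n \<and> real v \<le> V. if v = u then f u * f p else 0)"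
      unfolding type1_part_def
    proof (intro sum.cong refl)
      fix v assume v: "v \<in> {v. v dvd n \<and> real v \<le> V}"
      show "f v * on_primes f (n div v) = (if v = u then f u * f p else 0)"
      proof (cases "v = u")
        case True then show ?thesis using u u0 by (simp add: on_primes_def)
      next
        case False
        obtain m where m: "n = v * m" using v by auto
        have v0: "v > 0" using m n0 by (intro gr0I) auto
        have "\<not> prime m"
        proof
          assume pm: "prime m"
          have "p dvd v * m" using u m by (metis dvd_triv_right)
          then have "p dvd v \<or> p dvd m" using u(3) by (simp add: prime_dvd_mult_iff)
          moreover have "\<not> p dvd v" using v v0 pV by (auto dest: dvd_imp_le)
          ultimately have "p = m" using pm u(3) primes_dvd_imp_eq by blast
          then have "v = u" using m u prime_gt_0_nat[OF u(3)] by simp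
          then show False using False by simp
        qed
        then show ?thesis using False m v0 by (simp add: on_primes_def)
      qed
    qed
    also have "\<dots> = f u * f p" using u n0 by simp
    also have "\<dots> = f n" using class_C_mult[OF f, of u p] u u0 cop prime_gt_0_nat[OF u(3)] by simp
    finally show ?thesis using True by simp
  next
    case False
    then have "type1_part V f n = 0"
      unfolding type1_part_def using n0 by (intro sum.neutral) (auto simp: on_primes_def)
    then show ?thesis unfolding if_not_P[OF False] .
  qed
qed

lemma type2_part_eq:
  assumes f: "f \<in> class_C" and n: "n > 0"
  shows "type2_part V Z f n
    = (if \<exists>k l. n = k * l \<and> k \<in> cut_set V \<and> separated k l \<and> Z < real l then f n else 0)"
proof (cases "\<exists>k l. n = k * l \<and> k \<in> cut_set V \<and> separated k l \<and> Z < real l")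
  case True
  then obtain k l where k: "n = k * l" "k \<in> cut_set V" "separated k l" "Z < real l" by blast
  have pos: "k > 0" "l > 0" using k n by (auto intro: gr0I)
  have "{d. d dvd n \<and> d \<in> cut_set V \<and> separated d (n div d) \<and> Z < real (n div d)} = {k}"
  proof safe
    fix d assume d: "d dvd n" "d \<in> cut_set V" "separated d (n div d)"
    then show "d = k" using cut_set_unique[of n d "n div d" k l V] k n by simp
  qed (use k pos in auto)
  then have "type2_part V Z f n = f k * f l" using k pos by (simp add: type2_part_def)
  also have "\<dots> = f n" using class_C_mult[OF f, of k l] k pos separated_coprime by simp
  finally show ?thesis using True by simp
next
  case False
  then have "{d. d dvd n \<and> d \<in> cut_set V \<and> separated d (n div d) \<and> Z < real (n div d)} = {}"
    by auto
  then have "type2_part V Z f n = 0" unfolding type2_part_def by (simp only: sum.empty)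
  then show ?thesis unfolding if_not_P[OF False] .
qed

definition rest_part :: "real \<Rightarrow> real \<Rightarrow> (nat \<Rightarrow> complex) \<Rightarrow> nat \<Rightarrow> complex" where
  "rest_part V Z f n = f n - type1_part V f n - type2_part V Z f n"

text \<open>Cut n = k l with k = u p^e. If l > Z, then \<open>n\<close> is of type II; it is not of
  type I, since a product \<open>v r\<close> with v <= V and a prime r > V is itself in the cut set,
  forcing l = 1. If l <= Z, a prime power with e >= 2 is at most W^3 <= Z, and l > 1 would force p <
  Z as well; so either l > 1 or e > 1 would make \<open>n\<close> at most V Z^2. Hence n = u p is of
  type I.\<close>

lemma rest_part_eq_0:
  assumes f: "f \<in> class_C" and V: "V \<ge> 1" and Z: "W ^ 3 \<le> Z" "V \<le> Z" and W: "W \<ge> 1" and n: "V * Z\<^sup>2 < real n"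
    and sq: "\<And>t. t\<^sup>2 dvd n \<Longrightarrow> real t \<le> W"
  shows "rest_part V Z f n = 0"
proof -
  have Z1: "Z \<ge> 1" using Z V by simp
  have "V * V \<le> V * Z\<^sup>2" using V Z Z1 by (intro mult_left_mono) (auto simp: power2_eq_square intro: order_trans[of _ "Z * 1"] mult_left_mono)
  then have nV2: "V\<^sup>2 < real n" using n by (simp add: power2_eq_square)
  moreover have "V \<le> V\<^sup>2" using V by (simp add: power2_eq_square)
  ultimately have nV: "V < real n" by simp
  have VZ: "V * Z \<le> V * Z\<^sup>2" using V Z1 by (intro mult_left_mono) (auto simp: power2_eq_square)
  have n0: "n > 0" using nV V by (intro gr0I) auto
  obtain k l where k: "n = k * l" "k \<in> cut_set V" "separated k l" using cut_set_exists[OF V nV] by blast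
  obtain u p e where u: "k = u * p ^ e" "prime p" "e \<ge> 1" "u \<ge> 1" "real u \<le> V" "\<forall>q\<in>prime_factors u. q < p"
    using k(2) by (auto simp: cut_set_def)
  have l0: "l > 0" using k n0 by (intro gr0I) auto
  define c1 where "c1 \<longleftrightarrow> (\<exists>u p. n = u * p \<and> real u \<le> V \<and> prime p)"
  define c2 where "c2 \<longleftrightarrow> (\<exists>k l. n = k * l \<and> k \<in> cut_set V \<and> separated k l \<and> Z < real l)"
  have "c1 \<longleftrightarrow> \<not> c2"
  proof (cases "Z < real l")
    case True
    then have c2 unfolding c2_def using k by blast
    moreover have "\<not> c1"
    proof
      assume c1
      then obtain v r where v: "n = v * r" "real v \<le> V" "prime r" unfolding c1_def by blast
      have v1: "v \<ge> 1" using v n0 by (cases v) auto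
      have "V < real r"
      proof (rule ccontr)
        assume "\<not> V < real r"
        then have "real v * real r \<le> V * V" using v V by (intro mult_mono) auto
        then show False using nV2 v by (simp add: power2_eq_square)
      qed
      then have vr: "v < r" using v by simp
      have "\<forall>q\<in>prime_factors v. q < r"
      proof
        fix q assume "q \<in> prime_factors v"
        then have "q dvd v" by auto
        then have "q \<le> v" using v1 by (intro dvd_imp_le) auto
        then show "q < r" using vr by simp
      qed
      then have "n \<in> cut_set V" unfolding cut_set_def using nV v v1
        by (intro CollectI conjI exI[of _ v] exI[of _ r] exI[of _ "1::nat"]) auto
      then have "k = n" using cut_set_unique[of n k l n 1 V] k n0 by simp
      then have "l = 1" using k n0 by simp
      then show False using True Z1 by simp
    qed
    ultimately show ?thesis by blast
  next
    case False
    then have lZ: "real l \<le> Z" by simp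
    have "\<not> c2"
    proof
      assume c2
      then obtain k' l' where k': "n = k' * l'" "k' \<in> cut_set V" "separated k' l'" "Z < real l'"
        unfolding c2_def by blast
      then have "k = k'" using cut_set_unique[of n k l k' l' V] k n0 by simp
      then have "l = l'" using k k' n0 by simp
      then show False using k' lZ by simp
    qed
    moreover have c1
    proof -
      have peZ: "real (p ^ e) \<le> Z" if "e \<ge> 2"
      proof -
        have "(p ^ (e div 2))\<^sup>2 dvd n"
        proof -
          have "(p ^ (e div 2))\<^sup>2 dvd p ^ e" by (simp add: power_mult[symmetric] le_imp_power_dvd)
          then show ?thesis using k u by (metis dvd_mult dvd_mult2)
        qed
        then have t: "real (p ^ (e div 2)) \<le> W" by (rule sq)
        \<comment> \<open>Sharp at e = 3; this is the origin of the exponent in the condition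
          \<open>W ^ 3 \<le> Z\<close>.\<close>
        have "e \<le> (e div 2) * 3" using that by linarith
        then have "p ^ e \<le> (p ^ (e div 2)) ^ 3"
          using prime_ge_1_nat[OF u(2)] by (simp add: power_mult[symmetric] power_increasing)
        then have "real (p ^ e) \<le> real ((p ^ (e div 2)) ^ 3)" by (simp only: of_nat_le_iff)
        also have "\<dots> \<le> W ^ 3" using t by (simp add: power_mono)
        finally show ?thesis using Z by simp
      qed
      have nreal: "real n = real u * real (p ^ e) * real l" using k u by simp
      have l1: "l = 1"
      proof (rule ccontr)
        assume "l \<noteq> 1"
        then obtain r where r: "prime r" "r dvd l" using prime_factor_nat by blast
        then have "r \<in> prime_factors l" using l0 by (auto simp: prime_factors_dvd)
        moreover have "p \<in> prime_factors k" using prime_factors_cut[of p e u] u by auto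
        ultimately have "p < r" using k(3) by (auto simp: separated_def)
        moreover have "r \<le> l" using r l0 by (auto dest: dvd_imp_le)
        ultimately have pZ: "real p \<le> Z" using lZ by simp
        have "real (p ^ e) \<le> Z"
        proof (cases "e \<ge> 2")
          case False
          then have "e = 1" using u by simp
          then show ?thesis using pZ by simp
        qed (use peZ in blast)
        then have "real u * real (p ^ e) * real l \<le> V * Z * Z"
          using u lZ V Z1 by (intro mult_mono) auto
        then show False using n nreal by (simp add: power2_eq_square mult.assoc)
      qed
      have "e = 1"
      proof (rule ccontr)
        assume "e \<noteq> 1"
        then have "real (p ^ e) \<le> Z" using u peZ by simp
        then have "real u * real (p ^ e) \<le> V * Z" using u V Z1 by (intro mult_mono) auto
        then show False using n nreal l1 VZ by simp
      qed
      then show c1 unfolding c1_def using k u l1 by auto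
    qed
    ultimately show ?thesis by blast
  qed
  moreover have "type1_part V f n = (if c1 then f n else 0)"
    unfolding c1_def by (rule type1_part_eq[OF f V nV2])
  moreover have "type2_part V Z f n = (if c2 then f n else 0)"
    unfolding c2_def by (rule type2_part_eq[OF f n0])
  ultimately show ?thesis by (auto simp: rest_part_def)
qed

text \<open>The crude bound counts the admissible \<open>u\<close> and is meant for the short range
  up to V Z^2; beyond V^2 each of the three parts has modulus at most 1.\<close>

lemma rest_part_bound:
  assumes f: "f \<in> class_C" and V: "V \<ge> 1" and n: "n \<ge> 1"
  shows "cmod (rest_part V Z f n) \<le> 2 + V" "V\<^sup>2 < real n \<Longrightarrow> cmod (rest_part V Z f n) \<le> 3"
proof -
  have fn: "cmod (f n) \<le> 1" by (rule class_C_bound[OF f n])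
  have 2: "cmod (type2_part V Z f n) \<le> 1" using fn n by (simp add: type2_part_eq[OF f])
  have tri: "cmod (rest_part V Z f n) \<le> cmod (f n) + cmod (type1_part V f n) + cmod (type2_part V Z f n)"
    unfolding rest_part_def by (meson add_mono norm_triangle_ineq4 order_refl order_trans)
  have "cmod (type1_part V f n) \<le> (\<Sum>u | u dvd n \<and> real u \<le> V. 1)"
    unfolding type1_part_def
  proof (rule order_trans[OF norm_sum], rule sum_mono)
    fix u assume "u \<in> {u. u dvd n \<and> real u \<le> V}"
    then obtain m where m: "n = u * m" by auto
    then have "u \<ge> 1" "m \<ge> 1" using n by (cases u; cases m; simp)+
    then have "cmod (f u) \<le> 1" "cmod (on_primes f m) \<le> 1"
      using class_C_bound[OF f] by (auto simp: on_primes_def)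
    then show "cmod (f u * on_primes f (n div u)) \<le> 1"
      using m \<open>u \<ge> 1\<close> by (simp add: norm_mult mult_le_one)
  qed
  also have "\<dots> = real (card {u. u dvd n \<and> real u \<le> V})" by simp
  also have "\<dots> \<le> real (card (nats_upto V))"
    using n dvd_imp_ge_1[of _ n] by (intro of_nat_mono card_mono finite_nats_upto) (auto simp: nats_upto_def)
  also have "\<dots> \<le> V" using V by (intro card_upto_le) auto
  finally show "cmod (rest_part V Z f n) \<le> 2 + V" using tri fn 2 by simp
  assume "V\<^sup>2 < real n"
  then have "cmod (type1_part V f n) \<le> 1" using fn by (simp add: type1_part_eq[OF f V])
  then show "cmod (rest_part V Z f n) \<le> 3" using tri fn 2 by simp
qed

section \<open>Dirichlet convolutions in residue classes\<close>

lemma sum_hyperbola: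
  fixes F :: "nat \<Rightarrow> nat \<Rightarrow> 'b::comm_monoid_add"
  shows "(\<Sum>n | n \<in> nats_upto X \<and> P n. \<Sum>d | d dvd n \<and> C d (n div d). F d (n div d))
    = (\<Sum>d\<in>nats_upto X. \<Sum>m | m \<in> nats_upto (X / real d) \<and> C d m \<and> P (d * m). F d m)"
proof -
  have fin: "finite {d. d dvd n \<and> C d (n div d)}" if "n \<in> {n. n \<in> nats_upto X \<and> P n}" for n
    by (rule finite_subset[of _ "{d. d dvd n}"]) (use that in \<open>auto simp: nats_upto_def\<close>)
  have "(\<Sum>n | n \<in> nats_upto X \<and> P n. \<Sum>d | d dvd n \<and> C d (n div d). F d (n div d))
    = (\<Sum>(n, d)\<in>(SIGMA n:{n. n \<in> nats_upto X \<and> P n}. {d. d dvd n \<and> C d (n div d)}). F d (n div d))"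
    by (rule sum.Sigma) (use fin in auto)
  also have "\<dots> = (\<Sum>(d, m)\<in>(SIGMA d:nats_upto X. {m. m \<in> nats_upto (X / real d) \<and> C d m \<and> P (d * m)}). F d m)"
  proof (rule sum.reindex_bij_witness[of _ "\<lambda>(d, m). (d * m, d)" "\<lambda>(n, d). (d, n div d)"])
    fix x assume "x \<in> (SIGMA n:{n. n \<in> nats_upto X \<and> P n}. {d. d dvd n \<and> C d (n div d)})"
    then obtain n d where nd: "x = (n, d)" "n \<in> nats_upto X" "P n" "d dvd n" "C d (n div d)" by auto
    then obtain m where m: "n = d * m" by blast
    have x: "x = (d * m, d)" "d * m \<in> nats_upto X" "P (d * m)" "C d (d * m div d)" using nd m by auto
    have pos: "d > 0" "m > 0" using x(2) by (auto simp: nats_upto_def)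
    have le: "real d * real m \<le> X" using x(2) by (simp add: nats_upto_def)
    have "real d * 1 \<le> real d * real m" using pos by (intro mult_left_mono) auto
    then have dX: "real d \<le> X" using le by simp
    have mX: "real m \<le> X / real d" using le pos by (simp add: pos_le_divide_eq mult.commute)
    show "(case case x of (n, d) \<Rightarrow> (d, n div d) of (d, m) \<Rightarrow> (d * m, d)) = x" using x pos by simp
    show "(case x of (n, d) \<Rightarrow> (d, n div d)) \<in> (SIGMA d:nats_upto X. {m. m \<in> nats_upto (X / real d) \<and> C d m \<and> P (d * m)})"
      using x pos dX mX by (auto simp: nats_upto_def)
    show "(case case x of (n, d) \<Rightarrow> (d, n div d) of (d, m) \<Rightarrow> F d m) = (case x of (n, d) \<Rightarrow> F d (n div d))"
      using x by simp
  next
    fix y assume "y \<in> (SIGMA d:nats_upto X. {m. m \<in> nats_upto (X / real d) \<and> C d m \<and> P (d * m)})"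
    then obtain d m where y: "y = (d, m)" "d \<in> nats_upto X" "m \<in> nats_upto (X / real d)" "C d m" "P (d * m)" by auto
    have pos: "d > 0" "m > 0" using y by (auto simp: nats_upto_def)
    have "real d * real m \<le> X" using y(3) pos by (simp add: nats_upto_def pos_le_divide_eq mult.commute)
    then show "(case case y of (d, m) \<Rightarrow> (d * m, d) of (n, d) \<Rightarrow> (d, n div d)) = y"
      "(case y of (d, m) \<Rightarrow> (d * m, d)) \<in> (SIGMA n:{n. n \<in> nats_upto X \<and> P n}. {d. d dvd n \<and> C d (n div d)})"
      using y pos by (auto simp: nats_upto_def)
  qed
  also have "\<dots> = (\<Sum>d\<in>nats_upto X. \<Sum>m | m \<in> nats_upto (X / real d) \<and> C d m \<and> P (d * m). F d m)"
    by (rule sum.Sigma[symmetric]) auto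
  finally show ?thesis .
qed

definition inv_mod :: "nat \<Rightarrow> nat \<Rightarrow> int" where
  "inv_mod d u = (SOME v. [int u * v = 1] (mod int d) \<and> coprime v (int d))"

lemma inv_mod:
  assumes "d > 0" "coprime u d"
  shows "[int u * inv_mod d u = 1] (mod int d)" "coprime (inv_mod d u) (int d)"
proof -
  have "\<exists>v. [int u * v = 1] (mod int d) \<and> coprime v (int d)"
    using assms by (intro inverse_mod_exists) auto
  then have "[int u * inv_mod d u = 1] (mod int d) \<and> coprime (inv_mod d u) (int d)"
    unfolding inv_mod_def by (rule someI_ex)
  then show "[int u * inv_mod d u = 1] (mod int d)" "coprime (inv_mod d u) (int d)" by auto
qed

text \<open>The condition on \<open>u\<close> is an arbitrary predicate \<open>C\<close> so that one
  statement serves both the type I part (u <= V) and the coprimality sieve (all primes of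
  \<open>u\<close> divide the modulus).\<close>

lemma class_part_convolution:
  assumes d: "d > 0" "d dvd q"
    and h: "\<And>n. n \<ge> 1 \<Longrightarrow> h n = (\<Sum>u | u dvd n \<and> C u. g u * w (n div u))"
  shows "class_part h X q d a
    = (\<Sum>u | u \<in> nats_upto X \<and> C u \<and> coprime u q. g u * class_part w (X / real u) q d (a * inv_mod d u))"
proof -
  have S: "(\<Sum>n | n \<in> nats_upto X \<and> coprime n q \<and> R n. h n)
     = (\<Sum>u | u \<in> nats_upto X \<and> C u \<and> coprime u q. g u * (\<Sum>m | m \<in> nats_upto (X / real u) \<and> coprime m q \<and> R (u * m). w m))" for R
  proof -
    have "(\<Sum>n | n \<in> nats_upto X \<and> coprime n q \<and> R n. h n)
      = (\<Sum>n | n \<in> nats_upto X \<and> coprime n q \<and> R n. \<Sum>u | u dvd n \<and> C u. g u * w (n div u))"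
      by (intro sum.cong refl h) (auto simp: nats_upto_def)
    also have "\<dots> = (\<Sum>u\<in>nats_upto X. \<Sum>m | m \<in> nats_upto (X / real u) \<and> C u \<and> coprime (u * m) q \<and> R (u * m). g u * w m)"
      using sum_hyperbola[where X = X and P = "\<lambda>n. coprime n q \<and> R n" and C = "\<lambda>u _. C u" and F = "\<lambda>u m. g u * w m"] by simp
    also have "\<dots> = (\<Sum>u\<in>nats_upto X. if C u \<and> coprime u q then g u * (\<Sum>m | m \<in> nats_upto (X / real u) \<and> coprime m q \<and> R (u * m). w m) else 0)"
      by (intro sum.cong refl) (auto simp: sum_distrib_left)
    also have "\<dots> = (\<Sum>u | u \<in> nats_upto X \<and> C u \<and> coprime u q. g u * (\<Sum>m | m \<in> nats_upto (X / real u) \<and> coprime m q \<and> R (u * m). w m))"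
      by (rule sum.inter_filter[symmetric]) simp
    finally show ?thesis .
  qed
  have cop: "coprime u d" if "coprime u q" for u using that d by (meson coprime_divisors dvd_refl)
  have cg: "[int (u * m) = a] (mod int d) \<longleftrightarrow> [int m = a * inv_mod d u] (mod int d)" if u: "coprime u q" for u m
  proof -
    have v: "[int u * inv_mod d u = 1] (mod int d)" "coprime (inv_mod d u) (int d)"
      using inv_mod[OF d(1) cop[OF u]] by auto
    have "[int (u * m) = a] (mod int d) \<longleftrightarrow> [inv_mod d u * int (u * m) = inv_mod d u * a] (mod int d)"
      using cong_mult_lcancel[OF v(2), of "int (u * m)" a] by simp
    also have "\<dots> \<longleftrightarrow> [int m = a * inv_mod d u] (mod int d)"
    proof -
      have "[inv_mod d u * int (u * m) = int m] (mod int d)"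
        using cong_scalar_right[OF v(1), of "int m"] by (simp add: mult_ac)
      then show ?thesis by (simp add: cong_def mult.commute)
    qed
    finally show ?thesis .
  qed
  have "class_part h X q d a
    = (\<Sum>u | u \<in> nats_upto X \<and> C u \<and> coprime u q. g u * (of_nat (totient d) *
        (\<Sum>m | m \<in> nats_upto (X / real u) \<and> coprime m q \<and> [int (u * m) = a] (mod int d). w m)
        - (\<Sum>m | m \<in> nats_upto (X / real u) \<and> coprime m q. w m)))"
    unfolding class_part_def using S[of "\<lambda>n. [int n = a] (mod int d)"] S[of "\<lambda>_. True"]
    by (simp add: sum_distrib_left right_diff_distrib sum_subtractf mult_ac)
  also have "\<dots> = (\<Sum>u | u \<in> nats_upto X \<and> C u \<and> coprime u q. g u * class_part w (X / real u) q d (a * inv_mod d u))"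
    unfolding class_part_def by (intro sum.cong refl) (simp only: mem_Collect_eq cg)
  finally show ?thesis .
qed

section \<open>The type II estimate\<close>

lemma geometric_sum_bound:
  fixes s T :: real
  assumes s: "s \<ge> 4 / 3" and I: "finite I" and T: "T \<ge> 0" "\<And>i. i \<in> I \<Longrightarrow> s ^ i \<le> T"
  shows "(\<Sum>i\<in>I. s ^ i) \<le> 4 * T"
proof (cases "I = {}")
  case False
  define m where "m = Max I"
  have m: "m \<in> I" "\<And>i. i \<in> I \<Longrightarrow> i \<le> m" using False I by (auto simp: m_def)
  have "(\<Sum>i\<in>I. s ^ i) \<le> (\<Sum>i\<le>m. s ^ i)" using m s by (intro sum_mono2) auto
  also have "\<dots> \<le> 4 * s ^ m"
  proof (induction m)
    case (Suc m)
    have "s ^ Suc m \<ge> 4 / 3 * s ^ m" using s by (simp add: mult_right_mono)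
    then show ?case using Suc by simp
  qed simp
  also have "\<dots> \<le> 4 * T" using T m by simp
  finally show ?thesis .
qed (use T in auto)

lemma geometric_sum_bound_inverse:
  fixes s T :: real
  assumes s: "s \<ge> 4 / 3" and I: "finite I" and T: "T \<ge> 0" "\<And>i. i \<in> I \<Longrightarrow> 1 / s ^ i \<le> T"
  shows "(\<Sum>i\<in>I. 1 / s ^ i) \<le> 4 * T"
proof (cases "I = {}")
  case False
  define m where "m = Min I"
  have m: "m \<in> I" "\<And>i. i \<in> I \<Longrightarrow> m \<le> i" using False I by (auto simp: m_def)
  have "(\<Sum>i\<in>I. 1 / s ^ i) \<le> (\<Sum>i\<in>{m..Max I}. 1 / s ^ i)" using m s I by (intro sum_mono2) auto
  also have "\<dots> \<le> 4 / s ^ m"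
  proof -
    have "(\<Sum>i\<in>{m..n}. 1 / s ^ i) \<le> 4 / s ^ m - 3 / s ^ n" if "n \<ge> m" for n
      using that
    proof (induction n rule: dec_induct)
      case base
      have "s ^ m > 0" using s by simp
      then show ?case by (simp add: field_simps)
    next
      case (step n)
      have "4 * s ^ n \<le> 3 * s ^ Suc n" using s by (simp add: mult_right_mono)
      then have "4 * (1 / s ^ Suc n) \<le> 3 / s ^ n" using s by (simp add: field_simps)
      moreover have "3 / s ^ Suc n = 3 * (1 / s ^ Suc n)" by simp
      moreover have "(\<Sum>i\<in>{m..Suc n}. 1 / s ^ i) = (\<Sum>i\<in>{m..n}. 1 / s ^ i) + 1 / s ^ Suc n" using step by simp
      ultimately show ?case using step.IH by linarith
    qed
    moreover have "m \<le> Max I" using m I by simp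
    moreover have "3 / s ^ Max I \<ge> 0" using s by simp
    ultimately show ?thesis by (smt (verit))
  qed
  also have "\<dots> \<le> 4 * T" using T(2)[OF m(1)] by simp
  finally show ?thesis .
qed (use T in auto)

text \<open>Brings separation into the shape of the splitting lemma: the rank of \<open>n\<close> is
  its least prime, the threshold of \<open>m\<close> is one more than its largest prime.\<close>

lemma separated_iff:
  assumes "m > 1" "n > 1"
  shows "separated m n \<longleftrightarrow> \<not> Min (prime_factors n) < Max (prime_factors m) + 1"
proof -
  have ne: "prime_factors m \<noteq> {}" "prime_factors n \<noteq> {}"
    using assms by (simp_all add: prime_factorization_empty_iff)
  have "\<not> Min (prime_factors n) < Max (prime_factors m) + 1 \<longleftrightarrow> Max (prime_factors m) < Min (prime_factors n)"
    by linarith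
  then show ?thesis using ne by (auto simp: separated_def)
qed

text \<open>With \<epsilon> r chosen as a conjugate sign, the sum over conductors of absolute values
  becomes a single bilinear form. Joint conditions on \<open>m\<close> and \<open>n\<close> can then
  be removed once for all conductors together.\<close>

definition moduli_kernel :: "nat \<Rightarrow> nat \<Rightarrow> nat \<Rightarrow> (nat \<Rightarrow> int) \<Rightarrow> (nat \<Rightarrow> complex) \<Rightarrow> nat \<Rightarrow> nat \<Rightarrow> complex" where
  "moduli_kernel R0 R k a \<epsilon> m n = (\<Sum>r\<in>{R0<..R}. if coprime (m * n) (r * k)
     then \<epsilon> r * of_real (prim_kernel r (int (m * n)) (a r)) / of_nat (totient r) else 0)"

lemma bilinear_form_moduli_kernel:
  "bilinear_form M N (moduli_kernel R0 R k a \<epsilon>) \<alpha> \<beta>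
    = (\<Sum>r\<in>{R0<..R}. \<epsilon> r * (\<Sum>m | m \<in> {1..M} \<and> coprime m r. \<Sum>n | n \<in> {1..N} \<and> coprime n r.
        (if coprime m k then \<alpha> m else 0) * (if coprime n k then \<beta> n else 0) * of_real (prim_kernel r (int (m * n)) (a r))) / of_nat (totient r))"
proof -
  have "bilinear_form M N (moduli_kernel R0 R k a \<epsilon>) \<alpha> \<beta>
    = (\<Sum>r\<in>{R0<..R}. \<Sum>m\<in>{1..M}. \<Sum>n\<in>{1..N}. \<alpha> m * \<beta> n * (if coprime (m * n) (r * k)
     then \<epsilon> r * of_real (prim_kernel r (int (m * n)) (a r)) / of_nat (totient r) else 0))"
    unfolding bilinear_form_def moduli_kernel_def sum_distrib_left by (simp only: sum.swap[of _ _ "{R0<..R}"])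
  also have "\<dots> = (\<Sum>r\<in>{R0<..R}. \<epsilon> r * (\<Sum>m | m \<in> {1..M} \<and> coprime m r. \<Sum>n | n \<in> {1..N} \<and> coprime n r.
        (if coprime m k then \<alpha> m else 0) * (if coprime n k then \<beta> n else 0) * of_real (prim_kernel r (int (m * n)) (a r))) / of_nat (totient r))"
  proof (intro sum.cong refl)
    fix r
    define g where "g = (\<lambda>m n. (if coprime m k then \<alpha> m else 0) * (if coprime n k then \<beta> n else 0) * of_real (prim_kernel r (int (m * n)) (a r)))"
    have "(\<Sum>m\<in>{1..M}. \<Sum>n\<in>{1..N}. \<alpha> m * \<beta> n * (if coprime (m * n) (r * k)
        then \<epsilon> r * of_real (prim_kernel r (int (m * n)) (a r)) / of_nat (totient r) else 0))
      = (\<Sum>m\<in>{1..M}. if coprime m r then (\<Sum>n\<in>{1..N}. if coprime n r then \<epsilon> r * g m n / of_nat (totient r) else 0) else 0)"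
      by (intro sum.cong refl) (auto simp: g_def intro!: sum.cong sum.neutral)
    also have "\<dots> = (\<Sum>m | m \<in> {1..M} \<and> coprime m r. \<Sum>n | n \<in> {1..N} \<and> coprime n r. \<epsilon> r * g m n / of_nat (totient r))"
      by (simp only: sum.inter_filter[symmetric, OF finite_atLeastAtMost])
    also have "\<dots> = \<epsilon> r * (\<Sum>m | m \<in> {1..M} \<and> coprime m r. \<Sum>n | n \<in> {1..N} \<and> coprime n r. g m n) / of_nat (totient r)"
      by (simp add: sum_distrib_left sum_divide_distrib)
    finally show "(\<Sum>m\<in>{1..M}. \<Sum>n\<in>{1..N}. \<alpha> m * \<beta> n * (if coprime (m * n) (r * k)
        then \<epsilon> r * of_real (prim_kernel r (int (m * n)) (a r)) / of_nat (totient r) else 0))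
      = \<epsilon> r * (\<Sum>m | m \<in> {1..M} \<and> coprime m r. \<Sum>n | n \<in> {1..N} \<and> coprime n r.
        (if coprime m k then \<alpha> m else 0) * (if coprime n k then \<beta> n else 0) * of_real (prim_kernel r (int (m * n)) (a r))) / of_nat (totient r)"
      by (simp only: g_def)
  qed
  finally show ?thesis .
qed

lemma bilinear_bound_nonneg: "bilinear_bound R0 R M N \<ge> 0"
  by (simp add: bilinear_bound_def sum_nonneg)

lemma kernel_bound_moduli_kernel:
  assumes R0: "R0 > 0" and a: "\<And>r. coprime (a r) (int r)" and e: "\<And>r. cmod (\<epsilon> r) \<le> 1"
  shows "kernel_bound M N (bilinear_bound R0 R M N) (moduli_kernel R0 R k a \<epsilon>)"
  unfolding kernel_bound_def
proof (intro allI)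
  fix \<alpha> \<beta> :: "nat \<Rightarrow> complex"
  define \<alpha>' where "\<alpha>' = (\<lambda>m. if coprime m k then \<alpha> m else 0)"
  define \<beta>' where "\<beta>' = (\<lambda>n. if coprime n k then \<beta> n else 0)"
  have "cmod (bilinear_form M N (moduli_kernel R0 R k a \<epsilon>) \<alpha> \<beta>)
    \<le> (\<Sum>r\<in>{R0<..R}. cmod (\<Sum>m | m \<in> {1..M} \<and> coprime m r. \<Sum>n | n \<in> {1..N} \<and> coprime n r.
        \<alpha>' m * \<beta>' n * of_real (prim_kernel r (int (m * n)) (a r))) / real (totient r))"
    unfolding bilinear_form_moduli_kernel \<alpha>'_def \<beta>'_def
    by (intro order_trans[OF norm_sum] sum_mono)
      (simp only: norm_mult norm_divide norm_of_nat, intro divide_right_mono mult_left_le_one_le, use e in auto)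
  also have "\<dots> \<le> bilinear_bound R0 R M N * (l2 M \<alpha>' * l2 N \<beta>')" by (rule prim_bilinear[OF R0 a])
  also have "\<dots> \<le> bilinear_bound R0 R M N * (l2 M \<alpha> * l2 N \<beta>)"
    unfolding \<alpha>'_def \<beta>'_def by (intro mult_left_mono mult_mono l2_restrict_le bilinear_bound_nonneg) auto
  finally show "cmod (bilinear_form M N (moduli_kernel R0 R k a \<epsilon>) \<alpha> \<beta>) \<le> bilinear_bound R0 R M N * (l2 M \<alpha> * l2 N \<beta>)" .
qed

lemma l2_le_sqrt_card:
  assumes "\<And>n. n \<in> {1..N} \<Longrightarrow> cmod (\<alpha> n) \<le> (if n \<in> A then 1 else 0)" "finite A"
  shows "l2 N \<alpha> \<le> sqrt (real (card A))"
  unfolding l2_def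
proof (rule real_sqrt_le_mono)
  have "(\<Sum>n\<in>{1..N}. (cmod (\<alpha> n))\<^sup>2) \<le> (\<Sum>n\<in>{1..N}. if n \<in> A then 1 else 0)"
  proof (rule sum_mono)
    fix n assume n: "n \<in> {1..N}"
    have "(cmod (\<alpha> n))\<^sup>2 \<le> (if n \<in> A then 1 else 0)\<^sup>2" using assms(1)[OF n] by (intro power_mono) auto
    then show "(cmod (\<alpha> n))\<^sup>2 \<le> (if n \<in> A then 1 else 0)" by (simp only: if_distrib[of "\<lambda>x. x\<^sup>2"] power_one zero_power2)
  qed
  also have "\<dots> = real (card ({1..N} \<inter> A))" by (simp add: sum.If_cases)
  also have "\<dots> \<le> real (card A)" using assms(2) by (intro of_nat_mono card_mono) auto
  finally show "(\<Sum>n\<in>{1..N}. (cmod (\<alpha> n))\<^sup>2) \<le> real (card A)" .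
qed

text \<open>On a dyadic block of \<open>m\<close> the lengths are fixed, and two joint conditions
  remain: m n <= X and separation. Each is removed by binary splitting in at most \<open>J\<close>
  levels, which together cost (J + 2)^2.\<close>

lemma type2_part_block_bound:
  assumes f: "f \<in> class_C" and R0: "R0 > 0" and a: "\<And>r. coprime (a r) (int r)" and e: "\<And>r. cmod (\<epsilon> r) \<le> 1"
    and V: "V \<ge> 1" and Z: "Z \<ge> 1" and X: "X \<ge> 1" and J: "X < 2 ^ J"
  shows "cmod (\<Sum>m | 2 ^ i \<le> m \<and> m < 2 ^ Suc i \<and> m \<in> cut_set V. \<Sum>n | n \<in> nats_upto (X / real m) \<and> separated m n \<and> Z < real n.
      f m * f n * moduli_kernel R0 R k a \<epsilon> m n)
    \<le> (real J + 2)\<^sup>2 * (8 * (2 * sqrt X / real R0 + (2 * sqrt 2 ^ i + sqrt X / sqrt 2 ^ i) * (1 + (\<Sum>k\<in>{1..R}. 1 / real k)) + 2 * real R)) * sqrt X"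
proof -
  define M where "M = (2::nat) ^ Suc i"
  define N where "N = nat \<lfloor>X / 2 ^ i\<rfloor>"
  define D where "D = bilinear_bound R0 R M N"
  have D0: "D \<ge> 0" by (simp add: D_def bilinear_bound_nonneg)
  define K where "K = moduli_kernel R0 R k a \<epsilon>"
  define K1 where "K1 = (\<lambda>m n. if n < nat \<lfloor>X / real m\<rfloor> + 1 then K m n else 0)"
  \<comment> \<open>There is no least prime for n <= 1; the rank 0 keeps the range below 2^J, and
    \<beta> vanishes there because Z >= 1.\<close>
  define K2 where "K2 = (\<lambda>m n. if (if n > 1 then Min (prime_factors n) else 0) < Max (prime_factors m) + 1 then 0 else K1 m n)"
  have NX: "real N \<le> X / 2 ^ i" using X by (simp add: N_def)
  have "X / 2 ^ i \<le> X" using X by (simp add: divide_le_eq)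
  then have NJ: "N < 2 ^ J" using NX J by (metis le_less_trans of_nat_less_iff of_nat_numeral of_nat_power order_trans)
  have b0: "kernel_bound M N D K" unfolding D_def K_def by (rule kernel_bound_moduli_kernel[OF R0 a e])
  have b1: "kernel_bound M N ((real J + 1) * D) K1"
    unfolding K1_def by (rule kernel_bound_truncate[OF b0 D0]) (use NJ in auto)
  have b2: "kernel_bound M N ((real J + 2) * ((real J + 1) * D)) K2"
    unfolding K2_def
  proof (rule kernel_bound_truncate_compl[OF b1])
    fix n assume n: "n \<in> {1..N}"
    show "(if n > 1 then Min (prime_factors n) else 0) < 2 ^ J"
    proof (cases "n > 1")
      case True
      then have "prime_factors n \<noteq> {}" by (simp add: prime_factorization_empty_iff)
      then have "Min (prime_factors n) \<in> prime_factors n" by (intro Min_in) auto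
      then have "Min (prime_factors n) \<le> n" using True by (auto simp: prime_factors_dvd intro!: dvd_imp_le)
      then show ?thesis using True n NJ by simp
    qed simp
  qed (use D0 in auto)
  define \<alpha> where "\<alpha> = (\<lambda>m. if 2 ^ i \<le> m \<and> m < 2 ^ Suc i \<and> m \<in> cut_set V then f m else 0)"
  define \<beta> where "\<beta> = (\<lambda>n. if Z < real n then f n else 0)"
  have "(\<Sum>m | 2 ^ i \<le> m \<and> m < 2 ^ Suc i \<and> m \<in> cut_set V. \<Sum>n | n \<in> nats_upto (X / real m) \<and> separated m n \<and> Z < real n. f m * f n * K m n)
    = (\<Sum>m | 2 ^ i \<le> m \<and> m < 2 ^ Suc i \<and> m \<in> cut_set V. \<Sum>n\<in>{1..N}. \<alpha> m * \<beta> n * K2 m n)"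
  proof (rule sum.cong[OF refl])
    fix m assume "m \<in> {m. 2 ^ i \<le> m \<and> m < 2 ^ Suc i \<and> m \<in> cut_set V}"
    then have m: "2 ^ i \<le> m" "m < 2 ^ Suc i" "m \<in> cut_set V" by auto
    have m1: "m > 1" using m(3) V by (auto simp: cut_set_def)
    have "(2::real) ^ i \<le> real m" using m(1) by (metis of_nat_le_iff of_nat_numeral of_nat_power)
    then have "X / real m \<le> X / 2 ^ i" using X m1 by (intro divide_left_mono) auto
    then have sub: "{n. n \<in> nats_upto (X / real m) \<and> separated m n \<and> Z < real n} \<subseteq> {1..N}"
      by (auto simp: nats_upto_def N_def intro!: le_nat_floor)
    have "\<alpha> m * \<beta> n * K2 m n = (if n \<in> nats_upto (X / real m) \<and> separated m n \<and> Z < real n then f m * f n * K m n else 0)"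
      if n: "n \<in> {1..N}" for n
    proof (cases "Z < real n")
      case True
      then have n1: "n > 1" using Z by simp
      have "n \<in> nats_upto (X / real m) \<longleftrightarrow> n < nat \<lfloor>X / real m\<rfloor> + 1"
        using n by (auto simp: nats_upto_eq)
      then show ?thesis using True n1 m separated_iff[OF m1 n1]
        by (simp add: \<alpha>_def \<beta>_def K2_def K1_def)
    qed (simp add: \<beta>_def)
    then have "(\<Sum>n\<in>{1..N}. \<alpha> m * \<beta> n * K2 m n) = (\<Sum>n\<in>{1..N}. if n \<in> nats_upto (X / real m) \<and> separated m n \<and> Z < real n then f m * f n * K m n else 0)"
      by (intro sum.cong refl)
    also have "\<dots> = (\<Sum>n | n \<in> {1..N} \<and> (n \<in> nats_upto (X / real m) \<and> separated m n \<and> Z < real n). f m * f n * K m n)"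
      by (rule sum.inter_filter[symmetric]) simp
    also have "{n. n \<in> {1..N} \<and> (n \<in> nats_upto (X / real m) \<and> separated m n \<and> Z < real n)} = {n. n \<in> nats_upto (X / real m) \<and> separated m n \<and> Z < real n}"
      using sub by blast
    finally show "(\<Sum>n | n \<in> nats_upto (X / real m) \<and> separated m n \<and> Z < real n. f m * f n * K m n) = (\<Sum>n\<in>{1..N}. \<alpha> m * \<beta> n * K2 m n)" by simp
  qed
  also have "\<dots> = bilinear_form M N K2 \<alpha> \<beta>"
    unfolding bilinear_form_def by (rule sum.mono_neutral_left) (auto simp: M_def \<alpha>_def intro: order_trans[of 1 "2 ^ i"])
  finally have eq: "(\<Sum>m | 2 ^ i \<le> m \<and> m < 2 ^ Suc i \<and> m \<in> cut_set V. \<Sum>n | n \<in> nats_upto (X / real m) \<and> separated m n \<and> Z < real n. f m * f n * K m n) = \<dots>" .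
  have l2a: "l2 M \<alpha> \<le> sqrt (2 ^ i)"
  proof -
    have "l2 M \<alpha> \<le> sqrt (real (card {2 ^ i..<(2::nat) ^ Suc i}))"
      by (rule l2_le_sqrt_card) (use class_C_bound[OF f] in \<open>auto simp: \<alpha>_def\<close>)
    then show ?thesis by simp
  qed
  have l2b: "l2 N \<beta> \<le> sqrt (X / 2 ^ i)"
  proof -
    have "l2 N \<beta> \<le> sqrt (real (card {1..N}))"
      by (rule l2_le_sqrt_card) (use class_C_bound[OF f] in \<open>auto simp: \<beta>_def\<close>)
    also have "\<dots> \<le> sqrt (X / 2 ^ i)" using NX by simp
    finally show ?thesis .
  qed
  have Dle: "D \<le> 8 * (2 * sqrt X / real R0 + (2 * sqrt 2 ^ i + sqrt X / sqrt 2 ^ i) * (1 + (\<Sum>k\<in>{1..R}. 1 / real k)) + 2 * real R)"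
  proof -
    have sM: "sqrt (real M) \<le> 2 * sqrt 2 ^ i"
    proof -
      have "sqrt 2 \<le> (2::real)" by (rule real_le_lsqrt) auto
      then show ?thesis by (simp add: M_def real_sqrt_mult real_sqrt_power mult_right_mono)
    qed
    have sN: "sqrt (real N) \<le> sqrt X / sqrt 2 ^ i"
    proof -
      have "sqrt (real N) \<le> sqrt (X / 2 ^ i)" using NX by simp
      then show ?thesis by (simp add: real_sqrt_divide real_sqrt_power)
    qed
    have "sqrt (real M) * sqrt (real N) \<le> (2 * sqrt 2 ^ i) * (sqrt X / sqrt 2 ^ i)"
      by (intro mult_mono sM sN) (use X in auto)
    also have "\<dots> = 2 * sqrt X" by simp
    finally have sMN: "sqrt (real M) * sqrt (real N) \<le> 2 * sqrt X" .
    have "0 \<le> 1 + (\<Sum>k\<in>{1..R}. 1 / real k)" by (intro add_nonneg_nonneg sum_nonneg) auto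
    then show ?thesis unfolding D_def bilinear_bound_def
      by (intro mult_left_mono add_mono mult_right_mono divide_right_mono sM sN sMN) auto
  qed
  have "cmod (bilinear_form M N K2 \<alpha> \<beta>) \<le> ((real J + 2) * ((real J + 1) * D)) * (l2 M \<alpha> * l2 N \<beta>)"
    using b2 by (simp add: kernel_bound_def)
  also have "\<dots> \<le> ((real J + 2) * ((real J + 2) * D)) * (sqrt (2 ^ i) * sqrt (X / 2 ^ i))"
    using D0 X by (intro mult_mono l2a l2b mult_left_mono mult_right_mono) auto
  also have "sqrt (2 ^ i) * sqrt (X / 2 ^ i) = sqrt X" by (simp add: real_sqrt_mult[symmetric])
  also have "((real J + 2) * ((real J + 2) * D)) * sqrt X = (real J + 2)\<^sup>2 * D * sqrt X" by (simp add: power2_eq_square)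
  also have "\<dots> \<le> (real J + 2)\<^sup>2 * (8 * (2 * sqrt X / real R0 + (2 * sqrt 2 ^ i + sqrt X / sqrt 2 ^ i) * (1 + (\<Sum>k\<in>{1..R}. 1 / real k)) + 2 * real R)) * sqrt X"
    using X by (intro mult_right_mono mult_left_mono Dle) auto
  finally show ?thesis using eq by (simp only: K_def)
qed

text \<open>Both cuts are needed for the dyadic sum: k > V leaves only blocks with 2^(i+1) > V, and
  a long second factor n > Z leaves only those with 2^i < X / Z. The two geometric sums are
  therefore dominated by sqrt (X / Z) and sqrt (X / V), without a further factor
  \<open>J\<close>.\<close>

lemma type2_part_bound:
  assumes f: "f \<in> class_C" and R0: "R0 > 0" and a: "\<And>r. coprime (a r) (int r)"
    and V: "V \<ge> 1" and Z: "Z \<ge> 1" and X: "X \<ge> 1" and J: "X < 2 ^ J"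
  shows "(\<Sum>r\<in>{R0<..R}. cmod (prim_part (type2_part V Z f) X (r * k) r (a r)) / real (totient r))
    \<le> 16 * (real J + 2)\<^sup>2 * sqrt X * (real J * (sqrt X / real R0 + real R)
       + 4 * (1 + (\<Sum>k\<in>{1..R}. 1 / real k)) * (sqrt (X / Z) + sqrt (X / V)))"
proof -
  define P where "P = (\<lambda>r. prim_part (type2_part V Z f) X (r * k) r (a r))"
  define \<epsilon> where "\<epsilon> = (\<lambda>r. cnj (sgn (P r)))"
  have e: "cmod (\<epsilon> r) \<le> 1" for r by (simp add: \<epsilon>_def norm_sgn)
  have eP: "\<epsilon> r * P r = of_real (cmod (P r))" for r
  proof (cases "P r = 0")
    case False
    then show ?thesis
      by (simp add: \<epsilon>_def sgn_eq) (metis complex_norm_square mult.commute nonzero_mult_div_cancel_left norm_eq_zero of_real_eq_0_iff of_real_power power2_eq_square times_divide_eq_left)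
  qed (simp add: \<epsilon>_def)
  define H where "H = 1 + (\<Sum>k\<in>{1..R}. 1 / real k)"
  have H0: "H \<ge> 0" by (simp add: H_def sum_nonneg)
  define K where "K = moduli_kernel R0 R k a \<epsilon>"
  define g where "g = (\<lambda>m. \<Sum>n | n \<in> nats_upto (X / real m) \<and> separated m n \<and> Z < real n. f m * f n * K m n)"
  have Pr: "P r = (\<Sum>m\<in>nats_upto X. \<Sum>n | n \<in> nats_upto (X / real m) \<and> (m \<in> cut_set V \<and> separated m n \<and> Z < real n) \<and> coprime (m * n) (r * k).
      f m * f n * of_real (prim_kernel r (int (m * n)) (a r)))" for r
  proof -
    have "P r = (\<Sum>n | n \<in> nats_upto X \<and> coprime n (r * k). \<Sum>m | m dvd n \<and> (m \<in> cut_set V \<and> separated m (n div m) \<and> Z < real (n div m)).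
       f m * f (n div m) * of_real (prim_kernel r (int (m * (n div m))) (a r)))"
      unfolding P_def prim_part_def type2_part_def sum_distrib_right
      by (intro sum.cong refl) auto
    also have "\<dots> = (\<Sum>m\<in>nats_upto X. \<Sum>n | n \<in> nats_upto (X / real m) \<and> (m \<in> cut_set V \<and> separated m n \<and> Z < real n) \<and> coprime (m * n) (r * k).
      f m * f n * of_real (prim_kernel r (int (m * n)) (a r)))"
      by (rule sum_hyperbola[where C = "\<lambda>m n. m \<in> cut_set V \<and> separated m n \<and> Z < real n"
            and F = "\<lambda>m n. f m * f n * of_real (prim_kernel r (int (m * n)) (a r))"])
    finally show ?thesis .
  qed
  have "complex_of_real (\<Sum>r\<in>{R0<..R}. cmod (P r) / real (totient r)) = (\<Sum>r\<in>{R0<..R}. \<epsilon> r * P r / of_nat (totient r))"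
    by (simp add: eP)
  also have "\<dots> = (\<Sum>r\<in>{R0<..R}. \<Sum>m\<in>nats_upto X. if m \<in> cut_set V then \<Sum>n | n \<in> nats_upto (X / real m) \<and> separated m n \<and> Z < real n.
       f m * f n * (if coprime (m * n) (r * k) then \<epsilon> r * of_real (prim_kernel r (int (m * n)) (a r)) / of_nat (totient r) else 0) else 0)"
  proof (intro sum.cong refl)
    fix r
    have "\<epsilon> r * P r / of_nat (totient r) = (\<Sum>m\<in>nats_upto X. \<Sum>n | n \<in> nats_upto (X / real m) \<and> (m \<in> cut_set V \<and> separated m n \<and> Z < real n) \<and> coprime (m * n) (r * k).
      f m * f n * (\<epsilon> r * of_real (prim_kernel r (int (m * n)) (a r)) / of_nat (totient r)))"
      unfolding Pr by (simp add: sum_distrib_left sum_divide_distrib mult_ac)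
    also have "\<dots> = (\<Sum>m\<in>nats_upto X. if m \<in> cut_set V then \<Sum>n | n \<in> nats_upto (X / real m) \<and> separated m n \<and> Z < real n.
       f m * f n * (if coprime (m * n) (r * k) then \<epsilon> r * of_real (prim_kernel r (int (m * n)) (a r)) / of_nat (totient r) else 0) else 0)"
    proof (intro sum.cong refl)
      fix m
      define S where "S = {n. n \<in> nats_upto (X / real m) \<and> separated m n \<and> Z < real n}"
      have fS: "finite S" by (rule finite_subset[of _ "nats_upto (X / real m)"]) (auto simp: S_def)
      define G where "G = (\<lambda>n. f m * f n * (\<epsilon> r * of_real (prim_kernel r (int (m * n)) (a r)) / of_nat (totient r)))"
      have "(\<Sum>n\<in>S. f m * f n * (if coprime (m * n) (r * k) then \<epsilon> r * of_real (prim_kernel r (int (m * n)) (a r)) / of_nat (totient r) else 0))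
        = (\<Sum>n\<in>S. if coprime (m * n) (r * k) then G n else 0)" by (intro sum.cong refl) (simp add: G_def)
      also have "\<dots> = (\<Sum>n | n \<in> S \<and> coprime (m * n) (r * k). G n)" by (rule sum.inter_filter[symmetric, OF fS])
      finally show "(\<Sum>n | n \<in> nats_upto (X / real m) \<and> (m \<in> cut_set V \<and> separated m n \<and> Z < real n) \<and> coprime (m * n) (r * k).
          f m * f n * (\<epsilon> r * of_real (prim_kernel r (int (m * n)) (a r)) / of_nat (totient r)))
        = (if m \<in> cut_set V then \<Sum>n | n \<in> nats_upto (X / real m) \<and> separated m n \<and> Z < real n.
          f m * f n * (if coprime (m * n) (r * k) then \<epsilon> r * of_real (prim_kernel r (int (m * n)) (a r)) / of_nat (totient r) else 0) else 0)"
        by (simp only: S_def[symmetric] G_def[symmetric]) (simp add: S_def conj_assoc)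
    qed
    finally show "\<epsilon> r * P r / of_nat (totient r) = (\<Sum>m\<in>nats_upto X. if m \<in> cut_set V then \<Sum>n | n \<in> nats_upto (X / real m) \<and> separated m n \<and> Z < real n.
       f m * f n * (if coprime (m * n) (r * k) then \<epsilon> r * of_real (prim_kernel r (int (m * n)) (a r)) / of_nat (totient r) else 0) else 0)" .
  qed
  also have "\<dots> = (\<Sum>m\<in>nats_upto X. if m \<in> cut_set V then g m else 0)"
  proof (subst sum.swap, intro sum.cong refl)
    fix m
    show "(\<Sum>r\<in>{R0<..R}. if m \<in> cut_set V then \<Sum>n | n \<in> nats_upto (X / real m) \<and> separated m n \<and> Z < real n.
       f m * f n * (if coprime (m * n) (r * k) then \<epsilon> r * of_real (prim_kernel r (int (m * n)) (a r)) / of_nat (totient r) else 0) else 0)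
       = (if m \<in> cut_set V then g m else 0)"
      by (auto simp: g_def K_def moduli_kernel_def sum_distrib_left intro: sum.swap)
  qed
  also have "\<dots> = (\<Sum>m | m \<in> nats_upto X \<and> m \<in> cut_set V. g m)" by (rule sum.inter_filter[symmetric]) simp
  also have "\<dots> = (\<Sum>m\<in>(\<Union>i<J. {m. 2 ^ i \<le> m \<and> m < 2 ^ Suc i \<and> m \<in> cut_set V}). g m)"
  proof (rule sum.mono_neutral_left)
    show "finite (\<Union>i<J. {m. 2 ^ i \<le> m \<and> m < (2::nat) ^ Suc i \<and> m \<in> cut_set V})"
      by (intro finite_UN_I) (auto intro: finite_subset[of _ "{..<2 ^ Suc i}" for i])
    show "{m. m \<in> nats_upto X \<and> m \<in> cut_set V} \<subseteq> (\<Union>i<J. {m. 2 ^ i \<le> m \<and> m < 2 ^ Suc i \<and> m \<in> cut_set V})"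
    proof
      fix m assume "m \<in> {m. m \<in> nats_upto X \<and> m \<in> cut_set V}"
      then have m: "1 \<le> m" "real m \<le> X" "m \<in> cut_set V" by (auto simp: nats_upto_def)
      obtain i where i: "2 ^ i \<le> m" "m < 2 ^ Suc i" using ex_power_ivl1[of 2 m] m(1) by auto
      have "(2::real) ^ i \<le> real m" using i(1) by (metis of_nat_le_iff of_nat_numeral of_nat_power)
      then have "(2::real) ^ i < 2 ^ J" using m J by linarith
      then have "i < J" by simp
      then show "m \<in> (\<Union>i<J. {m. 2 ^ i \<le> m \<and> m < 2 ^ Suc i \<and> m \<in> cut_set V})" using i m by blast
    qed
    show "\<forall>m\<in>(\<Union>i<J. {m. 2 ^ i \<le> m \<and> m < 2 ^ Suc i \<and> m \<in> cut_set V}) - {m. m \<in> nats_upto X \<and> m \<in> cut_set V}. g m = 0"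
    proof
      fix m assume "m \<in> (\<Union>i<J. {m. 2 ^ i \<le> m \<and> m < (2::nat) ^ Suc i \<and> m \<in> cut_set V}) - {m. m \<in> nats_upto X \<and> m \<in> cut_set V}"
      then obtain i where m: "2 ^ i \<le> m" "m \<notin> nats_upto X" by auto
      then have "m \<ge> 1" by (metis le_trans one_le_numeral one_le_power)
      then have "X < real m" using m by (auto simp: nats_upto_def)
      then have "X / real m < 1" using X by (simp add: divide_less_eq)
      then have "nats_upto (X / real m) = {}" by (auto simp: nats_upto_def)
      then show "g m = 0" by (simp add: g_def)
    qed
  qed
  also have "\<dots> = (\<Sum>i<J. \<Sum>m | 2 ^ i \<le> m \<and> m < 2 ^ Suc i \<and> m \<in> cut_set V. g m)"
  proof (rule sum.UNION_disjoint)
    show "\<forall>i\<in>{..<J}. \<forall>j\<in>{..<J}. i \<noteq> j \<longrightarrow> {m. 2 ^ i \<le> m \<and> m < (2::nat) ^ Suc i \<and> m \<in> cut_set V} \<inter> {m. 2 ^ j \<le> m \<and> m < 2 ^ Suc j \<and> m \<in> cut_set V} = {}"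
    proof (intro ballI impI)
      fix i j :: nat assume "i \<noteq> j"
      then have "Suc i \<le> j \<or> Suc j \<le> i" by linarith
      then have "(2::nat) ^ Suc i \<le> 2 ^ j \<or> (2::nat) ^ Suc j \<le> 2 ^ i" by (metis one_le_numeral power_increasing)
      then have "\<not> (2 ^ i \<le> m \<and> m < (2::nat) ^ Suc i \<and> 2 ^ j \<le> m \<and> m < 2 ^ Suc j)" for m by linarith
      then show "{m. 2 ^ i \<le> m \<and> m < (2::nat) ^ Suc i \<and> m \<in> cut_set V} \<inter> {m. 2 ^ j \<le> m \<and> m < 2 ^ Suc j \<and> m \<in> cut_set V} = {}"
        by blast
    qed
  qed (auto intro: finite_subset[of _ "{..<2 ^ Suc i}" for i])
  also have "\<dots> = (\<Sum>i | i < J \<and> V < 2 ^ Suc i \<and> 2 ^ i < X / Z. \<Sum>m | 2 ^ i \<le> m \<and> m < 2 ^ Suc i \<and> m \<in> cut_set V. g m)"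
  proof (rule sum.mono_neutral_right)
    show "\<forall>i\<in>{..<J} - {i. i < J \<and> V < 2 ^ Suc i \<and> 2 ^ i < X / Z}. (\<Sum>m | 2 ^ i \<le> m \<and> m < 2 ^ Suc i \<and> m \<in> cut_set V. g m) = 0"
    proof (intro ballI sum.neutral)
      fix i m assume i: "i \<in> {..<J} - {i. i < J \<and> V < 2 ^ Suc i \<and> 2 ^ i < X / Z}" and "m \<in> {m. 2 ^ i \<le> m \<and> m < 2 ^ Suc i \<and> m \<in> cut_set V}"
      then have m: "2 ^ i \<le> m" "m < 2 ^ Suc i" "m \<in> cut_set V" by auto
      have "real m < 2 ^ Suc i" using m(2) by (metis of_nat_less_iff of_nat_numeral of_nat_power)
      moreover have "V < real m" using m(3) by (simp add: cut_set_def)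
      ultimately have "V < 2 ^ Suc i" by linarith
      then have "\<not> 2 ^ i < X / Z" using i by auto
      moreover have "(2::real) ^ i \<le> real m" using m(1) by (metis of_nat_le_iff of_nat_numeral of_nat_power)
      ultimately have "X / Z \<le> real m" by linarith
      then have "X / real m \<le> Z" using Z V \<open>V < real m\<close> by (simp add: field_simps)
      then have "{n. n \<in> nats_upto (X / real m) \<and> separated m n \<and> Z < real n} = {}" by (auto simp: nats_upto_def)
      then show "g m = 0" by (simp only: g_def sum.empty)
    qed
  qed auto
  finally have eq: "complex_of_real (\<Sum>r\<in>{R0<..R}. cmod (P r) / real (totient r)) = \<dots>" .
  define I where "I = {i. i < J \<and> V < 2 ^ Suc i \<and> 2 ^ i < X / Z}"
  have fI: "finite I" "card I \<le> J"
    using card_mono[of "{..<J}" I] by (auto simp: I_def intro: finite_subset[of _ "{..<J}"])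
  \<comment> \<open>A rational lower bound for the ratio of the geometric sums; their constant 4 is
    1 / (1 - 3/4).\<close>
  have s2: "4 / 3 \<le> sqrt 2" by (rule real_le_rsqrt) (simp add: power2_eq_square)
  have VX: "0 \<le> sqrt (X / Z)" "0 \<le> sqrt (X / V)" using X V Z by auto
  have S1: "(\<Sum>i\<in>I. sqrt 2 ^ i) \<le> 4 * sqrt (X / Z)"
  proof (rule geometric_sum_bound[OF s2 fI(1) VX(1)])
    fix i assume "i \<in> I"
    then have "sqrt (2 ^ i) \<le> sqrt (X / Z)" by (simp add: I_def)
    then show "sqrt 2 ^ i \<le> sqrt (X / Z)" by (simp add: real_sqrt_power)
  qed
  have S2: "(\<Sum>i\<in>I. 1 / sqrt 2 ^ i) \<le> 4 * (2 / sqrt V)"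
  proof (rule geometric_sum_bound_inverse[OF s2 fI(1)])
    fix i assume "i \<in> I"
    then have "V < 2 * 2 ^ i" by (simp add: I_def)
    moreover have "(0::real) < 2 ^ i" by simp
    ultimately have "V \<le> 4 * 2 ^ i" by linarith
    then have "sqrt V \<le> sqrt (4 * 2 ^ i)" by (rule real_sqrt_le_mono)
    then have "sqrt V \<le> 2 * sqrt 2 ^ i" by (simp add: real_sqrt_mult real_sqrt_power)
    then show "1 / sqrt 2 ^ i \<le> 2 / sqrt V" using V by (simp add: field_simps)
  qed (use V in auto)
  have "(\<Sum>r\<in>{R0<..R}. cmod (P r) / real (totient r)) = cmod (complex_of_real (\<Sum>r\<in>{R0<..R}. cmod (P r) / real (totient r)))"
    by (simp only: norm_of_real) (simp add: sum_nonneg)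
  also have "\<dots> \<le> (\<Sum>i\<in>I. cmod (\<Sum>m | 2 ^ i \<le> m \<and> m < 2 ^ Suc i \<and> m \<in> cut_set V. g m))"
    unfolding eq I_def by (rule norm_sum)
  also have "\<dots> \<le> (\<Sum>i\<in>I. (real J + 2)\<^sup>2 * (8 * (2 * sqrt X / real R0 + (2 * sqrt 2 ^ i + sqrt X / sqrt 2 ^ i) * H + 2 * real R)) * sqrt X)"
    unfolding g_def K_def H_def by (intro sum_mono type2_part_block_bound f R0 a e V Z X J)
  also have "\<dots> = 8 * (real J + 2)\<^sup>2 * sqrt X * (\<Sum>i\<in>I. (2 * sqrt X / real R0 + 2 * real R) + H * (2 * sqrt 2 ^ i + sqrt X * (1 / sqrt 2 ^ i)))"
    by (simp add: sum_distrib_left sum_distrib_right algebra_simps)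
  also have "(\<Sum>i\<in>I. (2 * sqrt X / real R0 + 2 * real R) + H * (2 * sqrt 2 ^ i + sqrt X * (1 / sqrt 2 ^ i)))
    = real (card I) * (2 * sqrt X / real R0 + 2 * real R) + H * (2 * (\<Sum>i\<in>I. sqrt 2 ^ i) + sqrt X * (\<Sum>i\<in>I. 1 / sqrt 2 ^ i))"
    by (simp only: sum.distrib sum_distrib_left[symmetric] sum_constant) (simp add: distrib_left)
  also have "8 * (real J + 2)\<^sup>2 * sqrt X * \<dots> \<le> 8 * (real J + 2)\<^sup>2 * sqrt X *
     (real J * (2 * sqrt X / real R0 + 2 * real R) + H * (2 * (4 * sqrt (X / Z)) + sqrt X * (4 * (2 / sqrt V))))"
    using X H0 fI S1 S2 by (intro mult_left_mono add_mono mult_right_mono mult_nonneg_nonneg) auto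
  also have "\<dots> = 16 * (real J + 2)\<^sup>2 * sqrt X * (real J * (sqrt X / real R0 + real R)
       + 4 * H * (sqrt (X / Z) + sqrt (X / V)))"
    by (simp add: real_sqrt_divide algebra_simps)
  finally show ?thesis by (simp add: P_def H_def)
qed

section \<open>Small conductors\<close>

definition norm1 :: "(nat \<Rightarrow> complex) \<Rightarrow> real \<Rightarrow> real" where
  "norm1 h X = (\<Sum>n\<in>nats_upto X. cmod (h n))"

lemma norm1_nonneg [simp]: "norm1 h X \<ge> 0"
  by (simp add: norm1_def sum_nonneg)

lemma norm1_class_C: "f \<in> class_C \<Longrightarrow> X \<ge> 0 \<Longrightarrow> norm1 f X \<le> X"
proof -
  assume f: "f \<in> class_C" and X: "X \<ge> 0"
  have "norm1 f X \<le> (\<Sum>n\<in>nats_upto X. 1)"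
    unfolding norm1_def using class_C_bound[OF f] by (intro sum_mono) (auto simp: nats_upto_def)
  also have "\<dots> \<le> X" using card_upto_le[OF X] by simp
  finally show ?thesis .
qed

lemma sum_filter_le_norm1: "cmod (\<Sum>n | n \<in> nats_upto X \<and> P n. h n) \<le> norm1 h X"
  unfolding norm1_def by (rule order_trans[OF norm_sum]) (intro sum_mono2, auto)

lemma class_part_le_norm1:
  assumes "d \<ge> 1"
  shows "cmod (class_part h X q d a) \<le> 2 * real (totient d) * norm1 h X"
proof -
  have t: "real (totient d) \<ge> 1" using assms by (simp add: Suc_le_eq)
  have 1: "cmod (class_part h X q d a) \<le> real (totient d) * norm1 h X + norm1 h X"
    unfolding class_part_def
    by (rule order_trans[OF norm_triangle_ineq4], intro add_mono)
      (simp_all add: norm_mult mult_left_mono sum_filter_le_norm1)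
  have "norm1 h X \<le> real (totient d) * norm1 h X" using mult_right_mono[OF t, of "norm1 h X"] by simp
  then show ?thesis using 1 by linarith
qed

lemma two_power_omega_le:
  assumes "n > (0::nat)"
  shows "2 ^ card (prime_factors n) \<le> n"
proof -
  have "2 ^ card (prime_factors n) = (\<Prod>p\<in>prime_factors n. 2::nat)" by simp
  also have "\<dots> \<le> \<Prod>(prime_factors n)" by (intro prod_mono) (auto intro: prime_ge_2_nat)
  also have "\<dots> \<le> n" using assms by (intro dvd_imp_le prod_primes_dvd) auto
  finally show ?thesis .
qed

lemma prim_part_le_const:
  assumes r: "r > 1" and B: "\<And>d. d dvd r \<Longrightarrow> cmod (class_part h X q d a) \<le> S"
  shows "cmod (prim_part h X q r a) \<le> 2 ^ card (prime_factors r) * S"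
proof -
  have "cmod (prim_part h X q r a) \<le> (\<Sum>T\<in>Pow (prime_factors r). cmod (class_part h X q (r div \<Prod>T) a))"
    by (rule prim_part_le_class_parts[OF r])
  also have "\<dots> \<le> (\<Sum>T\<in>Pow (prime_factors r). S)"
  proof (rule sum_mono)
    fix T assume T: "T \<in> Pow (prime_factors r)"
    have "\<Prod>T dvd r" using T by (intro prod_primes_dvd) (auto intro: finite_subset)
    then show "cmod (class_part h X q (r div \<Prod>T) a) \<le> S" by (intro B) (metis dvd_div_mult_self dvd_triv_left)
  qed
  also have "\<dots> = 2 ^ card (prime_factors r) * S" by (simp add: card_Pow)
  finally show ?thesis .
qed

lemma prim_part_le_of_class_part:
  assumes r: "r > 1" and B: "\<And>d. d dvd r \<Longrightarrow> cmod (class_part h X q d a) \<le> real (totient d) * S" and S: "S \<ge> 0"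
  shows "cmod (prim_part h X q r a) \<le> 2 ^ card (prime_factors r) * (real (totient r) * S)"
proof (rule prim_part_le_const[OF r])
  fix d assume d: "d dvd r"
  then have "totient d \<le> totient r" using r by (intro totient_dvd_mono) auto
  then have "real (totient d) * S \<le> real (totient r) * S" using S by (intro mult_right_mono) auto
  then show "cmod (class_part h X q d a) \<le> real (totient r) * S" using B[OF d] by linarith
qed

lemma sum_div_upto_le:
  assumes "Y \<ge> 1"
  shows "(\<Sum>u\<in>nats_upto Y. 1 / real u) \<le> 1 + ln Y"
proof -
  have "nat \<lfloor>Y\<rfloor> \<ge> 1" using assms by (simp add: le_nat_iff le_floor_iff)
  then have "(\<Sum>u\<in>nats_upto Y. 1 / real u) \<le> 1 + ln (real (nat \<lfloor>Y\<rfloor>))"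
    unfolding nats_upto_eq by (rule harmonic_upper)
  also have "ln (real (nat \<lfloor>Y\<rfloor>)) \<le> ln Y"
    using assms \<open>nat \<lfloor>Y\<rfloor> \<ge> 1\<close> by (intro ln_mono) auto
  finally show ?thesis by simp
qed

text \<open>The hypothesis on \<open>f\<close> modulo \<open>d\<close> only sees integers coprime to
  \<open>d\<close>; the condition of being coprime to \<open>q\<close> is inserted by
  \<open>class_C_coprime_sieve\<close>. For u <= sqrt x the hypothesis applies at x / u >= sqrt x.
  For larger \<open>u\<close> the trivial bound is summed over integers composed of primes of
  \<open>q\<close>, and Rankin's trick saves x^(1/4).\<close>

lemma class_part_SW_bound:
  assumes f: "f \<in> class_C" and x: "x \<ge> 1" and d: "d dvd q" "q \<ge> 1" and a: "coprime a (int d)" and \<delta>: "\<delta> \<ge> 0"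
    and SW: "\<And>X q a. sqrt x \<le> X \<Longrightarrow> X \<le> x \<Longrightarrow> q \<ge> 1 \<Longrightarrow> coprime a (int q) \<Longrightarrow> cmod (Delta f X q a) \<le> X * \<delta>"
  shows "cmod (class_part f x q d a) \<le> real (totient d) * (\<delta> * x * (1 + ln x) + 2 * x * 4 ^ card (prime_factors q) / sqrt (sqrt x))"
proof -
  define h where "h = (\<lambda>n. if coprime n q then f n else 0)"
  have d1: "d \<ge> 1" using d dvd_imp_ge_1 by simp
  have hq: "(\<Sum>n | n \<in> nats_upto x \<and> coprime n d \<and> P n. h n) = (\<Sum>n | n \<in> nats_upto x \<and> coprime n q \<and> P n. f n)" for P
  proof (rule sum.mono_neutral_cong_right)
    show "finite {n. n \<in> nats_upto x \<and> coprime n d \<and> P n}" by (rule finite_subset[of _ "nats_upto x"]) auto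
    show "{n. n \<in> nats_upto x \<and> coprime n q \<and> P n} \<subseteq> {n. n \<in> nats_upto x \<and> coprime n d \<and> P n}"
      using d(1) by (auto intro: coprime_divisors[OF dvd_refl d(1)])
  qed (auto simp: h_def)
  have "class_part f x q d a = class_part h x d d a"
    unfolding class_part_def using hq[of "\<lambda>n. [int n = a] (mod int d)"] hq[of "\<lambda>_. True"] by simp
  also have "\<dots> = (\<Sum>u | u \<in> nats_upto x \<and> prime_factors u \<subseteq> prime_factors q \<and> coprime u d.
      dirichlet_inv f u * class_part f (x / real u) d d (a * inv_mod d u))"
  proof (rule class_part_convolution)
    fix n :: nat assume "n \<ge> 1"
    then show "h n = (\<Sum>u | u dvd n \<and> prime_factors u \<subseteq> prime_factors q. dirichlet_inv f u * f (n div u))"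
      unfolding h_def using d by (intro class_C_coprime_sieve f)
  qed (use d1 in auto)
  finally have "cmod (class_part f x q d a) \<le> (\<Sum>u | u \<in> nats_upto x \<and> prime_factors u \<subseteq> prime_factors q \<and> coprime u d.
      cmod (class_part f (x / real u) d d (a * inv_mod d u)))"
  proof (simp only:, intro order_trans[OF norm_sum] sum_mono)
    fix u assume "u \<in> {u. u \<in> nats_upto x \<and> prime_factors u \<subseteq> prime_factors q \<and> coprime u d}"
    then have "cmod (dirichlet_inv f u) \<le> 1" using dirichlet_inv_bound[OF f] by (simp add: nats_upto_def)
    then show "cmod (dirichlet_inv f u * class_part f (x / real u) d d (a * inv_mod d u))
      \<le> cmod (class_part f (x / real u) d d (a * inv_mod d u))"
      by (simp add: norm_mult mult_left_le_one_le)
  qed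
  also have "\<dots> \<le> (\<Sum>u | u \<in> nats_upto x \<and> prime_factors u \<subseteq> prime_factors q \<and> coprime u d.
      real (totient d) * (x / real u * \<delta> + (if sqrt x < real u then 2 * (x / real u) else 0)))"
  proof (rule sum_mono)
    fix u assume "u \<in> {u. u \<in> nats_upto x \<and> prime_factors u \<subseteq> prime_factors q \<and> coprime u d}"
    then have u: "1 \<le> u" "real u \<le> x" "coprime u d" by (auto simp: nats_upto_def)
    have v: "coprime (a * inv_mod d u) (int d)" using inv_mod[of d u] u d1 a by simp
    have X1: "x / real u \<ge> 1" using u by (simp add: le_divide_eq)
    show "cmod (class_part f (x / real u) d d (a * inv_mod d u))
      \<le> real (totient d) * (x / real u * \<delta> + (if sqrt x < real u then 2 * (x / real u) else 0))"
    proof (cases "sqrt x < real u")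
      case True
      have "cmod (class_part f (x / real u) d d (a * inv_mod d u)) \<le> 2 * real (totient d) * norm1 f (x / real u)"
        by (rule class_part_le_norm1[OF d1])
      also have "\<dots> \<le> 2 * real (totient d) * (x / real u)"
        using X1 by (intro mult_left_mono norm1_class_C f) auto
      also have "\<dots> \<le> real (totient d) * (x / real u * \<delta> + 2 * (x / real u))"
      proof -
        have "0 \<le> x / real u * \<delta>" using X1 \<delta> by (intro mult_nonneg_nonneg) linarith+
        then have "real (totient d) * (2 * (x / real u)) \<le> real (totient d) * (x / real u * \<delta> + 2 * (x / real u))"
          by (intro mult_left_mono) auto
        then show ?thesis by (simp add: mult_ac)
      qed
      finally show ?thesis using True by simp
    next
      case False
      have "sqrt x * real u \<le> sqrt x * sqrt x" using False x by (intro mult_left_mono) auto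
      then have "sqrt x \<le> x / real u" using x u by (simp add: pos_le_divide_eq)
      moreover have "x / real u \<le> x" using x u by (simp add: divide_le_eq mult_le_cancel_left1)
      ultimately have "cmod (Delta f (x / real u) d (a * inv_mod d u)) \<le> x / real u * \<delta>"
        using d1 v by (intro SW) auto
      then show ?thesis using False
        unfolding Delta_class_part[OF d1 v, symmetric] norm_mult norm_of_nat
        by (intro mult_left_mono) auto
    qed
  qed
  also have "\<dots> \<le> (\<Sum>u | u \<in> nats_upto x \<and> prime_factors u \<subseteq> prime_factors q.
      real (totient d) * (x / real u * \<delta> + (if sqrt x < real u then 2 * (x / real u) else 0)))"
    using x \<delta> by (intro sum_mono2) auto
  also have "\<dots> = real (totient d) * (\<delta> * x * (\<Sum>u | u \<in> nats_upto x \<and> prime_factors u \<subseteq> prime_factors q. 1 / real u)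
     + 2 * x * (\<Sum>u | u \<in> nats_upto x \<and> prime_factors u \<subseteq> prime_factors q. if sqrt x < real u then 1 / real u else 0))"
  proof -
    have "real (totient d) * (x / real u * \<delta> + (if sqrt x < real u then 2 * (x / real u) else 0))
      = real (totient d) * (\<delta> * x * (1 / real u) + 2 * x * (if sqrt x < real u then 1 / real u else 0))" for u
      by simp
    then show ?thesis by (simp only: sum.distrib sum_distrib_left[symmetric])
  qed
  also have "\<dots> \<le> real (totient d) * (\<delta> * x * (1 + ln x) + 2 * x * (4 ^ card (prime_factors q) / sqrt (sqrt x)))"
  proof (intro mult_left_mono add_mono)
    have "(\<Sum>u | u \<in> nats_upto x \<and> prime_factors u \<subseteq> prime_factors q. 1 / real u) \<le> (\<Sum>u\<in>nats_upto x. 1 / real u)"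
      by (intro sum_mono2) auto
    also have "\<dots> \<le> 1 + ln x" by (rule sum_div_upto_le[OF x])
    finally show "(\<Sum>u | u \<in> nats_upto x \<and> prime_factors u \<subseteq> prime_factors q. 1 / real u) \<le> 1 + ln x" .
    have "(\<Sum>u | u \<in> nats_upto x \<and> prime_factors u \<subseteq> prime_factors q. if sqrt x < real u then 1 / real u else 0)
      = (\<Sum>u | u \<in> {u. u \<in> nats_upto x \<and> prime_factors u \<subseteq> prime_factors q} \<and> sqrt x < real u. 1 / real u)"
      by (rule sum.inter_filter[symmetric]) simp
    also have "\<dots> = (\<Sum>u | u \<in> {1..nat \<lfloor>x\<rfloor>} \<and> prime_factors u \<subseteq> prime_factors q \<and> sqrt x < real u. 1 / real u)"
      by (simp add: nats_upto_eq conj_assoc)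
    also have "\<dots> \<le> 4 ^ card (prime_factors q) / sqrt (sqrt x)"
      using d x by (intro smooth_tail_le) auto
    finally show "(\<Sum>u | u \<in> nats_upto x \<and> prime_factors u \<subseteq> prime_factors q. if sqrt x < real u then 1 / real u else 0)
      \<le> 4 ^ card (prime_factors q) / sqrt (sqrt x)" .
  qed (use x \<delta> in auto)
  finally show ?thesis by simp
qed

section \<open>The remainder, in residue classes and in mean\<close>

lemma sum_inverse_squares_tail:
  assumes "W \<ge> 1"
  shows "(\<Sum>t | t \<in> {1..n::nat} \<and> W < real t. 1 / (real t)\<^sup>2) \<le> 2 / W"
proof -
  define m where "m = nat \<lfloor>W\<rfloor> + 1"
  have m: "m \<ge> 2" "W \<le> real m" "real m \<le> W + 1" using assms unfolding m_def by linarith+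
  have sub: "{t. t \<in> {1..n} \<and> W < real t} \<subseteq> {m..max m n}"
  proof
    fix t assume "t \<in> {t. t \<in> {1..n} \<and> W < real t}"
    then have "t \<le> n" "W < real t" by auto
    moreover from this have "m \<le> t" using assms unfolding m_def by linarith
    ultimately show "t \<in> {m..max m n}" by simp
  qed
  have "(\<Sum>t | t \<in> {1..n} \<and> W < real t. 1 / (real t)\<^sup>2) \<le> (\<Sum>t\<in>{m..max m n}. 1 / (real t)\<^sup>2)"
    using sub by (intro sum_mono2) auto
  also have "\<dots> \<le> 1 / (real m - 1) - 1 / real (max m n)"
  proof -
    have "(\<Sum>t\<in>{m..k}. 1 / (real t)\<^sup>2) \<le> 1 / (real m - 1) - 1 / real k" if "k \<ge> m" for k
      using that
    proof (induction k rule: dec_induct)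
      case base
      have "real m * (real m - 1) \<le> (real m)\<^sup>2" by (simp add: power2_eq_square algebra_simps)
      then have "1 / (real m)\<^sup>2 \<le> 1 / (real m * (real m - 1))" using m by (intro divide_left_mono) auto
      also have "\<dots> = 1 / (real m - 1) - 1 / real m" using m by (simp add: field_simps)
      finally show ?case by simp
    next
      case (step k)
      have k: "real k > 0" using step m by simp
      have "1 / (real (Suc k))\<^sup>2 \<le> 1 / (real k * real (Suc k))"
        using k by (intro divide_left_mono) (auto simp: power2_eq_square)
      also have "\<dots> = 1 / real k - 1 / real (Suc k)" using k by (simp add: field_simps)
      finally show ?case using step by simp
    qed
    then show ?thesis by simp
  qed
  also have "\<dots> \<le> 1 / (real m - 1)" by simp
  also have "\<dots> \<le> 2 / W"
  proof -
    have "real m \<ge> 2" using m(1) by simp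
    then have "W \<le> 2 * (real m - 1)" using m(2) by (simp add: algebra_simps)
    then show ?thesis using m assms by (simp add: field_simps)
  qed
  finally show ?thesis .
qed

text \<open>Members of a reduced class are coprime to \<open>q\<close>, so if any is divisible by
  \<open>s\<close> then \<open>s\<close> is coprime to \<open>q\<close> and any two members differ
  by a multiple of \<open>s * q\<close>.\<close>

lemma card_class_multiples_le:
  assumes X: "X \<ge> 0" and q: "q \<ge> 1" and s: "s \<ge> 1" and a: "coprime a (int q)"
  shows "real (card {n. n \<in> nats_upto X \<and> [int n = a] (mod int q) \<and> s dvd n}) \<le> X / (real s * real q) + 1"
proof -
  let ?S = "{n. n \<in> nats_upto X \<and> [int n = a] (mod int q) \<and> s dvd n}"
  have dv: "s * q dvd n - m" if "m \<in> ?S" "n \<in> ?S" "m \<le> n" for m n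
  proof -
    have "[int n = int m] (mod int q)" using that by (metis (mono_tags, lifting) mem_Collect_eq cong_sym cong_trans)
    then have "int q dvd int n - int m" by (simp add: cong_iff_dvd_diff)
    then have "q dvd n - m" using that by (metis int_dvd_int_iff of_nat_diff)
    moreover have "s dvd n - m" using that by (simp add: dvd_diff_nat)
    moreover have "coprime s q"
    proof -
      have "coprime m q" using coprime_of_cong[of m a q] that a by simp
      then show ?thesis using that by (metis (mono_tags, lifting) mem_Collect_eq coprime_divisors dvd_refl)
    qed
    ultimately show ?thesis by (simp add: divides_mult)
  qed
  have inj: "inj_on (\<lambda>n. n div (s * q)) ?S"
  proof (rule inj_onI)
    fix m n assume mn: "m \<in> ?S" "n \<in> ?S" "m div (s * q) = n div (s * q)"
    have aux: "m = n" if "m \<le> n" "s * q dvd n - m" "m div (s * q) = n div (s * q)" for m n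
    proof -
      have "m mod (s * q) = n mod (s * q)" using that mod_eq_dvd_iff_nat by metis
      then show ?thesis using that(3) by (metis div_mult_mod_eq)
    qed
    show "m = n" using aux[of m n] aux[of n m] dv[of m n] dv[of n m] mn by (metis nat_le_linear)
  qed
  have sub: "(\<lambda>n. n div (s * q)) ` ?S \<subseteq> {0..nat \<lfloor>X / (real s * real q)\<rfloor>}"
  proof
    fix y assume "y \<in> (\<lambda>n. n div (s * q)) ` ?S"
    then obtain n where n: "real n \<le> X" "y = n div (s * q)" by (auto simp: nats_upto_def)
    have "y * (s * q) \<le> n" unfolding n(2) by (rule div_times_less_eq_dividend)
    then have "real (y * (s * q)) \<le> real n" by (simp only: of_nat_le_iff)
    then have "real y \<le> real n / real (s * q)" using s q by (simp add: pos_le_divide_eq)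
    also have "\<dots> \<le> X / (real s * real q)" using n s q by (simp add: divide_right_mono)
    finally show "y \<in> {0..nat \<lfloor>X / (real s * real q)\<rfloor>}" by (simp add: le_nat_floor)
  qed
  have "card ?S = card ((\<lambda>n. n div (s * q)) ` ?S)" using inj by (simp add: card_image)
  also have "\<dots> \<le> card {0..nat \<lfloor>X / (real s * real q)\<rfloor>}" by (intro card_mono sub) auto
  also have "\<dots> = nat \<lfloor>X / (real s * real q)\<rfloor> + 1" by simp
  finally have "real (card ?S) \<le> real (nat \<lfloor>X / (real s * real q)\<rfloor>) + 1" by linarith
  also have "real (nat \<lfloor>X / (real s * real q)\<rfloor>) \<le> X / (real s * real q)" using X by simp
  finally show ?thesis by simp
qed

text \<open>Supported where \<open>rest_part_eq_0\<close> does not apply: short integers and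
  integers divisible by the square of some t > W. Summing over \<open>t\<close> overcounts, but
  makes the majorant additive and hence easy to sum in classes.\<close>

definition rest_majorant :: "real \<Rightarrow> real \<Rightarrow> real \<Rightarrow> real \<Rightarrow> nat \<Rightarrow> real" where
  "rest_majorant V Z W X n = (2 + V) * (if real n \<le> V * Z\<^sup>2 then 1 else 0)
     + 3 * (\<Sum>t | t \<in> nats_upto (sqrt X) \<and> W < real t. if t\<^sup>2 dvd n then 1 else 0)"

lemma rest_part_le_majorant:
  assumes f: "f \<in> class_C" and V: "V \<ge> 1" and Z: "W ^ 3 \<le> Z" "V \<le> Z" and W: "W \<ge> 1" and n: "n \<in> nats_upto X"
  shows "cmod (rest_part V Z f n) \<le> rest_majorant V Z W X n"
proof -
  have n1: "n \<ge> 1" "real n \<le> X" using n by (auto simp: nats_upto_def)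
  let ?S = "\<Sum>t | t \<in> nats_upto (sqrt X) \<and> W < real t. if t\<^sup>2 dvd n then 1 else (0::real)"
  have S0: "?S \<ge> 0" by (intro sum_nonneg) auto
  show ?thesis
  proof (cases "real n \<le> V * Z\<^sup>2")
    case True
    have "cmod (rest_part V Z f n) \<le> 2 + V" by (rule rest_part_bound(1)[OF f V n1(1)])
    then show ?thesis using True S0 by (simp add: rest_majorant_def)
  next
    case False
    have Z1: "Z \<ge> 1" using Z V by simp
    have "V * V \<le> V * Z\<^sup>2"
    proof (intro mult_left_mono)
      have "V * 1 \<le> Z * Z" using Z V Z1 by (intro mult_mono) auto
      then show "V \<le> Z\<^sup>2" by (simp add: power2_eq_square)
    qed (use V in auto)
    then have V2: "V\<^sup>2 < real n" using False by (simp add: power2_eq_square)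
    show ?thesis
    proof (cases "\<exists>t. t\<^sup>2 dvd n \<and> W < real t")
      case True
      then obtain t where t: "t\<^sup>2 dvd n" "W < real t" by blast
      have "t\<^sup>2 \<le> n" using t n1 by (intro dvd_imp_le) auto
      then have "real (t\<^sup>2) \<le> real n" by (simp only: of_nat_le_iff)
      then have "(real t)\<^sup>2 \<le> X" using n1(2) unfolding of_nat_power by linarith
      then have "real t \<le> sqrt X" by (rule real_le_rsqrt)
      then have tin: "t \<in> {t. t \<in> nats_upto (sqrt X) \<and> W < real t}" using t W by (auto simp: nats_upto_def)
      have "(if t\<^sup>2 dvd n then 1 else 0) \<le> ?S"
        by (rule member_le_sum[OF tin]) auto
      then have "1 \<le> ?S" using t by simp
      moreover have "cmod (rest_part V Z f n) \<le> 3" by (rule rest_part_bound(2)[OF f V n1(1) V2])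
      ultimately show ?thesis using False by (simp add: rest_majorant_def)
    next
      case False': False
      then have "rest_part V Z f n = 0"
        using False by (intro rest_part_eq_0[OF f V Z W]) (auto simp: not_less)
      then show ?thesis using S0 False by (simp add: rest_majorant_def)
    qed
  qed
qed

lemma rest_part_class_sum:
  assumes f: "f \<in> class_C" and V: "V \<ge> 1" and Z: "W ^ 3 \<le> Z" "V \<le> Z" and W: "W \<ge> 1" and X: "X \<ge> 1"
    and q: "q \<ge> 1" and a: "coprime a (int q)"
  shows "(\<Sum>n | n \<in> nats_upto X \<and> [int n = a] (mod int q). cmod (rest_part V Z f n))
    \<le> (2 + V) * (V * Z\<^sup>2) + 3 * (2 * X / (W * real q) + sqrt X)"
proof -
  let ?S = "{n. n \<in> nats_upto X \<and> [int n = a] (mod int q)}"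
  let ?T = "{t. t \<in> nats_upto (sqrt X) \<and> W < real t}"
  have "(\<Sum>n\<in>?S. cmod (rest_part V Z f n)) \<le> (\<Sum>n\<in>?S. rest_majorant V Z W X n)"
    by (intro sum_mono rest_part_le_majorant f V Z W) auto
  also have "\<dots> = (2 + V) * (\<Sum>n\<in>?S. if real n \<le> V * Z\<^sup>2 then 1 else 0)
     + 3 * (\<Sum>t\<in>?T. \<Sum>n\<in>?S. if t\<^sup>2 dvd n then 1 else 0)"
    unfolding rest_majorant_def sum.distrib sum_distrib_left[symmetric] by (subst sum.swap) simp
  also have "\<dots> \<le> (2 + V) * (V * Z\<^sup>2) + 3 * (2 * X / (W * real q) + sqrt X)"
  proof (intro add_mono mult_left_mono)
    have "(\<Sum>n\<in>?S. if real n \<le> V * Z\<^sup>2 then 1 else 0) = real (card (?S \<inter> {n. real n \<le> V * Z\<^sup>2}))"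
      by (simp add: sum.If_cases)
    also have "\<dots> \<le> real (card (nats_upto (V * Z\<^sup>2)))"
      by (intro of_nat_mono card_mono finite_nats_upto) (auto simp: nats_upto_def)
    also have "\<dots> \<le> V * Z\<^sup>2" using V by (intro card_upto_le) auto
    finally show "(\<Sum>n\<in>?S. if real n \<le> V * Z\<^sup>2 then 1 else 0) \<le> V * Z\<^sup>2" .
    have "(\<Sum>t\<in>?T. \<Sum>n\<in>?S. if t\<^sup>2 dvd n then 1 else (0::real)) \<le> (\<Sum>t\<in>?T. X / real q * (1 / (real t)\<^sup>2) + 1)"
    proof (rule sum_mono)
      fix t assume "t \<in> ?T"
      then have t: "t \<ge> 1" by (simp add: nats_upto_def)
      have "(\<Sum>n\<in>?S. if t\<^sup>2 dvd n then 1 else (0::real)) = real (card (?S \<inter> {n. t\<^sup>2 dvd n}))"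
        by (simp add: sum.If_cases)
      also have "?S \<inter> {n. t\<^sup>2 dvd n} = {n. n \<in> nats_upto X \<and> [int n = a] (mod int q) \<and> t\<^sup>2 dvd n}" by auto
      also have "real (card \<dots>) \<le> X / (real (t\<^sup>2) * real q) + 1"
        using X q a t by (intro card_class_multiples_le) auto
      finally show "(\<Sum>n\<in>?S. if t\<^sup>2 dvd n then 1 else (0::real)) \<le> X / real q * (1 / (real t)\<^sup>2) + 1"
        by (simp add: mult.commute)
    qed
    also have "\<dots> = X / real q * (\<Sum>t\<in>?T. 1 / (real t)\<^sup>2) + real (card ?T)"
      by (simp add: sum.distrib sum_distrib_left)
    also have "\<dots> \<le> X / real q * (2 / W) + sqrt X"
    proof (intro add_mono mult_left_mono)
      show "(\<Sum>t\<in>?T. 1 / (real t)\<^sup>2) \<le> 2 / W"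
        unfolding nats_upto_eq by (rule sum_inverse_squares_tail[OF W])
      have "real (card ?T) \<le> real (card (nats_upto (sqrt X)))" by (intro of_nat_mono card_mono) auto
      also have "\<dots> \<le> sqrt X" using X by (intro card_upto_le) auto
      finally show "real (card ?T) \<le> sqrt X" .
    qed (use X in auto)
    finally show "(\<Sum>t\<in>?T. \<Sum>n\<in>?S. if t\<^sup>2 dvd n then 1 else (0::real)) \<le> 2 * X / (W * real q) + sqrt X"
      by (simp add: mult_ac)
  qed (use V in auto)
  finally show ?thesis .
qed

lemma norm1_rest_part:
  assumes f: "f \<in> class_C" and V: "V \<ge> 1" and Z: "W ^ 3 \<le> Z" "V \<le> Z" and W: "W \<ge> 1" and X: "X \<ge> 1"
  shows "norm1 (rest_part V Z f) X \<le> (2 + V) * (V * Z\<^sup>2) + 3 * (2 * X / W + sqrt X)"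
  using rest_part_class_sum[OF f V Z W X, of 1 1] by (simp add: norm1_def)

text \<open>The trivial estimate \<open>class_part_le_norm1\<close> would give the same bound for
  every \<open>q\<close> and lose a factor \<open>N\<close> on summation. Counting inside the class
  keeps the decay in \<open>q\<close> of the main contribution, so that summation costs only
  logarithms there.\<close>

lemma Delta_rest_part:
  assumes f: "f \<in> class_C" and V: "V \<ge> 1" and Z: "W ^ 3 \<le> Z" "V \<le> Z" and W: "W \<ge> 1" and X: "X \<ge> 1"
    and q: "q \<ge> 1" and a: "coprime a (int q)"
  shows "cmod (class_part (rest_part V Z f) X q q a) / real (totient q)
    \<le> (2 + V) * (V * Z\<^sup>2) + 3 * (2 * X / (W * real q) + sqrt X) + norm1 (rest_part V Z f) X / real (totient q)"
proof -
  let ?h = "rest_part V Z f"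
  have t: "real (totient q) > 0" using q by simp
  have "cmod (class_part ?h X q q a) \<le> real (totient q) * cmod (\<Sum>n | n \<in> nats_upto X \<and> coprime n q \<and> [int n = a] (mod int q). ?h n) + norm1 ?h X"
    unfolding class_part_def
    by (rule order_trans[OF norm_triangle_ineq4], intro add_mono) (simp_all add: norm_mult sum_filter_le_norm1)
  then have "cmod (class_part ?h X q q a) / real (totient q)
    \<le> cmod (\<Sum>n | n \<in> nats_upto X \<and> coprime n q \<and> [int n = a] (mod int q). ?h n) + norm1 ?h X / real (totient q)"
    using t by (simp add: field_simps)
  also have "cmod (\<Sum>n | n \<in> nats_upto X \<and> coprime n q \<and> [int n = a] (mod int q). ?h n)
    \<le> (\<Sum>n | n \<in> nats_upto X \<and> [int n = a] (mod int q). cmod (?h n))"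
    by (rule order_trans[OF norm_sum]) (intro sum_mono2, auto)
  also have "\<dots> \<le> (2 + V) * (V * Z\<^sup>2) + 3 * (2 * X / (W * real q) + sqrt X)"
    by (rule rest_part_class_sum[OF f V Z W X q a])
  finally show ?thesis by simp
qed

section \<open>The type I part and the averaging over rough cofactors\<close>

lemma class_part_type1:
  assumes "q \<ge> 1" "d dvd q"
  shows "class_part (type1_part V f) X q d a = (\<Sum>u | u \<in> nats_upto X \<and> real u \<le> V \<and> coprime u q.
    f u * class_part (on_primes f) (X / real u) q d (a * inv_mod d u))"
proof (rule class_part_convolution)
  show "d > 0" using assms dvd_pos_nat[of q d] by simp
  show "type1_part V f n = (\<Sum>u | u dvd n \<and> real u \<le> V. f u * on_primes f (n div u))" for n
    by (rule type1_part_def)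
qed (rule assms(2))

lemma class_part_type1_le:
  assumes f: "f \<in> class_C" and q: "q \<ge> 1" "d dvd q" and a: "coprime a (int d)"
    and B: "\<And>u b. u \<in> nats_upto V \<Longrightarrow> coprime b (int d) \<Longrightarrow> cmod (class_part (on_primes f) (X / real u) q d b) \<le> S u"
    and S: "\<And>u. S u \<ge> 0"
  shows "cmod (class_part (type1_part V f) X q d a) \<le> (\<Sum>u\<in>nats_upto V. S u)"
proof -
  have d: "d > 0" using q dvd_pos_nat[of q d] by simp
  have "cmod (class_part (type1_part V f) X q d a) \<le> (\<Sum>u | u \<in> nats_upto X \<and> real u \<le> V \<and> coprime u q. S u)"
    unfolding class_part_type1[OF q]
  proof (rule order_trans[OF norm_sum], rule sum_mono)
    fix u assume "u \<in> {u. u \<in> nats_upto X \<and> real u \<le> V \<and> coprime u q}"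
    then have u: "u \<ge> 1" "u \<in> nats_upto V" "coprime u q" by (auto simp: nats_upto_def)
    have "coprime u d" using u(3) q(2) by (meson coprime_divisors dvd_refl)
    then have "coprime (a * inv_mod d u) (int d)" using a inv_mod[OF d] by simp
    then have "cmod (class_part (on_primes f) (X / real u) q d (a * inv_mod d u)) \<le> S u" using B u by blast
    moreover have "cmod (f u) \<le> 1" by (rule class_C_bound[OF f u(1)])
    ultimately have "cmod (f u) * cmod (class_part (on_primes f) (X / real u) q d (a * inv_mod d u)) \<le> 1 * S u"
      by (intro mult_mono) auto
    then show "cmod (f u * class_part (on_primes f) (X / real u) q d (a * inv_mod d u)) \<le> S u"
      by (simp add: norm_mult)
  qed
  also have "\<dots> \<le> (\<Sum>u\<in>nats_upto V. S u)"
    using S by (intro sum_mono2 finite_nats_upto) (auto simp: nats_upto_def)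
  finally show ?thesis .
qed

lemma sum_indicator_le_card:
  assumes "finite M" "finite P"
  shows "(\<Sum>n\<in>M. if n \<in> P then 1 else (0::real)) \<le> real (card P)"
proof -
  have "(\<Sum>n\<in>M. if n \<in> P then 1 else (0::real)) = real (card (M \<inter> P))"
    using assms by (simp add: sum.If_cases)
  also have "\<dots> \<le> real (card P)" using assms by (intro of_nat_mono card_mono) auto
  finally show ?thesis .
qed

text \<open>A function on primes notices a change of the coprimality modulus only at the few primes
  dividing \<open>q\<close> or q'. This allows the cofactor \<open>k\<close> of the conductor to be
  exchanged for a rough one.\<close>

lemma class_part_primes_change:
  assumes f: "f \<in> class_C" and q: "q \<ge> 1" "q' \<ge> 1" and d: "d \<ge> 1"
  shows "cmod (class_part (on_primes f) X q d b)
    \<le> cmod (class_part (on_primes f) X q' d b) + 2 * real (totient d) * real (card (prime_factors q) + card (prime_factors q'))"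
proof -
  let ?w = "on_primes f"
  define D where "D = real (card (prime_factors q) + card (prime_factors q'))"
  have one: "cmod ((\<Sum>n | n \<in> nats_upto X \<and> coprime n q \<and> P n. ?w n) - (\<Sum>n | n \<in> nats_upto X \<and> (coprime n q \<and> coprime n q') \<and> P n. ?w n))
     \<le> real (card (prime_factors q'))" if q': "q' \<ge> 1" for q q' P
  proof -
    define S where "S = {n. n \<in> nats_upto X \<and> coprime n q \<and> P n}"
    define T where "T = {n. n \<in> nats_upto X \<and> (coprime n q \<and> coprime n q') \<and> P n}"
    have ST: "finite S" "T \<subseteq> S" by (auto simp: S_def T_def)
    have "cmod (sum ?w S - sum ?w T) = cmod (sum ?w (S - T))" using ST by (simp add: sum_diff)
    also have "\<dots> \<le> (\<Sum>n\<in>S - T. if n \<in> prime_factors q' then 1 else 0)"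
    proof (rule order_trans[OF norm_sum], rule sum_mono)
      fix n assume "n \<in> S - T"
      then have n: "n \<in> nats_upto X" "\<not> coprime n q'" by (auto simp: S_def T_def)
      show "cmod (?w n) \<le> (if n \<in> prime_factors q' then 1 else 0)"
      proof (cases "prime n")
        case True
        then have "n dvd q'" using n prime_imp_coprime by blast
        then have "n \<in> prime_factors q'" using True q' by (simp add: prime_factors_dvd)
        moreover have "cmod (f n) \<le> 1" using n by (intro class_C_bound[OF f]) (auto simp: nats_upto_def)
        ultimately show ?thesis using True by (simp add: on_primes_def)
      qed (simp add: on_primes_def)
    qed
    also have "\<dots> \<le> real (card (prime_factors q'))"
      using ST by (intro sum_indicator_le_card) auto
    finally show ?thesis by (simp only: S_def T_def)
  qed
  have both: "cmod ((\<Sum>n | n \<in> nats_upto X \<and> coprime n q \<and> P n. ?w n) - (\<Sum>n | n \<in> nats_upto X \<and> coprime n q' \<and> P n. ?w n)) \<le> D" for P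
  proof -
    have e: "(\<Sum>n | n \<in> nats_upto X \<and> (coprime n q' \<and> coprime n q) \<and> P n. ?w n) = (\<Sum>n | n \<in> nats_upto X \<and> (coprime n q \<and> coprime n q') \<and> P n. ?w n)"
      by (rule sum.cong) auto
    have "cmod (A - C) \<le> D" if "cmod (A - B) \<le> real (card (prime_factors q'))" "cmod (C - B) \<le> real (card (prime_factors q))" for A B C
    proof -
      have "cmod (A - C) = cmod ((A - B) - (C - B))" by simp
      also have "\<dots> \<le> cmod (A - B) + cmod (C - B)" by (rule norm_triangle_ineq4)
      finally show ?thesis using that by (simp add: D_def)
    qed
    then show ?thesis using one[OF q(2), of q P] one[OF q(1), of q' P] unfolding e by blast
  qed
  have t: "real (totient d) \<ge> 1" using d by (simp add: Suc_le_eq)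
  have D0: "D \<ge> 0" by (simp add: D_def)
  have "class_part ?w X q d b - class_part ?w X q' d b
    = of_nat (totient d) * ((\<Sum>n | n \<in> nats_upto X \<and> coprime n q \<and> [int n = b] (mod int d). ?w n) - (\<Sum>n | n \<in> nats_upto X \<and> coprime n q' \<and> [int n = b] (mod int d). ?w n))
     - ((\<Sum>n | n \<in> nats_upto X \<and> coprime n q \<and> True. ?w n) - (\<Sum>n | n \<in> nats_upto X \<and> coprime n q' \<and> True. ?w n))"
    by (simp add: class_part_def algebra_simps)
  then have "cmod (class_part ?w X q d b - class_part ?w X q' d b) \<le> real (totient d) * D + D"
    by (simp only:) (rule order_trans[OF norm_triangle_ineq4], intro add_mono both,
      simp only: norm_mult norm_of_nat, intro mult_left_mono both, simp)
  also have "\<dots> \<le> 2 * real (totient d) * D" using mult_right_mono[OF t D0] by (simp add: mult.commute)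
  finally have "cmod (class_part ?w X q d b - class_part ?w X q' d b) \<le> 2 * real (totient d) * D" .
  then show ?thesis using norm_triangle_sub[of "class_part ?w X q d b" "class_part ?w X q' d b"] by (simp add: D_def)
qed

lemma prime_factors_coprime_of_le:
  assumes "r \<in> {1..R0}" "prime_factors k \<inter> {p. prime p \<and> p \<le> R0} = {}" "k \<ge> (1::nat)"
  shows "coprime r k"
proof (rule coprime_of_disjoint_prime_factors)
  have "p \<le> R0" if "p \<in> prime_factors r" for p
  proof -
    have "p dvd r" using that by auto
    then have "p \<le> r" using assms by (intro dvd_imp_le) auto
    then show ?thesis using assms by simp
  qed
  then show "prime_factors r \<inter> prime_factors k = {}" using assms(2) by auto
qed (use assms in auto)

text \<open>All primes of \<open>r\<close> are at most \<open>R0\<close> and those of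
  \<open>k\<close> are not, so the product determines both factors and no modulus is counted
  twice.\<close>

lemma sum_smooth_times_rough_le:
  fixes g :: "nat \<Rightarrow> real"
  assumes g: "\<And>q. q \<in> {1..N} \<Longrightarrow> g q \<ge> 0" and N: "R0 * z \<le> N"
  shows "(\<Sum>r\<in>{1..R0}. \<Sum>k | k \<in> {1..z} \<and> prime_factors k \<inter> {p. prime p \<and> p \<le> R0} = {}. g (r * k)) \<le> (\<Sum>q\<in>{1..N}. g q)"
proof -
  let ?K = "{k. k \<in> {1..z} \<and> prime_factors k \<inter> {p. prime p \<and> p \<le> R0} = {}}"
  have inj: "inj_on (\<lambda>(r, k). r * k) ({1..R0} \<times> ?K)"
  proof (rule inj_onI, clarify)
    fix r k s l assume h: "r \<in> {1..R0}" "s \<in> {1..R0}" "k \<in> {1..z}" "l \<in> {1..z}"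
      "prime_factors k \<inter> {p. prime p \<and> p \<le> R0} = {}" "prime_factors l \<inter> {p. prime p \<and> p \<le> R0} = {}" "r * k = s * l"
    have "coprime r l" "coprime s k" using h by (auto intro!: prime_factors_coprime_of_le)
    moreover have "r dvd s * l" "s dvd r * k" using h(7) by (metis dvd_triv_left)+
    ultimately have "r dvd s" "s dvd r" by (simp_all add: coprime_dvd_mult_left_iff)
    then have "r = s" by (rule dvd_antisym)
    then show "r = s \<and> k = l" using h by auto
  qed
  have sub: "(\<lambda>(r, k). r * k) ` ({1..R0} \<times> ?K) \<subseteq> {1..N}"
  proof
    fix y assume "y \<in> (\<lambda>(r, k). r * k) ` ({1..R0} \<times> ?K)"
    then obtain r k where y: "y = r * k" "1 \<le> r" "r \<le> R0" "1 \<le> k" "k \<le> z" by auto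
    have "r * k \<le> R0 * z" using y by (intro mult_le_mono) auto
    then show "y \<in> {1..N}" using y N by auto
  qed
  have "(\<Sum>r\<in>{1..R0}. \<Sum>k\<in>?K. g (r * k)) = (\<Sum>y\<in>(\<lambda>(r, k). r * k) ` ({1..R0} \<times> ?K). g y)"
    unfolding sum.reindex[OF inj] by (simp add: sum.cartesian_product o_def case_prod_unfold)
  also have "\<dots> \<le> (\<Sum>q\<in>{1..N}. g q)" using sub g by (intro sum_mono2) auto
  finally show ?thesis .
qed

text \<open>The conductors \<open>r \<le> R0\<close> of the type I part. A single modulus \<open>r\<close> would be counted with
  weight \<open>1 / \<phi>(r)\<close> times a full logarithm; averaging the discrepancy modulo \<open>r\<close> over the moduli
  \<open>r k'\<close> with \<open>k'\<close> free of primes up to \<open>R0\<close> recovers that logarithm, since each modulus has at most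
  one such factorization.\<close>

lemma type1_small_conductors:
  assumes f: "f \<in> class_C" and V: "V \<ge> 1" and N: "R0 * z \<le> N" and k: "k \<in> {1..N}"
    and w0: "\<And>q. q \<in> {1..N} \<Longrightarrow> real (card (prime_factors q)) \<le> w0"
    and \<Omega>: "\<And>r. r \<in> {1..R0} \<Longrightarrow> 2 ^ card (prime_factors r) \<le> \<Omega>" "\<Omega> \<ge> 0"
    and S: "S = (\<Sum>k | k \<in> {1..z} \<and> prime_factors k \<inter> {p. prime p \<and> p \<le> R0} = {}. 1 / real k)" "S > 0"
    and a: "\<And>q. coprime (a q) (int q)"
  shows "(\<Sum>r | r \<in> {1..N} \<and> (1 < r \<and> r \<le> R0) \<and> r * k \<le> N.
      cmod (prim_part (type1_part V f) x (r * k) r (a (r * k))) / real (totient r))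
    \<le> \<Omega> * ((\<Sum>u\<in>nats_upto V. \<Sum>q\<in>{1..N}. max_Delta (on_primes f) (x / real u) q) / S + 4 * w0 * V * real R0)"
proof -
  let ?K = "{k. k \<in> {1..z} \<and> prime_factors k \<inter> {p. prime p \<and> p \<le> R0} = {}}"
  let ?R = "{r. r \<in> {1..N} \<and> (1 < r \<and> r \<le> R0) \<and> r * k \<le> N}"
  let ?w = "on_primes f"
  define g where "g = (\<lambda>q. \<Sum>u\<in>nats_upto V. max_Delta ?w (x / real u) q)"
  define F where "F = (\<lambda>r. cmod (prim_part (type1_part V f) x (r * k) r (a (r * k))) / real (totient r))"
  have g0: "g q \<ge> 0" if "q \<in> {1..N}" for q
    using that by (auto simp: g_def intro!: sum_nonneg max_Delta_nonneg)
  have w00: "w0 \<ge> 0" using w0[OF k] by (meson of_nat_0_le_iff order_trans)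
  have single: "F r \<le> \<Omega> * (real k' * g (r * k') + 4 * w0 * V)" if r: "r \<in> ?R" and k': "k' \<in> ?K" for r k'
  proof -
    have r1: "r > 1" "r \<in> {1..R0}" using r by auto
    have q: "r * k \<in> {1..N}" using r k by auto
    have k'z: "1 \<le> k'" "k' \<le> z" using k' by auto
    have "r * k' \<le> R0 * z" using r1 k'z by (intro mult_le_mono) auto
    then have q': "r * k' \<in> {1..N}" using N r1 k'z by auto
    have tr: "real (totient r) > 0" using r1 by simp
    define Su where "Su = (\<lambda>u. real (totient r) * (real k' * max_Delta ?w (x / real u) (r * k') + 4 * w0))"
    have Su0: "Su u \<ge> 0" for u using q' w00 by (auto simp: Su_def intro!: mult_nonneg_nonneg add_nonneg_nonneg max_Delta_nonneg)
    have "cmod (prim_part (type1_part V f) x (r * k) r (a (r * k))) \<le> 2 ^ card (prime_factors r) * (\<Sum>u\<in>nats_upto V. Su u)"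
    proof (rule prim_part_le_const[OF r1(1)])
      fix d assume d: "d dvd r"
      have d1: "d \<ge> 1" using d r1 dvd_imp_ge_1[of d r] by simp
      have dr: "totient d \<le> totient r" using d r1 by (intro totient_dvd_mono) auto
      have ad: "coprime (a (r * k)) (int d)"
        using a[of "r * k"] d by (meson coprime_divisors dvd_refl dvd_mult2 int_dvd_int_iff)
      show "cmod (class_part (type1_part V f) x (r * k) d (a (r * k))) \<le> (\<Sum>u\<in>nats_upto V. Su u)"
      proof (rule class_part_type1_le[OF f _ _ ad _ Su0])
        fix u b assume b: "coprime b (int d)"
        have "cmod (class_part ?w (x / real u) (r * k) d b) \<le> cmod (class_part ?w (x / real u) (r * k') d b)
           + 2 * real (totient d) * real (card (prime_factors (r * k)) + card (prime_factors (r * k')))"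
          using q q' d1 by (intro class_part_primes_change[OF f]) auto
        also have "\<dots> \<le> real (totient (r * k')) * max_Delta ?w (x / real u) (r * k') + 2 * real (totient r) * (w0 + w0)"
        proof (intro add_mono mult_mono)
          show "cmod (class_part ?w (x / real u) (r * k') d b) \<le> real (totient (r * k')) * max_Delta ?w (x / real u) (r * k')"
            using q' d b by (intro class_part_le_max_Delta) auto
          show "real (card (prime_factors (r * k)) + card (prime_factors (r * k'))) \<le> w0 + w0"
            using w0[OF q] w0[OF q'] by simp
        qed (use dr w00 in auto)
        also have "\<dots> \<le> real (totient r * k') * max_Delta ?w (x / real u) (r * k') + 2 * real (totient r) * (w0 + w0)"
          using q' r1 by (intro add_right_mono mult_right_mono max_Delta_nonneg) (simp_all only: of_nat_le_iff totient_mult_le, auto)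
        also have "\<dots> = Su u" by (simp add: Su_def algebra_simps)
        finally show "cmod (class_part ?w (x / real u) (r * k) d b) \<le> Su u" .
      qed (use q d in auto)
    qed
    also have "\<dots> \<le> \<Omega> * (\<Sum>u\<in>nats_upto V. Su u)"
      using \<Omega>(1)[OF r1(2)] Su0 by (intro mult_right_mono sum_nonneg) auto
    finally have 1: "cmod (prim_part (type1_part V f) x (r * k) r (a (r * k))) \<le> \<Omega> * (\<Sum>u\<in>nats_upto V. Su u)" .
    have "(\<Sum>u\<in>nats_upto V. Su u) = real (totient r) * (real k' * g (r * k') + 4 * w0 * real (card (nats_upto V)))"
      by (simp add: Su_def g_def sum.distrib sum_distrib_left algebra_simps)
    also have "\<dots> \<le> real (totient r) * (real k' * g (r * k') + 4 * w0 * V)"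
      using w00 V card_upto_le[of V] by (intro mult_left_mono add_left_mono) auto
    finally have "\<Omega> * (\<Sum>u\<in>nats_upto V. Su u) \<le> \<Omega> * (real (totient r) * (real k' * g (r * k') + 4 * w0 * V))"
      using \<Omega>(2) by (rule mult_left_mono)
    with 1 have "cmod (prim_part (type1_part V f) x (r * k) r (a (r * k))) \<le> \<Omega> * (real (totient r) * (real k' * g (r * k') + 4 * w0 * V))"
      by (rule order_trans)
    then have "cmod (prim_part (type1_part V f) x (r * k) r (a (r * k))) \<le> real (totient r) * (\<Omega> * (real k' * g (r * k') + 4 * w0 * V))"
      by (simp only: mult.left_commute)
    then show ?thesis using tr by (simp add: F_def pos_divide_le_eq mult.commute)
  qed
  \<comment> \<open>The weight 1 / k' cancels the factor k' lost in phi(r k') <= phi(r) k', and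
    \<open>S\<close> is the total weight; dividing by \<open>S\<close> at the end is the
    gain.\<close>
  have "S * (\<Sum>r\<in>?R. F r) = (\<Sum>r\<in>?R. \<Sum>k'\<in>?K. 1 / real k' * F r)"
    by (simp only: S(1) sum_distrib_left sum_distrib_right)
  also have "\<dots> \<le> (\<Sum>r\<in>?R. \<Sum>k'\<in>?K. \<Omega> * (g (r * k') + 4 * w0 * V * (1 / real k')))"
  proof (intro sum_mono)
    fix r k' assume r: "r \<in> ?R" and k': "k' \<in> ?K"
    have "1 / real k' * F r \<le> 1 / real k' * (\<Omega> * (real k' * g (r * k') + 4 * w0 * V))"
      by (intro mult_left_mono single r k') auto
    also have "\<dots> = \<Omega> * (g (r * k') + 4 * w0 * V * (1 / real k'))" using k' by (simp add: field_simps)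
    finally show "1 / real k' * F r \<le> \<Omega> * (g (r * k') + 4 * w0 * V * (1 / real k'))" .
  qed
  also have "\<dots> \<le> (\<Sum>r\<in>{1..R0}. \<Sum>k'\<in>?K. \<Omega> * (g (r * k') + 4 * w0 * V * (1 / real k')))"
  proof (rule sum_mono2)
    fix r assume r: "r \<in> {1..R0} - ?R"
    show "0 \<le> (\<Sum>k'\<in>?K. \<Omega> * (g (r * k') + 4 * w0 * V * (1 / real k')))"
    proof (intro sum_nonneg mult_nonneg_nonneg add_nonneg_nonneg \<Omega>(2))
      fix k' assume k': "k' \<in> ?K"
      have "r * k' \<le> R0 * z" using r k' by (intro mult_le_mono) auto
      then show "g (r * k') \<ge> 0" using r k' N by (intro g0) auto
    qed (use w00 V in auto)
  qed auto
  also have "\<dots> = \<Omega> * ((\<Sum>r\<in>{1..R0}. \<Sum>k'\<in>?K. g (r * k')) + 4 * w0 * V * real R0 * S)"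
    by (simp only: sum_distrib_left[symmetric] sum.distrib S(1)[symmetric] sum_constant card_atLeastAtMost) simp
  also have "\<dots> \<le> \<Omega> * ((\<Sum>q\<in>{1..N}. g q) + 4 * w0 * V * real R0 * S)"
    using \<Omega>(2) by (intro mult_left_mono add_right_mono sum_smooth_times_rough_le g0 N) auto
  finally have "S * (\<Sum>r\<in>?R. F r) \<le> S * (\<Omega> * ((\<Sum>q\<in>{1..N}. g q) / S + 4 * w0 * V * real R0))"
    using S(2) by (simp add: algebra_simps)
  then have "(\<Sum>r\<in>?R. F r) \<le> \<Omega> * ((\<Sum>q\<in>{1..N}. g q) / S + 4 * w0 * V * real R0)"
    using S(2) by (subst (asm) mult_le_cancel_left_pos)
  also have "(\<Sum>q\<in>{1..N}. g q) = (\<Sum>u\<in>nats_upto V. \<Sum>q\<in>{1..N}. max_Delta ?w (x / real u) q)"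
    unfolding g_def by (rule sum.swap)
  finally show ?thesis by (simp only: F_def)
qed

section \<open>Assembling the bounds\<close>

lemma prim_part_decomposition:
  "prim_part f X q r a = prim_part (type1_part V f) X q r a + prim_part (type2_part V Z f) X q r a
     + prim_part (rest_part V Z f) X q r a"
  unfolding prim_part_def sum.distrib[symmetric] by (intro sum.cong refl) (simp add: rest_part_def algebra_simps)

text \<open>At large conductors the type I and remainder parts are never estimated one by one: their
  sum is the complete discrepancy minus the small conductors. Only the type II part is left
  there.\<close>

lemma Delta_decomposition:
  assumes q: "q \<ge> 1" and a: "coprime a (int q)" and R0: "R0 \<ge> 1"
  shows "cmod (Delta f X q a) \<le>
     (cmod (class_part (type1_part V f) X q q a) + cmod (class_part (rest_part V Z f) X q q a)) / real (totient q)
     + (\<Sum>r | r dvd q \<and> (1 < r \<and> r \<le> R0). cmod (prim_part f X q r a) + cmod (prim_part (type1_part V f) X q r a)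
         + cmod (prim_part (rest_part V Z f) X q r a)) / real (totient q)
     + (\<Sum>r | r dvd q \<and> R0 < r. cmod (prim_part (type2_part V Z f) X q r a)) / real (totient q)"
proof -
  let ?f1 = "type1_part V f" and ?f2 = "type2_part V Z f" and ?f3 = "rest_part V Z f"
  let ?A = "{r. r dvd q \<and> (1 < r \<and> r \<le> R0)}" and ?B = "{r. r dvd q \<and> R0 < r}"
  have fin: "finite ?A" "finite ?B" by (rule finite_subset[of _ "{r. r dvd q}"], use q in auto)+
  have AB: "{r. r dvd q \<and> r > 1} = ?A \<union> ?B" "?A \<inter> ?B = {}" using R0 by auto
  have split: "class_part h X q q a = (\<Sum>r\<in>?A. prim_part h X q r a) + (\<Sum>r\<in>?B. prim_part h X q r a)" for h
    unfolding class_part_eq_sum_prim_part[OF q] AB(1) by (rule sum.union_disjoint[OF fin AB(2)])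
  have "class_part f X q q a = (\<Sum>r\<in>?A. prim_part f X q r a)
     + ((\<Sum>r\<in>?B. prim_part ?f1 X q r a) + (\<Sum>r\<in>?B. prim_part ?f2 X q r a) + (\<Sum>r\<in>?B. prim_part ?f3 X q r a))"
    unfolding split[of f] sum.distrib[symmetric] by (subst (2) prim_part_decomposition[of f X q _ a V Z]) (rule refl)
  also have "\<dots> = class_part ?f1 X q q a + class_part ?f3 X q q a + (\<Sum>r\<in>?A. prim_part f X q r a)
     - (\<Sum>r\<in>?A. prim_part ?f1 X q r a) - (\<Sum>r\<in>?A. prim_part ?f3 X q r a) + (\<Sum>r\<in>?B. prim_part ?f2 X q r a)"
    unfolding split[of ?f1] split[of ?f3] by simp
  finally have e: "class_part f X q q a = \<dots>" .
  have tri: "cmod (z1 + z3 + s - s1 - s3 + b) \<le> (cmod z1 + cmod z3) + (cmod s + cmod s1 + cmod s3) + cmod b" for z1 z3 s s1 s3 b :: complex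
  proof -
    have "cmod (z1 + z3 + s - s1 - s3 + b) \<le> cmod (z1 + z3 + s - s1 - s3) + cmod b" by (rule norm_triangle_ineq)
    also have "cmod (z1 + z3 + s - s1 - s3) \<le> cmod (z1 + z3 + s - s1) + cmod s3" by (rule norm_triangle_ineq4)
    also have "cmod (z1 + z3 + s - s1) \<le> cmod (z1 + z3 + s) + cmod s1" by (rule norm_triangle_ineq4)
    also have "cmod (z1 + z3 + s) \<le> cmod (z1 + z3) + cmod s" by (rule norm_triangle_ineq)
    also have "cmod (z1 + z3) \<le> cmod z1 + cmod z3" by (rule norm_triangle_ineq)
    finally show ?thesis by simp
  qed
  have "real (totient q) * cmod (Delta f X q a) = cmod (class_part f X q q a)"
    unfolding Delta_class_part[OF q a, symmetric] by (simp add: norm_mult)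
  also have "\<dots> \<le> (cmod (class_part ?f1 X q q a) + cmod (class_part ?f3 X q q a))
     + (cmod (\<Sum>r\<in>?A. prim_part f X q r a) + cmod (\<Sum>r\<in>?A. prim_part ?f1 X q r a) + cmod (\<Sum>r\<in>?A. prim_part ?f3 X q r a))
     + cmod (\<Sum>r\<in>?B. prim_part ?f2 X q r a)"
    unfolding e by (rule tri)
  also have "\<dots> \<le> (cmod (class_part ?f1 X q q a) + cmod (class_part ?f3 X q q a))
     + ((\<Sum>r\<in>?A. cmod (prim_part f X q r a)) + (\<Sum>r\<in>?A. cmod (prim_part ?f1 X q r a)) + (\<Sum>r\<in>?A. cmod (prim_part ?f3 X q r a)))
     + (\<Sum>r\<in>?B. cmod (prim_part ?f2 X q r a))"
    by (intro add_mono norm_sum order_refl)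
  finally have "cmod (Delta f X q a) \<le> ((cmod (class_part ?f1 X q q a) + cmod (class_part ?f3 X q q a))
     + (\<Sum>r\<in>?A. cmod (prim_part f X q r a) + cmod (prim_part ?f1 X q r a) + cmod (prim_part ?f3 X q r a))
     + (\<Sum>r\<in>?B. cmod (prim_part ?f2 X q r a))) / real (totient q)"
    using q by (simp add: pos_le_divide_eq sum.distrib mult.commute)
  then show ?thesis by (simp add: add_divide_distrib)
qed

lemma sum_Delta_decomposition:
  assumes a: "\<And>q. coprime (a q) (int q)" and R0: "R0 \<ge> 1"
  shows "(\<Sum>q\<in>{1..N}. cmod (Delta f X q (a q))) \<le>
     (\<Sum>q\<in>{1..N}. cmod (class_part (type1_part V f) X q q (a q)) / real (totient q))
     + (\<Sum>q\<in>{1..N}. cmod (class_part (rest_part V Z f) X q q (a q)) / real (totient q))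
     + (\<Sum>k\<in>{1..N}. (\<Sum>r | r \<in> {1..N} \<and> (1 < r \<and> r \<le> R0) \<and> r * k \<le> N. cmod (prim_part f X (r * k) r (a (r * k))) / real (totient r)) / real (totient k))
     + (\<Sum>k\<in>{1..N}. (\<Sum>r | r \<in> {1..N} \<and> (1 < r \<and> r \<le> R0) \<and> r * k \<le> N. cmod (prim_part (type1_part V f) X (r * k) r (a (r * k))) / real (totient r)) / real (totient k))
     + (\<Sum>k\<in>{1..N}. (\<Sum>r | r \<in> {1..N} \<and> (1 < r \<and> r \<le> R0) \<and> r * k \<le> N. cmod (prim_part (rest_part V Z f) X (r * k) r (a (r * k))) / real (totient r)) / real (totient k))
     + (\<Sum>k\<in>{1..N}. (\<Sum>r | r \<in> {1..N} \<and> R0 < r \<and> r * k \<le> N. cmod (prim_part (type2_part V Z f) X (r * k) r (a (r * k))) / real (totient r)) / real (totient k))"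
proof -
  let ?f1 = "type1_part V f" and ?f2 = "type2_part V Z f" and ?f3 = "rest_part V Z f"
  define P where "P = (\<lambda>r. 1 < r \<and> r \<le> R0)"
  define G where "G = (\<lambda>h q r. cmod (prim_part h X q r (a q)))"
  have G0: "G h q r \<ge> 0" for h q r by (simp add: G_def)
  have "(\<Sum>q\<in>{1..N}. cmod (Delta f X q (a q))) \<le> (\<Sum>q\<in>{1..N}.
     (cmod (class_part ?f1 X q q (a q)) + cmod (class_part ?f3 X q q (a q))) / real (totient q)
     + (\<Sum>r | r dvd q \<and> P r. G f q r + G ?f1 q r + G ?f3 q r) / real (totient q)
     + (\<Sum>r | r dvd q \<and> R0 < r. G ?f2 q r) / real (totient q))"
    unfolding G_def P_def by (intro sum_mono Delta_decomposition a R0) auto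
  also have "\<dots> = (\<Sum>q\<in>{1..N}. cmod (class_part ?f1 X q q (a q)) / real (totient q))
     + (\<Sum>q\<in>{1..N}. cmod (class_part ?f3 X q q (a q)) / real (totient q))
     + ((\<Sum>q\<in>{1..N}. (\<Sum>r | r dvd q \<and> P r. G f q r) / real (totient q))
     + (\<Sum>q\<in>{1..N}. (\<Sum>r | r dvd q \<and> P r. G ?f1 q r) / real (totient q))
     + (\<Sum>q\<in>{1..N}. (\<Sum>r | r dvd q \<and> P r. G ?f3 q r) / real (totient q)))
     + (\<Sum>q\<in>{1..N}. (\<Sum>r | r dvd q \<and> R0 < r. G ?f2 q r) / real (totient q))"
    by (simp only: sum.distrib add_divide_distrib)
  also have "\<dots> \<le> (\<Sum>q\<in>{1..N}. cmod (class_part ?f1 X q q (a q)) / real (totient q))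
     + (\<Sum>q\<in>{1..N}. cmod (class_part ?f3 X q q (a q)) / real (totient q))
     + ((\<Sum>k\<in>{1..N}. (\<Sum>r | r \<in> {1..N} \<and> P r \<and> r * k \<le> N. G f (r * k) r / real (totient r)) / real (totient k))
     + (\<Sum>k\<in>{1..N}. (\<Sum>r | r \<in> {1..N} \<and> P r \<and> r * k \<le> N. G ?f1 (r * k) r / real (totient r)) / real (totient k))
     + (\<Sum>k\<in>{1..N}. (\<Sum>r | r \<in> {1..N} \<and> P r \<and> r * k \<le> N. G ?f3 (r * k) r / real (totient r)) / real (totient k)))
     + (\<Sum>k\<in>{1..N}. (\<Sum>r | r \<in> {1..N} \<and> R0 < r \<and> r * k \<le> N. G ?f2 (r * k) r / real (totient r)) / real (totient k))"
    by (intro add_mono order_refl regroup_moduli G0)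
  finally show ?thesis by (simp only: G_def P_def add.assoc)
qed

text \<open>Crude: there are at most \<open>R0\<close> conductors, and 2 to the number of primes of
  \<open>r\<close> is at most \<open>R0\<close>. The loss of R0^2 is affordable where
  \<open>S\<close> saves a large power of the logarithm, as for \<open>f\<close> and for the
  remainder.\<close>

lemma small_conductors_le:
  assumes B: "\<And>q d. q \<in> {1..N} \<Longrightarrow> d dvd q \<Longrightarrow> cmod (class_part h X q d (a q)) \<le> real (totient d) * S" and S: "S \<ge> 0"
    and k: "k \<in> {1..N}"
  shows "(\<Sum>r | r \<in> {1..N} \<and> (1 < r \<and> r \<le> R0) \<and> r * k \<le> N. cmod (prim_part h X (r * k) r (a (r * k))) / real (totient r))
    \<le> (real R0)\<^sup>2 * S"
proof -
  have "(\<Sum>r | r \<in> {1..N} \<and> (1 < r \<and> r \<le> R0) \<and> r * k \<le> N. cmod (prim_part h X (r * k) r (a (r * k))) / real (totient r))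
    \<le> (\<Sum>r | r \<in> {1..N} \<and> (1 < r \<and> r \<le> R0) \<and> r * k \<le> N. real R0 * S)"
  proof (rule sum_mono)
    fix r assume "r \<in> {r. r \<in> {1..N} \<and> (1 < r \<and> r \<le> R0) \<and> r * k \<le> N}"
    then have r: "r > 1" "r \<le> R0" "r * k \<in> {1..N}" using k by auto
    have "cmod (prim_part h X (r * k) r (a (r * k))) \<le> 2 ^ card (prime_factors r) * (real (totient r) * S)"
      using r S by (intro prim_part_le_of_class_part B) auto
    also have "\<dots> \<le> real R0 * (real (totient r) * S)"
    proof (intro mult_right_mono)
      have "2 ^ card (prime_factors r) \<le> r" using r by (intro two_power_omega_le) simp
      then have "real (2 ^ card (prime_factors r)) \<le> real R0" using r(2) by (simp only: of_nat_le_iff)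
      then show "2 ^ card (prime_factors r) \<le> real R0" by simp
    qed (use S in auto)
    finally show "cmod (prim_part h X (r * k) r (a (r * k))) / real (totient r) \<le> real R0 * S"
      using r by (simp add: pos_divide_le_eq mult_ac)
  qed
  also have "\<dots> = real (card {r. r \<in> {1..N} \<and> (1 < r \<and> r \<le> R0) \<and> r * k \<le> N}) * (real R0 * S)" by simp
  also have "\<dots> \<le> real R0 * (real R0 * S)"
  proof (intro mult_right_mono)
    have "card {r. r \<in> {1..N} \<and> (1 < r \<and> r \<le> R0) \<and> r * k \<le> N} \<le> card {1..R0}" by (intro card_mono) auto
    then show "real (card {r. r \<in> {1..N} \<and> (1 < r \<and> r \<le> R0) \<and> r * k \<le> N}) \<le> real R0" by simp
  qed (use S in auto)
  finally show ?thesis by (simp add: power2_eq_square mult.assoc)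
qed

text \<open>One estimate for each of the six sums of \<open>sum_Delta_decomposition\<close>, with
  all parameters free. \<open>H\<close> is the price of summing over the cofactor of a conductor,
  \<open>Y\<close> collects the hypothesis on primes over all u <= V, and \<open>B0\<close> bounds
  the part of the remainder that does not decay with the modulus.\<close>

lemma main_inequality:
  fixes x V W Z \<delta> S4 w0 \<Omega> S :: real and R0 N z J :: nat
  assumes f: "f \<in> class_C" and x: "x \<ge> 1" and R0: "R0 \<ge> 1" and V: "V \<ge> 1" and W: "W \<ge> 1"
    and Z: "W ^ 3 \<le> Z" "V \<le> Z" and a: "\<And>q. coprime (a q) (int q)" and J: "x < 2 ^ J" and \<delta>: "\<delta> \<ge> 0"
    and SW: "\<And>X q a. sqrt x \<le> X \<Longrightarrow> X \<le> x \<Longrightarrow> q \<ge> 1 \<Longrightarrow> coprime a (int q) \<Longrightarrow> cmod (Delta f X q a) \<le> X * \<delta>"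
    and S4: "\<And>q. q \<in> {1..N} \<Longrightarrow> 4 ^ card (prime_factors q) \<le> S4" "S4 \<ge> 0"
    and zN: "R0 * z \<le> N" and w0: "\<And>q. q \<in> {1..N} \<Longrightarrow> real (card (prime_factors q)) \<le> w0"
    and \<Omega>: "\<And>r. r \<in> {1..R0} \<Longrightarrow> 2 ^ card (prime_factors r) \<le> \<Omega>" "\<Omega> \<ge> 0"
    and S: "S = (\<Sum>k | k \<in> {1..z} \<and> prime_factors k \<inter> {p. prime p \<and> p \<le> R0} = {}. 1 / real k)" "S > 0"
    and H: "(\<Sum>k\<in>{1..N}. 1 / real (totient k)) \<le> H" and h: "1 + (\<Sum>k\<in>{1..N}. 1 / real k) \<le> h"
    and Y: "(\<Sum>u\<in>nats_upto V. \<Sum>q\<in>{1..N}. max_Delta (on_primes f) (x / real u) q) \<le> Y"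
    and B0: "(2 + V) * (V * Z\<^sup>2) + 3 * sqrt x \<le> B0"
  shows "(\<Sum>q\<in>{1..N}. cmod (Delta f x q (a q))) \<le> Y + (real N * B0 + 6 * x * h / W + H * (B0 + 6 * x / W))
     + H * ((real R0)\<^sup>2 * (\<delta> * x * (1 + ln x) + 2 * x * S4 / sqrt (sqrt x)))
     + H * (\<Omega> * (Y / S + 4 * w0 * V * real R0))
     + H * ((real R0)\<^sup>2 * (2 * (B0 + 6 * x / W)))
     + H * (16 * (real J + 2)\<^sup>2 * sqrt x * (real J * (sqrt x / real R0 + real N) + 4 * h * (sqrt (x / Z) + sqrt (x / V))))"
proof -
  let ?f1 = "type1_part V f" and ?f2 = "type2_part V Z f" and ?f3 = "rest_part V Z f"
  let ?w = "on_primes f"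
  define T where "T = B0 + 6 * x / W"
  have n3: "norm1 ?f3 x \<le> T"
    using norm1_rest_part[OF f V Z W x] B0 by (simp add: T_def)
  have T0: "T \<ge> 0" using n3 norm1_nonneg order_trans by blast
  have weight: "(\<Sum>k\<in>{1..N}. g k / real (totient k)) \<le> H * E" if "\<And>k. k \<in> {1..N} \<Longrightarrow> g k \<le> E" "E \<ge> 0" for g E
  proof -
    have "(\<Sum>k\<in>{1..N}. g k / real (totient k)) \<le> (\<Sum>k\<in>{1..N}. 1 / real (totient k) * E)"
      using that(1) by (intro sum_mono) (simp add: divide_right_mono)
    also have "\<dots> = (\<Sum>k\<in>{1..N}. 1 / real (totient k)) * E" by (simp only: sum_distrib_right)
    also have "\<dots> \<le> H * E" using H that(2) by (rule mult_right_mono)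
    finally show ?thesis .
  qed
  have md: "max_Delta ?w (x / real u) q \<ge> 0" if "q \<in> {1..N}" for u q using that by (intro max_Delta_nonneg) auto
  have Y0: "Y \<ge> 0" using Y md by (meson order_trans sum_nonneg)
  have E1: "(\<Sum>q\<in>{1..N}. cmod (class_part ?f1 x q q (a q)) / real (totient q)) \<le> Y"
  proof -
    have "(\<Sum>q\<in>{1..N}. cmod (class_part ?f1 x q q (a q)) / real (totient q))
      \<le> (\<Sum>q\<in>{1..N}. \<Sum>u\<in>nats_upto V. max_Delta ?w (x / real u) q)"
    proof (rule sum_mono)
      fix q assume q: "q \<in> {1..N}"
      have "cmod (class_part ?f1 x q q (a q)) \<le> (\<Sum>u\<in>nats_upto V. real (totient q) * max_Delta ?w (x / real u) q)"
        using q md a by (intro class_part_type1_le[OF f] class_part_le_max_Delta mult_nonneg_nonneg) auto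
      then show "cmod (class_part ?f1 x q q (a q)) / real (totient q) \<le> (\<Sum>u\<in>nats_upto V. max_Delta ?w (x / real u) q)"
        using q by (simp add: sum_distrib_left[symmetric] pos_divide_le_eq mult.commute)
    qed
    also have "\<dots> = (\<Sum>u\<in>nats_upto V. \<Sum>q\<in>{1..N}. max_Delta ?w (x / real u) q)" by (rule sum.swap)
    finally show ?thesis using Y by simp
  qed
  have E2: "(\<Sum>q\<in>{1..N}. cmod (class_part ?f3 x q q (a q)) / real (totient q)) \<le> real N * B0 + 6 * x * h / W + H * T"
  proof -
    have "(\<Sum>q\<in>{1..N}. cmod (class_part ?f3 x q q (a q)) / real (totient q))
      \<le> (\<Sum>q\<in>{1..N}. (B0 + 6 * x / W * (1 / real q)) + T / real (totient q))"
    proof (rule sum_mono)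
      fix q assume q: "q \<in> {1..N}"
      have "cmod (class_part ?f3 x q q (a q)) / real (totient q)
        \<le> (2 + V) * (V * Z\<^sup>2) + 3 * (2 * x / (W * real q) + sqrt x) + norm1 ?f3 x / real (totient q)"
        using q a by (intro Delta_rest_part[OF f V Z W x]) auto
      also have "\<dots> \<le> (B0 + 6 * x / W * (1 / real q)) + T / real (totient q)"
      proof (rule add_mono)
        have "3 * (2 * x / (W * real q) + sqrt x) = 6 * x / W * (1 / real q) + 3 * sqrt x" by simp
        then show "(2 + V) * (V * Z\<^sup>2) + 3 * (2 * x / (W * real q) + sqrt x) \<le> B0 + 6 * x / W * (1 / real q)"
          using B0 by linarith
      qed (intro divide_right_mono n3, simp)
      finally show "cmod (class_part ?f3 x q q (a q)) / real (totient q) \<le> (B0 + 6 * x / W * (1 / real q)) + T / real (totient q)" .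
    qed
    also have "\<dots> = real N * B0 + 6 * x / W * (\<Sum>q\<in>{1..N}. 1 / real q) + (\<Sum>q\<in>{1..N}. T / real (totient q))"
      by (simp only: sum.distrib sum_distrib_left[symmetric] sum_constant) simp
    also have "\<dots> \<le> real N * B0 + 6 * x / W * h + H * T"
      using h x W T0 by (intro add_mono order_refl mult_left_mono weight) auto
    finally show ?thesis by simp
  qed
  have E3: "(\<Sum>k\<in>{1..N}. (\<Sum>r | r \<in> {1..N} \<and> (1 < r \<and> r \<le> R0) \<and> r * k \<le> N. cmod (prim_part f x (r * k) r (a (r * k))) / real (totient r)) / real (totient k))
    \<le> H * ((real R0)\<^sup>2 * (\<delta> * x * (1 + ln x) + 2 * x * S4 / sqrt (sqrt x)))"
  proof (intro weight small_conductors_le)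
    show S0: "0 \<le> \<delta> * x * (1 + ln x) + 2 * x * S4 / sqrt (sqrt x)"
      using \<delta> x S4(2) by (intro add_nonneg_nonneg mult_nonneg_nonneg divide_nonneg_nonneg) auto
    show "0 \<le> (real R0)\<^sup>2 * (\<delta> * x * (1 + ln x) + 2 * x * S4 / sqrt (sqrt x))" using S0 by simp
    fix q d assume q: "q \<in> {1..N}" and d: "d dvd q"
    have ad: "coprime (a q) (int d)" using a[of q] d by (meson coprime_divisors dvd_refl int_dvd_int_iff)
    have "cmod (class_part f x q d (a q)) \<le> real (totient d) * (\<delta> * x * (1 + ln x) + 2 * x * 4 ^ card (prime_factors q) / sqrt (sqrt x))"
      using q by (intro class_part_SW_bound[OF f x d _ ad \<delta> SW]) auto
    also have "\<dots> \<le> real (totient d) * (\<delta> * x * (1 + ln x) + 2 * x * S4 / sqrt (sqrt x))"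
      using S4(1)[OF q] x by (intro mult_left_mono add_left_mono divide_right_mono) auto
    finally show "cmod (class_part f x q d (a q)) \<le> real (totient d) * (\<delta> * x * (1 + ln x) + 2 * x * S4 / sqrt (sqrt x))" .
  qed auto
  have w00: "w0 \<ge> 0" if "N \<ge> 1" using w0[of 1] that by simp
  have E4: "(\<Sum>k\<in>{1..N}. (\<Sum>r | r \<in> {1..N} \<and> (1 < r \<and> r \<le> R0) \<and> r * k \<le> N. cmod (prim_part ?f1 x (r * k) r (a (r * k))) / real (totient r)) / real (totient k))
    \<le> H * (\<Omega> * (Y / S + 4 * w0 * V * real R0))"
  proof (rule weight)
    fix k assume k: "k \<in> {1..N}"
    have "(\<Sum>r | r \<in> {1..N} \<and> (1 < r \<and> r \<le> R0) \<and> r * k \<le> N. cmod (prim_part ?f1 x (r * k) r (a (r * k))) / real (totient r))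
      \<le> \<Omega> * ((\<Sum>u\<in>nats_upto V. \<Sum>q\<in>{1..N}. max_Delta ?w (x / real u) q) / S + 4 * w0 * V * real R0)"
      by (rule type1_small_conductors[OF f V zN k w0 \<Omega> S a])
    also have "\<dots> \<le> \<Omega> * (Y / S + 4 * w0 * V * real R0)"
      using Y S(2) \<Omega>(2) by (intro mult_left_mono add_right_mono divide_right_mono) auto
    finally show "(\<Sum>r | r \<in> {1..N} \<and> (1 < r \<and> r \<le> R0) \<and> r * k \<le> N. cmod (prim_part ?f1 x (r * k) r (a (r * k))) / real (totient r))
      \<le> \<Omega> * (Y / S + 4 * w0 * V * real R0)" .
  next
    \<comment> \<open>Positivity of \<open>S\<close> forces a nonempty range, hence N >= 1, which in
      turn gives w0 >= 0.\<close>
    have "1 \<le> z"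
    proof (rule ccontr)
      assume "\<not> 1 \<le> z"
      then have "S = 0" unfolding S(1) by (intro sum.neutral) auto
      then show False using S(2) by simp
    qed
    then have "1 * 1 \<le> R0 * z" using R0 by (intro mult_le_mono) auto
    then have "N \<ge> 1" using zN by linarith
    then show "0 \<le> \<Omega> * (Y / S + 4 * w0 * V * real R0)"
      using w00 \<Omega>(2) Y0 S(2) V by (intro mult_nonneg_nonneg add_nonneg_nonneg divide_nonneg_nonneg) auto
  qed
  have E5: "(\<Sum>k\<in>{1..N}. (\<Sum>r | r \<in> {1..N} \<and> (1 < r \<and> r \<le> R0) \<and> r * k \<le> N. cmod (prim_part ?f3 x (r * k) r (a (r * k))) / real (totient r)) / real (totient k))
    \<le> H * ((real R0)\<^sup>2 * (2 * T))"
  proof (intro weight small_conductors_le)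
    fix q d assume q: "q \<in> {1..N}" and d: "d dvd q"
    have "cmod (class_part ?f3 x q d (a q)) \<le> 2 * real (totient d) * norm1 ?f3 x"
      using q d dvd_imp_ge_1[of d q] by (intro class_part_le_norm1) auto
    also have "\<dots> \<le> 2 * real (totient d) * T" using n3 by (intro mult_left_mono) auto
    finally show "cmod (class_part ?f3 x q d (a q)) \<le> real (totient d) * (2 * T)" by simp
  qed (use T0 in auto)
  have E6: "(\<Sum>k\<in>{1..N}. (\<Sum>r | r \<in> {1..N} \<and> R0 < r \<and> r * k \<le> N. cmod (prim_part ?f2 x (r * k) r (a (r * k))) / real (totient r)) / real (totient k))
    \<le> H * (16 * (real J + 2)\<^sup>2 * sqrt x * (real J * (sqrt x / real R0 + real N) + 4 * h * (sqrt (x / Z) + sqrt (x / V))))"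
  proof (rule weight)
    have h0: "h \<ge> 0" using h by (rule order_trans[rotated]) (intro add_nonneg_nonneg sum_nonneg, auto)
    have Z1: "Z \<ge> 1" using Z V by simp
    show "0 \<le> 16 * (real J + 2)\<^sup>2 * sqrt x * (real J * (sqrt x / real R0 + real N) + 4 * h * (sqrt (x / Z) + sqrt (x / V)))"
      using h0 x Z1 V by (intro mult_nonneg_nonneg add_nonneg_nonneg divide_nonneg_nonneg) auto
    fix k assume k: "k \<in> {1..N}"
    have ak: "coprime (a (r * k)) (int r)" for r
      using a[of "r * k"] by (meson coprime_divisors dvd_refl dvd_triv_left int_dvd_int_iff)
    have "(\<Sum>r | r \<in> {1..N} \<and> R0 < r \<and> r * k \<le> N. cmod (prim_part ?f2 x (r * k) r (a (r * k))) / real (totient r))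
      \<le> (\<Sum>r\<in>{R0<..N}. cmod (prim_part ?f2 x (r * k) r (a (r * k))) / real (totient r))"
      by (intro sum_mono2) auto
    also have "\<dots> \<le> 16 * (real J + 2)\<^sup>2 * sqrt x * (real J * (sqrt x / real R0 + real N)
       + 4 * (1 + (\<Sum>k\<in>{1..N}. 1 / real k)) * (sqrt (x / Z) + sqrt (x / V)))"
      using R0 by (intro type2_part_bound[OF f _ ak V Z1 x J]) auto
    also have "\<dots> \<le> 16 * (real J + 2)\<^sup>2 * sqrt x * (real J * (sqrt x / real R0 + real N) + 4 * h * (sqrt (x / Z) + sqrt (x / V)))"
      using h x Z1 V by (intro mult_left_mono add_left_mono mult_right_mono) auto
    finally show "(\<Sum>r | r \<in> {1..N} \<and> R0 < r \<and> r * k \<le> N. cmod (prim_part ?f2 x (r * k) r (a (r * k))) / real (totient r)) \<le> \<dots>" .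
  qed
  show ?thesis
    using sum_Delta_decomposition[OF a R0, where N = N and f = f and X = x and V = V and Z = Z] E1 E2 E3 E4 E5 E6 unfolding T_def by linarith
qed

section \<open>Trivial bounds, choice of parameters and conclusion\<close>

lemma nats_upto_set: "{q. 1 \<le> q \<and> real q \<le> Q} = {1..nat \<lfloor>Q\<rfloor>}"
  using nats_upto_eq[of Q] by (simp add: nats_upto_def)

lemma max_Delta_le_trivial:
  assumes f: "f \<in> class_C" and x: "x \<ge> 0" and q: "q \<ge> 1"
  shows "max_Delta f x q \<le> 2 * x"
proof -
  obtain a where a: "coprime a (int q)" "max_Delta f x q = cmod (Delta f x q a)"
    using max_Delta_attained[OF q] by blast
  have t: "real (totient q) > 0" using q by simp
  have "real (totient q) * cmod (Delta f x q a) = cmod (class_part f x q q a)"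
    unfolding Delta_class_part[OF q a(1), symmetric] by (simp add: norm_mult)
  also have "\<dots> \<le> 2 * real (totient q) * norm1 f x" by (rule class_part_le_norm1[OF q])
  also have "\<dots> \<le> 2 * real (totient q) * x" by (intro mult_left_mono norm1_class_C f x) auto
  finally have "real (totient q) * cmod (Delta f x q a) \<le> real (totient q) * (2 * x)" by simp
  then show ?thesis using t a(2) by simp
qed

lemma sum_max_Delta_le_trivial:
  assumes f: "f \<in> class_C" and x: "x \<ge> 0" and Q: "Q \<ge> 0"
  shows "(\<Sum>q | 1 \<le> q \<and> real q \<le> Q. max_Delta f x q) \<le> 2 * x * Q"
proof -
  have "(\<Sum>q\<in>nats_upto Q. max_Delta f x q) \<le> (\<Sum>q\<in>nats_upto Q. 2 * x)"
    by (intro sum_mono max_Delta_le_trivial f x) (auto simp: nats_upto_def)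
  also have "\<dots> \<le> 2 * x * Q" using mult_right_mono[OF card_upto_le[OF Q] x] by (simp add: mult.commute)
  finally show ?thesis by (simp add: nats_upto_def)
qed

lemma rough_sum_lower:
  assumes R0: "R0 \<le> 2 ^ m" and m: "m \<ge> 1"
  shows "ln (real z + 1) \<le> exp 5 * real m ^ 4 * (\<Sum>k | k \<in> {1..z} \<and> prime_factors k \<inter> {p. prime p \<and> p \<le> R0} = {}. 1 / real k)"
proof -
  let ?S = "\<Sum>k | k \<in> {1..z} \<and> prime_factors k \<inter> {p. prime p \<and> p \<le> R0} = {}. 1 / real k"
  have g1: "1 / (1 - 1 / real p) \<ge> 1" if "prime p" for p
  proof -
    have "real p \<ge> 2" using prime_ge_2_nat[OF that] by simp
    then show ?thesis by (simp add: field_simps)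
  qed
  have "ln (real z + 1) \<le> (\<Prod>p | prime p \<and> p \<le> R0. 1 / (1 - 1 / real p)) * ?S"
    by (rule rough_sum_ge) auto
  also have "\<dots> \<le> (\<Prod>p | prime p \<and> p \<le> 2 ^ m. 1 / (1 - 1 / real p)) * ?S"
  proof (intro mult_right_mono prod_mono2)
    show "{p. prime p \<and> p \<le> R0} \<subseteq> {p. prime p \<and> p \<le> 2 ^ m}" using R0 by auto
    show "1 \<le> 1 / (1 - 1 / real p)" if "p \<in> {p. prime p \<and> p \<le> 2 ^ m} - {p. prime p \<and> p \<le> R0}" for p
      using that g1 by simp
    show "0 \<le> 1 / (1 - 1 / real p)" if "p \<in> {p. prime p \<and> p \<le> R0}" for p
      by (rule order_trans[OF zero_le_one g1]) (use that in simp)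
  qed (auto intro: sum_nonneg)
  also have "\<dots> \<le> exp 5 * real m ^ 4 * ?S"
    by (intro mult_right_mono prod_primes_le[OF m] sum_nonneg) auto
  finally show ?thesis .
qed

text \<open>In order after ln x >= 3: the short range V^2 Z^2 of the remainder is below sqrt x; W <=
  sqrt x; the Rankin tail x^(13/16) absorbs its logarithms; the error from changing cofactors is
  small; the range of rough cofactors reaches x^(1/4); a fourth power of log log x is below (log
  x)^(1/4).\<close>

lemma eventually_parameters:
  fixes A B \<gamma> :: real
  assumes A: "A \<ge> 0"
  shows "\<exists>x0\<ge>2. \<forall>x\<ge>x0. ln x \<ge> 3
    \<and> ln x powr (4 * \<gamma> + 18 * A + 62) \<le> x powr (1/2)
    \<and> ln x powr (3 * A + 10) \<le> x powr (1/2)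
    \<and> ln x powr (3 * A + 6) \<le> x powr (3/16)
    \<and> ln x powr (\<gamma> + 2 * A + 5) \<le> x
    \<and> ln x powr (A + B + 5) \<le> x powr (1/4)
    \<and> (2 * (A + 3) * ln (ln x) + 2) ^ 4 \<le> ln x powr (1/4)"
proof -
  define a where "a = 2 * (A + 3)"
  have a: "a > 0" using A by (simp add: a_def)
  have "\<forall>\<^sub>F x::real in at_top. ln x \<ge> 3" by real_asymp
  moreover have "\<forall>\<^sub>F x::real in at_top. ln x powr (4 * \<gamma> + 18 * A + 62) \<le> x powr (1/2)" by real_asymp
  moreover have "\<forall>\<^sub>F x::real in at_top. ln x powr (3 * A + 10) \<le> x powr (1/2)" by real_asymp
  moreover have "\<forall>\<^sub>F x::real in at_top. ln x powr (3 * A + 6) \<le> x powr (3/16)" by real_asymp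
  moreover have "\<forall>\<^sub>F x::real in at_top. ln x powr (\<gamma> + 2 * A + 5) \<le> x" by real_asymp
  moreover have "\<forall>\<^sub>F x::real in at_top. ln x powr (A + B + 5) \<le> x powr (1/4)" by real_asymp
  moreover have "\<forall>\<^sub>F x::real in at_top. (a * ln (ln x) + 2) ^ 4 \<le> ln x powr (1/4)" using a by real_asymp
  ultimately have "\<forall>\<^sub>F x::real in at_top. ln x \<ge> 3
    \<and> ln x powr (4 * \<gamma> + 18 * A + 62) \<le> x powr (1/2)
    \<and> ln x powr (3 * A + 10) \<le> x powr (1/2)
    \<and> ln x powr (3 * A + 6) \<le> x powr (3/16)
    \<and> ln x powr (\<gamma> + 2 * A + 5) \<le> x
    \<and> ln x powr (A + B + 5) \<le> x powr (1/4)
    \<and> (2 * (A + 3) * ln (ln x) + 2) ^ 4 \<le> ln x powr (1/4)"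
    unfolding a_def by eventually_elim blast
  then obtain x1 where "\<And>x. x \<ge> x1 \<Longrightarrow> ln x \<ge> 3
    \<and> ln x powr (4 * \<gamma> + 18 * A + 62) \<le> x powr (1/2)
    \<and> ln x powr (3 * A + 10) \<le> x powr (1/2)
    \<and> ln x powr (3 * A + 6) \<le> x powr (3/16)
    \<and> ln x powr (\<gamma> + 2 * A + 5) \<le> x
    \<and> ln x powr (A + B + 5) \<le> x powr (1/4)
    \<and> (2 * (A + 3) * ln (ln x) + 2) ^ 4 \<le> ln x powr (1/4)"
    unfolding eventually_at_top_linorder by blast
  then show ?thesis by (intro exI[of _ "max x1 2"]) auto
qed

text \<open>Every term of \<open>main_inequality\<close> is compared with T = x (log x)^(1 - A).
  With all parameters powers of L = log x, apart from the bounds in powers of x, this is a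
  comparison of exponents.\<close>

lemma bound_for_large_x:
  fixes A B \<gamma> K1 K2 C2 C4 x :: real
  assumes A: "A \<ge> 0" and B: "B > A + 5" and \<gamma>: "\<gamma> > 2 * A + 6" and K: "K1 \<ge> 0" "K2 \<ge> 0" and C: "C2 \<ge> 0" "C4 \<ge> 0"
    and C2: "\<And>k. k \<ge> 1 \<Longrightarrow> 2 ^ card (prime_factors k) \<le> C2 * real k powr (1 / (4 * (A + 3)))"
    and C4: "\<And>k. k \<ge> 1 \<Longrightarrow> 4 ^ card (prime_factors k) \<le> C4 * real k powr (1 / 16)"
    and x2: "x \<ge> 2" and L3: "ln x \<ge> 3"
    and p1: "ln x powr (4 * \<gamma> + 18 * A + 62) \<le> x powr (1/2)"
    and p2: "ln x powr (3 * A + 10) \<le> x powr (1/2)"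
    and p3: "ln x powr (3 * A + 6) \<le> x powr (3/16)"
    and p4: "ln x powr (\<gamma> + 2 * A + 5) \<le> x"
    and p5: "ln x powr (A + B + 5) \<le> x powr (1/4)"
    and p6: "(2 * (A + 3) * ln (ln x) + 2) ^ 4 \<le> ln x powr (1/4)"
    and f: "f \<in> class_C" and N: "N = nat \<lfloor>x powr (1/2) / (ln x) powr B\<rfloor>"
    and P: "\<And>u. u \<in> nats_upto (ln x powr \<gamma>) \<Longrightarrow>
       (\<Sum>q\<in>{1..N}. max_Delta (on_primes f) (x / real u) q) \<le> K1 * (x / real u / (ln x powr A * ln (ln x powr \<gamma>)))"
    and SW: "\<And>X q a. sqrt x \<le> X \<Longrightarrow> X \<le> x \<Longrightarrow> q \<ge> 1 \<Longrightarrow> coprime a (int q) \<Longrightarrow>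
       cmod (Delta f X q a) \<le> X * (K2 / ln x powr (A + 2 * B))"
  shows "(\<Sum>q\<in>{1..N}. max_Delta f x q)
     \<le> (2 * K1 + 80000 + 48 * K2 + 240 * C4 + 96 * exp 5 * C2 * K1 + 192 * C2) * (x * ln x powr (1 - A))"
proof -
  define L where "L = ln x"
  define T where "T = x * L powr (1 - A)"
  \<comment> \<open>The type II part loses L^4 and has to end at L^(1 - A).\<close>
  define \<rho> where "\<rho> = L powr (A + 3)"
  define R0 where "R0 = nat \<lceil>\<rho>\<rceil>"
  define V where "V = L powr \<gamma>"
  \<comment> \<open>At small conductors the remainder meets a factor L R0^2 of size L^(2A + 7);
    dividing by \<open>W\<close> leaves L^(-A - 3). The next choice of \<open>Z\<close> fulfils both
    lower bounds required of it.\<close>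
  define W where "W = L powr (3 * A + 10)"
  define Z where "Z = W ^ 3 * V"
  define \<delta> where "\<delta> = K2 / L powr (A + 2 * B)"
  define J where "J = nat \<lfloor>log 2 x\<rfloor> + 1"
  define z where "z = N div R0"
  define S where "S = (\<Sum>k | k \<in> {1..z} \<and> prime_factors k \<inter> {p. prime p \<and> p \<le> R0} = {}. 1 / real k)"
  \<comment> \<open>The exponent 1 / (4 (A + 3)) in the divisor bound is chosen so that \<rho>
    raised to it is L^(1/4).\<close>
  define \<Omega> where "\<Omega> = 2 * C2 * L powr (1/4)"
  define S4 where "S4 = C4 * x powr (1/16)"
  define Y where "Y = 2 * K1 * (x * L powr (- A))"
  note p = p1 p2 p3 p4 p5 p6 L3
  note p = p[folded L_def]
  have L1: "L \<ge> 1" "L > 0" "L \<ge> 3" using p(7) by auto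
  have x0: "x > 0" "x \<ge> 1" using x2 by auto
  have mono: "L powr s \<le> L powr t" if "s \<le> t" for s t using that L1 by (intro powr_mono) auto
  have ge1: "L powr s \<ge> 1" if "s \<ge> 0" for s using mono[OF that] L1 by simp
  have pos: "L powr s > 0" for s using L1 by simp
  have sx: "x powr (1/2) = sqrt x" using x0 by (simp add: powr_half_sqrt)
  have T0: "T \<ge> 0" using x0 by (simp add: T_def)
  have leT: "x * L powr s \<le> T" if "s \<le> 1 - A" for s
    unfolding T_def using mono[OF that] x0 by (intro mult_left_mono) auto
  have L_powr: "L = L powr 1" "L ^ 2 = L powr 2" "L ^ 3 = L powr 3" "L ^ 4 = L powr 4"
    using L1 by (simp_all add: powr_numeral)
  have \<rho>1: "\<rho> \<ge> 1" unfolding \<rho>_def using A by (intro ge1) simp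
  have R0: "R0 \<ge> 1" "\<rho> \<le> real R0" "real R0 \<le> 2 * \<rho>" using \<rho>1 unfolding R0_def by linarith+
  have V1: "V \<ge> 1" unfolding V_def using A \<gamma> by (intro ge1) simp
  have W1: "W \<ge> 1" unfolding W_def using A by (intro ge1) simp
  have Z: "W ^ 3 \<le> Z" "V \<le> Z" using V1 W1 by (simp_all add: Z_def mult_le_cancel_left1 mult_le_cancel_right1 one_le_power)
  \<comment> \<open>Ensures that z + 1 is at least x^(1/4), so that log (z + 1) is at least a
    quarter of log x.\<close>
  have Q1: "x powr (1/2) / L powr B \<ge> 4 * \<rho> * x powr (1/4)"
  proof -
    have "4 * \<rho> * L powr B \<le> L powr 2 * \<rho> * L powr B"
    proof -
      have "3\<^sup>2 \<le> L\<^sup>2" using L1 by (intro power_mono) auto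
      then show ?thesis unfolding L_powr(2)[symmetric] using \<rho>1 by (intro mult_right_mono) auto
    qed
    also have "\<dots> = L powr (A + B + 5)" unfolding \<rho>_def powr_add[symmetric] by (simp add: algebra_simps)
    also have "\<dots> \<le> x powr (1/4)" by (rule p(5))
    finally have "4 * \<rho> * L powr B * x powr (1/4) \<le> x powr (1/4) * x powr (1/4)"
      by (intro mult_right_mono) auto
    also have "\<dots> = x powr (1/2)" by (simp flip: powr_add)
    finally show ?thesis using pos[of B] by (simp add: pos_le_divide_eq mult_ac)
  qed
  define Q where "Q = x powr (1/2) / L powr B"
  have x14: "x powr (1/4) \<ge> 1" using x0 by (simp add: ge_one_powr_ge_zero)
  have "4 * \<rho> * 1 \<le> 4 * \<rho> * x powr (1/4)" using x14 \<rho>1 by (intro mult_left_mono) auto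
  then have Q4: "Q \<ge> 4 * \<rho>" using Q1 unfolding Q_def by linarith
  have NQ: "N = nat \<lfloor>Q\<rfloor>" by (simp add: N Q_def L_def)
  have N1: "N \<ge> 1" "real N \<le> Q" "Q \<le> real N + 1" using Q4 \<rho>1 unfolding NQ by linarith+
  have Qs: "Q \<le> sqrt x"
    unfolding Q_def sx using ge1[of B] A B x0 pos[of B] by (simp add: divide_le_eq mult_le_cancel_left1)
  have Nx: "real N \<le> sqrt x" using N1 Qs by simp
  have sxx: "sqrt x \<le> x" using x0 by (simp add: real_le_lsqrt power2_eq_square)
  have lnN: "ln (real N) \<le> L / 2"
  proof -
    have "ln (real N) \<le> ln (sqrt x)" using Nx N1 by (intro ln_mono) auto
    then show ?thesis using x0 by (simp add: ln_sqrt L_def)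
  qed
  have H: "(\<Sum>k\<in>{1..N}. 1 / real (totient k)) \<le> 6 * L"
    by (rule order_trans[OF sum_inverse_totient_le[OF N1(1)]]) (use lnN L1 in simp)
  have h: "1 + (\<Sum>k\<in>{1..N}. 1 / real k) \<le> 3 * L"
    using harmonic_upper[OF N1(1)] lnN L1 by linarith
  have lg: "log 2 x \<le> 2 * L" "log 2 x \<ge> 1"
  proof -
    have "ln (2::real) \<ge> 1 / 2" using ln_add_one_self_le_self2[of "-1/2"] ln_div[of 1 2] by simp
    then have "L / ln 2 \<le> L / (1 / 2)" using L1 by (intro divide_left_mono) auto
    then show "log 2 x \<le> 2 * L" by (simp add: log_def L_def)
    show "log 2 x \<ge> 1" using x2 by simp
  qed
  have J: "x < 2 ^ J" "real J \<le> 3 * L"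
  proof -
    have "log 2 x < real J" using lg unfolding J_def by linarith
    then have "2 powr log 2 x < 2 powr real J" by simp
    then show "x < 2 ^ J" using x0 by (simp add: powr_realpow)
    show "real J \<le> 3 * L" using lg L1 unfolding J_def by linarith
  qed
  have zN: "R0 * z \<le> N" by (simp add: z_def)
  have lnz: "ln (real z + 1) \<ge> L / 4"
  proof -
    have "N < R0 * (z + 1)" using R0(1) unfolding z_def
      by (metis Suc_eq_plus1 dividend_less_times_div mult.commute mult_Suc_right One_nat_def Suc_le_lessD add.commute)
    then have "real N < real (R0 * (z + 1))" by (simp only: of_nat_less_iff)
    then have "real N < real R0 * (real z + 1)" by (simp add: algebra_simps)
    also have "\<dots> \<le> 2 * \<rho> * (real z + 1)" using R0(3) by (intro mult_right_mono) auto
    finally have "real N < 2 * \<rho> * (real z + 1)" .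
    moreover have "4 * \<rho> * x powr (1/4) \<le> 2 * real N"
    proof -
      have "Q \<le> 2 * real N" using N1 by simp
      then show ?thesis using Q1 by (simp add: Q_def)
    qed
    ultimately have "2 * \<rho> * x powr (1/4) < 2 * \<rho> * (real z + 1)" by linarith
    then have "x powr (1/4) \<le> real z + 1" using \<rho>1 by simp
    then have "ln (x powr (1/4)) \<le> ln (real z + 1)" using x0 by (intro ln_mono) auto
    then show ?thesis using x0 by (simp add: ln_powr L_def)
  qed
  \<comment> \<open>The Euler product over primes up to \<open>R0\<close> is a power of log log x,
    hence costs at most L^(1/4) of the logarithm supplied by the rough cofactors.\<close>
  have S: "S \<ge> L powr (3/4) / (4 * exp 5)" "S > 0"
  proof -
    define m where "m = nat \<lceil>log 2 (2 * \<rho>)\<rceil>"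
    have l1: "log 2 (2 * \<rho>) = 1 + log 2 \<rho>" using \<rho>1 by (simp add: log_mult)
    have l2: "log 2 \<rho> \<ge> 0" using \<rho>1 by simp
    have m1: "m \<ge> 1" "log 2 (2 * \<rho>) \<le> real m" "real m \<le> log 2 \<rho> + 2" using l1 l2 unfolding m_def by linarith+
    have "2 * \<rho> \<le> 2 ^ m"
    proof -
      have "2 * \<rho> = 2 powr log 2 (2 * \<rho>)" using \<rho>1 by simp
      also have "\<dots> \<le> 2 powr real m" using m1 by simp
      finally show ?thesis by (simp add: powr_realpow)
    qed
    then have "real R0 \<le> 2 ^ m" using R0(3) by linarith
    then have R0m: "R0 \<le> 2 ^ m" by (metis of_nat_le_iff of_nat_numeral of_nat_power)
    have "log 2 \<rho> \<le> 2 * (A + 3) * ln L"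
    proof -
      have "ln (2::real) \<ge> 1 / 2" using ln_add_one_self_le_self2[of "-1/2"] ln_div[of 1 2] by simp
      moreover have "(A + 3) * ln L \<ge> 0" using A L1 by simp
      ultimately have "(A + 3) * ln L / ln 2 \<le> (A + 3) * ln L / (1 / 2)" by (intro divide_left_mono) auto
      moreover have "log 2 \<rho> = (A + 3) * ln L / ln 2" using L1 by (simp add: \<rho>_def log_def ln_powr)
      moreover have "(A + 3) * ln L / (1 / 2) = 2 * (A + 3) * ln L" by simp
      ultimately show ?thesis by (simp only:)
    qed
    then have "real m ^ 4 \<le> (2 * (A + 3) * ln L + 2) ^ 4" using m1 by (intro power_mono) auto
    also have "\<dots> \<le> L powr (1/4)" by (rule p(6))
    finally have m4: "real m ^ 4 \<le> L powr (1/4)" .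
    have S0: "S \<ge> 0" unfolding S_def by (intro sum_nonneg) auto
    have "L / 4 \<le> exp 5 * real m ^ 4 * S" using lnz rough_sum_lower[OF R0m m1(1), of z] unfolding S_def by linarith
    also have "\<dots> \<le> exp 5 * L powr (1/4) * S" using m4 S0 by (intro mult_right_mono mult_left_mono) auto
    finally have "L \<le> 4 * exp 5 * S * L powr (1/4)" by (simp add: mult_ac)
    moreover have "L = L powr (3/4) * L powr (1/4)" using L1 by (simp flip: powr_add)
    ultimately have "L powr (3/4) * L powr (1/4) \<le> 4 * exp 5 * S * L powr (1/4)" by simp
    then have "L powr (3/4) \<le> 4 * exp 5 * S" using pos[of "1/4"] by (simp add: mult_le_cancel_right)
    then show "S \<ge> L powr (3/4) / (4 * exp 5)" by (simp add: pos_divide_le_eq mult.commute)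
    then show "S > 0" using pos[of "3/4"] by (smt (verit) divide_pos_pos exp_gt_zero)
  qed
  have w0: "real (card (prime_factors q)) \<le> 2 * L" if q: "q \<in> {1..N}" for q
  proof -
    have "2 ^ card (prime_factors q) \<le> q" using q by (intro two_power_omega_le) auto
    then have "real (2 ^ card (prime_factors q)) \<le> real q" by (simp only: of_nat_le_iff)
    then have "2 powr real (card (prime_factors q)) \<le> real q" by (simp add: powr_realpow)
    also have "\<dots> \<le> x" using q Nx sxx by simp
    also have "x = 2 powr log 2 x" using x0 by simp
    finally have "real (card (prime_factors q)) \<le> log 2 x" by simp
    then show ?thesis using lg by simp
  qed
  have \<Omega>: "2 ^ card (prime_factors r) \<le> \<Omega>" if r: "r \<in> {1..R0}" for r
  proof -
    define \<epsilon> where "\<epsilon> = 1 / (4 * (A + 3))"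
    have \<epsilon>: "0 \<le> \<epsilon>" "\<epsilon> \<le> 1" using A by (auto simp: \<epsilon>_def)
    have "2 ^ card (prime_factors r) \<le> C2 * real r powr \<epsilon>" unfolding \<epsilon>_def using r by (intro C2) auto
    also have "\<dots> \<le> C2 * (2 * \<rho>) powr \<epsilon>"
    proof -
      have "real r \<le> real R0" using r by simp
      then have "real r \<le> 2 * \<rho>" using R0(3) by linarith
      then show ?thesis using C(1) \<epsilon> by (intro mult_left_mono powr_mono2) auto
    qed
    also have "(2 * \<rho>) powr \<epsilon> = 2 powr \<epsilon> * L powr (1/4)"
    proof -
      have "(A + 3) * \<epsilon> = 1 / 4" using A by (simp add: \<epsilon>_def field_simps)
      then have "\<rho> powr \<epsilon> = L powr (1/4)" unfolding \<rho>_def powr_powr by (rule arg_cong)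
      then show ?thesis using \<rho>1 by (subst powr_mult) auto
    qed
    also have "C2 * \<dots> \<le> C2 * (2 * L powr (1/4))"
      using C(1) \<epsilon> powr_mono[of \<epsilon> 1 2] by (intro mult_left_mono mult_right_mono) auto
    finally show ?thesis by (simp add: \<Omega>_def)
  qed
  have S4: "4 ^ card (prime_factors q) \<le> S4" if q: "q \<in> {1..N}" for q
  proof -
    have "4 ^ card (prime_factors q) \<le> C4 * real q powr (1/16)" using q by (intro C4) auto
    also have "\<dots> \<le> C4 * x powr (1/16)" using q Nx sxx C(2) by (intro mult_left_mono powr_mono2) auto
    finally show ?thesis by (simp add: S4_def)
  qed
  have lnV: "ln V \<ge> 1"
  proof -
    have "exp 1 \<le> (3::real)" by (rule exp_le)
    then have "exp 1 \<le> L" using L1 by linarith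
    then have "ln L \<ge> 1" using L1 by (subst ln_ge_iff) auto
    then have "1 * 1 \<le> \<gamma> * ln L" using A \<gamma> by (intro mult_mono) auto
    then show ?thesis using L1 by (simp add: V_def ln_powr)
  qed
  \<comment> \<open>The harmonic sum over u <= V is of size ln V = ln (x / y) and cancels the
    logarithm in the denominator of the hypothesis on primes.\<close>
  have Y: "(\<Sum>u\<in>nats_upto V. \<Sum>q\<in>{1..N}. max_Delta (on_primes f) (x / real u) q) \<le> Y"
  proof -
    have "(\<Sum>u\<in>nats_upto V. \<Sum>q\<in>{1..N}. max_Delta (on_primes f) (x / real u) q)
      \<le> (\<Sum>u\<in>nats_upto V. K1 * (x / real u / (L powr A * ln V)))"
      unfolding L_def V_def by (intro sum_mono P) (simp add: L_def)
    also have "\<dots> = K1 * x / (L powr A * ln V) * (\<Sum>u\<in>nats_upto V. 1 / real u)"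
      unfolding sum_distrib_left by (intro sum.cong refl) (simp add: mult_ac)
    also have "\<dots> \<le> K1 * x / (L powr A * ln V) * (1 + ln V)"
      using K x0 pos[of A] lnV by (intro mult_left_mono sum_div_upto_le V1) auto
    also have "\<dots> \<le> K1 * x / (L powr A * ln V) * (2 * ln V)"
      using K x0 pos[of A] lnV by (intro mult_left_mono) auto
    also have "\<dots> = Y" using lnV by (simp add: Y_def powr_minus divide_inverse)
    finally show ?thesis .
  qed
  have B0: "(2 + V) * (V * Z\<^sup>2) + 3 * sqrt x \<le> 4 * sqrt x"
  proof -
    have V4: "V ^ 4 = L powr (4 * \<gamma>)" unfolding V_def using L1 by (simp add: powr_power mult.commute)
    have W6: "W ^ 6 = L powr (6 * (3 * A + 10))" unfolding W_def using L1 by (simp add: powr_power mult.commute)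
    have "(2 + V) * (V * Z\<^sup>2) \<le> (3 * V) * (V * Z\<^sup>2)" using V1 by (intro mult_right_mono) auto
    also have "\<dots> = 3 * (V ^ 4 * W ^ 6)" by (simp add: Z_def power_mult_distrib power2_eq_square eval_nat_numeral)
    also have "\<dots> \<le> L powr 2 * (V ^ 4 * W ^ 6)"
    proof (rule mult_right_mono)
      have "3\<^sup>2 \<le> L\<^sup>2" using L1 by (intro power_mono) auto
      then show "3 \<le> L powr 2" by (simp add: L_powr(2)[symmetric])
    qed (use V1 W1 in auto)
    also have "\<dots> = L powr (4 * \<gamma> + 18 * A + 62)" unfolding V4 W6 powr_add[symmetric] by (simp add: algebra_simps)
    also have "\<dots> \<le> sqrt x" using p(1) sx by simp
    finally show ?thesis by simp
  qed
  have SW': "cmod (Delta f X q a) \<le> X * \<delta>" if "sqrt x \<le> X" "X \<le> x" "q \<ge> 1" "coprime a (int q)" for X q a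
    unfolding \<delta>_def L_def using that by (rule SW)
  \<comment> \<open>A residue attaining the maximum for each \<open>q\<close>; the value 1 at q = 0
    makes coprimality hold for every \<open>q\<close>.\<close>
  define a where "a = (\<lambda>q. if q \<ge> 1 then (SOME a. coprime a (int q) \<and> max_Delta f x q = cmod (Delta f x q a)) else 1)"
  have aq: "coprime (a q) (int q) \<and> max_Delta f x q = cmod (Delta f x q (a q))" if "q \<ge> 1" for q
    using someI_ex[OF max_Delta_attained[OF that, of f x]] that by (simp add: a_def)
  have a: "coprime (a q) (int q)" for q using aq[of q] by (cases "q \<ge> 1") (auto simp: a_def)
  have "(\<Sum>q\<in>{1..N}. max_Delta f x q) = (\<Sum>q\<in>{1..N}. cmod (Delta f x q (a q)))"
    using aq by (intro sum.cong refl) auto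
  also have "\<dots> \<le> Y + (real N * (4 * sqrt x) + 6 * x * (3 * L) / W + 6 * L * (4 * sqrt x + 6 * x / W))
     + 6 * L * ((real R0)\<^sup>2 * (\<delta> * x * (1 + ln x) + 2 * x * S4 / sqrt (sqrt x)))
     + 6 * L * (\<Omega> * (Y / S + 4 * (2 * L) * V * real R0))
     + 6 * L * ((real R0)\<^sup>2 * (2 * (4 * sqrt x + 6 * x / W)))
     + 6 * L * (16 * (real J + 2)\<^sup>2 * sqrt x * (real J * (sqrt x / real R0 + real N) + 4 * (3 * L) * (sqrt (x / Z) + sqrt (x / V))))"
    by (rule main_inequality[OF f x0(2) R0(1) V1 W1 Z a J(1) _ SW' S4 _ zN w0 \<Omega> _ S_def S(2) H h Y B0])
      (use K C pos x0 in \<open>auto simp: \<delta>_def S4_def \<Omega>_def intro!: divide_nonneg_nonneg mult_nonneg_nonneg\<close>)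
  finally have main: "(\<Sum>q\<in>{1..N}. max_Delta f x q) \<le> \<dots>" .
  have t1: "Y \<le> 2 * K1 * T"
    unfolding Y_def using K leT[of "- A"] by (intro mult_left_mono) auto
  have t2: "real N * (4 * sqrt x) \<le> 4 * T"
  proof -
    have "real N * (4 * sqrt x) \<le> Q * (4 * sqrt x)" using N1 x0 by (intro mult_right_mono) auto
    also have "\<dots> = 4 * (x * L powr (- B))" unfolding Q_def sx using x0 by (simp add: powr_minus divide_inverse mult_ac)
    also have "\<dots> \<le> 4 * T" using leT[of "- B"] A B by simp
    finally show ?thesis .
  qed
  have W: "x / W = x * L powr (- (3 * A + 10))" unfolding W_def powr_minus divide_inverse ..
  have LW: "L * (x / W) = x * L powr (1 - (3 * A + 10))"
  proof -
    have "L * (x / W) = x * (L powr 1 * L powr (- (3 * A + 10)))" unfolding W using L1 by simp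
    then show ?thesis by (simp only: powr_add[symmetric] diff_conv_add_uminus)
  qed
  have t3: "6 * x * (3 * L) / W \<le> 18 * T"
  proof -
    have "6 * x * (3 * L) / W = 18 * (L * (x / W))" by simp
    also have "\<dots> \<le> 18 * T" unfolding LW using leT[of "1 - (3 * A + 10)"] A by simp
    finally show ?thesis .
  qed
  have sW: "4 * sqrt x + 6 * x / W \<le> 10 * (x / W)"
  proof -
    have "sqrt x * W \<le> sqrt x * sqrt x" using p(2) sx x0 by (intro mult_left_mono) (auto simp: W_def)
    then have "sqrt x \<le> x / W" using W1 x0 by (simp add: pos_le_divide_eq)
    then show ?thesis by simp
  qed
  have t4: "6 * L * (4 * sqrt x + 6 * x / W) \<le> 60 * T"
  proof -
    have "6 * L * (4 * sqrt x + 6 * x / W) \<le> 6 * L * (10 * (x / W))" using sW L1 by (intro mult_left_mono) auto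
    also have "\<dots> = 60 * (L * (x / W))" by simp
    also have "\<dots> \<le> 60 * T" unfolding LW using leT[of "1 - (3 * A + 10)"] A by simp
    finally show ?thesis .
  qed
  have R2: "(real R0)\<^sup>2 \<le> 4 * L powr (2 * A + 6)"
  proof -
    have "(real R0)\<^sup>2 \<le> (2 * \<rho>)\<^sup>2" using R0 by (intro power_mono) auto
    also have "\<dots> = 4 * (\<rho> * \<rho>)" by (simp add: power2_eq_square)
    also have "\<rho> * \<rho> = L powr (2 * A + 6)" unfolding \<rho>_def powr_add[symmetric] by (simp add: algebra_simps)
    finally show ?thesis .
  qed
  \<comment> \<open>The saving L^(A + 2B) of the hypothesis on \<open>f\<close> meets R0^2 and two
    logarithms, leaving the exponent A + 8 - 2B <= 1 - A.\<close>
  have t5: "6 * L * ((real R0)\<^sup>2 * (\<delta> * x * (1 + ln x) + 2 * x * S4 / sqrt (sqrt x))) \<le> (48 * K2 + 48 * C4) * T"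
  proof -
    have ssx: "sqrt (sqrt x) = x powr (1/4)" using x0 by (simp add: powr_half_sqrt[symmetric] powr_powr)
    have e1: "\<delta> * x * (1 + ln x) \<le> 2 * K2 * (x * L powr (1 - A - 2 * B))"
    proof -
      have "\<delta> * x * (1 + ln x) \<le> \<delta> * x * (2 * L)"
        using K x0 L1 by (intro mult_left_mono) (auto simp: \<delta>_def L_def)
      also have "\<dots> = 2 * K2 * x * (L powr 1 / L powr (A + 2 * B))" using L1 by (simp add: \<delta>_def)
      also have "L powr 1 / L powr (A + 2 * B) = L powr (1 - A - 2 * B)" by (simp only: powr_diff[symmetric] diff_diff_eq)
      finally show ?thesis by simp
    qed
    have e2: "2 * x * S4 / sqrt (sqrt x) = 2 * C4 * x powr (13/16)"
    proof -
      have "2 * x * S4 / sqrt (sqrt x) = 2 * C4 * (x powr 1 * x powr (1/16) / x powr (1/4))"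
        using x0 by (simp add: S4_def ssx)
      also have "x powr 1 * x powr (1/16) / x powr (1/4) = x powr (13/16)"
        by (simp only: powr_add[symmetric] powr_diff[symmetric]) simp
      finally show ?thesis .
    qed
    have e4: "L powr 1 * L powr (2 * A + 6) * x powr (13/16) \<le> T"
    proof -
      have "L powr 1 * L powr (2 * A + 6) = L powr (3 * A + 6) * L powr (1 - A)"
        by (simp only: powr_add[symmetric]) (simp add: algebra_simps)
      then have "L powr 1 * L powr (2 * A + 6) * x powr (13/16) = L powr (3 * A + 6) * (L powr (1 - A) * x powr (13/16))" by simp
      also have "\<dots> \<le> x powr (3/16) * (L powr (1 - A) * x powr (13/16))" using p(3) by (intro mult_right_mono) auto
      also have "\<dots> = (x powr (3/16) * x powr (13/16)) * L powr (1 - A)" by simp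
      also have "x powr (3/16) * x powr (13/16) = x" using x0 by (simp flip: powr_add)
      finally show ?thesis by (simp add: T_def)
    qed
    have d0: "\<delta> \<ge> 0" "ln x \<ge> 0" using K L1 by (auto simp: \<delta>_def L_def)
    have e3: "(real R0)\<^sup>2 * (\<delta> * x * (1 + ln x) + 2 * C4 * x powr (13/16))
      \<le> (4 * L powr (2 * A + 6)) * (2 * K2 * (x * L powr (1 - A - 2 * B)) + 2 * C4 * x powr (13/16))"
    proof (rule mult_mono[OF R2])
      show "\<delta> * x * (1 + ln x) + 2 * C4 * x powr (13/16) \<le> 2 * K2 * (x * L powr (1 - A - 2 * B)) + 2 * C4 * x powr (13/16)"
        using e1 by simp
      show "0 \<le> \<delta> * x * (1 + ln x) + 2 * C4 * x powr (13/16)"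
        using d0 C x0 by (intro add_nonneg_nonneg mult_nonneg_nonneg) auto
    qed simp
    have "6 * L * ((real R0)\<^sup>2 * (\<delta> * x * (1 + ln x) + 2 * x * S4 / sqrt (sqrt x)))
      \<le> 6 * L * ((4 * L powr (2 * A + 6)) * (2 * K2 * (x * L powr (1 - A - 2 * B)) + 2 * C4 * x powr (13/16)))"
      unfolding e2 using e3 L1 by (intro mult_left_mono) auto
    also have "\<dots> = 48 * K2 * (x * (L powr 1 * L powr (2 * A + 6) * L powr (1 - A - 2 * B))) + 48 * C4 * (L powr 1 * L powr (2 * A + 6) * x powr (13/16))"
      using L1 by (simp add: algebra_simps)
    also have "L powr 1 * L powr (2 * A + 6) * L powr (1 - A - 2 * B) = L powr (A + 8 - 2 * B)"
      by (simp only: powr_add[symmetric]) (simp add: algebra_simps)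
    also have "48 * K2 * (x * L powr (A + 8 - 2 * B)) + 48 * C4 * (L powr 1 * L powr (2 * A + 6) * x powr (13/16)) \<le> 48 * K2 * T + 48 * C4 * T"
      using K C e4 leT[of "A + 8 - 2 * B"] A B by (intro add_mono mult_left_mono) auto
    finally show ?thesis by (simp only: distrib_right)
  qed
  \<comment> \<open>The exponents 1 + 1/4 - A - 3/4 sum to 1/2 - A. Without the division by
    \<open>S\<close> one would end at 5/4 - A, which is too large.\<close>
  have t6: "6 * L * (\<Omega> * (Y / S + 4 * (2 * L) * V * real R0)) \<le> (96 * exp 5 * C2 * K1 + 192 * C2) * T"
  proof -
    have YS: "Y / S \<le> 8 * exp 5 * K1 * (x * L powr (- A - 3/4))"
    proof -
      have "Y / S \<le> Y / (L powr (3/4) / (4 * exp 5))"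
        using S K x0 pos[of "3/4"] by (intro divide_left_mono) (auto simp: Y_def)
      also have "\<dots> = 8 * exp 5 * K1 * (x * (L powr (- A) / L powr (3/4)))" by (simp add: Y_def)
      also have "L powr (- A) / L powr (3/4) = L powr (- A - 3/4)" by (simp only: powr_diff)
      finally show ?thesis .
    qed
    have VR: "4 * (2 * L) * V * real R0 \<le> 16 * L powr (\<gamma> + A + 4)"
    proof -
      have "4 * (2 * L) * V * real R0 \<le> 4 * (2 * L) * V * (2 * \<rho>)" using L1 V1 R0 by (intro mult_left_mono) auto
      also have "\<dots> = 16 * (L powr 1 * L powr \<gamma> * L powr (A + 3))" using L1 by (simp add: V_def \<rho>_def)
      also have "L powr 1 * L powr \<gamma> * L powr (A + 3) = L powr (\<gamma> + A + 4)"
        by (simp only: powr_add[symmetric]) (simp add: algebra_simps)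
      finally show ?thesis .
    qed
    have "6 * L * (\<Omega> * (Y / S + 4 * (2 * L) * V * real R0))
      \<le> 6 * L * (\<Omega> * (8 * exp 5 * K1 * (x * L powr (- A - 3/4)) + 16 * L powr (\<gamma> + A + 4)))"
      using L1 C YS VR by (intro mult_left_mono add_mono) (auto simp: \<Omega>_def)
    also have "\<dots> = 96 * exp 5 * C2 * K1 * (x * (L powr 1 * L powr (1/4) * L powr (- A - 3/4)))
       + 192 * C2 * (L powr 1 * L powr (1/4) * L powr (\<gamma> + A + 4))"
      using L1 by (simp add: \<Omega>_def algebra_simps)
    also have "L powr 1 * L powr (1/4) * L powr (- A - 3/4) = L powr (1/2 - A)"
      by (simp only: powr_add[symmetric]) (simp add: algebra_simps)
    also have "L powr 1 * L powr (1/4) * L powr (\<gamma> + A + 4) = L powr (\<gamma> + A + 21/4)"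
      by (simp only: powr_add[symmetric]) (simp add: algebra_simps)
    also have "96 * exp 5 * C2 * K1 * (x * L powr (1/2 - A)) + 192 * C2 * L powr (\<gamma> + A + 21/4)
      \<le> 96 * exp 5 * C2 * K1 * T + 192 * C2 * T"
    proof (intro add_mono mult_left_mono)
      show "x * L powr (1/2 - A) \<le> T" by (rule leT) simp
      have "L powr (\<gamma> + A + 21/4) \<le> L powr (\<gamma> + 2 * A + 5 + (1 - A))" by (rule mono) simp
      also have "\<dots> = L powr (\<gamma> + 2 * A + 5) * L powr (1 - A)" by (rule powr_add)
      also have "\<dots> \<le> T" unfolding T_def using p(4) by (intro mult_right_mono) auto
      finally show "L powr (\<gamma> + A + 21/4) \<le> T" .
    qed (use C K in auto)
    finally show ?thesis by (simp add: algebra_simps)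
  qed
  have t7: "6 * L * ((real R0)\<^sup>2 * (2 * (4 * sqrt x + 6 * x / W))) \<le> 480 * T"
  proof -
    have "6 * L * ((real R0)\<^sup>2 * (2 * (4 * sqrt x + 6 * x / W))) \<le> 6 * L * ((4 * L powr (2 * A + 6)) * (2 * (10 * (x / W))))"
      using L1 R2 sW x0 W1 by (intro mult_left_mono mult_mono) auto
    also have "\<dots> = 480 * (x * (L powr 1 * L powr (2 * A + 6) * L powr (- (3 * A + 10))))" unfolding W using L1 by simp
    also have "L powr 1 * L powr (2 * A + 6) * L powr (- (3 * A + 10)) = L powr (- A - 3)"
      by (simp only: powr_add[symmetric]) (simp add: algebra_simps)
    also have "480 * (x * L powr (- A - 3)) \<le> 480 * T" using leT[of "- A - 3"] by simp
    finally show ?thesis .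
  qed
  have t8: "6 * L * (16 * (real J + 2)\<^sup>2 * sqrt x * (real J * (sqrt x / real R0 + real N) + 4 * (3 * L) * (sqrt (x / Z) + sqrt (x / V)))) \<le> 72000 * T"
  proof -
    \<comment> \<open>The common saving, relative to sqrt x, of the four type II errors: from
      \<open>R0\<close>, from \<open>N\<close> through B, from \<open>V\<close> through \<gamma> /
      2, and from \<open>Z\<close> through Z >= V.\<close>
    define \<mu> where "\<mu> = L powr (- (A + 3))"
    have J2: "(real J + 2)\<^sup>2 \<le> 25 * L powr 2"
    proof -
      have "(real J + 2)\<^sup>2 \<le> (5 * L)\<^sup>2" using J L1 by (intro power_mono) auto
      then show ?thesis by (simp add: power_mult_distrib L_powr(2))
    qed
    have a1: "sqrt x / real R0 \<le> sqrt x * \<mu>"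
    proof -
      have "sqrt x / real R0 \<le> sqrt x / \<rho>" using R0 \<rho>1 x0 by (intro divide_left_mono) auto
      then show ?thesis unfolding \<mu>_def \<rho>_def powr_minus divide_inverse .
    qed
    have a2: "real N \<le> sqrt x * \<mu>"
    proof -
      have "Q = sqrt x * L powr (- B)" unfolding Q_def powr_minus sx by (simp only: divide_inverse)
      also have "\<dots> \<le> sqrt x * \<mu>" unfolding \<mu>_def using mono[of "- B" "- (A + 3)"] A B x0 by (intro mult_left_mono) auto
      finally show ?thesis using N1 by simp
    qed
    have a3: "sqrt (x / V) \<le> sqrt x * \<mu>"
    proof -
      have "sqrt V = L powr (\<gamma> / 2)" unfolding V_def using L1 by (simp add: powr_half_sqrt[symmetric] powr_powr)
      then have "sqrt (x / V) = sqrt x * L powr (- (\<gamma> / 2))" unfolding real_sqrt_divide powr_minus by (simp only: divide_inverse)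
      also have "\<dots> \<le> sqrt x * \<mu>" unfolding \<mu>_def using mono[of "- (\<gamma> / 2)" "- (A + 3)"] \<gamma> x0 by (intro mult_left_mono) auto
      finally show ?thesis .
    qed
    have a4: "sqrt (x / Z) \<le> sqrt x * \<mu>"
    proof -
      have "x / Z \<le> x / V" using Z V1 x0 by (intro divide_left_mono) auto
      then have "sqrt (x / Z) \<le> sqrt (x / V)" by simp
      then show ?thesis using a3 by (rule order_trans)
    qed
    have "real J * (sqrt x / real R0 + real N) + 4 * (3 * L) * (sqrt (x / Z) + sqrt (x / V))
      \<le> (3 * L) * (sqrt x * \<mu> + sqrt x * \<mu>) + 4 * (3 * L) * (sqrt x * \<mu> + sqrt x * \<mu>)"
      using J L1 a1 a2 a3 a4 x0 by (intro add_mono mult_mono mult_left_mono) (auto intro!: add_nonneg_nonneg divide_nonneg_nonneg)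
    also have "\<dots> = 30 * (L * (sqrt x * \<mu>))" by simp
    finally have b: "real J * (sqrt x / real R0 + real N) + 4 * (3 * L) * (sqrt (x / Z) + sqrt (x / V)) \<le> 30 * (L * (sqrt x * \<mu>))" .
    have "6 * L * (16 * (real J + 2)\<^sup>2 * sqrt x * (real J * (sqrt x / real R0 + real N) + 4 * (3 * L) * (sqrt (x / Z) + sqrt (x / V))))
      \<le> 6 * L * (16 * (25 * L powr 2) * sqrt x * (30 * (L * (sqrt x * \<mu>))))"
    proof (intro mult_left_mono)
      have "16 * (real J + 2)\<^sup>2 * sqrt x \<le> 16 * (25 * L powr 2) * sqrt x" using J2 x0 by (intro mult_right_mono mult_left_mono) auto
      then show "16 * (real J + 2)\<^sup>2 * sqrt x * (real J * (sqrt x / real R0 + real N) + 4 * (3 * L) * (sqrt (x / Z) + sqrt (x / V)))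
        \<le> 16 * (25 * L powr 2) * sqrt x * (30 * (L * (sqrt x * \<mu>)))"
        using b L1 x0 V1 Z
        by (intro mult_mono) (auto intro!: add_nonneg_nonneg mult_nonneg_nonneg divide_nonneg_nonneg)
    qed (use L1 in auto)
    also have "\<dots> = 72000 * ((sqrt x * sqrt x) * (L powr 1 * L powr 2 * L powr 1 * \<mu>))" using L1 by simp
    also have "L powr 1 * L powr 2 * L powr 1 * \<mu> = L powr (1 - A)"
      unfolding \<mu>_def by (simp only: powr_add[symmetric]) (simp add: algebra_simps)
    also have "sqrt x * sqrt x = x" using x0 by simp
    finally show ?thesis by (simp add: T_def)
  qed
  have "(\<Sum>q\<in>{1..N}. max_Delta f x q) \<le> 2 * K1 * T + (4 * T + 18 * T + 60 * T) + (48 * K2 + 48 * C4) * T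
     + (96 * exp 5 * C2 * K1 + 192 * C2) * T + 480 * T + 72000 * T"
    using main t1 t2 t3 t4 t5 t6 t7 t8 by linarith
  \<comment> \<open>The explicit constants 4, 18, 60, 480 and 72000 add up to 72562.\<close>
  also have "\<dots> \<le> (2 * K1 + 80000 + 48 * K2 + 240 * C4 + 96 * exp 5 * C2 * K1 + 192 * C2) * T"
    using T0 mult_nonneg_nonneg[OF C(2) T0] by (simp add: algebra_simps)
  finally show ?thesis by (simp add: T_def L_def)
qed

theorem theorem2p1:
  fixes A B \<gamma> K1 K2 :: real
  assumes "A \<ge> 0" and "B > A + 5" and "\<gamma> > 2 * A + 6"
  shows "\<exists>C::real. \<forall>(x::real) (Q::real) (y::real) (f::nat \<Rightarrow> complex).
    x \<ge> 2 \<longrightarrow> Q = x powr (1/2) / (ln x) powr B \<longrightarrow> y = x / (ln x) powr \<gamma> \<longrightarrow>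
    f \<in> class_C \<longrightarrow>
    (\<forall>X. y < x \<and> y \<le> X \<and> X \<le> x \<longrightarrow>
       (\<Sum>q | 1 \<le> q \<and> real q \<le> Q. max_Delta (on_primes f) X q)
         \<le> K1 * (X / ((ln x) powr A * ln (x / y)))) \<longrightarrow>
    (\<forall>X (q::nat) (a::int). x powr (1/2) \<le> X \<and> X \<le> x \<and> q \<ge> 1 \<and> coprime a (int q) \<longrightarrow>
       cmod (Delta f X q a) \<le> K2 * (X / (ln x) powr (A + 2 * B))) \<longrightarrow>
    (\<Sum>q | 1 \<le> q \<and> real q \<le> Q. max_Delta f x q) \<le> C * (x / (ln x) powr (A - 1))"
proof -
  obtain C2 where C2: "C2 > 0" "\<And>k. k \<ge> 1 \<Longrightarrow> 2 ^ card (prime_factors k) \<le> C2 * real k powr (1 / (4 * (A + 3)))"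
    using power_omega_le[of 2 "1 / (4 * (A + 3))"] assms by auto
  obtain C4 where C4: "C4 > 0" "\<And>k. k \<ge> 1 \<Longrightarrow> 4 ^ card (prime_factors k) \<le> C4 * real k powr (1 / 16)"
    using power_omega_le[of 4 "1 / 16"] by auto
  obtain x0 where x0: "x0 \<ge> 2" and ev: "\<And>x. x \<ge> x0 \<Longrightarrow> ln x \<ge> 3
    \<and> ln x powr (4 * \<gamma> + 18 * A + 62) \<le> x powr (1/2)
    \<and> ln x powr (3 * A + 10) \<le> x powr (1/2)
    \<and> ln x powr (3 * A + 6) \<le> x powr (3/16)
    \<and> ln x powr (\<gamma> + 2 * A + 5) \<le> x
    \<and> ln x powr (A + B + 5) \<le> x powr (1/4)
    \<and> (2 * (A + 3) * ln (ln x) + 2) ^ 4 \<le> ln x powr (1/4)"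
    using eventually_parameters[OF assms(1), of \<gamma> B] by blast
  \<comment> \<open>For bounded \<open>x\<close> the exponent A - 1 may have either sign, so the
    power of ln x is bounded by the larger of its two endpoint values.\<close>
  define M where "M = max (ln 2 powr (A - 1)) (ln x0 powr (A - 1))"
  \<comment> \<open>\<open>K1\<close> and \<open>K2\<close> are arbitrary reals, while the bound for
    large \<open>x\<close> wants nonnegative constants.\<close>
  define D1 where "D1 = 2 * \<bar>K1\<bar> + 80000 + 48 * \<bar>K2\<bar> + 240 * C4 + 96 * exp 5 * C2 * \<bar>K1\<bar> + 192 * C2"
  define D2 where "D2 = 2 * (sqrt x0 / ln 2 powr B) * M"
  show ?thesis
  proof (intro exI[of _ "max D1 D2"] allI impI)
    fix x Q y :: real and f :: "nat \<Rightarrow> complex"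
    assume x: "x \<ge> 2" and Q: "Q = x powr (1/2) / (ln x) powr B" and y: "y = x / (ln x) powr \<gamma>"
      and f: "f \<in> class_C"
      and P: "\<forall>X. y < x \<and> y \<le> X \<and> X \<le> x \<longrightarrow>
       (\<Sum>q | 1 \<le> q \<and> real q \<le> Q. max_Delta (on_primes f) X q) \<le> K1 * (X / ((ln x) powr A * ln (x / y)))"
      and SW: "\<forall>X (q::nat) (a::int). x powr (1/2) \<le> X \<and> X \<le> x \<and> q \<ge> 1 \<and> coprime a (int q) \<longrightarrow>
       cmod (Delta f X q a) \<le> K2 * (X / (ln x) powr (A + 2 * B))"
    have sx: "x powr (1/2) = sqrt x" using x by (simp add: powr_half_sqrt)
    have lx: "ln x > 0" using x by simp
    show "(\<Sum>q | 1 \<le> q \<and> real q \<le> Q. max_Delta f x q) \<le> max D1 D2 * (x / (ln x) powr (A - 1))"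
    proof (cases "x \<ge> x0")
      case True
      define V where "V = ln x powr \<gamma>"
      note e = ev[OF True]
      have L3: "ln x \<ge> 3" using e by simp
      have V1: "V > 1" unfolding V_def using L3 assms by (simp add: gr_one_powr)
      have yV: "y = x / V" "x / y = V" using x V1 by (auto simp: y V_def)
      \<comment> \<open>The hypothesis on primes is guarded by y < x, which keeps ln (x / y)
        positive; it holds here because ln x > 1.\<close>
      have yx: "y < x" using V1 x by (simp add: yV(1) divide_less_eq)
      have lnV: "ln V > 0" using V1 by simp
      have "(\<Sum>q\<in>{1..nat \<lfloor>Q\<rfloor>}. max_Delta f x q) \<le> D1 * (x * ln x powr (1 - A))"
        unfolding D1_def
      proof (rule bound_for_large_x[where N = "nat \<lfloor>Q\<rfloor>" and \<gamma> = \<gamma> and B = B])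
        fix u assume "u \<in> nats_upto (ln x powr \<gamma>)"
        then have u: "u \<ge> 1" "real u \<le> V" by (auto simp: nats_upto_def V_def)
        \<comment> \<open>The type I range u <= V = x / y is exactly the one for which x / u stays
          in the range of the hypothesis on primes.\<close>
        have "y \<le> x / real u" unfolding yV(1) using u x V1 by (intro divide_left_mono) auto
        moreover have "x / real u \<le> x" using u x by (simp add: divide_le_eq mult_le_cancel_left1)
        ultimately have "(\<Sum>q | 1 \<le> q \<and> real q \<le> Q. max_Delta (on_primes f) (x / real u) q)
          \<le> K1 * (x / real u / ((ln x) powr A * ln V))" using P yx unfolding yV(2) by blast
        also have "\<dots> \<le> \<bar>K1\<bar> * (x / real u / ((ln x) powr A * ln V))"
          using x lnV by (intro mult_right_mono) auto
        finally show "(\<Sum>q\<in>{1..nat \<lfloor>Q\<rfloor>}. max_Delta (on_primes f) (x / real u) q)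
          \<le> \<bar>K1\<bar> * (x / real u / (ln x powr A * ln (ln x powr \<gamma>)))"
          by (simp only: nats_upto_set V_def)
      next
        fix X q a assume h: "sqrt x \<le> X" "X \<le> x" "1 \<le> q" "coprime a (int q)"
        have "X \<ge> 0" using h(1) x by (meson order_trans real_sqrt_ge_zero zero_le_numeral)
        have "cmod (Delta f X q a) \<le> K2 * (X / (ln x) powr (A + 2 * B))" using SW h sx by auto
        also have "\<dots> \<le> \<bar>K2\<bar> * (X / (ln x) powr (A + 2 * B))" using \<open>X \<ge> 0\<close> by (intro mult_right_mono) auto
        finally show "cmod (Delta f X q a) \<le> X * (\<bar>K2\<bar> / ln x powr (A + 2 * B))" by (simp add: mult.commute)
      qed (use assms C2 C4 x e f Q in auto)
      also have "x * ln x powr (1 - A) = x / (ln x) powr (A - 1)"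
        using powr_minus_divide[of "ln x" "A - 1"] by simp
      also have "D1 * (x / (ln x) powr (A - 1)) \<le> max D1 D2 * (x / (ln x) powr (A - 1))"
        using x by (intro mult_right_mono) auto
      finally show ?thesis by (simp only: nats_upto_set)
    next
      \<comment> \<open>For \<open>x\<close> below the threshold, \<open>Q\<close> is bounded and
        the trivial bound 2x for each modulus suffices, without either hypothesis on the
        discrepancies.\<close>
      case False
      have l2: "ln 2 \<le> ln x" "ln x \<le> ln x0" "ln (2::real) > 0" using x False x0 by auto
      have M: "ln x powr (A - 1) \<le> M"
      proof (cases "A \<ge> 1")
        case True
        then have "ln x powr (A - 1) \<le> ln x0 powr (A - 1)" using l2 lx by (intro powr_mono2) auto
        then show ?thesis by (simp add: M_def)
      next
        case False
        then have "ln x powr (A - 1) \<le> ln 2 powr (A - 1)" using l2 lx by (intro powr_mono2') auto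
        then show ?thesis by (simp add: M_def)
      qed
      have Q0: "Q \<ge> 0" by (simp add: Q)
      have QB: "Q \<le> sqrt x0 / ln 2 powr B"
        unfolding Q sx using l2 assms False x x0 by (intro frac_le powr_mono2) auto
      have pos: "ln x powr (A - 1) > 0" using lx by simp
      have "(\<Sum>q | 1 \<le> q \<and> real q \<le> Q. max_Delta f x q) \<le> 2 * x * Q"
        using x by (intro sum_max_Delta_le_trivial f Q0) auto
      also have "\<dots> \<le> 2 * x * (sqrt x0 / ln 2 powr B)" using QB x by (intro mult_left_mono) auto
      also have "\<dots> \<le> 2 * x * (sqrt x0 / ln 2 powr B) * (M / ln x powr (A - 1))"
      proof -
        have "1 \<le> M / ln x powr (A - 1)" using M pos by (simp add: le_divide_eq)
        then have "2 * x * (sqrt x0 / ln 2 powr B) * 1 \<le> 2 * x * (sqrt x0 / ln 2 powr B) * (M / ln x powr (A - 1))"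
          using x x0 by (intro mult_left_mono) auto
        then show ?thesis by simp
      qed
      also have "\<dots> = D2 * (x / (ln x) powr (A - 1))" by (simp add: D2_def)
      also have "\<dots> \<le> max D1 D2 * (x / (ln x) powr (A - 1))"
        using x by (intro mult_right_mono) auto
      finally show ?thesis .
    qed
  qed
qed

end
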